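(* Let $h:[0,1]\to\mathbb R$ be a smooth function. Define the pressure of the open symmetric (boundary-driven) harmonic process with parameter $s$ and reservoir densities $\rho_l,\rho_r$ as $$P(h):=\lim_{N\to\infty}\frac1N\log\mathbb E\left[e^{\sum_{i=1}^N\eta_i h\left(\frac iN\right)}\right],$$ where $\mathbb E$ is expectation when $\eta=(\eta_1,\dots,\eta_N)$ is distributed according to the invariant measure $\mu_{N,\rho_l,\rho_r}$ of the process on $N$ sites. Then the pressure admits the variational expression $$P(h)=\sup_{\theta}\,\big[P(h,\theta)-J(\theta)\big],$$ where the supremum is over strictly increasing functions $\theta:[0,1]\to\mathbb R_+$ with $\theta(0)=\rho_l$ and $\theta(1)=\rho_r$, and $$P(h,\theta)=2s\int_0^1\log\left(\frac{1}{1+(1-e^{h(x)})\theta(x)}\right)dx,\qquad J(\theta)=-2s\int_0^1\log\left(\frac{\theta'(x)}{\rho_r-\rho_l}\right)dx.$$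
   Context: Open symmetric (boundary-driven) harmonic process: let $s>0$, $N\in\mathbb N$, $0\le\rho_l\le\rho_r<\infty$. Let $\Omega_N=\mathbb N_0^N$ and let $\delta^i$ be the configuration with one particle at site $i$ and none elsewhere. For $1\le k\le m$ let $\varphi_s(k,m)=\frac1k\frac{\Gamma(m+1)\Gamma(m-k+2s)}{\Gamma(m-k+1)\Gamma(m+2s)}$. The process is the continuous-time Markov chain on $\Omega_N$ with generator $\mathscr L f=\mathscr L_{\mathrm{left}}f+\sum_{i=1}^{N-1}\mathscr L_{i,i+1}f+\mathscr L_{\mathrm{right}}f$, where $$(\mathscr L_{i,i+1}f)(\eta)=\sum_{k=1}^{\eta_i}\varphi_s(k,\eta_i)[f(\eta-k\delta^i+k\delta^{i+1})-f(\eta)]+\sum_{k=1}^{\eta_{i+1}}\varphi_s(k,\eta_{i+1})[f(\eta+k\delta^i-k\delta^{i+1})-f(\eta)],$$ and $\mathscr L_{\mathrm{left}}$ (acting at site $i=1$ with $\varrho=\rho_l$) and $\mathscr L_{\mathrm{right}}$ (acting at site $i=N$ with $\varrho=\rho_r$) have the form $$f\mapsto\sum_{k=1}^{\eta_i}\varphi_s(k,\eta_i)[f(\eta-k\delta^i)-f(\eta)]+\sum_{k=1}^\infty\frac1k\left(\frac{\varrho}{1+\varrho}\right)^k[f(\eta+k\delta^i)-f(\eta)].$$ $\mu_{N,\rho_l,\rho_r}$ denotes the invariant probability measure of this process. $\theta'$ denotes the derivative of $\theta$.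
   Formalization: Assumes ρ_l<ρ_r and excludes h with h ≤ log(1+1/ρ_r) on [0,1] and h(1)=log(1+1/ρ_r), where all expectations are infinite but the supremum can be finite, e.g. h(x)=log(1+1/ρ_r)-(1-x); log(1/a) is read as +∞ for a ≤ 0. *)

theory Defs
  imports "HOL-Probability.Probability"
begin

section \<open>The process\<close>

text \<open>A configuration on the sites \<open>1, \<dots>, N\<close> is a function on \<^typ>\<open>nat\<close> vanishing off \<open>{1..N}\<close>.\<close>

type_synonym config = "nat \<Rightarrow> nat"

definition configs :: "nat \<Rightarrow> config set" where
  "configs N = {\<eta>. \<forall>i. i \<notin> {1..N} \<longrightarrow> \<eta> i = 0}"

definition hop_rate :: "real \<Rightarrow> nat \<Rightarrow> nat \<Rightarrow> real" where
  "hop_rate s k m =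
     1 / real k * (Gamma (real m + 1) * Gamma (real m - real k + 2 * s))
       / (Gamma (real m - real k + 1) * Gamma (real m + 2 * s))"

definition bulk_gen :: "real \<Rightarrow> nat \<Rightarrow> (config \<Rightarrow> real) \<Rightarrow> config \<Rightarrow> real" where
  "bulk_gen s i f \<eta> =
     (\<Sum>k = 1..\<eta> i. hop_rate s k (\<eta> i) *
        (f (\<eta>(i := \<eta> i - k, Suc i := \<eta> (Suc i) + k)) - f \<eta>))
   + (\<Sum>k = 1..\<eta> (Suc i). hop_rate s k (\<eta> (Suc i)) *
        (f (\<eta>(i := \<eta> i + k, Suc i := \<eta> (Suc i) - k)) - f \<eta>))"

definition reservoir_gen :: "real \<Rightarrow> real \<Rightarrow> nat \<Rightarrow> (config \<Rightarrow> real) \<Rightarrow> config \<Rightarrow> real" where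
  "reservoir_gen s \<rho> i f \<eta> =
     (\<Sum>k = 1..\<eta> i. hop_rate s k (\<eta> i) * (f (\<eta>(i := \<eta> i - k)) - f \<eta>))
   + (\<Sum>n. 1 / real (Suc n) * (\<rho> / (1 + \<rho>)) ^ Suc n *
        (f (\<eta>(i := \<eta> i + Suc n)) - f \<eta>))"

definition harmonic_gen ::
    "real \<Rightarrow> real \<Rightarrow> real \<Rightarrow> nat \<Rightarrow> (config \<Rightarrow> real) \<Rightarrow> config \<Rightarrow> real" where
  "harmonic_gen s \<rho>l \<rho>r N f \<eta> =
     reservoir_gen s \<rho>l 1 f \<eta> + (\<Sum>i = 1..<N. bulk_gen s i f \<eta>) + reservoir_gen s \<rho>r N f \<eta>"

text \<open>
  \<open>P t \<eta>\<close> is the law at time \<open>t\<close> of the process started from \<open>\<eta>\<close>.  The chain has finite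
  exit rates, growing only logarithmically in the number of particles, so it does not explode;
  for such a chain the difference quotients of the transition probabilities converge in
  \<open>\<ell>\<^sup>1\<close>, and hence the generator acts on all bounded functions in the pointwise sense below.
\<close>

definition harmonic_process ::
    "real \<Rightarrow> real \<Rightarrow> real \<Rightarrow> nat \<Rightarrow> (real \<Rightarrow> config \<Rightarrow> config pmf) \<Rightarrow> bool" where
  "harmonic_process s \<rho>l \<rho>r N P \<longleftrightarrow>
     (\<forall>\<eta> \<in> configs N.
        P 0 \<eta> = return_pmf \<eta> \<and>
        (\<forall>t \<ge> 0. set_pmf (P t \<eta>) \<subseteq> configs N) \<and>
        (\<forall>t \<ge> 0. \<forall>u \<ge> 0. P (t + u) \<eta> = bind_pmf (P t \<eta>) (P u)) \<and>
        (\<forall>f. bounded (range f) \<longrightarrow>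
           ((\<lambda>t. measure_pmf.expectation (P t \<eta>) f)
              has_real_derivative harmonic_gen s \<rho>l \<rho>r N f \<eta>) (at 0 within {0..})))"

definition invariant_measure ::
    "nat \<Rightarrow> (real \<Rightarrow> config \<Rightarrow> config pmf) \<Rightarrow> config pmf \<Rightarrow> bool" where
  "invariant_measure N P \<mu> \<longleftrightarrow>
     set_pmf \<mu> \<subseteq> configs N \<and> (\<forall>t \<ge> 0. bind_pmf \<mu> (P t) = \<mu>)"


section \<open>The pressure and the variational functional\<close>

definition smooth_unit :: "(real \<Rightarrow> real) \<Rightarrow> bool" where
  "smooth_unit h \<longleftrightarrow>
     (\<exists>D :: nat \<Rightarrow> real \<Rightarrow> real. (\<forall>x \<in> {0..1}. D 0 x = h x) \<and>
        (\<forall>n. \<forall>x \<in> {0..1}. (D n has_real_derivative D (Suc n) x) (at x within {0..1})))"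

definition ereal_ln :: "ereal \<Rightarrow> ereal" where
  "ereal_ln x = (if x \<le> 0 then - \<infinity> else if x = \<infinity> then \<infinity> else ereal (ln (real_of_ereal x)))"

definition unit_integral :: "(real \<Rightarrow> ereal) \<Rightarrow> ereal" where
  "unit_integral f =
     enn2ereal (\<integral>\<^sup>+ x \<in> {0..1}. e2ennreal (f x) \<partial>lebesgue)
   - enn2ereal (\<integral>\<^sup>+ x \<in> {0..1}. e2ennreal (- f x) \<partial>lebesgue)"

definition scaled_log_mgf :: "(nat \<Rightarrow> config pmf) \<Rightarrow> (real \<Rightarrow> real) \<Rightarrow> nat \<Rightarrow> ereal" where
  "scaled_log_mgf \<mu> h N =
     ereal (1 / real N) *
       ereal_ln (enn2ereal
         (\<integral>\<^sup>+ \<eta>. ennreal (exp (\<Sum>i = 1..N. real (\<eta> i) * h (real i / real N)))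
            \<partial>measure_pmf (\<mu> N)))"

definition pressure :: "(nat \<Rightarrow> config pmf) \<Rightarrow> (real \<Rightarrow> real) \<Rightarrow> ereal" where
  "pressure \<mu> h = lim (scaled_log_mgf \<mu> h)"

text \<open>
  With \<open>a = 1 + (1 - exp (h x)) * \<theta> x\<close>, \<open>a powr (- 2 * s)\<close> is the expectation of
  \<open>exp (h x * n)\<close> for a negative binomial variable \<open>n\<close> with shape \<open>2 * s\<close> and mean
  \<open>2 * s * \<theta> x\<close>; it is infinite for \<open>a \<le> 0\<close>.  Accordingly \<open>ln (1 / a)\<close> is rendered
  as \<open>- ereal_ln a\<close>, with value \<open>\<infinity>\<close> for \<open>a \<le> 0\<close>.
\<close>

definition local_pressure :: "real \<Rightarrow> (real \<Rightarrow> real) \<Rightarrow> (real \<Rightarrow> real) \<Rightarrow> ereal" where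
  "local_pressure s h \<theta> =
     ereal (2 * s) * unit_integral (\<lambda>x. - ereal_ln (ereal (1 + (1 - exp (h x)) * \<theta> x)))"

text \<open>
  A monotone \<open>\<theta>\<close> is differentiable almost everywhere, so the value assigned to the
  integrand at points of non-differentiability is immaterial.
\<close>

definition profile_cost ::
    "real \<Rightarrow> real \<Rightarrow> real \<Rightarrow> (real \<Rightarrow> real) \<Rightarrow> ereal" where
  "profile_cost s \<rho>l \<rho>r \<theta> =
     - (ereal (2 * s) * unit_integral
          (\<lambda>x. if \<theta> differentiable (at x) then ereal_ln (ereal (deriv \<theta> x / (\<rho>r - \<rho>l)))
                else - \<infinity>))"

definition profiles :: "real \<Rightarrow> real \<Rightarrow> (real \<Rightarrow> real) set" where
  "profiles \<rho>l \<rho>r =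
     {\<theta>. strict_mono_on {0..1} \<theta> \<and> \<theta> ` {0..1} \<subseteq> {0..} \<and> \<theta> 0 = \<rho>l \<and> \<theta> 1 = \<rho>r}"

text \<open>
  For the expectations involved, \<open>ln (1 + 1 / \<rho>r)\<close> is the critical value of \<open>h\<close>.  If \<open>h\<close>
  exceeds it somewhere on \<open>[0, 1]\<close>, then the expectations are infinite for all large \<open>N\<close> and
  the supremum is \<open>\<infinity>\<close> as well.  The case excluded here is that \<open>h\<close> never exceeds it but
  attains it at the end point \<open>1\<close>: there the factor of the single site \<open>N\<close> makes every
  expectation infinite, while the supremum does not see a single point and can be finite.
  Outside this case, if \<open>h\<close> does not exceed the critical value, then \<open>local_pressure s h \<theta>\<close>
  is finite for every profile \<open>\<theta>\<close>, so the convention \<open>\<infinity> - \<infinity> = \<infinity>\<close> of \<^typ>\<open>ereal\<close> never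
  affects the supremum of \<open>local_pressure s h \<theta> - profile_cost s \<rho>l \<rho>r \<theta>\<close>.
\<close>

definition not_critical_at_end :: "real \<Rightarrow> (real \<Rightarrow> real) \<Rightarrow> bool" where
  "not_critical_at_end \<rho>r h \<longleftrightarrow>
     (h 1 = ln (1 + 1 / \<rho>r) \<longrightarrow> (\<exists>x \<in> {0..1}. ln (1 + 1 / \<rho>r) < h x))"

end

theory Submission
  imports Defs "HOL-Real_Asymp.Real_Asymp"
begin

text \<open>
  The invariant measure is a mixture of products of negative binomial laws: the densities
  \<open>\<theta>\<^sub>1 < \<dots> < \<theta>\<^sub>N\<close> of the sites are distributed with density proportional to
  \<open>(\<theta>\<^sub>1 - \<rho>l)\<^sup>r\<^sup>-\<^sup>1 \<cdots> (\<rho>r - \<theta>\<^sub>N)\<^sup>r\<^sup>-\<^sup>1\<close>, where \<open>r = 2 s\<close>.  Its invariance reduces to an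
  integral identity for one site between two neighbours, which follows from an involution of the
  interval; uniqueness comes from comparing any invariant measure with the mixture.  The moment
  generating function thus becomes an iterated integral of kernels \<open>(y - x)\<^sup>r\<^sup>-\<^sup>1\<close> and site
  factors \<open>(1 + (1 - exp h) \<theta>)\<^sup>-\<^sup>r\<close>.  Cutting the sites into \<open>K\<close> blocks, the integrals within a block
  contribute \<open>(t\<^sub>k\<^sub>+\<^sub>1 - t\<^sub>k)\<close> to the power \<open>r N / K\<close>, so that the exponential rate is the maximum of the
  discretized functional over chains \<open>t\<^sub>0 < \<dots> < t\<^sub>K\<close>, which are compared with profiles through
  \<open>t\<^sub>k = \<theta> (k / K)\<close> and through piecewise linear interpolation.
\<close>

section \<open>The Riemann--Liouville kernel and negative binomial weights\<close>

text \<open>The kernels \<open>kap\<close> form a convolution semigroup, so N + 1 of them with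
  trivial site factors compose to \<open>kap (r * real (Suc N)) \<rho>l \<rho>r\<close>, the
  normalising constant of the mixture; all bounds are stated relative to it. Blocks replace the one
  value Gamma (r (N + 1)) by K values near r N / K, and Stirling turns the ratio into exp (r N ln
  K): this is the factor K in the discrete slope \<open>real K * (t (Suc k) - t k)\<close>. The
  process is known only through derivatives of its semigroup at time 0, so for an arbitrary
  invariant measure Fatou gives no more than an inequality in the balance equations; hence the
  comparison of a subinvariant with an invariant measure. The obstacle in the asymptotics is that h
  may touch ln (1 + 1 / \<rho>r): the site factor is then of order (\<rho>r - \<theta>) to the power
  -r and has no uniform bound. The lower bound lowers h slightly. The upper bound separates off the
  paths that are close to \<rho>r well before the last site; near the end point 1 itself h is
  strictly subcritical. If h exceeds the critical value, both sides are infinite.\<close>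

definition kap :: "real \<Rightarrow> real \<Rightarrow> real \<Rightarrow> ennreal" where
  "kap \<beta> x y = ennreal (if x < y then (y - x) powr (\<beta> - 1) / Gamma \<beta> else 0)"

lemma kap_measurable [measurable]:
  assumes [measurable]: "f \<in> borel_measurable M" "g \<in> borel_measurable M"
  shows "(\<lambda>x. kap \<beta> (f x) (g x)) \<in> borel_measurable M"
  unfolding kap_def by measurable

lemma kap_eq_0: "y \<le> x \<Longrightarrow> kap \<beta> x y = 0"
  by (simp add: kap_def)

lemma kap_finite: "kap \<beta> x y < \<infinity>"
  by (simp add: kap_def)

lemma kap_pos: "0 < \<beta> \<Longrightarrow> x < y \<Longrightarrow> 0 < kap \<beta> x y"
  by (simp add: kap_def Gamma_real_pos)

text \<open>A power of the length shifts the index at the price of a ratio of Gamma values. Positive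
  shifts extract powers of block lengths (\<open>kap_split\<close>); negative ones absorb site
  factors that are singular at the right end.\<close>

lemma kap_mult_powr:
  assumes "0 < \<beta>" "0 < \<beta> + c"
  shows "kap \<beta> x y * ennreal ((y - x) powr c)
       = ennreal (Gamma (\<beta> + c) / Gamma \<beta>) * kap (\<beta> + c) x y"
proof (cases "x < y")
  case True
  have G: "0 < Gamma \<beta>" "0 < Gamma (\<beta> + c)" using assms by (auto intro: Gamma_real_pos)
  have "(y - x) powr (\<beta> - 1) * (y - x) powr c = (y - x) powr (\<beta> + c - 1)"
    by (simp add: algebra_simps flip: powr_add)
  with True G show ?thesis
    by (simp add: kap_def flip: ennreal_mult)
next
  case False
  then show ?thesis by (simp add: kap_def)
qed

text \<open>The substitution z = x + l t with l = y - x gives a Beta integral, and the division by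
  Gamma in \<open>kap\<close> is exactly what removes its constant.\<close>

lemma kap_comp:
  assumes "0 < \<beta>" "0 < \<gamma>"
  shows "(\<integral>\<^sup>+ z. kap \<beta> x z * kap \<gamma> z y \<partial>lborel) = kap (\<beta> + \<gamma>) x y"
proof (cases "x < y")
  case False
  then have "kap \<beta> x z * kap \<gamma> z y = 0" for z
    by (cases "x < z") (auto simp: kap_def)
  moreover have "kap (\<beta> + \<gamma>) x y = 0" using False by (simp add: kap_def)
  ultimately show ?thesis by (simp del: mult_eq_0_iff)
next
  case True
  define l where "l = y - x"
  have l: "0 < l" using True by (simp add: l_def)
  have G: "0 < Gamma \<beta>" "0 < Gamma \<gamma>" "0 < Gamma (\<beta> + \<gamma>)"
    using assms by (simp_all add: Gamma_real_pos)
  let ?b = "\<lambda>t::real. t powr (\<beta> - 1) * (1 - t) powr (\<gamma> - 1)"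
  define C where "C = l powr (\<beta> - 1) * l powr (\<gamma> - 1) / (Gamma \<beta> * Gamma \<gamma>)"
  have C: "0 \<le> C" using G by (simp add: C_def)
  have eq: "kap \<beta> x (x + l * t) * kap \<gamma> (x + l * t) y = ennreal C * ennreal (indicator {0..1} t * ?b t)"
    if "t \<noteq> 0" "t \<noteq> 1" for t
  proof (cases "0 < t \<and> t < 1")
    case True
    have 1: "y - (x + l * t) = l * (1 - t)" by (simp add: l_def algebra_simps)
    have 2: "x + l * t < y" using True l by (smt (verit) 1 mult_pos_pos)
    show ?thesis
      using True l 2 1 G C
      by (simp add: kap_def C_def powr_mult flip: ennreal_mult)
  next
    case False
    then have "x + l * t \<le> x \<or> y \<le> x + l * t"
      using l that by (auto simp: l_def not_less mult_le_0_iff)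
         (smt (verit) mult_le_cancel_left1)
    with False that show ?thesis by (auto simp: kap_eq_0)
  qed
  have "(\<integral>\<^sup>+ z. kap \<beta> x z * kap \<gamma> z y \<partial>lborel)
      = ennreal l * (\<integral>\<^sup>+ t. kap \<beta> x (x + l * t) * kap \<gamma> (x + l * t) y \<partial>lborel)"
    using l by (subst nn_integral_real_affine[where c = l and t = x]) auto
  also have "(\<integral>\<^sup>+ t. kap \<beta> x (x + l * t) * kap \<gamma> (x + l * t) y \<partial>lborel)
     = (\<integral>\<^sup>+ t. ennreal C * ennreal (indicator {0..1} t * ?b t) \<partial>lborel)"
  proof (rule nn_integral_cong_AE)
    have "AE t in lborel. t \<noteq> (0::real)" "AE t in lborel. t \<noteq> (1::real)"
      by (rule AE_lborel_singleton)+
    then show "AE t in lborel. kap \<beta> x (x + l * t) * kap \<gamma> (x + l * t) y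
        = ennreal C * ennreal (indicator {0..1} t * ?b t)"
      by eventually_elim (rule eq)
  qed
  also have "\<dots> = ennreal C * ennreal (Beta \<beta> \<gamma>)"
    using nn_integral_has_integral_lebesgue[OF _ has_integral_Beta_real[OF assms]]
    by (subst nn_integral_cmult) auto
  also have "ennreal l * \<dots> = kap (\<beta> + \<gamma>) x y"
  proof -
    have B: "Beta \<beta> \<gamma> = Gamma \<beta> * Gamma \<gamma> / Gamma (\<beta> + \<gamma>)" by (simp add: Beta_def)
    have "l * (l powr (\<beta> - 1) * l powr (\<gamma> - 1)) = l powr (\<beta> + \<gamma> - 1)"
    proof -
      have "l * (l powr (\<beta> - 1) * l powr (\<gamma> - 1)) = l powr 1 * (l powr (\<beta> - 1) * l powr (\<gamma> - 1))"
        using l by simp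
      also have "\<dots> = l powr (1 + ((\<beta> - 1) + (\<gamma> - 1)))" by (simp only: powr_add)
      also have "1 + ((\<beta> - 1) + (\<gamma> - 1)) = \<beta> + \<gamma> - 1" by simp
      finally show ?thesis .
    qed
    then have "l * (C * Beta \<beta> \<gamma>) = l powr (\<beta> + \<gamma> - 1) / Gamma (\<beta> + \<gamma>)"
      using G by (simp add: C_def B field_simps)
    then show ?thesis
      using True l C G by (simp add: kap_def l_def B flip: ennreal_mult)
  qed
  finally show ?thesis .
qed

text \<open>Once the lower coefficients vanish, the series divided by z ^ n still sums to 0 for z
  \<noteq> 0, and z tending to 0 isolates \<open>a n\<close>. This carries identities between
  generating functions over to each occupation number.\<close>

lemma powser_zero_coeffs:
  fixes a :: "nat \<Rightarrow> real"
  assumes "\<And>z. \<bar>z\<bar> < 1 \<Longrightarrow> (\<lambda>n. a n * z ^ n) sums 0"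
  shows "a n = 0"
proof (induction n rule: less_induct)
  case (less n)
  have "(\<lambda>k. a (k + n) * z ^ k) sums 0" if "z \<noteq> 0" "norm z < 1" for z :: real
  proof -
    have "(\<lambda>k. a (k + n) * z ^ (k + n)) sums (0 - (\<Sum>i<n. a i * z ^ i))"
      using assms[of z] that by (subst sums_iff_shift) auto
    also have "(\<Sum>i<n. a i * z ^ i) = 0" using less by (intro sum.neutral) auto
    finally have "(\<lambda>k. (1 / z ^ n) * (a (k + n) * z ^ (k + n))) sums ((1 / z ^ n) * 0)"
      by (intro sums_mult) simp
    then show ?thesis using that by (simp add: power_add)
  qed
  then have "((\<lambda>z::real. 0) \<longlongrightarrow> a (0 + n)) (at (0::real))"
    using powser_limit_0_strong[of 1 "\<lambda>k. a (k + n)" "\<lambda>_. 0"] by simp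
  then show ?case
    using tendsto_unique[OF at_neq_bot, of "\<lambda>_. 0" "a n" "0::real" 0] by simp
qed

section \<open>Negative binomial weights and their generating functions\<close>

definition nbw :: "real \<Rightarrow> nat \<Rightarrow> real" where
  "nbw r n = pochhammer r n / fact n"

definition odds :: "real \<Rightarrow> real" where "odds \<theta> = \<theta> / (1 + \<theta>)"

text \<open>The negative binomial law of shape r and mean r \<theta>. Its geometric ratio
  \<open>odds \<theta>\<close> is also the parameter of a reservoir of density \<theta>.\<close>

definition nbp :: "real \<Rightarrow> real \<Rightarrow> nat \<Rightarrow> real" where
  "nbp r \<theta> n = nbw r n * odds \<theta> ^ n * (1 + \<theta>) powr (- r)"

text \<open>The logarithmic series of x convolved with \<open>nbp\<close>: the rate at which a site
  in equilibrium at density \<theta> is brought to n particles by a neighbour that emits k particles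
  at rate x ^ k / k.\<close>

definition feed :: "real \<Rightarrow> real \<Rightarrow> real \<Rightarrow> nat \<Rightarrow> real" where
  "feed r x \<theta> n = (\<Sum>k = 1..n. x ^ k / real k * nbp r \<theta> (n - k))"

lemma odds_bounds: "0 \<le> \<theta> \<Longrightarrow> 0 \<le> odds \<theta> \<and> odds \<theta> < 1"
  by (simp add: odds_def)

lemma nbw_pos: "0 < r \<Longrightarrow> 0 < nbw r n"
  by (simp add: nbw_def pochhammer_pos)

lemma nbp_nonneg: "0 < r \<Longrightarrow> 0 \<le> \<theta> \<Longrightarrow> 0 \<le> nbp r \<theta> n"
  using nbw_pos[of r n] odds_bounds[of \<theta>] by (simp add: nbp_def)

lemma feed_nonneg: "0 < r \<Longrightarrow> 0 \<le> \<theta> \<Longrightarrow> 0 \<le> x \<Longrightarrow> 0 \<le> feed r x \<theta> n"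
  unfolding feed_def by (intro sum_nonneg mult_nonneg_nonneg nbp_nonneg divide_nonneg_nonneg) auto

lemma hop_rate_nbw:
  assumes "0 < s" "k \<le> m"
  shows "hop_rate s k m = nbw (2 * s) (m - k) / (real k * nbw (2 * s) m)"
proof -
  have *: "nbw (2 * s) n = Gamma (2 * s + real n) / (Gamma (2 * s) * Gamma (real n + 1))" for n
    using assms(1) by (simp add: nbw_def pochhammer_Gamma Gamma_fact nonpos_Ints_def add.commute)
  have G: "0 < Gamma (2 * s)" "0 < Gamma (2 * s + real m)" "0 < Gamma (real m + 1)"
     "0 < Gamma (real (m - k) + 1)"
    using assms by (auto intro!: Gamma_real_pos)
  have e: "real m - real k + 2 * s = 2 * s + real (m - k)" "real m - real k + 1 = real (m - k) + 1"
     "real m + 2 * s = 2 * s + real m"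
    using assms by (auto simp: of_nat_diff)
  show ?thesis
    unfolding hop_rate_def e * using G by (simp add: divide_simps)
qed

lemma hop_rate_nonneg: "0 < s \<Longrightarrow> k \<le> m \<Longrightarrow> 0 \<le> hop_rate s k m"
  using nbw_pos[of "2 * s"] by (simp add: hop_rate_nbw less_imp_le)

lemma hop_rate_pos: "0 < s \<Longrightarrow> k \<le> m \<Longrightarrow> 1 \<le> k \<Longrightarrow> 0 < hop_rate s k m"
  using nbw_pos[of "2 * s"] by (simp add: hop_rate_nbw)

text \<open>The weight at n + k cancels against the denominator of the rate. Seen from outside, a
  site with this law emits k particles like a reservoir of density \<theta>, which lets bulk and
  boundary bonds be treated alike.\<close>

lemma hop_rate_nbp:
  assumes "0 < s" "1 \<le> k"
  shows "hop_rate s k (n + k) * nbp (2 * s) \<theta> (n + k) = odds \<theta> ^ k / real k * nbp (2 * s) \<theta> n"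
  using assms nbw_pos[of "2 * s" "n + k"]
  by (simp add: hop_rate_nbw nbp_def power_add field_simps)

text \<open>Summing the cancellation over k: the outflow of a site equals the inflow from a
  fictitious neighbour of its own density.\<close>

lemma sum_hop_rate_nbp:
  assumes "0 < s"
  shows "(\<Sum>k = 1..n. hop_rate s k n) * nbp (2 * s) \<theta> n = feed (2 * s) (odds \<theta>) \<theta> n"
  unfolding feed_def sum_distrib_right
proof (intro sum.cong refl)
  fix k assume k: "k \<in> {1..n}"
  then have n: "n - k + k = n" by simp
  show "hop_rate s k n * nbp (2 * s) \<theta> n = odds \<theta> ^ k / real k * nbp (2 * s) \<theta> (n - k)"
    using hop_rate_nbp[OF assms, of k "n - k"] k unfolding n by auto
qed

lemma nbw_sums:
  assumes "\<bar>x\<bar> < 1"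
  shows "(\<lambda>n. nbw r n * x ^ n) sums (1 - x) powr (- r)"
proof -
  have "(\<lambda>n. ((- r) gchoose n) * (- x) ^ n) sums (1 + (- x)) powr (- r)"
    by (rule gen_binomial_real) (use assms in simp)
  moreover have "((- r) gchoose n) * (- x) ^ n = nbw r n * x ^ n" for n
    by (simp add: gbinomial_pochhammer nbw_def power_minus' power_mult_distrib flip: power_mult)
  ultimately show ?thesis by simp
qed

lemma log_sums:
  assumes "\<bar>x\<bar> < (1::real)"
  shows "(\<lambda>n. x ^ n / real n) sums - ln (1 - x)"
proof -
  have "(\<lambda>n. - (- ((- (- x)) ^ n) / real n)) sums - ln (1 + (- x))"
    by (intro sums_minus ln_series') (use assms in simp)
  then show ?thesis by simp
qed

lemma odds_mult_bound:
  assumes "0 \<le> \<theta>" "\<bar>z\<bar> \<le> 1"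
  shows "\<bar>odds \<theta> * z\<bar> < 1"
proof -
  have "\<bar>odds \<theta> * z\<bar> \<le> odds \<theta>"
    using odds_bounds[OF assms(1)] assms(2) by (simp add: abs_mult mult_left_le)
  then show ?thesis using odds_bounds[OF assms(1)] by simp
qed

lemma one_minus_odds:
  assumes "0 \<le> \<theta>"
  shows "(1 + \<theta>) * (1 - odds \<theta> * z) = 1 + (1 - z) * \<theta>"
  using assms by (simp add: odds_def field_simps)

lemma nbp_sums:
  assumes "0 \<le> \<theta>" "\<bar>odds \<theta> * z\<bar> < 1"
  shows "(\<lambda>n. nbp r \<theta> n * z ^ n) sums (1 + (1 - z) * \<theta>) powr (- r)"
proof -
  have "(\<lambda>n. (1 + \<theta>) powr (- r) * (nbw r n * (odds \<theta> * z) ^ n)) sums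
      ((1 + \<theta>) powr (- r) * (1 - odds \<theta> * z) powr (- r))"
    using nbw_sums[OF assms(2)] by (rule sums_mult)
  also have "(1 + \<theta>) powr (- r) * (1 - odds \<theta> * z) powr (- r) = (1 + (1 - z) * \<theta>) powr (- r)"
    using assms one_minus_odds[OF assms(1), of z] by (simp flip: powr_mult)
  finally show ?thesis by (simp add: nbp_def power_mult_distrib mult_ac)
qed

lemma feed_sums:
  assumes "0 < r" "0 \<le> \<theta>" "0 \<le> x" and xz: "\<bar>x * z\<bar> < 1" and oz: "\<bar>odds \<theta> * z\<bar> < 1"
  shows "(\<lambda>n. feed r x \<theta> n * z ^ n) sums (- ln (1 - x * z) * (1 + (1 - z) * \<theta>) powr (- r))"
proof -
  \<comment> \<open>The coefficients are nonnegative, so the same series at \<bar>z\<bar> gives the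
    absolute summability that the Cauchy product demands.\<close>
  have xz': "\<bar>x * \<bar>z\<bar>\<bar> < 1" using xz by (simp add: abs_mult)
  have oz': "\<bar>odds \<theta> * \<bar>z\<bar>\<bar> < 1" using oz by (simp add: abs_mult)
  define A where "A k = (x * z) ^ k / real k" for k
  define B where "B n = nbp r \<theta> n * z ^ n" for n
  have nA: "summable (\<lambda>k. norm (A k))"
    using log_sums[OF xz'] assms by (auto simp: A_def sums_iff abs_mult power_abs power_mult_distrib)
  have nB: "summable (\<lambda>k. norm (B k))"
    using nbp_sums[OF assms(2) oz', of r] nbp_nonneg[OF assms(1,2)]
    by (auto simp: B_def sums_iff abs_mult power_abs)
  have "(\<lambda>n. \<Sum>i\<le>n. A i * B (n - i)) sums ((\<Sum>k. A k) * (\<Sum>k. B k))"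
    by (rule Cauchy_product_sums[OF nA nB])
  moreover have "(\<Sum>k. A k) = - ln (1 - x * z)"
    using log_sums[OF xz] by (simp add: A_def sums_iff)
  moreover have "(\<Sum>k. B k) = (1 + (1 - z) * \<theta>) powr (- r)"
    using nbp_sums[OF assms(2) oz, of r] by (simp add: B_def sums_iff)
  moreover have "(\<Sum>i\<le>n. A i * B (n - i)) = feed r x \<theta> n * z ^ n" for n
  proof -
    have "(\<Sum>i\<le>n. A i * B (n - i)) = (\<Sum>i = 1..n. A i * B (n - i))"
      by (intro sum.mono_neutral_right) (auto simp: A_def not_le)
    also have "\<dots> = (\<Sum>k = 1..n. (x ^ k / real k * nbp r \<theta> (n - k)) * z ^ n)"
    proof (intro sum.cong refl)
      fix i assume "i \<in> {1..n}"
      then have "z ^ n = z ^ i * z ^ (n - i)" by (simp flip: power_add)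
      then show "A i * B (n - i) = x ^ i / real i * nbp r \<theta> (n - i) * z ^ n"
        by (simp add: A_def B_def power_mult_distrib)
    qed
    finally show ?thesis by (simp add: feed_def sum_distrib_right)
  qed
  ultimately show ?thesis by simp
qed

section \<open>The bridge identity\<close>

lemma odds_measurable [measurable]: "odds \<in> borel_measurable borel"
  unfolding odds_def by measurable

lemma nbp_measurable [measurable]: "(\<lambda>\<theta>. nbp r \<theta> n) \<in> borel_measurable borel"
  unfolding nbp_def by measurable

lemma feed_measurable [measurable]:
  assumes [measurable]: "f \<in> borel_measurable M" "g \<in> borel_measurable M"
  shows "(\<lambda>x. feed r (f x) (g x) n) \<in> borel_measurable M"
  unfolding feed_def by measurable

lemma nbp_le_1:
  assumes "0 < r" "0 \<le> \<theta>"
  shows "nbp r \<theta> n \<le> 1"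
proof -
  have s: "(\<lambda>n. nbp r \<theta> n) sums 1"
    using nbp_sums[of \<theta> 1 r] assms odds_bounds[of \<theta>] by simp
  have "nbp r \<theta> n = (\<Sum>i\<in>{n}. nbp r \<theta> i)" by simp
  also have "\<dots> \<le> 1" using s nbp_nonneg[OF assms]
    by (metis finite.emptyI finite.insertI sum_le_suminf sums_iff)
  finally show ?thesis .
qed

lemma feed_le:
  assumes "0 < r" "0 \<le> \<theta>" "0 \<le> x" "x \<le> 1"
  shows "feed r x \<theta> n \<le> real n"
proof -
  have "feed r x \<theta> n \<le> (\<Sum>k = 1..n. 1)"
    unfolding feed_def
  proof (intro sum_mono)
    fix k assume "k \<in> {1..n}"
    then have "x ^ k / real k \<le> 1" "0 \<le> x ^ k / real k"
      using assms power_le_one[of x k] by (auto simp: divide_le_eq)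
    then show "x ^ k / real k * nbp r \<theta> (n - k) \<le> 1"
      using nbp_le_1[OF assms(1,2)] nbp_nonneg[OF assms(1,2)] by (intro mult_le_one)
  qed
  then show ?thesis by simp
qed

text \<open>The unnormalised Beta density of one site's \<theta> when its neighbours have densities
  a and b.\<close>

definition bridge :: "real \<Rightarrow> real \<Rightarrow> real \<Rightarrow> real \<Rightarrow> real" where
  "bridge r a b \<theta> = indicator {a<..<b} \<theta> * ((\<theta> - a) powr (r - 1) * (b - \<theta>) powr (r - 1))"

lemma bridge_measurable [measurable]: "bridge r a b \<in> borel_measurable borel"
  unfolding bridge_def by measurable

lemma bridge_nonneg: "0 \<le> bridge r a b \<theta>"
  by (simp add: bridge_def indicator_def)

lemma kap_kap_bridge:
  assumes "0 < r"
  shows "kap r a \<theta> * kap r \<theta> b = ennreal (bridge r a b \<theta> / (Gamma r)\<^sup>2)"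
  using Gamma_real_pos[OF assms]
  by (auto simp: kap_def bridge_def indicator_def power2_eq_square simp flip: ennreal_mult)

text \<open>The density is unbounded for r < 1, but up to a constant its mass is the value given by
  \<open>kap_comp\<close>.\<close>

lemma integrable_bridge:
  assumes "0 < r"
  shows "integrable lborel (bridge r a b)"
proof -
  have G: "0 < Gamma r" using assms by (rule Gamma_real_pos)
  have "(\<integral>\<^sup>+ \<theta>. ennreal (bridge r a b \<theta> / (Gamma r)\<^sup>2) \<partial>lborel) = kap (r + r) a b"
    using kap_comp[OF assms assms, of a b] by (simp add: kap_kap_bridge[OF assms])
  then have "integrable lborel (\<lambda>\<theta>. bridge r a b \<theta> / (Gamma r)\<^sup>2)"
    using kap_finite[of "r + r" a b] bridge_nonneg[of r a b]
    by (intro integrableI_nonneg) (auto simp: less_top)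
  then have "integrable lborel (\<lambda>\<theta>. (Gamma r)\<^sup>2 * (bridge r a b \<theta> / (Gamma r)\<^sup>2))"
    by (rule integrable_mult_right)
  then show ?thesis using G by simp
qed

lemma integrable_bridge_mult:
  fixes f :: "real \<Rightarrow> real"
  assumes "0 < r" and [measurable]: "f \<in> borel_measurable borel"
    and bound: "\<And>\<theta>. a < \<theta> \<Longrightarrow> \<theta> < b \<Longrightarrow> \<bar>f \<theta>\<bar> \<le> C"
  shows "integrable lborel (\<lambda>\<theta>. bridge r a b \<theta> * f \<theta>)"
proof (rule Bochner_Integration.integrable_bound)
  show "integrable lborel (\<lambda>\<theta>. bridge r a b \<theta> * C)"
    using integrable_bridge[OF assms(1)] by simp
  show "AE \<theta> in lborel. norm (bridge r a b \<theta> * f \<theta>) \<le> norm (bridge r a b \<theta> * C)"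
  proof (rule AE_I2)
    fix \<theta>
    show "norm (bridge r a b \<theta> * f \<theta>) \<le> norm (bridge r a b \<theta> * C)"
    proof (cases "a < \<theta> \<and> \<theta> < b")
      case True
      then have "\<bar>f \<theta>\<bar> \<le> \<bar>C\<bar>" using bound[of \<theta>] by linarith
      then show ?thesis by (simp add: abs_mult mult_left_mono)
    qed (auto simp: bridge_def)
  qed
qed measurable

text \<open>The integral is odd under the involution \<open>\<theta> \<mapsto> \<theta>'\<close> of \<open>(a, b)\<close> given by
  \<open>(1 + u \<theta>) (1 + u \<theta>') = (1 + u a) (1 + u b)\<close>.\<close>

lemma bridge_log_integral:
  assumes r: "0 < r" and a: "0 \<le> a" "a < b" and u: "0 < u"
  defines "f \<equiv> \<lambda>\<theta>. bridge r a b \<theta> *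
      ((1 + u * \<theta>) powr (- r) * (2 * ln (1 + u * \<theta>) - ln (1 + u * a) - ln (1 + u * b)))"
  shows "integral\<^sup>L lborel f = 0"
proof -
  define A B where "A = 1 + u * a" and "B = 1 + u * b"
  have A1: "1 \<le> A" and AB: "A < B" using a u by (auto simp: A_def B_def)
  have A0: "0 < A" and B0: "0 < B" using A1 AB by auto
  define S where "S = {a<..<b}"
  define g where "g = (\<lambda>\<theta>. (A * B / (1 + u * \<theta>) - 1) / u)"
  define g' where "g' = (\<lambda>\<theta>. - (A * B) / (1 + u * \<theta>)\<^sup>2)"
  have pos: "0 < 1 + u * \<theta>" and lo: "A < 1 + u * \<theta>" and hi: "1 + u * \<theta> < B"
    if "\<theta> \<in> S" for \<theta>
  proof -
    show "A < 1 + u * \<theta>" "1 + u * \<theta> < B" using that u by (auto simp: S_def A_def B_def)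
    then show "0 < 1 + u * \<theta>" using A0 by linarith
  qed
  \<comment> \<open>In the coordinate x = 1 + u \<theta> the involution is x to A B / x; the
    distances to a and to b are exchanged up to the factors A / x and B / x.\<close>
  have ga: "g \<theta> - a = A * (b - \<theta>) / (1 + u * \<theta>)" and gb: "b - g \<theta> = B * (\<theta> - a) / (1 + u * \<theta>)"
    if "\<theta> \<in> S" for \<theta>
  proof -
    define x where "x = 1 + u * \<theta>"
    have x: "0 < x" using pos[OF that] by (simp add: x_def)
    have t: "\<theta> = (x - 1) / u" "a = (A - 1) / u" "b = (B - 1) / u"
      using u by (auto simp: x_def A_def B_def)
    show "g \<theta> - a = A * (b - \<theta>) / (1 + u * \<theta>)"
      unfolding g_def x_def[symmetric] using x u
      apply (subst t(1)) apply (subst t(2)) apply (subst t(3)) by (simp add: field_simps)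
    show "b - g \<theta> = B * (\<theta> - a) / (1 + u * \<theta>)"
      unfolding g_def x_def[symmetric] using x u
      apply (subst t(1)) apply (subst t(2)) apply (subst t(3)) by (simp add: field_simps)
  qed
  have ug: "1 + u * g \<theta> = A * B / (1 + u * \<theta>)" for \<theta>
    using u by (simp add: g_def)
  have gS: "g \<theta> \<in> S" if "\<theta> \<in> S" for \<theta>
  proof -
    have "0 < g \<theta> - a" "0 < b - g \<theta>"
      unfolding ga[OF that] gb[OF that] using pos[OF that] that A0 B0 by (auto simp: S_def)
    then show ?thesis by (auto simp: S_def)
  qed
  have gg: "g (g \<theta>) = \<theta>" if "\<theta> \<in> S" for \<theta>
  proof -
    have "g (g \<theta>) = (A * B / (1 + u * g \<theta>) - 1) / u" by (simp add: g_def)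
    also have "\<dots> = \<theta>" unfolding ug using pos[OF that] A0 B0 u by simp
    finally show ?thesis .
  qed
  have img: "g ` S = S" using gS gg by force
  have inj: "inj_on g S" by (metis gg inj_onI)
  have der: "(g has_field_derivative g' \<theta>) (at \<theta> within S)" if "\<theta> \<in> S" for \<theta>
  proof -
    have "g = (\<lambda>\<theta>. A * B / u * inverse (1 + u * \<theta>) - 1 / u)"
      by (simp add: g_def fun_eq_iff divide_inverse algebra_simps)
    moreover have "((\<lambda>\<theta>. A * B / u * inverse (1 + u * \<theta>) - 1 / u) has_field_derivative
        (A * B / u * (- (u * inverse ((1 + u * \<theta>)\<^sup>2)))) ) (at \<theta> within S)"
      using pos[OF that] by (auto intro!: derivative_eq_intros simp: power2_eq_square)
    moreover have "A * B / u * (- (u * inverse ((1 + u * \<theta>)\<^sup>2))) = g' \<theta>"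
      using u by (simp add: g'_def divide_inverse)
    ultimately show ?thesis by simp
  qed
  have bnd: "\<bar>(1 + u * \<theta>) powr (- r) * (2 * ln (1 + u * \<theta>) - ln A - ln B)\<bar> \<le> 2 * (ln B)"
    if "a < \<theta>" "\<theta> < b" for \<theta>
  proof -
    have S: "\<theta> \<in> S" using that by (simp add: S_def)
    have x1: "1 \<le> 1 + u * \<theta>" using lo[OF S] A1 by linarith
    have "0 \<le> ln A" "ln A \<le> ln (1 + u * \<theta>)" "ln (1 + u * \<theta>) \<le> ln B"
      using lo[OF S] hi[OF S] A1 A0 by auto
    then have "\<bar>2 * ln (1 + u * \<theta>) - ln A - ln B\<bar> \<le> 2 * ln B" by linarith
    moreover have "(1 + u * \<theta>) powr (- r) \<le> 1"
      using x1 r by (simp add: powr_minus_divide divide_le_eq ge_one_powr_ge_zero)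
    ultimately show ?thesis
      unfolding abs_mult by (smt (verit) mult_left_le_one_le powr_ge_zero)
  qed
  have int: "integrable lborel f"
    unfolding f_def A_def[symmetric] B_def[symmetric]
    by (rule integrable_bridge_mult[OF r _ bnd]) measurable
  have fS: "f \<theta> = 0" if "\<theta> \<notin> S" for \<theta> using that by (simp add: f_def bridge_def S_def)
  have fi: "(\<lambda>\<theta>. indicator S \<theta> *\<^sub>R f \<theta>) = f" using fS by (auto simp: indicator_def fun_eq_iff)
  have "set_integrable lborel S f" unfolding set_integrable_def fi by (rule int)
  then have absint: "f absolutely_integrable_on S"
    unfolding set_integrable_def fi
    by (subst integrable_completion) (use int in auto)
  have "integral S (\<lambda>\<theta>. \<bar>g' \<theta>\<bar> * f (g \<theta>)) = integral S f"
    using has_absolute_integral_change_of_variables_1'[of S g g' f "integral S f"] der inj absint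
    unfolding img by (auto simp: S_def)
  \<comment> \<open>The Jacobian A B / x ^ 2, the power of the bridge and the power of 1 + u
    \<theta> recombine to the original weight, while the logarithmic factor changes sign. So the
    integral equals its own negative.\<close>
  also have "integral S (\<lambda>\<theta>. \<bar>g' \<theta>\<bar> * f (g \<theta>)) = integral S (\<lambda>\<theta>. - f \<theta>)"
  proof (rule Henstock_Kurzweil_Integration.integral_cong)
    fix \<theta> assume S: "\<theta> \<in> S"
    define x where "x = 1 + u * \<theta>"
    have x: "0 < x" using pos[OF S] by (simp add: x_def)
    have br: "bridge r a b (g \<theta>) = (A * B / x\<^sup>2) powr (r - 1) * bridge r a b \<theta>"
    proof -
      have "bridge r a b (g \<theta>) = (g \<theta> - a) powr (r - 1) * (b - g \<theta>) powr (r - 1)"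
        using gS[OF S] by (simp add: bridge_def S_def)
      also have "\<dots> = (A * B / x\<^sup>2 * ((\<theta> - a) * (b - \<theta>))) powr (r - 1)"
        unfolding ga[OF S] gb[OF S] x_def[symmetric] using x A0 B0 S
        by (simp add: S_def powr_mult[symmetric] power2_eq_square mult_ac)
      also have "\<dots> = (A * B / x\<^sup>2) powr (r - 1) * ((\<theta> - a) * (b - \<theta>)) powr (r - 1)"
        by (rule powr_mult)
      also have "((\<theta> - a) * (b - \<theta>)) powr (r - 1) = bridge r a b \<theta>"
        using S by (simp add: bridge_def S_def powr_mult)
      finally show ?thesis .
    qed
    have pw: "A * B / x\<^sup>2 * ((A * B / x\<^sup>2) powr (r - 1) * (A * B / x) powr (- r)) = x powr (- r)"
    proof -
      have "A * B / x\<^sup>2 * (A * B / x\<^sup>2) powr (r - 1) = (A * B / x\<^sup>2) powr r"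
        using x A0 B0 by (simp add: powr_diff)
      also have "(A * B / x\<^sup>2) powr r = (A * B / x) powr r * x powr (- r)"
        using x A0 B0 by (simp add: powr_minus_divide powr_divide[symmetric] power2_eq_square)
      finally show ?thesis using x A0 B0 by (simp add: powr_minus field_simps)
    qed
    have lg: "2 * ln (A * B / x) - ln A - ln B = - (2 * ln x - ln A - ln B)"
      using x A0 B0 by (simp add: ln_div ln_mult)
    have "\<bar>g' \<theta>\<bar> * f (g \<theta>)
       = (A * B / x\<^sup>2) * ((A * B / x\<^sup>2) powr (r - 1) * bridge r a b \<theta> *
         ((A * B / x) powr (- r) * (- (2 * ln x - ln A - ln B))))"
      unfolding f_def br ug A_def[symmetric] B_def[symmetric] x_def[symmetric] lg
      using x A0 B0 by (simp add: g'_def flip: x_def)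
    also have "\<dots> = (A * B / x\<^sup>2 * ((A * B / x\<^sup>2) powr (r - 1) * (A * B / x) powr (- r)))
         * (bridge r a b \<theta> * (- (2 * ln x - ln A - ln B)))"
      by (simp only: mult_ac)
    also have "\<dots> = x powr (- r) * (bridge r a b \<theta> * (- (2 * ln x - ln A - ln B)))"
      by (simp only: pw)
    also have "\<dots> = - f \<theta>"
      unfolding f_def x_def A_def B_def by (simp add: algebra_simps)
    finally show "\<bar>g' \<theta>\<bar> * f (g \<theta>) = - f \<theta>" .
  qed
  also have "\<dots> = - integral S f" by simp
  finally have "integral S f = 0" by simp
  moreover have "integral S f = integral\<^sup>L lborel f"
    using set_borel_integral_eq_integral(2)[OF \<open>set_integrable lborel S f\<close>]
    by (simp only: set_lebesgue_integral_def fi)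
  ultimately show ?thesis by simp
qed

text \<open>Multiplying by z ^ n and summing over n turns the terms into the integrand of
  \<open>bridge_log_integral\<close> with u = 1 - z. Its integral is 0 for all \<bar>z\<bar> < 1,
  hence so is every coefficient.\<close>

lemma bridge_feed_integral:
  assumes r: "0 < r" and a: "0 \<le> a" "a < b"
  defines "t \<equiv> \<lambda>n \<theta>. feed r (odds a) \<theta> n + feed r (odds b) \<theta> n - 2 * feed r (odds \<theta>) \<theta> n
      + (2 * ln (1 + \<theta>) - ln (1 + a) - ln (1 + b)) * nbp r \<theta> n"
  shows "integrable lborel (\<lambda>\<theta>. bridge r a b \<theta> * t n \<theta>)"
    and "(\<integral>\<theta>. bridge r a b \<theta> * t n \<theta> \<partial>lborel) = 0"
proof -
  define C where "C = 4 + 2 * ln (1 + b)"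
  have C: "0 \<le> C" using a by (simp add: C_def)
  have [measurable]: "(\<lambda>\<theta>. t n \<theta>) \<in> borel_measurable borel" for n
    unfolding t_def by measurable
  \<comment> \<open>A bound linear in n, uniform on (a, b), suffices to exchange the series in z
    with the integral.\<close>
  have bnd: "\<bar>t n \<theta>\<bar> \<le> C * (real n + 1)" if "a < \<theta>" "\<theta> < b" for n \<theta>
  proof -
    have \<theta>: "0 \<le> \<theta>" using that a by simp
    have o: "0 \<le> odds a \<and> odds a \<le> 1" "0 \<le> odds b \<and> odds b \<le> 1" "0 \<le> odds \<theta> \<and> odds \<theta> \<le> 1"
      using odds_bounds[of a] odds_bounds[of b] odds_bounds[of \<theta>] a \<theta> by auto
    have f: "0 \<le> feed r (odds a) \<theta> n" "feed r (odds a) \<theta> n \<le> real n"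
      "0 \<le> feed r (odds b) \<theta> n" "feed r (odds b) \<theta> n \<le> real n"
      "0 \<le> feed r (odds \<theta>) \<theta> n" "feed r (odds \<theta>) \<theta> n \<le> real n"
      using feed_nonneg[OF r \<theta>] feed_le[OF r \<theta>] o by auto
    have "0 \<le> ln (1 + a)" "ln (1 + a) \<le> ln (1 + \<theta>)" "ln (1 + \<theta>) \<le> ln (1 + b)"
      using a that by auto
    then have "\<bar>2 * ln (1 + \<theta>) - ln (1 + a) - ln (1 + b)\<bar> \<le> 2 * ln (1 + b)" by linarith
    then have "\<bar>(2 * ln (1 + \<theta>) - ln (1 + a) - ln (1 + b)) * nbp r \<theta> n\<bar> \<le> 2 * ln (1 + b)"
      using nbp_nonneg[OF r \<theta>, of n] nbp_le_1[OF r \<theta>, of n]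
      unfolding abs_mult by (smt (verit) mult_right_le_one_le)
    then have "\<bar>t n \<theta>\<bar> \<le> 4 * real n + 2 * ln (1 + b)" using f unfolding t_def by linarith
    also have "\<dots> \<le> C * (real n + 1)"
    proof -
      have "C * (real n + 1) = 4 * real n + 4 + 2 * ln (1 + b) * real n + 2 * ln (1 + b)"
        by (simp add: C_def algebra_simps)
      moreover have "0 \<le> 2 * ln (1 + b) * real n" using a by simp
      ultimately show ?thesis by linarith
    qed
    finally show ?thesis .
  qed
  show int: "integrable lborel (\<lambda>\<theta>. bridge r a b \<theta> * t n \<theta>)" for n
    by (rule integrable_bridge_mult[OF r _ bnd]) measurable
  define W where "W = integral\<^sup>L lborel (bridge r a b)"
  have "(\<lambda>n. (\<integral>\<theta>. bridge r a b \<theta> * t n \<theta> \<partial>lborel) * z ^ n) sums 0" if z: "\<bar>z\<bar> < 1" for z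
  proof -
    define F where "F = (\<lambda>n \<theta>. bridge r a b \<theta> * t n \<theta> * z ^ n)"
    have Fint: "integrable lborel (F n)" for n
      unfolding F_def using int[of n] by (rule integrable_mult_left)
    have Fb: "norm (F n \<theta>) \<le> bridge r a b \<theta> * (C * (real n + 1) * \<bar>z\<bar> ^ n)" for n \<theta>
    proof (cases "a < \<theta> \<and> \<theta> < b")
      case True
      then show ?thesis using bnd[of \<theta> n] bridge_nonneg[of r a b \<theta>]
        by (auto simp: F_def abs_mult power_abs mult.assoc[of "bridge r a b \<theta>"]
          intro!: mult_left_mono mult_right_mono)
    qed (auto simp: F_def bridge_def)
    have "(\<lambda>n. real (Suc n) * \<bar>z\<bar> ^ n) sums (1 / (1 - \<bar>z\<bar>)\<^sup>2)"
      using geometric_deriv_sums[of "\<bar>z\<bar>"] z by simp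
    then have "summable (\<lambda>n. C * (real (Suc n) * \<bar>z\<bar> ^ n))"
      by (intro summable_mult) (rule sums_summable)
    then have sm: "summable (\<lambda>n. C * (real n + 1) * \<bar>z\<bar> ^ n)"
      by (simp add: mult_ac add.commute)
    have "(\<lambda>n. integral\<^sup>L lborel (F n)) sums (\<integral>\<theta>. (\<Sum>n. F n \<theta>) \<partial>lborel)"
    proof (rule sums_integral[OF Fint])
      show "AE \<theta> in lborel. summable (\<lambda>n. norm (F n \<theta>))"
        by (intro AE_I2 summable_comparison_test[OF _ summable_mult[OF sm]] exI[of _ 0])
           (use Fb in auto)
      show "summable (\<lambda>n. \<integral>\<theta>. norm (F n \<theta>) \<partial>lborel)"
      proof (rule summable_comparison_test[OF _ summable_mult[OF sm, of W]], intro exI[of _ 0] allI impI)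
        fix n
        have "(\<integral>\<theta>. norm (F n \<theta>) \<partial>lborel) \<le> (\<integral>\<theta>. bridge r a b \<theta> * (C * (real n + 1) * \<bar>z\<bar> ^ n) \<partial>lborel)"
          using Fint integrable_bridge[OF r] Fb by (intro integral_mono integrable_norm) auto
        also have "\<dots> = W * (C * (real n + 1) * \<bar>z\<bar> ^ n)" by (simp add: W_def)
        finally show "norm (\<integral>\<theta>. norm (F n \<theta>) \<partial>lborel) \<le> W * (C * (real n + 1) * \<bar>z\<bar> ^ n)"
          by (simp add: integral_nonneg_AE)
      qed
    qed
    moreover have "(\<integral>\<theta>. (\<Sum>n. F n \<theta>) \<partial>lborel) = 0"
    proof -
      define u where "u = 1 - z"
      have u: "0 < u" using z by (simp add: u_def)
      have "(\<Sum>n. F n \<theta>) = bridge r a b \<theta> *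
        ((1 + u * \<theta>) powr (- r) * (2 * ln (1 + u * \<theta>) - ln (1 + u * a) - ln (1 + u * b)))" for \<theta>
      proof (cases "a < \<theta> \<and> \<theta> < b")
        case True
        then have \<theta>: "0 \<le> \<theta>" using a by simp
        have b0: "0 \<le> b" using a by simp
        \<comment> \<open>By this splitting, the part of each logarithm without z comes from the
          factor in front of \<open>nbp\<close>, and the part with z from the series of
          \<open>feed\<close>.\<close>
        have lnu: "ln (1 + u * c) = ln (1 + c) + ln (1 - odds c * z)" if "0 \<le> c" for c
          unfolding u_def one_minus_odds[OF that, symmetric]
          using that odds_mult_bound[OF that, of z] z by (intro ln_mult_pos) auto
        have fs: "(\<lambda>n. feed r (odds c) \<theta> n * z ^ n) sums (- ln (1 - odds c * z) * (1 + u * \<theta>) powr (- r))"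
          if "0 \<le> c" for c
          unfolding u_def
          using feed_sums[OF r \<theta>, of "odds c" z] odds_bounds[OF that] odds_mult_bound[OF that, of z]
            odds_mult_bound[OF \<theta>, of z] z by simp
        have ns: "(\<lambda>n. nbp r \<theta> n * z ^ n) sums (1 + u * \<theta>) powr (- r)"
          unfolding u_def using nbp_sums[OF \<theta> odds_mult_bound[OF \<theta>]] z by simp
        have "(\<lambda>n. feed r (odds a) \<theta> n * z ^ n + feed r (odds b) \<theta> n * z ^ n
              - 2 * (feed r (odds \<theta>) \<theta> n * z ^ n)
              + (2 * ln (1 + \<theta>) - ln (1 + a) - ln (1 + b)) * (nbp r \<theta> n * z ^ n)) sums
           (- ln (1 - odds a * z) * (1 + u * \<theta>) powr (- r)
            + - ln (1 - odds b * z) * (1 + u * \<theta>) powr (- r)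
            - 2 * (- ln (1 - odds \<theta> * z) * (1 + u * \<theta>) powr (- r))
            + (2 * ln (1 + \<theta>) - ln (1 + a) - ln (1 + b)) * (1 + u * \<theta>) powr (- r))"
          by (intro sums_add sums_diff sums_mult fs ns \<theta> b0 a(1))
        then have "(\<lambda>n. t n \<theta> * z ^ n) sums
          ((1 + u * \<theta>) powr (- r) * (2 * ln (1 + u * \<theta>) - ln (1 + u * a) - ln (1 + u * b)))"
          unfolding lnu[OF \<theta>] lnu[OF a(1)] lnu[OF b0] by (simp add: t_def algebra_simps)
        then have "(\<lambda>n. bridge r a b \<theta> * (t n \<theta> * z ^ n)) sums (bridge r a b \<theta> *
          ((1 + u * \<theta>) powr (- r) * (2 * ln (1 + u * \<theta>) - ln (1 + u * a) - ln (1 + u * b))))"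
          by (rule sums_mult)
        then show ?thesis by (simp add: F_def sums_iff mult.assoc)
      next
        case False
        then show ?thesis by (auto simp: F_def bridge_def)
      qed
      then show ?thesis using bridge_log_integral[OF r a u] by simp
    qed
    ultimately show ?thesis by (simp add: F_def)
  qed
  then show "(\<integral>\<theta>. bridge r a b \<theta> * t n \<theta> \<partial>lborel) = 0"
    by (rule powser_zero_coeffs)
qed

text \<open>The bridge identity with every negative term moved to the other side, so that it can be
  used for integrals in \<open>ennreal\<close>. Without a < b both sides vanish.\<close>

lemma kap_feed_identity:
  assumes r: "0 < r" and a: "0 \<le> a"
  shows "(\<integral>\<^sup>+ \<theta>. kap r a \<theta> * kap r \<theta> b *
        ennreal (feed r (odds a) \<theta> n + feed r (odds b) \<theta> n + 2 * ln (1 + \<theta>) * nbp r \<theta> n) \<partial>lborel)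
     = (\<integral>\<^sup>+ \<theta>. kap r a \<theta> * kap r \<theta> b *
        ennreal (2 * feed r (odds \<theta>) \<theta> n + (ln (1 + a) + ln (1 + b)) * nbp r \<theta> n) \<partial>lborel)"
proof (cases "a < b")
  case False
  then have "kap r a \<theta> * kap r \<theta> b = 0" for \<theta>
    by (cases "a < \<theta>") (auto simp: kap_def)
  then show ?thesis by (simp del: mult_eq_0_iff)
next
  case True
  define X where "X = (\<lambda>\<theta>. feed r (odds a) \<theta> n + feed r (odds b) \<theta> n + 2 * ln (1 + \<theta>) * nbp r \<theta> n)"
  define Y where "Y = (\<lambda>\<theta>. 2 * feed r (odds \<theta>) \<theta> n + (ln (1 + a) + ln (1 + b)) * nbp r \<theta> n)"
  define G where "G = (Gamma r)\<^sup>2"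
  have G: "0 < G" using Gamma_real_pos[OF r] by (simp add: G_def)
  have [measurable]: "X \<in> borel_measurable borel" "Y \<in> borel_measurable borel"
    unfolding X_def Y_def by measurable
  have b0: "0 \<le> b" using True a by simp
  have o: "0 \<le> odds c \<and> odds c \<le> 1" if "0 \<le> c" for c using odds_bounds[OF that] by simp
  have XY0: "0 \<le> X \<theta>" "0 \<le> Y \<theta>" if "a < \<theta>" for \<theta>
    using that a b0 o nbp_nonneg[OF r, of \<theta> n] feed_nonneg[OF r, of \<theta> _ n]
    by (auto simp: X_def Y_def intro!: add_nonneg_nonneg mult_nonneg_nonneg)
  have Xb: "\<bar>X \<theta>\<bar> \<le> 2 * real n + 2 * ln (1 + b)" if "a < \<theta>" "\<theta> < b" for \<theta>
  proof -
    have \<theta>: "0 \<le> \<theta>" using that a by simp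
    have "0 \<le> ln (1 + \<theta>)" "ln (1 + \<theta>) \<le> ln (1 + b)" using that \<theta> by auto
    then have "2 * ln (1 + \<theta>) * nbp r \<theta> n \<le> 2 * ln (1 + b) * 1"
      using nbp_le_1[OF r \<theta>] nbp_nonneg[OF r \<theta>] by (intro mult_mono) auto
    then have "X \<theta> \<le> 2 * real n + 2 * ln (1 + b)"
      using feed_le[OF r \<theta>, of "odds a" n] feed_le[OF r \<theta>, of "odds b" n] o a b0
      by (auto simp: X_def)
    then show ?thesis using XY0[OF that(1)] by simp
  qed
  have Xi: "integrable lborel (\<lambda>\<theta>. bridge r a b \<theta> * X \<theta>)"
    by (rule integrable_bridge_mult[OF r _ Xb]) measurable
  have t: "bridge r a b \<theta> * (feed r (odds a) \<theta> n + feed r (odds b) \<theta> n - 2 * feed r (odds \<theta>) \<theta> n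
      + (2 * ln (1 + \<theta>) - ln (1 + a) - ln (1 + b)) * nbp r \<theta> n)
      = bridge r a b \<theta> * X \<theta> - bridge r a b \<theta> * Y \<theta>" for \<theta>
    by (simp add: X_def Y_def algebra_simps)
  note bi = bridge_feed_integral[OF r a True, of n, unfolded t]
  have Yi: "integrable lborel (\<lambda>\<theta>. bridge r a b \<theta> * Y \<theta>)"
    using Bochner_Integration.integrable_diff[OF Xi bi(1)] by simp
  have eq: "(\<integral>\<theta>. bridge r a b \<theta> * X \<theta> \<partial>lborel) = (\<integral>\<theta>. bridge r a b \<theta> * Y \<theta> \<partial>lborel)"
    using bi(2) Xi Yi by simp
  have conv: "(\<integral>\<^sup>+ \<theta>. kap r a \<theta> * kap r \<theta> b * ennreal (Z \<theta>) \<partial>lborel)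
      = ennreal ((\<integral>\<theta>. bridge r a b \<theta> * Z \<theta> \<partial>lborel) / G)"
    if Zi: "integrable lborel (\<lambda>\<theta>. bridge r a b \<theta> * Z \<theta>)" and Z0: "\<And>\<theta>. a < \<theta> \<Longrightarrow> 0 \<le> Z \<theta>" for Z
  proof -
    have nn: "0 \<le> bridge r a b \<theta> * Z \<theta>" for \<theta>
      using Z0[of \<theta>] by (auto simp: bridge_def indicator_def)
    have "kap r a \<theta> * kap r \<theta> b * ennreal (Z \<theta>) = ennreal (bridge r a b \<theta> * Z \<theta> / G)" for \<theta>
    proof (cases "a < \<theta>")
      case True
      then show ?thesis
        using G bridge_nonneg[of r a b \<theta>] Z0[OF True]
        by (simp add: kap_kap_bridge[OF r] G_def flip: ennreal_mult)
    qed (auto simp: kap_def bridge_def)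
    then have "(\<integral>\<^sup>+ \<theta>. kap r a \<theta> * kap r \<theta> b * ennreal (Z \<theta>) \<partial>lborel)
        = (\<integral>\<^sup>+ \<theta>. ennreal (bridge r a b \<theta> * Z \<theta> / G) \<partial>lborel)" by simp
    also have "\<dots> = ennreal (\<integral>\<theta>. bridge r a b \<theta> * Z \<theta> / G \<partial>lborel)"
      using Zi nn G by (intro nn_integral_eq_integral) auto
    finally show ?thesis by simp
  qed
  show ?thesis
    using conv[OF Xi XY0(1)] conv[OF Yi XY0(2)] eq unfolding X_def Y_def by simp
qed

section \<open>Uniqueness of the invariant measure\<close>

text \<open>The difference integrates to 0, and counting measure has no nonempty null set;
  finiteness permits the subtraction.\<close>

lemma nn_integral_eq_pointwise:
  fixes f g :: "'a \<Rightarrow> ennreal"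
  assumes le: "\<And>x. x \<in> A \<Longrightarrow> f x \<le> g x"
    and eq: "(\<integral>\<^sup>+ x. f x \<partial>count_space A) = (\<integral>\<^sup>+ x. g x \<partial>count_space A)"
    and fin: "(\<integral>\<^sup>+ x. g x \<partial>count_space A) < \<infinity>" and x: "x \<in> A"
  shows "f x = g x"
proof -
  have "(\<integral>\<^sup>+ x. g x - f x \<partial>count_space A) = (\<integral>\<^sup>+ x. g x \<partial>count_space A) - (\<integral>\<^sup>+ x. f x \<partial>count_space A)"
    using fin eq le by (intro nn_integral_diff) (auto simp: AE_count_space)
  also have "\<dots> = 0" unfolding eq using fin by (simp add: less_top)
  finally have "AE x in count_space A. g x - f x = 0"
    by (subst (asm) nn_integral_0_iff_AE) auto
  then have d: "g x - f x = 0" using x by (auto simp: AE_count_space)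
  have "g x \<noteq> \<infinity>"
    using fin x nn_integral_ge_point[OF x, of g] by (auto simp: top_unique)
  with d le[OF x] show ?thesis by (auto simp: diff_eq_0_iff_ennreal intro: antisym)
qed

text \<open>The pointwise minimum of a subinvariant and an invariant measure is again subinvariant;
  since the total in- and outflow agree, it is invariant.  The set where the minimum is attained
  by the invariant measure is then closed under predecessors.\<close>

lemma subinvariant_eq_invariant:
  fixes q :: "'a \<Rightarrow> 'a \<Rightarrow> ennreal" and out m n :: "'a \<Rightarrow> ennreal"
  assumes S: "countable S"
    and m1: "(\<integral>\<^sup>+ x. m x \<partial>count_space S) = 1" and n1: "(\<integral>\<^sup>+ x. n x \<partial>count_space S) = 1"
    and sub: "\<And>y. y \<in> S \<Longrightarrow> (\<integral>\<^sup>+ x. m x * q x y \<partial>count_space S) \<le> m y * out y"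
    and inv: "\<And>y. y \<in> S \<Longrightarrow> (\<integral>\<^sup>+ x. n x * q x y \<partial>count_space S) = n y * out y"
    and out: "\<And>x. x \<in> S \<Longrightarrow> (\<integral>\<^sup>+ y. q x y \<partial>count_space S) = out x"
    and fin: "(\<integral>\<^sup>+ x. n x * out x \<partial>count_space S) < \<infinity>"
    and irred: "\<And>Z. Z \<subseteq> S \<Longrightarrow> Z \<noteq> {} \<Longrightarrow>
        (\<And>x y. x \<in> S \<Longrightarrow> y \<in> Z \<Longrightarrow> 0 < q x y \<Longrightarrow> x \<in> Z) \<Longrightarrow> Z = S"
    and x: "x \<in> S"
  shows "m x = n x"
proof -
  define l where "l x = min (m x) (n x)" for x
  define Z where "Z = {x \<in> S. n x \<le> m x}"
  \<comment> \<open>The inflow of the minimum is bounded by \<open>m y * out y\<close> and by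
    \<open>n y * out y\<close>; the smaller of the two is \<open>l y * out y\<close>.\<close>
  have inflow_le: "(\<integral>\<^sup>+ x. l x * q x y \<partial>count_space S) \<le> l y * out y" if "y \<in> S" for y
  proof -
    have "(\<integral>\<^sup>+ x. l x * q x y \<partial>count_space S) \<le> (\<integral>\<^sup>+ x. m x * q x y \<partial>count_space S)"
      by (intro nn_integral_mono mult_right_mono) (auto simp: l_def)
    also have "\<dots> \<le> m y * out y" using sub that .
    finally have 1: "(\<integral>\<^sup>+ x. l x * q x y \<partial>count_space S) \<le> m y * out y" .
    have "(\<integral>\<^sup>+ x. l x * q x y \<partial>count_space S) \<le> (\<integral>\<^sup>+ x. n x * q x y \<partial>count_space S)"
      by (intro nn_integral_mono mult_right_mono) (auto simp: l_def)
    with 1 show ?thesis using inv[OF that] by (auto simp: l_def min_def)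
  qed
  have total: "(\<integral>\<^sup>+ y. \<integral>\<^sup>+ x. l x * q x y \<partial>count_space S \<partial>count_space S)
      = (\<integral>\<^sup>+ y. l y * out y \<partial>count_space S)"
  proof -
    have "(\<integral>\<^sup>+ y. \<integral>\<^sup>+ x. l x * q x y \<partial>count_space S \<partial>count_space S)
      = (\<integral>\<^sup>+ x. \<integral>\<^sup>+ y. l x * q x y \<partial>count_space S \<partial>count_space S)"
      using S by (intro nn_integral_count_space_nn_integral) auto
    also have "\<dots> = (\<integral>\<^sup>+ x. l x * out x \<partial>count_space S)"
      by (intro nn_integral_cong) (auto simp: nn_integral_cmult out)
    finally show ?thesis .
  qed
  have lfin: "(\<integral>\<^sup>+ y. l y * out y \<partial>count_space S) < \<infinity>"
  proof -
    have "(\<integral>\<^sup>+ y. l y * out y \<partial>count_space S) \<le> (\<integral>\<^sup>+ y. n y * out y \<partial>count_space S)"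
      by (intro nn_integral_mono mult_right_mono) (auto simp: l_def)
    then show ?thesis using fin by simp
  qed
  have inflow: "(\<integral>\<^sup>+ x. l x * q x y \<partial>count_space S) = l y * out y" if "y \<in> S" for y
    using nn_integral_eq_pointwise[OF inflow_le total lfin that] .
  have closed: "x \<in> Z" if "x \<in> S" "y \<in> Z" "0 < q x y" for x y
  proof -
    have y: "y \<in> S" "l y = n y" using that by (auto simp: Z_def l_def min_def)
    have eq: "(\<integral>\<^sup>+ x. l x * q x y \<partial>count_space S) = (\<integral>\<^sup>+ x. n x * q x y \<partial>count_space S)"
      using inflow[OF y(1)] inv[OF y(1)] y(2) by simp
    have f: "(\<integral>\<^sup>+ x. n x * q x y \<partial>count_space S) < \<infinity>"
      using inv[OF y(1)] nn_integral_ge_point[OF y(1), of "\<lambda>x. n x * out x"] fin by simp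
    have e: "l x * q x y = n x * q x y"
      by (rule nn_integral_eq_pointwise[OF _ eq f that(1)]) (auto simp: l_def intro: mult_right_mono)
    have "n x * q x y < \<infinity>"
      using f nn_integral_ge_point[OF that(1), of "\<lambda>x. n x * q x y"] by simp
    \<comment> \<open>A factor may be cancelled in \<open>ennreal\<close> only if it is finite and
      nonzero; the remaining possibility \<open>n x = 0\<close> makes the minimum equal to
      \<open>n x\<close> at once.\<close>
    then have "n x \<noteq> \<infinity> \<and> q x y \<noteq> \<infinity> \<or> n x = 0"
      using that(3) by (auto simp: ennreal_mult_less_top less_top)
    then have "l x = n x"
    proof
      assume "n x \<noteq> \<infinity> \<and> q x y \<noteq> \<infinity>"
      then show ?thesis
        using e that(3) ennreal_mult_cancel_left[of "q x y" "l x" "n x"] by (auto simp: mult.commute)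
    qed (simp add: l_def)
    then show ?thesis using that(1) by (auto simp: Z_def l_def min_def split: if_splits)
  qed
  \<comment> \<open>If m were strictly below n everywhere, the total masses, both equal to 1, could
    not agree.\<close>
  have "Z \<noteq> {}"
  proof
    assume "Z = {}"
    then have lt: "m x < n x" if "x \<in> S" for x using that by (auto simp: Z_def not_le)
    obtain z where z: "z \<in> S" using n1 by (cases "S = {}") (auto simp: nn_integral_empty)
    have "m z = n z"
    proof (rule nn_integral_eq_pointwise[OF _ _ _ z])
      show "m x \<le> n x" if "x \<in> S" for x using lt[OF that] by (rule less_imp_le)
    qed (simp_all add: m1 n1)
    with lt[OF z] show False by simp
  qed
  then have "Z = S"
  proof (rule irred[rotated])
    show "Z \<subseteq> S" by (auto simp: Z_def)
    show "x \<in> Z" if "x \<in> S" "y \<in> Z" "0 < q x y" for x y using that by (rule closed)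
  qed
  then have le: "n x \<le> m x" if "x \<in> S" for x using that by (auto simp: Z_def)
  have "n x = m x"
    by (rule nn_integral_eq_pointwise[OF le _ _ x]) (simp_all add: m1 n1)
  then show ?thesis ..
qed

section \<open>Moves along bonds, with the reservoirs as sites 0 and N + 1\<close>

definition mv :: "nat \<Rightarrow> nat \<Rightarrow> nat \<Rightarrow> nat \<Rightarrow> config \<Rightarrow> config" where
  "mv N i j k \<eta> = (\<lambda>l. if l \<in> {1..N} then (if l = i then \<eta> l - k else if l = j then \<eta> l + k else \<eta> l)
      else \<eta> l)"

text \<open>A move of more particles than present gets rate 0, so the truncated subtraction in
  \<open>mv\<close> never carries any rate. An index outside 1..N is a reservoir, and only there
  does the rate see \<theta>.\<close>

definition mv_rate :: "real \<Rightarrow> nat \<Rightarrow> (nat \<Rightarrow> real) \<Rightarrow> nat \<Rightarrow> nat \<Rightarrow> config \<Rightarrow> real" where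
  "mv_rate s N \<theta> i k \<eta> =
     (if i \<in> {1..N} then (if k \<le> \<eta> i then hop_rate s k (\<eta> i) else 0) else odds (\<theta> i) ^ k / real k)"

definition channels :: "nat \<Rightarrow> (nat \<times> nat) set" where
  "channels N = (\<lambda>i. (i, Suc i)) ` {0..N} \<union> (\<lambda>i. (Suc i, i)) ` {0..N}"

lemma sum_channels:
  fixes F :: "nat \<Rightarrow> nat \<Rightarrow> 'a :: comm_monoid_add"
  shows "(\<Sum>(i, j)\<in>channels N. F i j) = (\<Sum>i = 0..N. F i (Suc i) + F (Suc i) i)"
proof -
  have "(\<Sum>(i, j)\<in>channels N. F i j)
      = (\<Sum>(i, j)\<in>(\<lambda>i. (i, Suc i)) ` {0..N}. F i j) + (\<Sum>(i, j)\<in>(\<lambda>i. (Suc i, i)) ` {0..N}. F i j)"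
    unfolding channels_def by (intro sum.union_disjoint) auto
  also have "\<dots> = (\<Sum>i = 0..N. F i (Suc i)) + (\<Sum>i = 0..N. F (Suc i) i)"
    by (subst (1 2) sum.reindex) (auto simp: inj_on_def)
  finally show ?thesis by (simp add: sum.distrib)
qed

lemma finite_channels [simp]: "finite (channels N)"
  by (simp add: channels_def)

lemma channels_neq: "(i, j) \<in> channels N \<Longrightarrow> i \<noteq> j"
  by (auto simp: channels_def)

lemma channels_le: "(i, j) \<in> channels N \<Longrightarrow> i \<le> Suc N \<and> j \<le> Suc N"
  by (auto simp: channels_def)

lemma channels_site:
  assumes "1 \<le> N" "(i, j) \<in> channels N"
  shows "i \<in> {1..N} \<or> j \<in> {1..N}"
  using assms by (auto simp: channels_def)

lemma mv_configs: "\<eta> \<in> configs N \<Longrightarrow> mv N i j k \<eta> \<in> configs N"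
  by (auto simp: configs_def mv_def)

lemma mv_neq:
  assumes "i \<in> {1..N} \<or> j \<in> {1..N}" "i \<noteq> j" "i \<in> {1..N} \<longrightarrow> k \<le> \<eta> i" "1 \<le> k"
  shows "mv N i j k \<eta> \<noteq> \<eta>"
proof (cases "i \<in> {1..N}")
  case True
  then have "mv N i j k \<eta> i \<noteq> \<eta> i" using assms by (auto simp: mv_def)
  then show ?thesis by metis
next
  case False
  then have "mv N i j k \<eta> j \<noteq> \<eta> j" using assms by (auto simp: mv_def)
  then show ?thesis by metis
qed

text \<open>A move is undone by the opposite move along the same bond. So for each channel and each
  k a configuration has at most one predecessor, which makes inflows computable.\<close>

lemma mv_reverse:
  assumes "i \<noteq> j"
  shows "(i \<in> {1..N} \<longrightarrow> k \<le> \<eta> i) \<and> mv N i j k \<eta> = \<xi> \<longleftrightarrow>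
         (j \<in> {1..N} \<longrightarrow> k \<le> \<xi> j) \<and> \<eta> = mv N j i k \<xi>" (is "?L \<longleftrightarrow> ?R")
proof
  assume ?L
  then have 1: "i \<in> {1..N} \<longrightarrow> k \<le> \<eta> i" and 2: "\<xi> = mv N i j k \<eta>" by auto
  show ?R unfolding 2 using 1 assms by (auto simp: mv_def fun_eq_iff)
next
  assume ?R
  then have 1: "j \<in> {1..N} \<longrightarrow> k \<le> \<xi> j" and 2: "\<eta> = mv N j i k \<xi>" by auto
  show ?L unfolding 2 using 1 assms by (auto simp: mv_def fun_eq_iff)
qed

lemma mv_rate_nonneg:
  assumes "0 < s" "i \<notin> {1..N} \<longrightarrow> 0 \<le> \<theta> i"
  shows "0 \<le> mv_rate s N \<theta> i k \<eta>"
  using assms hop_rate_nonneg odds_bounds by (auto simp: mv_rate_def)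

definition flow :: "real \<Rightarrow> nat \<Rightarrow> (nat \<Rightarrow> real) \<Rightarrow> config \<Rightarrow> config \<Rightarrow> ennreal" where
  "flow s N \<theta> \<eta> \<xi> = (\<Sum>(i, j)\<in>channels N. \<Sum>n. ennreal (mv_rate s N \<theta> i (Suc n) \<eta>) *
      indicator {\<xi>} (mv N i j (Suc n) \<eta>))"

definition exit :: "real \<Rightarrow> nat \<Rightarrow> (nat \<Rightarrow> real) \<Rightarrow> config \<Rightarrow> ennreal" where
  "exit s N \<theta> \<eta> = (\<Sum>(i, j)\<in>channels N. \<Sum>n. ennreal (mv_rate s N \<theta> i (Suc n) \<eta>))"

text \<open>A configuration is recovered from the list of its first N + 1 values. Countability is
  what permits exchanging sums over configurations with integrals over densities.\<close>

lemma countable_configs: "countable (configs N)"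
proof -
  have "configs N \<subseteq> (\<lambda>xs i. if i < length xs then xs ! i else 0) ` (UNIV :: nat list set)"
  proof
    fix \<eta> assume \<eta>: "\<eta> \<in> configs N"
    have "\<eta> = (\<lambda>i. if i < length (map \<eta> [0..<Suc N]) then map \<eta> [0..<Suc N] ! i else 0)"
    proof
      fix i
      show "\<eta> i = (if i < length (map \<eta> [0..<Suc N]) then map \<eta> [0..<Suc N] ! i else 0)"
      proof (cases "i < Suc N")
        case True
        then show ?thesis by (simp del: upt_Suc)
      next
        case False
        then show ?thesis using \<eta> by (auto simp: configs_def)
      qed
    qed
    then show "\<eta> \<in> (\<lambda>xs i. if i < length xs then xs ! i else 0) ` (UNIV :: nat list set)" by (rule image_eqI) simp
  qed
  then show ?thesis by (rule countable_subset) simp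
qed

lemma nn_integral_sum_channels:
  "(\<integral>\<^sup>+ x. (\<Sum>(i, j)\<in>C. \<Sum>n. F i j n x) \<partial>count_space A) =
   (\<Sum>(i, j)\<in>C. \<Sum>n. \<integral>\<^sup>+ x. F i j n x \<partial>count_space A)"
  unfolding case_prod_beta
  by (subst nn_integral_sum) (auto intro!: sum.cong nn_integral_suminf)

lemma flow_total:
  assumes "\<eta> \<in> configs N"
  shows "(\<integral>\<^sup>+ \<xi>. flow s N \<theta> \<eta> \<xi> \<partial>count_space (configs N)) = exit s N \<theta> \<eta>"
  unfolding flow_def exit_def nn_integral_sum_channels
proof (intro sum.cong refl, clarify, intro suminf_cong)
  fix i j n
  have "(\<integral>\<^sup>+ \<xi>. ennreal (mv_rate s N \<theta> i (Suc n) \<eta>) * indicator {\<xi>} (mv N i j (Suc n) \<eta>) \<partial>count_space (configs N))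
     = ennreal (mv_rate s N \<theta> i (Suc n) \<eta>) *
       (\<integral>\<^sup>+ \<xi>. indicator {mv N i j (Suc n) \<eta>} \<xi> \<partial>count_space (configs N))"
    by (subst nn_integral_cmult[symmetric]) (auto intro!: nn_integral_cong simp: indicator_def)
  then show "(\<integral>\<^sup>+ \<xi>. ennreal (mv_rate s N \<theta> i (Suc n) \<eta>) * indicator {\<xi>} (mv N i j (Suc n) \<eta>) \<partial>count_space (configs N))
     = ennreal (mv_rate s N \<theta> i (Suc n) \<eta>)"
    using mv_configs[OF assms] by simp
qed

text \<open>By \<open>mv_reverse\<close> the predecessor of \<xi> along (i, j) is the reverse move
  of \<xi>; it exists unless j is a site that holds too few particles.\<close>

lemma inflow_eq:
  assumes "\<xi> \<in> configs N"
  shows "(\<integral>\<^sup>+ \<eta>. w \<eta> * flow s N \<theta> \<eta> \<xi> \<partial>count_space (configs N)) =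
    (\<Sum>(i, j)\<in>channels N. \<Sum>n. if j \<in> {1..N} \<longrightarrow> Suc n \<le> \<xi> j
       then w (mv N j i (Suc n) \<xi>) * ennreal (mv_rate s N \<theta> i (Suc n) (mv N j i (Suc n) \<xi>)) else 0)"
proof -
  have "(\<integral>\<^sup>+ \<eta>. w \<eta> * flow s N \<theta> \<eta> \<xi> \<partial>count_space (configs N)) =
    (\<integral>\<^sup>+ \<eta>. (\<Sum>(i, j)\<in>channels N. \<Sum>n. w \<eta> * (ennreal (mv_rate s N \<theta> i (Suc n) \<eta>) *
      indicator {\<xi>} (mv N i j (Suc n) \<eta>))) \<partial>count_space (configs N))"
    unfolding flow_def by (simp add: sum_distrib_left case_prod_beta)
  also have "\<dots> = (\<Sum>(i, j)\<in>channels N. \<Sum>n. \<integral>\<^sup>+ \<eta>. w \<eta> * (ennreal (mv_rate s N \<theta> i (Suc n) \<eta>) *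
      indicator {\<xi>} (mv N i j (Suc n) \<eta>)) \<partial>count_space (configs N))"
    by (rule nn_integral_sum_channels)
  also have "\<dots> = (\<Sum>(i, j)\<in>channels N. \<Sum>n. if j \<in> {1..N} \<longrightarrow> Suc n \<le> \<xi> j
       then w (mv N j i (Suc n) \<xi>) * ennreal (mv_rate s N \<theta> i (Suc n) (mv N j i (Suc n) \<xi>)) else 0)"
  proof (intro sum.cong refl, clarify, intro suminf_cong)
    fix i j n assume ij: "(i, j) \<in> channels N"
    let ?k = "Suc n"
    let ?c = "j \<in> {1..N} \<longrightarrow> ?k \<le> \<xi> j"
    let ?z = "mv N j i ?k \<xi>"
    have "w \<eta> * (ennreal (mv_rate s N \<theta> i ?k \<eta>) * indicator {\<xi>} (mv N i j ?k \<eta>))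
       = (if ?c then w ?z * ennreal (mv_rate s N \<theta> i ?k ?z) else 0) * indicator {?z} \<eta>" for \<eta>
    proof (cases "i \<in> {1..N} \<longrightarrow> ?k \<le> \<eta> i")
      case True
      then show ?thesis
        using mv_reverse[OF channels_neq[OF ij], of N ?k \<eta> \<xi>]
        by (auto simp: indicator_def)
    next
      case False
      then have "mv_rate s N \<theta> i ?k \<eta> = 0" by (simp add: mv_rate_def)
      moreover have "\<not> (?c \<and> \<eta> = ?z)"
        using mv_reverse[OF channels_neq[OF ij], of N ?k \<eta> \<xi>] False by auto
      ultimately show ?thesis by (auto simp: indicator_def)
    qed
    then have "(\<integral>\<^sup>+ \<eta>. w \<eta> * (ennreal (mv_rate s N \<theta> i ?k \<eta>) * indicator {\<xi>} (mv N i j ?k \<eta>)) \<partial>count_space (configs N))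
      = (\<integral>\<^sup>+ \<eta>. (if ?c then w ?z * ennreal (mv_rate s N \<theta> i ?k ?z) else 0) * indicator {?z} \<eta> \<partial>count_space (configs N))"
      by simp
    also have "\<dots> = (if ?c then w ?z * ennreal (mv_rate s N \<theta> i ?k ?z) else 0)"
      using mv_configs[OF assms] by (subst nn_integral_cmult) auto
    finally show "(\<integral>\<^sup>+ \<eta>. w \<eta> * (ennreal (mv_rate s N \<theta> i ?k \<eta>) * indicator {\<xi>} (mv N i j ?k \<eta>)) \<partial>count_space (configs N))
      = (if ?c then w ?z * ennreal (mv_rate s N \<theta> i ?k ?z) else 0)" .
  qed
  finally show ?thesis .
qed

section \<open>From the generator to the balance equations\<close>

lemma suminf_mv_rate_site:
  assumes "i \<in> {1..N}"
  shows "(\<lambda>n. mv_rate s N \<theta> i (Suc n) \<eta> * g (Suc n)) sums (\<Sum>k = 1..\<eta> i. hop_rate s k (\<eta> i) * g k)"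
proof -
  have "(\<lambda>n. mv_rate s N \<theta> i (Suc n) \<eta> * g (Suc n)) sums
      (\<Sum>n<\<eta> i. mv_rate s N \<theta> i (Suc n) \<eta> * g (Suc n))"
    using assms by (intro sums_finite) (auto simp: mv_rate_def)
  also have "(\<Sum>n<\<eta> i. mv_rate s N \<theta> i (Suc n) \<eta> * g (Suc n)) = (\<Sum>k = 1..\<eta> i. hop_rate s k (\<eta> i) * g k)"
    using assms by (simp add: sum.atLeast1_atMost_eq mv_rate_def)
  finally show ?thesis .
qed

lemma log_sums_Suc:
  assumes "\<bar>x\<bar> < (1::real)"
  shows "(\<lambda>n. x ^ Suc n / real (Suc n)) sums - ln (1 - x)"
  using log_sums[OF assms] by (subst sums_Suc_iff) simp

lemma sums_mv_rate:
  assumes "0 < s" "i \<notin> {1..N} \<longrightarrow> 0 \<le> \<theta> i"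
  shows "(\<lambda>n. mv_rate s N \<theta> i (Suc n) \<eta>) sums
     (if i \<in> {1..N} then \<Sum>k = 1..\<eta> i. hop_rate s k (\<eta> i) else ln (1 + \<theta> i))"
proof (cases "i \<in> {1..N}")
  case True
  then show ?thesis using suminf_mv_rate_site[OF True, of s \<theta> \<eta> "\<lambda>_. 1"] by simp
next
  case False
  with assms have \<theta>: "0 \<le> \<theta> i" by simp
  have o: "\<bar>odds (\<theta> i)\<bar> < 1" using odds_bounds[OF \<theta>] by simp
  have "1 - odds (\<theta> i) = inverse (1 + \<theta> i)" using \<theta> by (simp add: odds_def field_simps)
  then have "- ln (1 - odds (\<theta> i)) = ln (1 + \<theta> i)" using \<theta> by (simp add: ln_inverse)
  then show ?thesis using log_sums_Suc[OF o] False by (auto simp: mv_rate_def)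
qed

text \<open>With the reservoirs as ends of the bonds (0, 1) and (N, N + 1), bulk and boundary terms
  take one form. For N = 1 both bonds meet the same site.\<close>

lemma harmonic_gen_channels:
  fixes f :: "config \<Rightarrow> real"
  assumes N: "1 \<le> N" and \<theta>: "\<theta> 0 = \<rho>l" "\<theta> (Suc N) = \<rho>r"
  shows "harmonic_gen s \<rho>l \<rho>r N f \<eta> =
    (\<Sum>(i, j)\<in>channels N. \<Sum>n. mv_rate s N \<theta> i (Suc n) \<eta> * (f (mv N i j (Suc n) \<eta>) - f \<eta>))"
proof -
  define T where "T i j = (\<Sum>n. mv_rate s N \<theta> i (Suc n) \<eta> * (f (mv N i j (Suc n) \<eta>) - f \<eta>))" for i j
  have Tsite: "T i j = (\<Sum>k = 1..\<eta> i. hop_rate s k (\<eta> i) * (f (mv N i j k \<eta>) - f \<eta>))" if "i \<in> {1..N}" for i j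
    using suminf_mv_rate_site[OF that, of s \<theta> \<eta> "\<lambda>k. f (mv N i j k \<eta>) - f \<eta>"]
    by (simp add: T_def sums_iff)
  have bulk: "bulk_gen s i f \<eta> = T i (Suc i) + T (Suc i) i" if i: "i \<in> {1..<N}" for i
  proof -
    have 1: "mv N i (Suc i) k \<eta> = \<eta>(i := \<eta> i - k, Suc i := \<eta> (Suc i) + k)" for k
      using i by (auto simp: mv_def fun_eq_iff)
    have 2: "mv N (Suc i) i k \<eta> = \<eta>(i := \<eta> i + k, Suc i := \<eta> (Suc i) - k)" for k
      using i by (auto simp: mv_def fun_eq_iff)
    show ?thesis using i by (simp add: bulk_gen_def Tsite 1 2)
  qed
  have res: "reservoir_gen s (\<theta> j) i f \<eta> = T i j + T j i" if i: "i \<in> {1..N}" and j: "j \<notin> {1..N}" for i j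
  proof -
    have 1: "mv N i j k \<eta> = \<eta>(i := \<eta> i - k)" "mv N j i k \<eta> = \<eta>(i := \<eta> i + k)" for k
      using i j by (auto simp: mv_def fun_eq_iff)
    have "T j i = (\<Sum>n. 1 / real (Suc n) * (\<theta> j / (1 + \<theta> j)) ^ Suc n * (f (\<eta>(i := \<eta> i + Suc n)) - f \<eta>))"
      unfolding T_def 1 mv_rate_def if_not_P[OF j] odds_def by (simp add: mult_ac)
    then show ?thesis
      using i j by (simp add: reservoir_gen_def Tsite 1)
  qed
  have split: "{0..N} = insert 0 (insert N {1..<N})" using N by auto
  have "(\<Sum>(i, j)\<in>channels N. T i j) = (\<Sum>i = 0..N. T i (Suc i) + T (Suc i) i)"
    by (rule sum_channels)
  also have "\<dots> = (T 0 1 + T 1 0) + (T N (Suc N) + T (Suc N) N) + (\<Sum>i = 1..<N. T i (Suc i) + T (Suc i) i)"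
    unfolding split using N by simp
  also have "\<dots> = harmonic_gen s \<rho>l \<rho>r N f \<eta>"
    using res[of 1 0] res[of N "Suc N"] N \<theta> by (simp add: harmonic_gen_def bulk)
  finally show ?thesis by (simp add: T_def)
qed

lemma exit_finite:
  assumes "0 < s" "\<And>i. 0 \<le> \<theta> i"
  shows "exit s N \<theta> \<eta> < \<infinity>"
proof -
  have "(\<Sum>n. ennreal (mv_rate s N \<theta> i (Suc n) \<eta>)) < \<infinity>" for i
    using sums_mv_rate[OF assms(1), of i N \<theta> \<eta>] mv_rate_nonneg[OF assms(1), of i N \<theta>] assms(2)
    by (subst suminf_ennreal2) (auto simp: sums_iff)
  then show ?thesis by (auto simp: exit_def less_top)
qed

lemma flow_le_exit: "flow s N \<theta> \<eta> \<xi> \<le> exit s N \<theta> \<eta>"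
  unfolding flow_def exit_def
  by (intro sum_mono) (auto intro!: suminf_le summableI simp: indicator_def)

lemma flow_self:
  assumes "1 \<le> N"
  shows "flow s N \<theta> \<eta> \<eta> = 0"
proof -
  have "ennreal (mv_rate s N \<theta> i (Suc n) \<eta>) * indicator {\<eta>} (mv N i j (Suc n) \<eta>) = 0"
    if ij: "(i, j) \<in> channels N" for i j n
  proof (cases "i \<in> {1..N} \<longrightarrow> Suc n \<le> \<eta> i")
    case True
    then show ?thesis
      using mv_neq[OF channels_site[OF assms ij] channels_neq[OF ij], of "Suc n" \<eta>] True
      by (simp add: indicator_def)
  qed (simp add: mv_rate_def)
  then show ?thesis unfolding flow_def
    by (intro sum.neutral ballI) (auto simp del: mult_eq_0_iff)
qed

text \<open>The column of \<xi> in the rate matrix, which is the derivative at time 0 of the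
  probability of being at \<xi>.\<close>

lemma harmonic_gen_indicator:
  assumes s: "0 < s" and N: "1 \<le> N" and \<theta>: "\<And>i. 0 \<le> \<theta> i" "\<theta> 0 = \<rho>l" "\<theta> (Suc N) = \<rho>r"
  shows "harmonic_gen s \<rho>l \<rho>r N (indicator {\<xi>}) \<eta> =
    enn2real (flow s N \<theta> \<eta> \<xi>) - indicator {\<xi>} \<eta> * enn2real (exit s N \<theta> \<eta>)"
proof -
  define a where "a i n = mv_rate s N \<theta> i (Suc n) \<eta>" for i n
  have a0: "0 \<le> a i n" for i n unfolding a_def using mv_rate_nonneg[OF s] \<theta>(1) by blast
  have sa: "summable (a i)" for i
    using sums_mv_rate[OF s, of i N \<theta> \<eta>] \<theta>(1) by (auto simp: a_def[abs_def] sums_iff)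
  define b where "b i j n = a i n * (indicator {\<xi>} (mv N i j (Suc n) \<eta>) :: real)" for i j n
  have b0: "0 \<le> b i j n" for i j n using a0 by (simp add: b_def)
  have sb: "summable (b i j)" for i j
    by (rule summable_comparison_test[OF _ sa[of i]]) (auto intro!: exI[of _ 0] simp: b_def a0 indicator_def)
  have f: "flow s N \<theta> \<eta> \<xi> = ennreal (\<Sum>(i, j)\<in>channels N. \<Sum>n. b i j n)"
  proof -
    have "flow s N \<theta> \<eta> \<xi> = (\<Sum>(i, j)\<in>channels N. \<Sum>n. ennreal (b i j n))"
      unfolding flow_def b_def a_def using mv_rate_nonneg[OF s] \<theta>(1)
      by (intro sum.cong refl, clarify, intro suminf_cong) (auto simp: indicator_def)
    also have "\<dots> = (\<Sum>(i, j)\<in>channels N. ennreal (\<Sum>n. b i j n))"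
      using b0 sb by (simp add: suminf_ennreal2)
    also have "\<dots> = ennreal (\<Sum>(i, j)\<in>channels N. \<Sum>n. b i j n)"
      unfolding case_prod_beta using b0 sb by (intro sum_ennreal suminf_nonneg) auto
    finally show ?thesis .
  qed
  have e: "exit s N \<theta> \<eta> = ennreal (\<Sum>(i, j)\<in>channels N. \<Sum>n. a i n)"
  proof -
    have "exit s N \<theta> \<eta> = (\<Sum>(i, j)\<in>channels N. ennreal (\<Sum>n. a i n))"
      unfolding exit_def a_def[symmetric] using a0 sa by (simp add: suminf_ennreal2)
    also have "\<dots> = ennreal (\<Sum>(i, j)\<in>channels N. \<Sum>n. a i n)"
      unfolding case_prod_beta using a0 sa by (intro sum_ennreal suminf_nonneg) auto
    finally show ?thesis .
  qed
  have "harmonic_gen s \<rho>l \<rho>r N (indicator {\<xi>}) \<eta>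
     = (\<Sum>(i, j)\<in>channels N. \<Sum>n. b i j n - a i n * indicator {\<xi>} \<eta>)"
    unfolding harmonic_gen_channels[OF N \<theta>(2,3)] b_def a_def by (simp add: algebra_simps)
  also have "\<dots> = (\<Sum>(i, j)\<in>channels N. (\<Sum>n. b i j n) - (\<Sum>n. a i n) * indicator {\<xi>} \<eta>)"
    using sb sa by (simp add: suminf_diff[symmetric] suminf_mult2 summable_mult2)
  also have "\<dots> = (\<Sum>(i, j)\<in>channels N. \<Sum>n. b i j n) - (\<Sum>(i, j)\<in>channels N. \<Sum>n. a i n) * indicator {\<xi>} \<eta>"
    by (simp add: case_prod_beta sum_subtractf sum_distrib_right)
  also have "(\<Sum>(i, j)\<in>channels N. \<Sum>n. b i j n) = enn2real (flow s N \<theta> \<eta> \<xi>)"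
    unfolding f using b0 sb by (subst enn2real_ennreal) (auto intro!: sum_nonneg suminf_nonneg)
  also have "(\<Sum>(i, j)\<in>channels N. \<Sum>n. a i n) = enn2real (exit s N \<theta> \<eta>)"
    unfolding e using a0 sa by (subst enn2real_ennreal) (auto intro!: sum_nonneg suminf_nonneg)
  finally show ?thesis by simp
qed

lemma flow_pos:
  assumes "(i, j) \<in> channels N" "0 < mv_rate s N \<theta> i (Suc n) \<eta>" "mv N i j (Suc n) \<eta> = \<xi>"
  shows "0 < flow s N \<theta> \<eta> \<xi>"
proof -
  let ?t = "\<lambda>i j n. ennreal (mv_rate s N \<theta> i (Suc n) \<eta>) * indicator {\<xi>} (mv N i j (Suc n) \<eta>)"
  have "0 < ?t i j n" using assms by simp
  also have "?t i j n \<le> (\<Sum>n. ?t i j n)"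
  proof -
    define g where "g = ?t i j"
    have "(\<Sum>m\<in>{n}. g m) \<le> (\<Sum>m. g m)" by (rule sum_le_suminf) (auto intro: summableI)
    then have "g n \<le> (\<Sum>m. g m)" by simp
    then show ?thesis by (simp only: g_def)
  qed
  also have "\<dots> \<le> flow s N \<theta> \<eta> \<xi>"
    unfolding flow_def using member_le_sum[OF assms(1), of "\<lambda>(i, j). \<Sum>n. ?t i j n"] by simp
  finally show ?thesis .
qed

text \<open>The potential \<open>pot\<close> measures the distance of the particles to the right
  reservoir, and pushing a whole pile one site to the right lowers it. So every configuration leads
  to the empty one, and the reversed pushes lead back. Particles need only be injected from the
  right, where the density is positive; \<rho>l may be 0.\<close>

lemma flow_irreducible:
  assumes s: "0 < s" and N: "1 \<le> N" and \<rho>r: "0 < \<theta> (Suc N)"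
    and Z: "Z \<subseteq> configs N" "Z \<noteq> {}"
    and closed: "\<And>\<eta> \<xi>. \<eta> \<in> configs N \<Longrightarrow> \<xi> \<in> Z \<Longrightarrow> 0 < flow s N \<theta> \<eta> \<xi> \<Longrightarrow> \<eta> \<in> Z"
  shows "Z = configs N"
proof -
  define pot where "pot \<eta> = (\<Sum>i\<in>{1..N}. \<eta> i * (Suc N - i))" for \<eta> :: config
  define z :: config where "z = (\<lambda>_. 0)"
  have nz: "\<exists>i\<in>{1..N}. 0 < \<eta> i" if "\<eta> \<in> configs N" "\<eta> \<noteq> z" for \<eta>
    using that by (auto simp: configs_def z_def fun_eq_iff) force
  have pot_less: "pot (mv N i (Suc i) (\<eta> i) \<eta>) < pot \<eta>" if i: "i \<in> {1..N}" "0 < \<eta> i" for i \<eta>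
  proof -
    let ?\<xi> = "mv N i (Suc i) (\<eta> i) \<eta>"
    define R where "R = (\<Sum>l\<in>{1..N} - {i, Suc i}. \<eta> l * (Suc N - l))"
    have R: "(\<Sum>l\<in>{1..N} - {i, Suc i}. ?\<xi> l * (Suc N - l)) = R"
      unfolding R_def by (intro sum.cong) (auto simp: mv_def)
    show ?thesis
    proof (cases "Suc i \<in> {1..N}")
      case True
      then have sp: "{1..N} = insert i (insert (Suc i) ({1..N} - {i, Suc i}))" using i by auto
      have "pot \<xi> = \<xi> i * (Suc N - i) + \<xi> (Suc i) * (Suc N - Suc i) + (\<Sum>l\<in>{1..N} - {i, Suc i}. \<xi> l * (Suc N - l))" for \<xi>
        unfolding pot_def by (subst sp) simp
      moreover have "?\<xi> i = 0" "?\<xi> (Suc i) = \<eta> (Suc i) + \<eta> i" using i True by (auto simp: mv_def)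
      moreover have "Suc N - i = Suc (Suc N - Suc i)" using i by auto
      ultimately show ?thesis using R i by (simp add: R_def algebra_simps)
    next
      case False
      then have sp: "{1..N} = insert i ({1..N} - {i, Suc i})" using i by auto
      have "pot \<xi> = \<xi> i * (Suc N - i) + (\<Sum>l\<in>{1..N} - {i, Suc i}. \<xi> l * (Suc N - l))" for \<xi>
        unfolding pot_def by (subst sp) simp
      moreover have "?\<xi> i = 0" using i by (auto simp: mv_def)
      ultimately show ?thesis using R i by (simp add: R_def)
    qed
  qed
  have ch: "(i, Suc i) \<in> channels N" "(Suc i, i) \<in> channels N" if "i \<in> {1..N}" for i
    using that by (auto simp: channels_def)
  \<comment> \<open>The pushed configuration is a predecessor of \<xi>, because the reverse push
    leads back to \<xi>; so it lies in Z, with smaller potential.\<close>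
  have z_in: "z \<in> Z" if "\<xi> \<in> Z" for \<xi>
    using that
  proof (induction "pot \<xi>" arbitrary: \<xi> rule: less_induct)
    case less
    show ?case
    proof (cases "\<xi> = z")
      case False
      have c: "\<xi> \<in> configs N" using less.prems Z by auto
      obtain i where i: "i \<in> {1..N}" "0 < \<xi> i" using nz[OF c False] by auto
      let ?\<eta> = "mv N i (Suc i) (\<xi> i) \<xi>"
      obtain n where n: "\<xi> i = Suc n" using i(2) by (cases "\<xi> i") auto
      have "mv N (Suc i) i (Suc n) ?\<eta> = \<xi> \<and> (Suc i \<in> {1..N} \<longrightarrow> Suc n \<le> ?\<eta> (Suc i))"
        using mv_reverse[of "Suc i" i N "Suc n" ?\<eta> \<xi>] n by auto
      moreover have "0 < mv_rate s N \<theta> (Suc i) (Suc n) ?\<eta>"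
      proof (cases "Suc i \<in> {1..N}")
        case True
        then show ?thesis
          using hop_rate_pos[OF s, of "Suc n" "?\<eta> (Suc i)"] calculation by (simp add: mv_rate_def)
      next
        case False
        then have "Suc i = Suc N" using i by auto
        then show ?thesis using \<rho>r by (simp add: mv_rate_def odds_def)
      qed
      ultimately have "?\<eta> \<in> Z"
        using closed[OF mv_configs[OF c] less.prems flow_pos[OF ch(2)[OF i(1)]]] by blast
      then show ?thesis using less.hyps[OF pot_less[of i \<xi>, OF i]] by blast
    qed (use less in simp)
  qed
  \<comment> \<open>Conversely, \<eta> is a predecessor of its pushed version, which is in Z by
    induction.\<close>
  have "\<eta> \<in> Z" if "\<eta> \<in> configs N" for \<eta>
    using that
  proof (induction "pot \<eta>" arbitrary: \<eta> rule: less_induct)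
    case less
    show ?case
    proof (cases "\<eta> = z")
      case True
      then show ?thesis using z_in Z by auto
    next
      case False
      obtain i where i: "i \<in> {1..N}" "0 < \<eta> i" using nz[OF less.prems False] by auto
      obtain n where n: "\<eta> i = Suc n" using i(2) by (cases "\<eta> i") auto
      have "mv N i (Suc i) (\<eta> i) \<eta> \<in> Z"
        by (rule less.hyps[OF pot_less[of i \<eta>, OF i] mv_configs[OF less.prems]])
      moreover have "0 < flow s N \<theta> \<eta> (mv N i (Suc i) (\<eta> i) \<eta>)"
        by (rule flow_pos[OF ch(1)[OF i(1)], of s \<theta> n])
           (use i n hop_rate_pos[OF s, of "Suc n" "\<eta> i"] in \<open>auto simp: mv_rate_def\<close>)
      ultimately show ?thesis using closed[OF less.prems] by blast
    qed
  qed
  then show ?thesis using Z by auto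
qed

text \<open>Invariance at time t expresses the off-diagonal inflow of P t into \<xi> through the
  diagonal entry. After division by t the latter converges to the outflow as t tends to 0; for the
  inflow only Fatou's lemma is available, hence an inequality.\<close>

lemma invariant_subinvariant:
  assumes s: "0 < s" and N: "1 \<le> N" and \<theta>: "\<And>i. 0 \<le> \<theta> i" "\<theta> 0 = \<rho>l" "\<theta> (Suc N) = \<rho>r"
    and P: "harmonic_process s \<rho>l \<rho>r N P" and \<mu>: "invariant_measure N P \<mu>"
    and \<xi>: "\<xi> \<in> configs N"
  shows "(\<integral>\<^sup>+ \<eta>. ennreal (pmf \<mu> \<eta>) * flow s N \<theta> \<eta> \<xi> \<partial>count_space (configs N))
     \<le> ennreal (pmf \<mu> \<xi>) * exit s N \<theta> \<xi>"
proof -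
  define t where "t n = 1 / real (Suc n)" for n
  have t0: "0 < t n" for n by (simp add: t_def)
  have tlim: "filterlim t (at 0 within {0..}) sequentially"
    unfolding filterlim_at
  proof
    show "\<forall>\<^sub>F n in sequentially. t n \<in> {0..} \<and> t n \<noteq> 0"
      using t0 by (intro always_eventually allI) (metis atLeast_iff less_imp_le less_irrefl)
    show "t \<longlonglongrightarrow> 0"
      using LIMSEQ_inverse_real_of_nat by (simp add: t_def[abs_def] inverse_eq_divide)
  qed
  have lim: "(\<lambda>n. (pmf (P (t n) \<eta>) \<xi> - indicator {\<xi>} \<eta>) / t n) \<longlonglongrightarrow>
      enn2real (flow s N \<theta> \<eta> \<xi>) - indicator {\<xi>} \<eta> * enn2real (exit s N \<theta> \<eta>)"
    if \<eta>: "\<eta> \<in> configs N" for \<eta>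
  proof -
    have ex: "measure_pmf.expectation p (indicator {\<xi>} :: config \<Rightarrow> real) = pmf p \<xi>" for p
      by (simp add: pmf.rep_eq)
    have "bounded (range (indicator {\<xi>} :: config \<Rightarrow> real))"
      by (rule boundedI[of _ 1]) (auto simp: indicator_def)
    then have "((\<lambda>t. measure_pmf.expectation (P t \<eta>) (indicator {\<xi>}))
         has_real_derivative harmonic_gen s \<rho>l \<rho>r N (indicator {\<xi>}) \<eta>) (at 0 within {0..})"
      using P \<eta> unfolding harmonic_process_def by blast
    then have "((\<lambda>u. (pmf (P u \<eta>) \<xi> - pmf (P 0 \<eta>) \<xi>) / (u - 0)) \<longlongrightarrow>
        harmonic_gen s \<rho>l \<rho>r N (indicator {\<xi>}) \<eta>) (at 0 within {0..})"
      unfolding ex has_field_derivative_iff .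
    from filterlim_compose[OF this tlim]
    have "(\<lambda>n. (pmf (P (t n) \<eta>) \<xi> - pmf (P 0 \<eta>) \<xi>) / t n) \<longlonglongrightarrow> harmonic_gen s \<rho>l \<rho>r N (indicator {\<xi>}) \<eta>"
      by simp
    moreover have "P 0 \<eta> = return_pmf \<eta>" using P \<eta> unfolding harmonic_process_def by blast
    ultimately show ?thesis
      unfolding harmonic_gen_indicator[OF s N \<theta>] by (simp add: indicator_def eq_commute)
  qed
  have ef: "exit s N \<theta> \<eta> < \<infinity>" for \<eta> by (rule exit_finite[OF s \<theta>(1)])
  have ff: "flow s N \<theta> \<eta> \<xi> < \<infinity>" for \<eta> using flow_le_exit[of s N \<theta> \<eta> \<xi>] ef[of \<eta>] by (rule le_less_trans)
  have set: "set_pmf \<mu> \<subseteq> configs N" using \<mu> by (simp add: invariant_measure_def)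
  \<comment> \<open>The diagonal entry is taken out: its difference quotient is not positive, and
    Fatou needs nonnegative integrands.\<close>
  define u where "u n \<eta> = (if \<eta> = \<xi> then 0 else ennreal (pmf (P (t n) \<eta>) \<xi> / t n))" for n \<eta>
  have ulim: "liminf (\<lambda>n. u n \<eta>) = flow s N \<theta> \<eta> \<xi>" if \<eta>: "\<eta> \<in> configs N" for \<eta>
  proof (cases "\<eta> = \<xi>")
    case True
    then show ?thesis using flow_self[OF N, of s \<theta> \<xi>] by (simp add: u_def Liminf_const)
  next
    case False
    then have "(\<lambda>n. ennreal (pmf (P (t n) \<eta>) \<xi> / t n)) \<longlonglongrightarrow> ennreal (enn2real (flow s N \<theta> \<eta> \<xi>))"
      using lim[OF \<eta>] by (intro tendsto_ennrealI) simp
    then have "(\<lambda>n. u n \<eta>) \<longlonglongrightarrow> flow s N \<theta> \<eta> \<xi>"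
      using False ff[of \<eta>] by (simp add: u_def)
    then show ?thesis by (intro lim_imp_Liminf) auto
  qed
  have uint: "(\<integral>\<^sup>+ \<eta>. u n \<eta> \<partial>measure_pmf \<mu>) = ennreal (pmf \<mu> \<xi> * ((1 - pmf (P (t n) \<xi>) \<xi>) / t n))" for n
  proof -
    define A where "A = (\<integral>\<^sup>+ \<eta>. (if \<eta> = \<xi> then 0 else ennreal (pmf (P (t n) \<eta>) \<xi>)) \<partial>measure_pmf \<mu>)"
    have "bind_pmf \<mu> (P (t n)) = \<mu>" using \<mu> t0[of n] by (simp add: invariant_measure_def)
    then have "ennreal (pmf \<mu> \<xi>) = (\<integral>\<^sup>+ \<eta>. ennreal (pmf (P (t n) \<eta>) \<xi>) \<partial>measure_pmf \<mu>)"
      using ennreal_pmf_bind[of \<mu> "P (t n)" \<xi>] by simp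
    also have "\<dots> = (\<integral>\<^sup>+ \<eta>. (if \<eta> = \<xi> then 0 else ennreal (pmf (P (t n) \<eta>) \<xi>))
        + ennreal (pmf (P (t n) \<xi>) \<xi>) * indicator {\<xi>} \<eta> \<partial>measure_pmf \<mu>)"
      by (intro nn_integral_cong) (auto simp: indicator_def)
    also have "\<dots> = A + ennreal (pmf (P (t n) \<xi>) \<xi>) * ennreal (pmf \<mu> \<xi>)"
      by (subst nn_integral_add) (auto simp: A_def nn_integral_cmult emeasure_pmf_single)
    finally have eq: "ennreal (pmf \<mu> \<xi>) = A + ennreal (pmf (P (t n) \<xi>) \<xi> * pmf \<mu> \<xi>)"
      by (simp add: ennreal_mult)
    have "A \<noteq> \<infinity>"
    proof
      assume "A = \<infinity>"
      with eq show False by simp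
    qed
    then obtain a where a: "A = ennreal a" "0 \<le> a" by (cases A) auto
    have "pmf \<mu> \<xi> = a + pmf (P (t n) \<xi>) \<xi> * pmf \<mu> \<xi>"
      using eq a by (simp add: flip: ennreal_plus)
    then have a2: "a = pmf \<mu> \<xi> * (1 - pmf (P (t n) \<xi>) \<xi>)" by (simp add: algebra_simps)
    have "(\<integral>\<^sup>+ \<eta>. u n \<eta> \<partial>measure_pmf \<mu>) = (\<integral>\<^sup>+ \<eta>. ennreal (1 / t n) * (if \<eta> = \<xi> then 0 else ennreal (pmf (P (t n) \<eta>) \<xi>)) \<partial>measure_pmf \<mu>)"
      using t0[of n] by (intro nn_integral_cong) (auto simp: u_def simp flip: ennreal_mult)
    also have "\<dots> = ennreal (1 / t n) * A" by (simp add: nn_integral_cmult A_def)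
    finally show ?thesis using a a2 t0[of n] by (simp flip: ennreal_mult)
  qed
  have rlim: "(\<lambda>n. ennreal (pmf \<mu> \<xi> * ((1 - pmf (P (t n) \<xi>) \<xi>) / t n))) \<longlonglongrightarrow> ennreal (pmf \<mu> \<xi> * enn2real (exit s N \<theta> \<xi>))"
  proof (intro tendsto_ennrealI tendsto_mult tendsto_const)
    have "(\<lambda>n. - ((pmf (P (t n) \<xi>) \<xi> - indicator {\<xi>} \<xi>) / t n)) \<longlonglongrightarrow> - (0 - 1 * enn2real (exit s N \<theta> \<xi>))"
      using lim[OF \<xi>] flow_self[OF N, of s \<theta> \<xi>] by (intro tendsto_minus) simp
    then show "(\<lambda>n. (1 - pmf (P (t n) \<xi>) \<xi>) / t n) \<longlonglongrightarrow> enn2real (exit s N \<theta> \<xi>)"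
      by (simp add: minus_divide_left)
  qed
  have "(\<integral>\<^sup>+ \<eta>. ennreal (pmf \<mu> \<eta>) * flow s N \<theta> \<eta> \<xi> \<partial>count_space (configs N))
      = (\<integral>\<^sup>+ \<eta>. flow s N \<theta> \<eta> \<xi> \<partial>measure_pmf \<mu>)"
    unfolding nn_integral_measure_pmf using set
    by (intro nn_integral_count_space_eq) (auto simp: set_pmf_iff)
  also have "\<dots> = (\<integral>\<^sup>+ \<eta>. liminf (\<lambda>n. u n \<eta>) \<partial>measure_pmf \<mu>)"
    using set ulim by (intro nn_integral_cong_AE) (auto simp: AE_measure_pmf_iff)
  also have "\<dots> \<le> liminf (\<lambda>n. \<integral>\<^sup>+ \<eta>. u n \<eta> \<partial>measure_pmf \<mu>)"
    by (intro nn_integral_liminf) auto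
  also have "\<dots> = ennreal (pmf \<mu> \<xi> * enn2real (exit s N \<theta> \<xi>))"
    unfolding uint using rlim by (intro lim_imp_Liminf) auto
  also have "\<dots> = ennreal (pmf \<mu> \<xi>) * exit s N \<theta> \<xi>"
    using ef[of \<xi>] by (simp add: ennreal_mult)
  finally show ?thesis .
qed

section \<open>Local balance at a site\<close>

text \<open>The reservoir densities become coordinates 0 and N + 1, so that kernels and rates
  address all neighbours uniformly while the integration runs over 1..N.\<close>

definition pinned :: "real \<Rightarrow> real \<Rightarrow> nat \<Rightarrow> (nat \<Rightarrow> real) \<Rightarrow> nat \<Rightarrow> real" where
  "pinned a b N \<theta> = \<theta>(0 := a, Suc N := b)"

definition wt :: "real \<Rightarrow> nat \<Rightarrow> (nat \<Rightarrow> real) \<Rightarrow> config \<Rightarrow> real" where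
  "wt r N \<theta> \<xi> = (\<Prod>l\<in>{1..N}. nbp r (\<theta> l) (\<xi> l))"

definition wt_except :: "real \<Rightarrow> nat \<Rightarrow> (nat \<Rightarrow> real) \<Rightarrow> config \<Rightarrow> nat \<Rightarrow> real" where
  "wt_except r N \<theta> \<xi> j = (\<Prod>l\<in>{1..N} - {j}. nbp r (\<theta> l) (\<xi> l))"

text \<open>The unnormalised joint density of the site densities. It vanishes unless the coordinates
  increase, which together with a \<ge> 0 supplies the nonnegativity of all densities on its
  support.\<close>

definition path_density :: "real \<Rightarrow> nat \<Rightarrow> (nat \<Rightarrow> real) \<Rightarrow> ennreal" where
  "path_density r N \<theta> = (\<Prod>i\<in>{0..N}. kap r (\<theta> i) (\<theta> (Suc i)))"

lemma wt_nonneg: "0 < r \<Longrightarrow> (\<And>l. l \<in> {1..N} \<Longrightarrow> 0 \<le> \<theta> l) \<Longrightarrow> 0 \<le> wt r N \<theta> \<xi>"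
  unfolding wt_def by (intro prod_nonneg) (auto intro: nbp_nonneg)

lemma wt_except_nonneg: "0 < r \<Longrightarrow> (\<And>l. l \<in> {1..N} \<Longrightarrow> 0 \<le> \<theta> l) \<Longrightarrow> 0 \<le> wt_except r N \<theta> \<xi> j"
  unfolding wt_except_def by (intro prod_nonneg) (auto intro: nbp_nonneg)

lemma wt_split: "j \<in> {1..N} \<Longrightarrow> wt r N \<theta> \<xi> = nbp r (\<theta> j) (\<xi> j) * wt_except r N \<theta> \<xi> j"
  unfolding wt_def wt_except_def by (subst prod.remove[of _ j]) auto

text \<open>At a donor site i, \<open>hop_rate_nbp\<close> trades rate and weight for odds ^ k / k;
  at a receiver site j the weight is taken with k particles fewer than in \<xi>. Reservoirs carry no
  weight, so the formula covers them too.\<close>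

lemma wt_mv_rate:
  assumes s: "0 < s" and ij: "i \<noteq> j" and k: "1 \<le> k" "j \<in> {1..N} \<longrightarrow> k \<le> \<xi> j"
  shows "mv_rate s N \<theta> i k (mv N j i k \<xi>) * wt (2 * s) N \<theta> (mv N j i k \<xi>) =
    odds (\<theta> i) ^ k / real k *
    (if j \<in> {1..N} then wt_except (2 * s) N \<theta> \<xi> j * nbp (2 * s) (\<theta> j) (\<xi> j - k) else wt (2 * s) N \<theta> \<xi>)"
proof -
  let ?\<eta> = "mv N j i k \<xi>"
  let ?c = "odds (\<theta> i) ^ k / real k"
  let ?B = "\<lambda>l. nbp (2 * s) (\<theta> l) (if l = j then \<xi> l - k else \<xi> l)"
  have "mv_rate s N \<theta> i k ?\<eta> * wt (2 * s) N \<theta> ?\<eta> = ?c * (\<Prod>l\<in>{1..N}. ?B l)"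
  proof (cases "i \<in> {1..N}")
    case True
    have "mv_rate s N \<theta> i k ?\<eta> * wt (2 * s) N \<theta> ?\<eta>
       = (hop_rate s k (\<xi> i + k) * nbp (2 * s) (\<theta> i) (\<xi> i + k)) * wt_except (2 * s) N \<theta> ?\<eta> i"
      using True ij by (simp add: wt_split[OF True] mv_rate_def mv_def)
    also have "\<dots> = ?c * (nbp (2 * s) (\<theta> i) (\<xi> i) * wt_except (2 * s) N \<theta> ?\<eta> i)"
      unfolding hop_rate_nbp[OF s k(1)] by simp
    also have "wt_except (2 * s) N \<theta> ?\<eta> i = (\<Prod>l\<in>{1..N} - {i}. ?B l)"
      unfolding wt_except_def by (intro prod.cong) (auto simp: mv_def)
    also have "nbp (2 * s) (\<theta> i) (\<xi> i) * (\<Prod>l\<in>{1..N} - {i}. ?B l) = (\<Prod>l\<in>{1..N}. ?B l)"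
      using True ij by (subst prod.remove[of "{1..N}" i]) auto
    finally show ?thesis .
  next
    case False
    have "wt (2 * s) N \<theta> ?\<eta> = (\<Prod>l\<in>{1..N}. ?B l)"
      unfolding wt_def using False by (intro prod.cong) (auto simp: mv_def)
    then show ?thesis using False by (auto simp: mv_rate_def)
  qed
  also have "(\<Prod>l\<in>{1..N}. ?B l) =
    (if j \<in> {1..N} then wt_except (2 * s) N \<theta> \<xi> j * nbp (2 * s) (\<theta> j) (\<xi> j - k) else wt (2 * s) N \<theta> \<xi>)"
  proof (cases "j \<in> {1..N}")
    case True
    have "(\<Prod>l\<in>{1..N}. ?B l) = ?B j * (\<Prod>l\<in>{1..N} - {j}. ?B l)"
      using True by (subst prod.remove[of _ j]) auto
    also have "(\<Prod>l\<in>{1..N} - {j}. ?B l) = wt_except (2 * s) N \<theta> \<xi> j"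
      unfolding wt_except_def by (intro prod.cong) auto
    finally show ?thesis using True by simp
  next
    case False
    then show ?thesis unfolding wt_def if_not_P[OF False] by (intro prod.cong) auto
  qed
  finally show ?thesis .
qed

lemma odds_log_sums:
  assumes "0 \<le> \<theta>"
  shows "(\<lambda>n. odds \<theta> ^ Suc n / real (Suc n)) sums ln (1 + \<theta>)"
proof -
  have o: "\<bar>odds \<theta>\<bar> < 1" using odds_bounds[OF assms] by simp
  have "1 - odds \<theta> = inverse (1 + \<theta>)" using assms by (simp add: odds_def field_simps)
  then have "- ln (1 - odds \<theta>) = ln (1 + \<theta>)" using assms by (simp add: ln_inverse)
  then show ?thesis using log_sums[OF o] sums_Suc_iff[of "\<lambda>n. odds \<theta> ^ n / real n"] by simp
qed

text \<open>For fixed \<theta>, the sum over k in a channel is a \<open>feed\<close> term if the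
  receiver is a site, where k is limited by its occupation, and the full logarithmic series if it is
  a reservoir.\<close>

lemma wt_inflow:
  assumes s: "0 < s" and \<theta>: "\<And>i. i \<le> Suc N \<Longrightarrow> 0 \<le> \<theta> i" and \<xi>: "\<xi> \<in> configs N"
  shows "(\<integral>\<^sup>+ \<eta>. ennreal (wt (2 * s) N \<theta> \<eta>) * flow s N \<theta> \<eta> \<xi> \<partial>count_space (configs N)) =
    ennreal (\<Sum>(i, j)\<in>channels N. if j \<in> {1..N}
       then wt_except (2 * s) N \<theta> \<xi> j * feed (2 * s) (odds (\<theta> i)) (\<theta> j) (\<xi> j)
       else ln (1 + \<theta> i) * wt (2 * s) N \<theta> \<xi>)"
proof -
  define r where "r = 2 * s"
  have r: "0 < r" using s by (simp add: r_def)
  have w0: "0 \<le> wt r N \<theta> \<eta>" "0 \<le> wt_except r N \<theta> \<eta> j" for \<eta> j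
    using \<theta> by (auto intro!: wt_nonneg wt_except_nonneg r)
  have "(\<Sum>n. if j \<in> {1..N} \<longrightarrow> Suc n \<le> \<xi> j
       then ennreal (wt r N \<theta> (mv N j i (Suc n) \<xi>)) * ennreal (mv_rate s N \<theta> i (Suc n) (mv N j i (Suc n) \<xi>)) else 0)
    = ennreal (if j \<in> {1..N} then wt_except r N \<theta> \<xi> j * feed r (odds (\<theta> i)) (\<theta> j) (\<xi> j)
       else ln (1 + \<theta> i) * wt r N \<theta> \<xi>)" (is "?L = ?R") if ij: "(i, j) \<in> channels N" for i j
  proof -
    have i: "0 \<le> \<theta> i" and j: "0 \<le> \<theta> j" using channels_le[OF ij] \<theta> by auto
    have t: "ennreal (wt r N \<theta> (mv N j i (Suc n) \<xi>)) * ennreal (mv_rate s N \<theta> i (Suc n) (mv N j i (Suc n) \<xi>))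
       = ennreal (odds (\<theta> i) ^ Suc n / real (Suc n) *
         (if j \<in> {1..N} then wt_except r N \<theta> \<xi> j * nbp r (\<theta> j) (\<xi> j - Suc n) else wt r N \<theta> \<xi>))"
      if "j \<in> {1..N} \<longrightarrow> Suc n \<le> \<xi> j" for n
      using wt_mv_rate[OF s channels_neq[OF ij], of "Suc n" N \<xi> \<theta>] that mv_rate_nonneg[OF s, of i N \<theta>] i w0
      by (subst ennreal_mult[symmetric]) (auto simp: r_def mult.commute)
    show ?thesis
    proof (cases "j \<in> {1..N}")
      case True
      have "?L = (\<Sum>n<\<xi> j. ennreal (odds (\<theta> i) ^ Suc n / real (Suc n) *
          (wt_except r N \<theta> \<xi> j * nbp r (\<theta> j) (\<xi> j - Suc n))))"
        using True t by (subst suminf_finite[of "{..<\<xi> j}"]) (auto intro!: sum.cong)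
      also have "\<dots> = ennreal (\<Sum>n<\<xi> j. odds (\<theta> i) ^ Suc n / real (Suc n) *
          (wt_except r N \<theta> \<xi> j * nbp r (\<theta> j) (\<xi> j - Suc n)))"
        using w0 odds_bounds[OF i] nbp_nonneg[OF r j] by (intro sum_ennreal) auto
      also have "(\<Sum>n<\<xi> j. odds (\<theta> i) ^ Suc n / real (Suc n) *
          (wt_except r N \<theta> \<xi> j * nbp r (\<theta> j) (\<xi> j - Suc n)))
         = wt_except r N \<theta> \<xi> j * feed r (odds (\<theta> i)) (\<theta> j) (\<xi> j)"
        by (simp only: feed_def One_nat_def sum.atLeast1_atMost_eq sum_distrib_left mult_ac)
      finally show ?thesis unfolding if_P[OF True] .
    next
      case False
      have "?L = (\<Sum>n. ennreal (odds (\<theta> i) ^ Suc n / real (Suc n) * wt r N \<theta> \<xi>))"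
        using False t by (intro suminf_cong) auto
      also have "\<dots> = ennreal (ln (1 + \<theta> i) * wt r N \<theta> \<xi>)"
        using sums_mult2[OF odds_log_sums[OF i], of "wt r N \<theta> \<xi>"] w0 odds_bounds[OF i]
        by (subst suminf_ennreal2) (auto simp: sums_iff)
      finally show ?thesis unfolding if_not_P[OF False] .
    qed
  qed
  then have "(\<integral>\<^sup>+ \<eta>. ennreal (wt r N \<theta> \<eta>) * flow s N \<theta> \<eta> \<xi> \<partial>count_space (configs N)) =
    (\<Sum>(i, j)\<in>channels N. ennreal (if j \<in> {1..N} then wt_except r N \<theta> \<xi> j * feed r (odds (\<theta> i)) (\<theta> j) (\<xi> j)
       else ln (1 + \<theta> i) * wt r N \<theta> \<xi>))"
    unfolding inflow_eq[OF \<xi>] by (intro sum.cong refl) auto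
  also have "\<dots> = ennreal (\<Sum>(i, j)\<in>channels N. if j \<in> {1..N}
       then wt_except r N \<theta> \<xi> j * feed r (odds (\<theta> i)) (\<theta> j) (\<xi> j) else ln (1 + \<theta> i) * wt r N \<theta> \<xi>)"
  proof -
    have "0 \<le> (if j \<in> {1..N} then wt_except r N \<theta> \<xi> j * feed r (odds (\<theta> i)) (\<theta> j) (\<xi> j) else ln (1 + \<theta> i) * wt r N \<theta> \<xi>)"
      if "(i, j) \<in> channels N" for i j
      using w0 \<theta>[of i] \<theta>[of j] channels_le[OF that] odds_bounds[of "\<theta> i"]
      by (auto intro!: mult_nonneg_nonneg feed_nonneg r)
    then show ?thesis
      unfolding case_prod_beta by (intro sum_ennreal) (metis prod.collapse)
  qed
  finally show ?thesis unfolding r_def .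
qed

text \<open>A site emits \<open>feed\<close> at its own odds by \<open>sum_hop_rate_nbp\<close>; a
  reservoir emits at the total rate ln (1 + \<theta> i).\<close>

lemma wt_outflow:
  assumes s: "0 < s" and \<theta>: "\<And>i. i \<le> Suc N \<Longrightarrow> 0 \<le> \<theta> i"
  shows "ennreal (wt (2 * s) N \<theta> \<xi>) * exit s N \<theta> \<xi> =
    ennreal (\<Sum>(i, j)\<in>channels N. if i \<in> {1..N}
       then wt_except (2 * s) N \<theta> \<xi> i * feed (2 * s) (odds (\<theta> i)) (\<theta> i) (\<xi> i)
       else ln (1 + \<theta> i) * wt (2 * s) N \<theta> \<xi>)"
proof -
  define r where "r = 2 * s"
  have r: "0 < r" using s by (simp add: r_def)
  have w0: "0 \<le> wt r N \<theta> \<eta>" "0 \<le> wt_except r N \<theta> \<eta> j" for \<eta> j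
    using \<theta> by (auto intro!: wt_nonneg wt_except_nonneg r)
  have "ennreal (wt r N \<theta> \<xi>) * (\<Sum>n. ennreal (mv_rate s N \<theta> i (Suc n) \<xi>)) =
      ennreal (if i \<in> {1..N} then wt_except r N \<theta> \<xi> i * feed r (odds (\<theta> i)) (\<theta> i) (\<xi> i)
       else ln (1 + \<theta> i) * wt r N \<theta> \<xi>)" if ij: "(i, j) \<in> channels N" for i j
  proof -
    have i: "0 \<le> \<theta> i" using channels_le[OF ij] \<theta> by auto
    have m0: "0 \<le> mv_rate s N \<theta> i k \<xi>" for k using mv_rate_nonneg[OF s] i by blast
    show ?thesis
    proof (cases "i \<in> {1..N}")
      case True
      have "(\<lambda>n. mv_rate s N \<theta> i (Suc n) \<xi>) sums (\<Sum>n<\<xi> i. mv_rate s N \<theta> i (Suc n) \<xi>)"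
        using True by (intro sums_finite) (auto simp: mv_rate_def)
      also have "(\<Sum>n<\<xi> i. mv_rate s N \<theta> i (Suc n) \<xi>) = (\<Sum>k = 1..\<xi> i. hop_rate s k (\<xi> i))"
        using True by (simp add: sum.atLeast1_atMost_eq mv_rate_def)
      finally have sm: "(\<lambda>n. mv_rate s N \<theta> i (Suc n) \<xi>) sums (\<Sum>k = 1..\<xi> i. hop_rate s k (\<xi> i))" .
      have S0: "0 \<le> (\<Sum>k = 1..\<xi> i. hop_rate s k (\<xi> i))"
        by (intro sum_nonneg) (auto intro: hop_rate_nonneg s)
      have "(\<Sum>n. ennreal (mv_rate s N \<theta> i (Suc n) \<xi>)) = ennreal (\<Sum>k = 1..\<xi> i. hop_rate s k (\<xi> i))"
        using sm m0 by (subst suminf_ennreal2) (auto simp: sums_iff)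
      then have "ennreal (wt r N \<theta> \<xi>) * (\<Sum>n. ennreal (mv_rate s N \<theta> i (Suc n) \<xi>))
         = ennreal (wt r N \<theta> \<xi> * (\<Sum>k = 1..\<xi> i. hop_rate s k (\<xi> i)))"
        by (simp only: ennreal_mult[OF w0(1) S0])
      also have "wt r N \<theta> \<xi> * (\<Sum>k = 1..\<xi> i. hop_rate s k (\<xi> i))
         = wt_except r N \<theta> \<xi> i * feed r (odds (\<theta> i)) (\<theta> i) (\<xi> i)"
        unfolding wt_split[OF True] r_def sum_hop_rate_nbp[OF s, symmetric] by (simp only: mult_ac)
      finally show ?thesis unfolding if_P[OF True] .
    next
      case False
      have "mv_rate s N \<theta> i (Suc n) \<xi> = odds (\<theta> i) ^ Suc n / real (Suc n)" for n
        unfolding mv_rate_def if_not_P[OF False] ..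
      then have "(\<Sum>n. ennreal (mv_rate s N \<theta> i (Suc n) \<xi>)) = ennreal (ln (1 + \<theta> i))"
        using odds_log_sums[OF i] m0 odds_bounds[OF i] by (subst suminf_ennreal2) (auto simp: sums_iff)
      then show ?thesis unfolding if_not_P[OF False] using w0 i by (simp add: ennreal_mult mult.commute)
    qed
  qed
  then have "ennreal (wt r N \<theta> \<xi>) * exit s N \<theta> \<xi> = (\<Sum>(i, j)\<in>channels N.
      ennreal (if i \<in> {1..N} then wt_except r N \<theta> \<xi> i * feed r (odds (\<theta> i)) (\<theta> i) (\<xi> i)
       else ln (1 + \<theta> i) * wt r N \<theta> \<xi>))"
    unfolding exit_def sum_distrib_left by (intro sum.cong refl) auto
  also have "\<dots> = ennreal (\<Sum>(i, j)\<in>channels N. if i \<in> {1..N}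
       then wt_except r N \<theta> \<xi> i * feed r (odds (\<theta> i)) (\<theta> i) (\<xi> i) else ln (1 + \<theta> i) * wt r N \<theta> \<xi>)"
  proof -
    have "0 \<le> (if i \<in> {1..N} then wt_except r N \<theta> \<xi> i * feed r (odds (\<theta> i)) (\<theta> i) (\<xi> i) else ln (1 + \<theta> i) * wt r N \<theta> \<xi>)"
      if "(i, j) \<in> channels N" for i j
      using w0 \<theta>[of i] \<theta>[of j] channels_le[OF that] odds_bounds[of "\<theta> i"]
      by (auto intro!: mult_nonneg_nonneg feed_nonneg r)
    then show ?thesis
      unfolding case_prod_beta by (intro sum_ennreal) (metis prod.collapse)
  qed
  finally show ?thesis unfolding r_def .
qed

text \<open>Regrouping channels by sites should produce the two sides of the one-site identity at
  each j, but these contain logarithmic terms that are absent from the flows. Adding the same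
  \<open>2 * L j\<close> to in- and outflow creates them, with the common remainder
  \<open>L 1 + L N\<close>. Adding instead of subtracting keeps the later integrals in
  \<open>ennreal\<close>.\<close>

lemma wt_flow_balance:
  fixes \<theta> :: "nat \<Rightarrow> real" and N :: nat and r :: real and \<xi> :: config
  assumes N: "1 \<le> N"
  defines "L \<equiv> \<lambda>i. ln (1 + \<theta> i) * wt r N \<theta> \<xi>"
    and "U \<equiv> \<lambda>i j. wt_except r N \<theta> \<xi> j * feed r (odds (\<theta> i)) (\<theta> j) (\<xi> j)"
  shows "(\<Sum>(i, j)\<in>channels N. if j \<in> {1..N} then U i j else L i) + (\<Sum>j\<in>{1..N}. 2 * L j)
       = (\<Sum>j\<in>{1..N}. U (j - 1) j + U (Suc j) j + 2 * L j) + (L 1 + L N)"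
    and "(\<Sum>(i, j)\<in>channels N. if i \<in> {1..N} then U i i else L i) + (\<Sum>j\<in>{1..N}. 2 * L j)
       = (\<Sum>j\<in>{1..N}. 2 * U j j + L (j - 1) + L (Suc j)) + (L 1 + L N)"
proof -
  have up: "{0..N} = insert 0 {1..N}" by auto
  have shift: "(\<Sum>i = 0..N. f (Suc i)) = (\<Sum>i = 1..N. f i) + f (Suc N)" for f :: "nat \<Rightarrow> real"
    using sum.atLeast_Suc_atMost_Suc_shift[of f 0 N] by (simp add: atLeast0AtMost)
  have lo: "(\<Sum>i = 0..N. f i) = f 0 + (\<Sum>i = 1..N. f i)" for f :: "nat \<Rightarrow> real"
    unfolding up by simp
  have "(\<Sum>(i, j)\<in>channels N. if j \<in> {1..N} then U i j else L i)
     = (\<Sum>i = 0..N. (if Suc i \<in> {1..N} then U (Suc i - 1) (Suc i) else L (Suc i - 1)))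
     + (\<Sum>i = 0..N. (if i \<in> {1..N} then U (Suc i) i else L (Suc i)))"
    by (simp only: sum_channels sum.distrib diff_Suc_1)
  also have "(\<Sum>i = 0..N. (if Suc i \<in> {1..N} then U (Suc i - 1) (Suc i) else L (Suc i - 1)))
     = (\<Sum>i = 1..N. U (i - 1) i) + L N"
    by (subst shift[of "\<lambda>i. if i \<in> {1..N} then U (i - 1) i else L (i - 1)"]) simp
  also have "(\<Sum>i = 0..N. (if i \<in> {1..N} then U (Suc i) i else L (Suc i))) = L 1 + (\<Sum>i = 1..N. U (Suc i) i)"
    by (subst lo) simp
  finally show "(\<Sum>(i, j)\<in>channels N. if j \<in> {1..N} then U i j else L i) + (\<Sum>j\<in>{1..N}. 2 * L j)
       = (\<Sum>j\<in>{1..N}. U (j - 1) j + U (Suc j) j + 2 * L j) + (L 1 + L N)"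
    by (simp add: sum.distrib)
  have "(\<Sum>(i, j)\<in>channels N. if i \<in> {1..N} then U i i else L i)
     = (\<Sum>i = 0..N. (if i \<in> {1..N} then U i i else L i))
     + (\<Sum>i = 0..N. (if Suc i \<in> {1..N} then U (Suc i) (Suc i) else L (Suc i)))"
    unfolding sum_channels by (simp add: sum.distrib)
  also have "(\<Sum>i = 0..N. (if i \<in> {1..N} then U i i else L i)) = L 0 + (\<Sum>i = 1..N. U i i)"
    by (subst lo) simp
  also have "(\<Sum>i = 0..N. (if Suc i \<in> {1..N} then U (Suc i) (Suc i) else L (Suc i))) = (\<Sum>i = 1..N. U i i) + L (Suc N)"
    by (subst shift[of "\<lambda>i. if i \<in> {1..N} then U i i else L i"]) simp
  finally have 1: "(\<Sum>(i, j)\<in>channels N. if i \<in> {1..N} then U i i else L i)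
     = 2 * (\<Sum>i = 1..N. U i i) + L 0 + L (Suc N)" by simp
  have 2: "(\<Sum>j = 1..N. L (j - 1)) + L N = L 0 + (\<Sum>j = 1..N. L j)"
    using shift[of "\<lambda>i. L (i - 1)"] lo[of L] by simp
  have 3: "(\<Sum>j = 1..N. L (Suc j)) + L 1 = (\<Sum>j = 1..N. L j) + L (Suc N)"
    using shift[of L] lo[of "\<lambda>i. L (Suc i)"] by simp
  show "(\<Sum>(i, j)\<in>channels N. if i \<in> {1..N} then U i i else L i) + (\<Sum>j\<in>{1..N}. 2 * L j)
       = (\<Sum>j\<in>{1..N}. 2 * U j j + L (j - 1) + L (Suc j)) + (L 1 + L N)"
    using 1 2 3 by (simp add: sum.distrib sum_distrib_left[symmetric])
qed

lemma pinned_simps [simp]: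
  "pinned a b N \<theta> 0 = a" "pinned a b N \<theta> (Suc N) = b"
  by (simp_all add: pinned_def)

lemma pinned_site: "l \<in> {1..N} \<Longrightarrow> pinned a b N \<theta> l = \<theta> l"
  by (auto simp: pinned_def)

lemma pinned_upd: "l \<in> {1..N} \<Longrightarrow> pinned a b N (\<theta>(l := y)) = (pinned a b N \<theta>)(l := y)"
  by (auto simp: pinned_def fun_eq_iff)

lemma pinned_measurable [measurable]:
  assumes "l \<le> Suc N"
  shows "(\<lambda>\<theta>. pinned a b N \<theta> l) \<in> borel_measurable (PiM {1..N} (\<lambda>_. lborel))"
proof (cases "l \<in> {1..N}")
  case True
  from measurable_component_singleton[OF this, of "\<lambda>_. lborel :: real measure"]
  have "(\<lambda>\<theta>. \<theta> l) \<in> borel_measurable (PiM {1..N} (\<lambda>_. lborel :: real measure))" by simp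
  then show ?thesis using True by (simp add: pinned_site)
next
  case False
  then have "l = 0 \<or> l = Suc N" using assms by auto
  then show ?thesis by auto
qed

lemma nbp_measurable' [measurable]:
  assumes [measurable]: "f \<in> borel_measurable M"
  shows "(\<lambda>x. nbp r (f x) n) \<in> borel_measurable M"
  unfolding nbp_def odds_def by measurable

lemma path_density_measurable [measurable]:
  "(\<lambda>\<theta>. path_density r N (pinned a b N \<theta>)) \<in> borel_measurable (PiM {1..N} (\<lambda>_. lborel))"
  unfolding path_density_def by (intro borel_measurable_prod_ennreal kap_measurable pinned_measurable) auto

lemma wt_measurable [measurable]:
  "(\<lambda>\<theta>. wt r N (pinned a b N \<theta>) \<xi>) \<in> borel_measurable (PiM {1..N} (\<lambda>_. lborel))"
  unfolding wt_def by (intro borel_measurable_prod nbp_measurable' pinned_measurable) auto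

lemma wt_except_measurable [measurable]:
  "(\<lambda>\<theta>. wt_except r N (pinned a b N \<theta>) \<xi> j) \<in> borel_measurable (PiM {1..N} (\<lambda>_. lborel))"
  unfolding wt_except_def by (intro borel_measurable_prod nbp_measurable' pinned_measurable) auto

lemma prod_kap_chain:
  assumes "(\<Prod>i\<in>{0..<m}. kap r (\<theta> i) (\<theta> (Suc i))) \<noteq> 0" "i \<le> m"
  shows "\<theta> 0 \<le> \<theta> i"
  using assms(2)
proof (induction i)
  case (Suc i)
  then have "kap r (\<theta> i) (\<theta> (Suc i)) \<noteq> 0" using assms(1) by auto
  then have "\<theta> i < \<theta> (Suc i)" using kap_eq_0 by (meson not_le)
  with Suc show ?case by simp
qed simp

lemma path_density_ge:
  assumes "path_density r N \<theta> \<noteq> 0" "i \<le> Suc N"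
  shows "\<theta> 0 \<le> \<theta> i"
  using assms prod_kap_chain[of r \<theta> "Suc N" i]
  by (simp add: path_density_def atLeastLessThanSuc_atLeastAtMost)

lemma path_density_split:
  assumes "j \<in> {1..N}"
  shows "path_density r N \<theta> = (\<Prod>i\<in>{0..N} - {j - 1, j}. kap r (\<theta> i) (\<theta> (Suc i))) *
    (kap r (\<theta> (j - 1)) (\<theta> j) * kap r (\<theta> j) (\<theta> (Suc j)))"
proof -
  have "{0..N} = insert (j - 1) (insert j ({0..N} - {j - 1, j}))" using assms by auto
  then have "path_density r N \<theta> = (\<Prod>i\<in>insert (j - 1) (insert j ({0..N} - {j - 1, j})). kap r (\<theta> i) (\<theta> (Suc i)))"
    by (simp add: path_density_def)
  also have "\<dots> = kap r (\<theta> (j - 1)) (\<theta> (Suc (j - 1))) * (kap r (\<theta> j) (\<theta> (Suc j)) *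
      (\<Prod>i\<in>{0..N} - {j - 1, j}. kap r (\<theta> i) (\<theta> (Suc i))))"
    using assms by (subst prod.insert; auto)
  finally show ?thesis using assms by (simp add: mult_ac)
qed

lemma measurable_compose3:
  fixes f g h :: "'a \<Rightarrow> real" and H :: "real \<Rightarrow> real \<Rightarrow> real \<Rightarrow> real"
  assumes H: "(\<lambda>(x, y, z). H x y z) \<in> borel_measurable (borel \<Otimes>\<^sub>M borel \<Otimes>\<^sub>M borel)"
    and [measurable]: "f \<in> borel_measurable M" "g \<in> borel_measurable M" "h \<in> borel_measurable M"
  shows "(\<lambda>x. H (f x) (g x) (h x)) \<in> borel_measurable M"
  using measurable_compose[OF _ H, of "\<lambda>x. (f x, g x, h x)" M] by simp

text \<open>Integrating over coordinate j first, with the others fixed, leaves the bridge between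
  its two neighbours, and \<open>kap_feed_identity\<close> applies to the inner integral.\<close>

lemma site_balance:
  assumes r: "0 < r" and a: "0 \<le> a" and j: "j \<in> {1..N}"
  shows "(\<integral>\<^sup>+ \<theta>. path_density r N (pinned a b N \<theta>) * ennreal (wt_except r N (pinned a b N \<theta>) \<xi> j *
       (feed r (odds (pinned a b N \<theta> (j - 1))) (pinned a b N \<theta> j) (\<xi> j)
      + feed r (odds (pinned a b N \<theta> (Suc j))) (pinned a b N \<theta> j) (\<xi> j)
      + 2 * ln (1 + pinned a b N \<theta> j) * nbp r (pinned a b N \<theta> j) (\<xi> j))) \<partial>PiM {1..N} (\<lambda>_. lborel))
    = (\<integral>\<^sup>+ \<theta>. path_density r N (pinned a b N \<theta>) * ennreal (wt_except r N (pinned a b N \<theta>) \<xi> j *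
       (2 * feed r (odds (pinned a b N \<theta> j)) (pinned a b N \<theta> j) (\<xi> j)
      + (ln (1 + pinned a b N \<theta> (j - 1)) + ln (1 + pinned a b N \<theta> (Suc j))) * nbp r (pinned a b N \<theta> j) (\<xi> j)))
      \<partial>PiM {1..N} (\<lambda>_. lborel))"
proof -
  interpret product_sigma_finite "\<lambda>_::nat. lborel :: real measure"
    by standard
  define Wx where "Wx \<theta> = (\<Prod>i\<in>{0..N} - {j - 1, j}. kap r (\<theta> i) (\<theta> (Suc i))) *
     (\<Prod>l\<in>{1..N} - {j}. ennreal (nbp r (\<theta> l) (\<xi> l)))" for \<theta>
  define I where "I = {1..N} - {j}"
  have I: "finite I" "j \<notin> I" "insert j I = {1..N}" using j by (auto simp: I_def)
  have j1: "j \<noteq> 0" "j - 1 \<noteq> j" "Suc j \<noteq> j" "j - 1 \<le> Suc N" "j \<le> Suc N" "Suc j \<le> Suc N" using j by auto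
  \<comment> \<open>The reduction to the inner integral is proved for a general function H of three
    neighbouring densities and then used for both sides of the identity.\<close>
  have step: "(\<integral>\<^sup>+ \<theta>. path_density r N (pinned a b N \<theta>) * ennreal (wt_except r N (pinned a b N \<theta>) \<xi> j *
       H (pinned a b N \<theta> (j - 1)) (pinned a b N \<theta> j) (pinned a b N \<theta> (Suc j))) \<partial>PiM {1..N} (\<lambda>_. lborel))
     = (\<integral>\<^sup>+ \<theta>. Wx (pinned a b N \<theta>) * (\<integral>\<^sup>+ y. kap r (pinned a b N \<theta> (j - 1)) y * kap r y (pinned a b N \<theta> (Suc j)) *
       ennreal (H (pinned a b N \<theta> (j - 1)) y (pinned a b N \<theta> (Suc j))) \<partial>lborel) \<partial>PiM I (\<lambda>_. lborel))"
    if Hm: "(\<lambda>(x, y, z). H x y z) \<in> borel_measurable (borel \<Otimes>\<^sub>M borel \<Otimes>\<^sub>M borel)"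
      and H0: "\<And>x y z. 0 \<le> x \<Longrightarrow> 0 \<le> y \<Longrightarrow> 0 \<le> z \<Longrightarrow> 0 \<le> H x y z" for H
  proof -
    note [measurable] = measurable_compose3[OF Hm]
    have m: "(\<lambda>\<theta>. path_density r N (pinned a b N \<theta>) * ennreal (wt_except r N (pinned a b N \<theta>) \<xi> j *
       H (pinned a b N \<theta> (j - 1)) (pinned a b N \<theta> j) (pinned a b N \<theta> (Suc j))))
       \<in> borel_measurable (PiM (insert j I) (\<lambda>_. lborel))"
      unfolding I(3) using j1 by measurable
    show ?thesis
      unfolding I(3)[symmetric] product_nn_integral_insert[OF I(1,2) m]
    proof (rule nn_integral_cong)
      fix \<theta>
      define x where "x = pinned a b N \<theta>"
      have x0: "x 0 = a" by (simp add: x_def)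
      have "path_density r N (pinned a b N (\<theta>(j := y))) * ennreal (wt_except r N (pinned a b N (\<theta>(j := y))) \<xi> j *
         H (pinned a b N (\<theta>(j := y)) (j - 1)) (pinned a b N (\<theta>(j := y)) j) (pinned a b N (\<theta>(j := y)) (Suc j)))
        = Wx x * (kap r (x (j - 1)) y * kap r y (x (Suc j)) * ennreal (H (x (j - 1)) y (x (Suc j))))" for y
      proof -
        let ?x = "x(j := y)"
        have px: "pinned a b N (\<theta>(j := y)) = ?x" using j by (simp add: pinned_upd x_def)
        have W1: "path_density r N ?x = (\<Prod>i\<in>{0..N} - {j - 1, j}. kap r (x i) (x (Suc i))) *
            (kap r (x (j - 1)) y * kap r y (x (Suc j)))"
          unfolding path_density_split[OF j] using j1
          by (intro arg_cong2[where f = "(*)"] prod.cong) auto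
        have W2: "wt_except r N ?x \<xi> j = (\<Prod>l\<in>{1..N} - {j}. nbp r (x l) (\<xi> l))"
          unfolding wt_except_def by (intro prod.cong) auto
        show ?thesis
        \<comment> \<open>Off the support the weights may have the wrong sign, so
          \<open>ennreal\<close> of a product is split on the support only.\<close>
        proof (cases "path_density r N ?x = 0")
          case True
          then have "Wx x * (kap r (x (j - 1)) y * kap r y (x (Suc j))) = 0"
            unfolding W1 Wx_def by (auto simp del: prod_eq_1_iff)
          then show ?thesis unfolding px True by (metis mult.assoc mult_zero_left)
        next
          case False
          have ge: "0 \<le> ?x i" if "i \<le> Suc N" for i
            using path_density_ge[OF False that] x0 a j1 by simp
          have nn: "0 \<le> x l" if "l \<in> {1..N} - {j}" for l using ge[of l] that by auto
          have y: "0 \<le> y" "0 \<le> x (j - 1)" "0 \<le> x (Suc j)"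
            using ge[of j] ge[of "j - 1"] ge[of "Suc j"] j1 by auto
          have e: "ennreal (\<Prod>l\<in>{1..N} - {j}. nbp r (x l) (\<xi> l)) = (\<Prod>l\<in>{1..N} - {j}. ennreal (nbp r (x l) (\<xi> l)))"
            by (rule prod_ennreal[symmetric]) (use nn nbp_nonneg[OF r] in auto)
          have p0: "0 \<le> (\<Prod>l\<in>{1..N} - {j}. nbp r (x l) (\<xi> l))"
            by (intro prod_nonneg) (use nn nbp_nonneg[OF r] in auto)
          have xs: "?x (j - 1) = x (j - 1)" "?x j = y" "?x (Suc j) = x (Suc j)" using j1 by auto
          have em: "ennreal ((\<Prod>l\<in>{1..N} - {j}. nbp r (x l) (\<xi> l)) * H (x (j - 1)) y (x (Suc j)))
             = (\<Prod>l\<in>{1..N} - {j}. ennreal (nbp r (x l) (\<xi> l))) * ennreal (H (x (j - 1)) y (x (Suc j)))"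
            by (simp only: ennreal_mult[OF p0 H0[OF y(2,1,3)]] e)
          show ?thesis
            unfolding px xs W1 W2 Wx_def em by (simp only: mult_ac)
        qed
      qed
      then have "(\<integral>\<^sup>+ y. path_density r N (pinned a b N (\<theta>(j := y))) * ennreal (wt_except r N (pinned a b N (\<theta>(j := y))) \<xi> j *
         H (pinned a b N (\<theta>(j := y)) (j - 1)) (pinned a b N (\<theta>(j := y)) j) (pinned a b N (\<theta>(j := y)) (Suc j))) \<partial>lborel)
        = (\<integral>\<^sup>+ y. Wx x * (kap r (x (j - 1)) y * kap r y (x (Suc j)) * ennreal (H (x (j - 1)) y (x (Suc j)))) \<partial>lborel)"
        by simp
      also have "\<dots> = Wx x * (\<integral>\<^sup>+ y. kap r (x (j - 1)) y * kap r y (x (Suc j)) * ennreal (H (x (j - 1)) y (x (Suc j))) \<partial>lborel)"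
        by (rule nn_integral_cmult) measurable
      finally show "(\<integral>\<^sup>+ y. path_density r N (pinned a b N (\<theta>(j := y))) * ennreal (wt_except r N (pinned a b N (\<theta>(j := y))) \<xi> j *
         H (pinned a b N (\<theta>(j := y)) (j - 1)) (pinned a b N (\<theta>(j := y)) j) (pinned a b N (\<theta>(j := y)) (Suc j))) \<partial>lborel)
        = Wx (pinned a b N \<theta>) * (\<integral>\<^sup>+ y. kap r (pinned a b N \<theta> (j - 1)) y * kap r y (pinned a b N \<theta> (Suc j)) *
          ennreal (H (pinned a b N \<theta> (j - 1)) y (pinned a b N \<theta> (Suc j))) \<partial>lborel)"
        by (simp only: x_def)
    qed
  qed
  define H1 where "H1 x y z = feed r (odds x) y (\<xi> j) + feed r (odds z) y (\<xi> j) + 2 * ln (1 + y) * nbp r y (\<xi> j)" for x y z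
  define H2 where "H2 x y z = 2 * feed r (odds y) y (\<xi> j) + (ln (1 + x) + ln (1 + z)) * nbp r y (\<xi> j)" for x y z
  have H0: "0 \<le> H1 x y z" "0 \<le> H2 x y z" if "0 \<le> x" "0 \<le> y" "0 \<le> z" for x y z
    using that odds_bounds nbp_nonneg[OF r] feed_nonneg[OF r]
    by (auto simp: H1_def H2_def intro!: add_nonneg_nonneg mult_nonneg_nonneg)
  have Hm: "(\<lambda>(x, y, z). H1 x y z) \<in> borel_measurable (borel \<Otimes>\<^sub>M borel \<Otimes>\<^sub>M borel)"
    "(\<lambda>(x, y, z). H2 x y z) \<in> borel_measurable (borel \<Otimes>\<^sub>M borel \<Otimes>\<^sub>M borel)"
    unfolding H1_def H2_def by measurable
  have "Wx (pinned a b N \<theta>) * (\<integral>\<^sup>+ y. kap r (pinned a b N \<theta> (j - 1)) y * kap r y (pinned a b N \<theta> (Suc j)) *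
       ennreal (H1 (pinned a b N \<theta> (j - 1)) y (pinned a b N \<theta> (Suc j))) \<partial>lborel)
     = Wx (pinned a b N \<theta>) * (\<integral>\<^sup>+ y. kap r (pinned a b N \<theta> (j - 1)) y * kap r y (pinned a b N \<theta> (Suc j)) *
       ennreal (H2 (pinned a b N \<theta> (j - 1)) y (pinned a b N \<theta> (Suc j))) \<partial>lborel)" for \<theta>
  \<comment> \<open>If the outer factor is nonzero, the kernels to the left of j force coordinate j
    - 1 to be at least a, hence nonnegative as the identity requires.\<close>
  proof (cases "Wx (pinned a b N \<theta>) = 0")
    case False
    let ?x = "pinned a b N \<theta>"
    have "(\<Prod>i\<in>{0..<j - 1}. kap r (?x i) (?x (Suc i))) \<noteq> 0"
      using False j by (auto simp: Wx_def prod_zero_iff)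
    from prod_kap_chain[OF this, of "j - 1"] have "0 \<le> ?x (j - 1)" using a by simp
    from kap_feed_identity[OF r this, of "?x (Suc j)" "\<xi> j"] show ?thesis
      by (simp add: H1_def H2_def)
  qed simp
  then show ?thesis
    using step[of H1, OF Hm(1) H0(1)] step[of H2, OF Hm(2) H0(2)]
    unfolding H1_def H2_def by simp
qed

section \<open>The invariant measure as a mixture\<close>

text \<open>Sites are integrated out from left to right: n sites numbered from j on remain, the
  current density is x, and the last kernel ends at b. \<open>M\<close> holds the site
  factors.\<close>

primrec chain :: "real \<Rightarrow> real \<Rightarrow> (nat \<Rightarrow> real \<Rightarrow> ennreal) \<Rightarrow> nat \<Rightarrow> nat \<Rightarrow> real \<Rightarrow> ennreal" where
  "chain r b M 0 j x = kap r x b"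
| "chain r b M (Suc n) j x = (\<integral>\<^sup>+ y. kap r x y * M j y * chain r b M n (Suc j) y \<partial>lborel)"

lemma chain_measurable [measurable]:
  assumes M: "\<And>l. M l \<in> borel_measurable borel"
  shows "chain r b M n j \<in> borel_measurable borel"
proof (induction n arbitrary: j)
  case 0
  show ?case by (simp add: kap_measurable cong: measurable_cong)
next
  case (Suc n)
  note [measurable] = Suc[of "Suc j"] M
  show ?case by simp
qed

text \<open>Fubini with coordinate \<open>Suc m\<close> outermost: its value becomes the left end of
  the path on the remaining coordinates. The general left index m makes this an induction.\<close>

lemma PiM_chain:
  assumes M [measurable]: "\<And>l. M l \<in> borel_measurable borel"
  shows "(\<integral>\<^sup>+ \<theta>. (\<Prod>i\<in>{m..m + n}. kap r ((\<theta>(m := x, Suc (m + n) := b)) i) ((\<theta>(m := x, Suc (m + n) := b)) (Suc i))) *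
      (\<Prod>l\<in>{Suc m..m + n}. M l (\<theta> l)) \<partial>PiM {Suc m..m + n} (\<lambda>_. lborel)) = chain r b M n (Suc m) x"
proof (induction n arbitrary: m x)
  case 0
  interpret product_sigma_finite "\<lambda>_::nat. lborel :: real measure" by standard
  show ?case by (simp add: nn_integral_empty PiM_empty nn_integral_count_space_finite)
next
  case (Suc n)
  interpret product_sigma_finite "\<lambda>_::nat. lborel :: real measure" by standard
  define I where "I = {Suc (Suc m)..Suc m + n}"
  define th where "th \<theta> = \<theta>(m := x, Suc (m + Suc n) := b)" for \<theta> :: "nat \<Rightarrow> real"
  define f where "f \<theta> = (\<Prod>i\<in>{m..m + Suc n}. kap r (th \<theta> i) (th \<theta> (Suc i))) *
      (\<Prod>l\<in>{Suc m..m + Suc n}. M l (\<theta> l))" for \<theta>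
  have ins: "{Suc m..m + Suc n} = insert (Suc m) I" by (auto simp: I_def)
  have I: "finite I" "Suc m \<notin> I" by (auto simp: I_def)
  have cm: "(\<lambda>\<theta>. \<theta> l) \<in> borel_measurable (PiM (insert (Suc m) I) (\<lambda>_. lborel :: real measure))"
    if "l \<in> insert (Suc m) I" for l
    using measurable_component_singleton[OF that, of "\<lambda>_. lborel :: real measure"] by simp
  have thmeas: "(\<lambda>\<theta>. th \<theta> l) \<in> borel_measurable (PiM (insert (Suc m) I) (\<lambda>_. lborel))"
    if "l \<in> {m..Suc (m + Suc n)}" for l
  proof (cases "l \<in> insert (Suc m) I")
    case True
    then have "(\<lambda>\<theta>. th \<theta> l) = (\<lambda>\<theta>. \<theta> l)" by (auto simp: th_def I_def)
    then show ?thesis using cm[OF True] by simp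
  next
    case False
    then have "l = m \<or> l = Suc (m + Suc n)" using that by (auto simp: I_def)
    then show ?thesis by (auto simp: th_def)
  qed
  have fm: "f \<in> borel_measurable (PiM (insert (Suc m) I) (\<lambda>_. lborel))"
    unfolding f_def
    by (intro borel_measurable_times_ennreal borel_measurable_prod_ennreal kap_measurable thmeas
        measurable_compose[OF cm M]) (auto simp: I_def)
  have fy: "f (\<theta>(Suc m := y)) = kap r x y * M (Suc m) y *
      ((\<Prod>i\<in>{Suc m..Suc m + n}. kap r ((\<theta>(Suc m := y, Suc (Suc m + n) := b)) i) ((\<theta>(Suc m := y, Suc (Suc m + n) := b)) (Suc i))) *
       (\<Prod>l\<in>{Suc (Suc m)..Suc m + n}. M l (\<theta> l)))" for \<theta> y
  proof -
    have 1: "{m..m + Suc n} = insert m {Suc m..Suc m + n}" by auto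
    have 2: "{Suc m..m + Suc n} = insert (Suc m) {Suc (Suc m)..Suc m + n}" by auto
    have 3: "(\<Prod>i\<in>{Suc m..Suc m + n}. kap r (th (\<theta>(Suc m := y)) i) (th (\<theta>(Suc m := y)) (Suc i))) =
      (\<Prod>i\<in>{Suc m..Suc m + n}. kap r ((\<theta>(Suc m := y, Suc (Suc m + n) := b)) i) ((\<theta>(Suc m := y, Suc (Suc m + n) := b)) (Suc i)))"
      by (intro prod.cong) (auto simp: th_def)
    have 4: "(\<Prod>l\<in>{Suc (Suc m)..Suc m + n}. M l ((\<theta>(Suc m := y)) l)) = (\<Prod>l\<in>{Suc (Suc m)..Suc m + n}. M l (\<theta> l))"
      by (intro prod.cong) auto
    have 5: "th (\<theta>(Suc m := y)) m = x" "th (\<theta>(Suc m := y)) (Suc m) = y" by (auto simp: th_def)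
    have 6: "(\<Prod>i\<in>insert m {Suc m..Suc m + n}. F i) = F m * (\<Prod>i\<in>{Suc m..Suc m + n}. F i)" for F :: "nat \<Rightarrow> ennreal"
      by (rule prod.insert) auto
    have 7: "(\<Prod>l\<in>insert (Suc m) {Suc (Suc m)..Suc m + n}. F l) = F (Suc m) * (\<Prod>l\<in>{Suc (Suc m)..Suc m + n}. F l)"
      for F :: "nat \<Rightarrow> ennreal" by (rule prod.insert) auto
    show ?thesis
      unfolding f_def 1 2 6 7 3 4 5 fun_upd_same by (simp only: mult_ac)
  qed
  have "(\<integral>\<^sup>+ \<theta>. f \<theta> \<partial>PiM {Suc m..m + Suc n} (\<lambda>_. lborel))
      = (\<integral>\<^sup>+ y. \<integral>\<^sup>+ \<theta>. f (\<theta>(Suc m := y)) \<partial>PiM I (\<lambda>_. lborel) \<partial>lborel)"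
    unfolding ins by (rule product_nn_integral_insert_rev[OF I fm])
  also have "\<dots> = (\<integral>\<^sup>+ y. kap r x y * M (Suc m) y * chain r b M n (Suc (Suc m)) y \<partial>lborel)"
  proof (rule nn_integral_cong)
    fix y :: real
    define g where "g \<theta> = (\<Prod>i\<in>{Suc m..Suc m + n}. kap r ((\<theta>(Suc m := y, Suc (Suc m + n) := b)) i) ((\<theta>(Suc m := y, Suc (Suc m + n) := b)) (Suc i))) *
       (\<Prod>l\<in>{Suc (Suc m)..Suc m + n}. M l (\<theta> l))" for \<theta>
    have cmI: "(\<lambda>\<theta>. \<theta> l) \<in> borel_measurable (PiM I (\<lambda>_. lborel :: real measure))" if "l \<in> I" for l
      using measurable_component_singleton[OF that, of "\<lambda>_. lborel :: real measure"] by simp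
    have thI: "(\<lambda>\<theta>. (\<theta>(Suc m := y, Suc (Suc m + n) := b)) l) \<in> borel_measurable (PiM I (\<lambda>_. lborel))"
      if "l \<in> {Suc m..Suc (Suc m + n)}" for l
    proof (cases "l \<in> I")
      case True
      then have "(\<lambda>\<theta>. (\<theta>(Suc m := y, Suc (Suc m + n) := b)) l) = (\<lambda>\<theta>. \<theta> l)" by (auto simp: I_def)
      then show ?thesis using cmI[OF True] by simp
    next
      case False
      then have "l = Suc m \<or> l = Suc (Suc m + n)" using that by (auto simp: I_def)
      then show ?thesis by auto
    qed
    have gm: "g \<in> borel_measurable (PiM I (\<lambda>_. lborel))"
      unfolding g_def
      by (intro borel_measurable_times_ennreal borel_measurable_prod_ennreal kap_measurable thI
          measurable_compose[OF cmI M]) (auto simp: I_def)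
    have "(\<integral>\<^sup>+ \<theta>. f (\<theta>(Suc m := y)) \<partial>PiM I (\<lambda>_. lborel)) = (\<integral>\<^sup>+ \<theta>. kap r x y * M (Suc m) y * g \<theta> \<partial>PiM I (\<lambda>_. lborel))"
      unfolding fy g_def ..
    also have "\<dots> = kap r x y * M (Suc m) y * (\<integral>\<^sup>+ \<theta>. g \<theta> \<partial>PiM I (\<lambda>_. lborel))"
      by (rule nn_integral_cmult[OF gm])
    also have "(\<integral>\<^sup>+ \<theta>. g \<theta> \<partial>PiM I (\<lambda>_. lborel)) = chain r b M n (Suc (Suc m)) y"
      unfolding g_def I_def by (rule Suc)
    finally show "(\<integral>\<^sup>+ \<theta>. f (\<theta>(Suc m := y)) \<partial>PiM I (\<lambda>_. lborel)) = kap r x y * M (Suc m) y * chain r b M n (Suc (Suc m)) y" .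
  qed
  also have "\<dots> = chain r b M (Suc n) (Suc m) x" by simp
  finally show ?case unfolding f_def th_def .
qed

lemma path_integral_chain:
  assumes "\<And>l. M l \<in> borel_measurable borel"
  shows "(\<integral>\<^sup>+ \<theta>. path_density r N (pinned a b N \<theta>) * (\<Prod>l\<in>{1..N}. M l (pinned a b N \<theta> l)) \<partial>PiM {1..N} (\<lambda>_. lborel))
    = chain r b M N 1 a"
proof -
  have "(\<Prod>l\<in>{1..N}. M l (pinned a b N \<theta> l)) = (\<Prod>l\<in>{1..N}. M l (\<theta> l))" for \<theta>
    by (intro prod.cong) (auto simp: pinned_site)
  then show ?thesis
    using PiM_chain[OF assms, where m = 0 and n = N and r = r and x = a and b = b] by (simp add: path_density_def pinned_def)
qed

lemma chain_one:
  assumes "0 < r"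
  shows "chain r b (\<lambda>_ _. 1) n j x = kap (r * real (Suc n)) x b"
proof (induction n arbitrary: j x)
  case (Suc n)
  have "r * real (Suc (Suc n)) = r + r * real (Suc n)" by (simp add: algebra_simps)
  then show ?case using kap_comp[of r "r * real (Suc n)" x b] assms Suc by simp
qed simp

text \<open>Restriction to 1..N identifies configurations with an extensional product, on which
  counting measure is a product measure.\<close>

lemma nn_integral_configs_prod:
  fixes g :: "nat \<Rightarrow> nat \<Rightarrow> ennreal"
  shows "(\<integral>\<^sup>+ \<eta>. (\<Prod>l\<in>{1..N}. g l (\<eta> l)) \<partial>count_space (configs N)) = (\<Prod>l\<in>{1..N}. \<Sum>n. g l n)"
proof -
  interpret product_sigma_finite "\<lambda>_::nat. count_space (UNIV :: nat set)"
    by (intro product_sigma_finite.intro sigma_finite_measure_count_space_countable) simp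
  have bij: "bij_betw (\<lambda>\<eta>. restrict \<eta> {1..N}) (configs N) (PiE {1..N} (\<lambda>_. UNIV))"
    by (rule bij_betwI[where g = "\<lambda>f i. if i \<in> {1..N} then f i else 0"])
       (auto simp: configs_def fun_eq_iff PiE_def extensional_def)
  have "(\<integral>\<^sup>+ \<eta>. (\<Prod>l\<in>{1..N}. g l (\<eta> l)) \<partial>count_space (configs N))
      = (\<integral>\<^sup>+ \<eta>. (\<Prod>l\<in>{1..N}. g l (restrict \<eta> {1..N} l)) \<partial>count_space (configs N))"
    by (intro nn_integral_cong prod.cong) auto
  also have "\<dots> = (\<integral>\<^sup>+ f. (\<Prod>l\<in>{1..N}. g l (f l)) \<partial>count_space (PiE {1..N} (\<lambda>_. UNIV)))"
    by (rule nn_integral_bij_count_space[OF bij])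
  also have "\<dots> = (\<integral>\<^sup>+ f. (\<Prod>l\<in>{1..N}. g l (f l)) \<partial>PiM {1..N} (\<lambda>_. count_space UNIV))"
    by (subst count_space_PiM_finite) auto
  also have "\<dots> = (\<Prod>l\<in>{1..N}. \<integral>\<^sup>+ n. g l n \<partial>count_space UNIV)"
    by (rule product_nn_integral_prod) auto
  finally show ?thesis by (simp add: nn_integral_count_space_nat)
qed

definition mix :: "real \<Rightarrow> real \<Rightarrow> real \<Rightarrow> nat \<Rightarrow> config \<Rightarrow> ennreal" where
  "mix r a b N \<xi> = (\<integral>\<^sup>+ \<theta>. path_density r N (pinned a b N \<theta>) * ennreal (wt r N (pinned a b N \<theta>) \<xi>)
      \<partial>PiM {1..N} (\<lambda>_. lborel))"

lemma pinned_nonneg: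
  assumes "path_density r N (pinned a b N \<theta>) \<noteq> 0" "0 \<le> a" "i \<le> Suc N"
  shows "0 \<le> pinned a b N \<theta> i"
  using path_density_ge[OF assms(1,3)] assms(2) by simp

text \<open>For fixed \<theta> the weights factorise, so the sum over configurations becomes a
  product of one-site series and a \<open>chain\<close> remains. The total mass and the moment
  generating function are both instances.\<close>

lemma mix_product:
  fixes g :: "nat \<Rightarrow> nat \<Rightarrow> ennreal"
  assumes r: "0 < r" and a: "0 \<le> a"
  shows "(\<integral>\<^sup>+ \<eta>. mix r a b N \<eta> * (\<Prod>l\<in>{1..N}. g l (\<eta> l)) \<partial>count_space (configs N))
    = chain r b (\<lambda>l \<theta>. \<Sum>n. ennreal (nbp r \<theta> n) * g l n) N 1 a"
proof -
  let ?\<Lambda> = "PiM {1..N} (\<lambda>_. lborel :: real measure)"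
  let ?p = "pinned a b N"
  have "(\<integral>\<^sup>+ \<eta>. mix r a b N \<eta> * (\<Prod>l\<in>{1..N}. g l (\<eta> l)) \<partial>count_space (configs N))
    = (\<integral>\<^sup>+ \<eta>. \<integral>\<^sup>+ \<theta>. path_density r N (?p \<theta>) * ennreal (wt r N (?p \<theta>) \<eta>) * (\<Prod>l\<in>{1..N}. g l (\<eta> l))
        \<partial>?\<Lambda> \<partial>count_space (configs N))"
    unfolding mix_def by (intro nn_integral_cong nn_integral_multc[symmetric]) measurable
  also have "\<dots> = (\<integral>\<^sup>+ \<theta>. \<integral>\<^sup>+ \<eta>. path_density r N (?p \<theta>) * ennreal (wt r N (?p \<theta>) \<eta>) * (\<Prod>l\<in>{1..N}. g l (\<eta> l))
        \<partial>count_space (configs N) \<partial>?\<Lambda>)"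
    by (rule nn_integral_count_space_nn_integral[OF countable_configs, symmetric]) measurable
  also have "\<dots> = (\<integral>\<^sup>+ \<theta>. path_density r N (?p \<theta>) * (\<Prod>l\<in>{1..N}. \<Sum>n. ennreal (nbp r (?p \<theta> l) n) * g l n) \<partial>?\<Lambda>)"
  proof (rule nn_integral_cong)
    fix \<theta>
    show "(\<integral>\<^sup>+ \<eta>. path_density r N (?p \<theta>) * ennreal (wt r N (?p \<theta>) \<eta>) * (\<Prod>l\<in>{1..N}. g l (\<eta> l)) \<partial>count_space (configs N))
       = path_density r N (?p \<theta>) * (\<Prod>l\<in>{1..N}. \<Sum>n. ennreal (nbp r (?p \<theta> l) n) * g l n)"
    proof (cases "path_density r N (?p \<theta>) = 0")
      case False
      have "ennreal (wt r N (?p \<theta>) \<eta>) = (\<Prod>l\<in>{1..N}. ennreal (nbp r (?p \<theta> l) (\<eta> l)))" for \<eta>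
        unfolding wt_def by (rule prod_ennreal[symmetric]) (use pinned_nonneg[OF False a] nbp_nonneg[OF r] in auto)
      then have "(\<integral>\<^sup>+ \<eta>. path_density r N (?p \<theta>) * ennreal (wt r N (?p \<theta>) \<eta>) * (\<Prod>l\<in>{1..N}. g l (\<eta> l)) \<partial>count_space (configs N))
        = path_density r N (?p \<theta>) * (\<integral>\<^sup>+ \<eta>. (\<Prod>l\<in>{1..N}. ennreal (nbp r (?p \<theta> l) (\<eta> l)) * g l (\<eta> l)) \<partial>count_space (configs N))"
        by (subst nn_integral_cmult[symmetric]) (auto simp: prod.distrib mult_ac)
      then show ?thesis
        using nn_integral_configs_prod[of N "\<lambda>l n. ennreal (nbp r (?p \<theta> l) n) * g l n"] by simp
    qed simp
  qed
  also have "\<dots> = chain r b (\<lambda>l \<theta>. \<Sum>n. ennreal (nbp r \<theta> n) * g l n) N 1 a"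
    by (rule path_integral_chain) measurable
  finally show ?thesis .
qed

lemma nbp_suminf:
  assumes "0 < r" "0 \<le> \<theta>"
  shows "(\<Sum>n. ennreal (nbp r \<theta> n)) = 1"
  using nbp_sums[of \<theta> 1 r] nbp_nonneg[OF assms] odds_bounds[OF assms(2)] assms
  by (subst suminf_ennreal2) (auto simp: sums_iff)

lemma chain_cong_ge:
  assumes "\<And>l y. a \<le> y \<Longrightarrow> M l y = M' l y" "a \<le> x"
  shows "chain r b M n j x = chain r b M' n j x"
  using assms(2)
proof (induction n arbitrary: j x)
  case (Suc n)
  have "kap r x y * M j y * chain r b M n (Suc j) y = kap r x y * M' j y * chain r b M' n (Suc j) y" for y
    using Suc assms(1)[of y j] by (cases "x < y") (auto simp: kap_eq_0)
  then show ?case by simp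
qed simp

lemma mix_total:
  assumes r: "0 < r" and a: "0 \<le> a"
  shows "(\<integral>\<^sup>+ \<eta>. mix r a b N \<eta> \<partial>count_space (configs N)) = kap (r * real (Suc N)) a b"
proof -
  have "(\<integral>\<^sup>+ \<eta>. mix r a b N \<eta> \<partial>count_space (configs N))
      = chain r b (\<lambda>l \<theta>. \<Sum>n. ennreal (nbp r \<theta> n) * 1) N 1 a"
    using mix_product[OF r a, where b = b and N = N and g = "\<lambda>_ _. 1"] by simp
  also have "\<dots> = chain r b (\<lambda>_ _. 1) N 1 a"
    by (rule chain_cong_ge[of a]) (use a in \<open>auto simp: nbp_suminf[OF r]\<close>)
  also have "\<dots> = kap (r * real (Suc N)) a b" by (rule chain_one[OF r])
  finally show ?thesis .
qed

lemma mv_rate_cong: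
  assumes "i \<le> Suc N" "\<theta> 0 = \<theta>' 0" "\<theta> (Suc N) = \<theta>' (Suc N)"
  shows "mv_rate s N \<theta> i k \<eta> = mv_rate s N \<theta>' i k \<eta>"
proof (cases "i \<in> {1..N}")
  case False
  then have "i = 0 \<or> i = Suc N" using assms(1) by auto
  then show ?thesis using assms by (auto simp: mv_rate_def)
qed (simp add: mv_rate_def)

text \<open>The rates see \<theta> only at the reservoirs. They may therefore be written with
  whichever interior densities the mixture is being integrated over.\<close>

lemma flow_cong:
  assumes "\<theta> 0 = \<theta>' 0" "\<theta> (Suc N) = \<theta>' (Suc N)"
  shows "flow s N \<theta> \<eta> \<xi> = flow s N \<theta>' \<eta> \<xi>" "exit s N \<theta> \<eta> = exit s N \<theta>' \<eta>"
proof -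
  have e: "mv_rate s N \<theta> i k \<eta> = mv_rate s N \<theta>' i k \<eta>" if "(i, j) \<in> channels N" for i j k
    using channels_le[OF that] by (intro mv_rate_cong assms) auto
  show "flow s N \<theta> \<eta> \<xi> = flow s N \<theta>' \<eta> \<xi>" "exit s N \<theta> \<eta> = exit s N \<theta>' \<eta>"
    unfolding flow_def exit_def using e by (auto intro!: sum.cong suminf_cong)
qed

text \<open>For fixed \<theta> the product weight is in general not balanced. Only its integral is,
  by \<open>site_balance\<close> at every site after the regrouping of
  \<open>wt_flow_balance\<close>.\<close>

lemma mix_flow:
  assumes s: "0 < s" and a: "0 \<le> a" and \<theta>0: "\<theta>0 0 = a" "\<theta>0 (Suc N) = b" and N: "1 \<le> N" and \<xi>: "\<xi> \<in> configs N"
  defines "r \<equiv> 2 * s"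
  shows "(\<integral>\<^sup>+ \<eta>. mix r a b N \<eta> * flow s N \<theta>0 \<eta> \<xi> \<partial>count_space (configs N)) = mix r a b N \<xi> * exit s N \<theta>0 \<xi>"
    and "mix r a b N \<xi> * exit s N \<theta>0 \<xi> < \<infinity>"
proof -
  have r: "0 < r" using s by (simp add: r_def)
  let ?\<Lambda> = "PiM {1..N} (\<lambda>_. lborel :: real measure)"
  let ?p = "pinned a b N"
  let ?D = "\<lambda>\<theta>. path_density r N (?p \<theta>)"
  define L where "L \<theta> i = ln (1 + \<theta> i) * wt r N \<theta> \<xi>" for \<theta> :: "nat \<Rightarrow> real" and i
  define U where "U \<theta> i j = wt_except r N \<theta> \<xi> j * feed r (odds (\<theta> i)) (\<theta> j) (\<xi> j)" for \<theta> :: "nat \<Rightarrow> real" and i j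
  define In where "In \<theta> = (\<Sum>(i, j)\<in>channels N. if j \<in> {1..N} then U \<theta> i j else L \<theta> i)" for \<theta>
  define Out where "Out \<theta> = (\<Sum>(i, j)\<in>channels N. if i \<in> {1..N} then U \<theta> i i else L \<theta> i)" for \<theta>
  define S where "S \<theta> = (\<Sum>j\<in>{1..N}. 2 * L \<theta> j)" for \<theta>
  define E where "E \<theta> = L \<theta> 1 + L \<theta> N" for \<theta>
  define X where "X \<theta> j = U \<theta> (j - 1) j + U \<theta> (Suc j) j + 2 * L \<theta> j" for \<theta> j
  define Y where "Y \<theta> j = 2 * U \<theta> j j + L \<theta> (j - 1) + L \<theta> (Suc j)" for \<theta> j
  have pm [measurable]: "(\<lambda>\<theta>. ?p \<theta> i) \<in> borel_measurable ?\<Lambda>" if "i \<le> Suc N" for i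
    using pinned_measurable[OF that] .
  have Lm [measurable]: "(\<lambda>\<theta>. L (?p \<theta>) i) \<in> borel_measurable ?\<Lambda>" if "i \<le> Suc N" for i
    unfolding L_def using that by measurable
  have Um [measurable]: "(\<lambda>\<theta>. U (?p \<theta>) i j) \<in> borel_measurable ?\<Lambda>" if "i \<le> Suc N" "j \<le> Suc N" for i j
    unfolding U_def using that by measurable
  have Xm: "(\<lambda>\<theta>. X (?p \<theta>) j) \<in> borel_measurable ?\<Lambda>" and Ym: "(\<lambda>\<theta>. Y (?p \<theta>) j) \<in> borel_measurable ?\<Lambda>"
    if "j \<in> {1..N}" for j
  proof -
    have b: "j - 1 \<le> Suc N" "j \<le> Suc N" "Suc j \<le> Suc N" using that by auto
    show "(\<lambda>\<theta>. X (?p \<theta>) j) \<in> borel_measurable ?\<Lambda>" "(\<lambda>\<theta>. Y (?p \<theta>) j) \<in> borel_measurable ?\<Lambda>"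
      unfolding X_def Y_def
      by (intro borel_measurable_add borel_measurable_times borel_measurable_const Lm Um b)+
  qed
  have Sm [measurable]: "(\<lambda>\<theta>. S (?p \<theta>)) \<in> borel_measurable ?\<Lambda>"
    unfolding S_def by (intro borel_measurable_sum borel_measurable_times borel_measurable_const Lm) auto
  have Em [measurable]: "(\<lambda>\<theta>. E (?p \<theta>)) \<in> borel_measurable ?\<Lambda>"
    unfolding E_def by (intro borel_measurable_add Lm) (use N in auto)
  have chm: "(\<lambda>\<theta>. if Q then U (?p \<theta>) i j else L (?p \<theta>) i) \<in> borel_measurable ?\<Lambda>"
    if "i \<le> Suc N" "j \<le> Suc N" for Q i j
    using Um[OF that] Lm[OF that(1)] by (cases Q) auto
  have chle: "fst c \<le> Suc N" "snd c \<le> Suc N" if "c \<in> channels N" for c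
    using channels_le[of "fst c" "snd c" N] that by auto
  have Inm [measurable]: "(\<lambda>\<theta>. In (?p \<theta>)) \<in> borel_measurable ?\<Lambda>"
    unfolding In_def case_prod_beta by (intro borel_measurable_sum chm chle)
  have Outm [measurable]: "(\<lambda>\<theta>. Out (?p \<theta>)) \<in> borel_measurable ?\<Lambda>"
    unfolding Out_def case_prod_beta by (intro borel_measurable_sum chm chle)
  have nn: "0 \<le> L (?p \<theta>) i" "0 \<le> U (?p \<theta>) i j" if D: "?D \<theta> \<noteq> 0" and i: "i \<le> Suc N" "j \<le> Suc N" for \<theta> i j
  proof -
    have p: "0 \<le> ?p \<theta> l" if "l \<le> Suc N" for l by (rule pinned_nonneg[OF D a that])
    have "0 \<le> wt r N (?p \<theta>) \<xi>" "0 \<le> wt_except r N (?p \<theta>) \<xi> j"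
      by (rule wt_nonneg[OF r] wt_except_nonneg[OF r]; use p in auto)+
    then show "0 \<le> L (?p \<theta>) i" "0 \<le> U (?p \<theta>) i j"
      unfolding L_def U_def using p[OF i(1)] p[OF i(2)] odds_bounds[of "?p \<theta> i"] feed_nonneg[OF r] by auto
  qed
  have nnL: "0 \<le> L (?p \<theta>) i" if "?D \<theta> \<noteq> 0" "i \<le> Suc N" for \<theta> i
    by (rule nn(1)[OF that order_refl])
  have nnS: "0 \<le> S (?p \<theta>)" "0 \<le> E (?p \<theta>)" if "?D \<theta> \<noteq> 0" for \<theta>
    unfolding S_def E_def using nnL[OF that] N by (auto intro!: sum_nonneg add_nonneg_nonneg)
  have nnX: "0 \<le> X (?p \<theta>) j" "0 \<le> Y (?p \<theta>) j" if "?D \<theta> \<noteq> 0" "j \<in> {1..N}" for \<theta> j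
    unfolding X_def Y_def using nnL[OF that(1)] nn(2)[OF that(1)] that(2)
    by (auto intro!: add_nonneg_nonneg)
  have nnIn: "0 \<le> In (?p \<theta>)" "0 \<le> Out (?p \<theta>)" if "?D \<theta> \<noteq> 0" for \<theta>
    unfolding In_def Out_def case_prod_beta using nnL[OF that] nn(2)[OF that] chle
    by (auto intro!: sum_nonneg)
  define J where "J F = (\<integral>\<^sup>+ \<theta>. ?D \<theta> * ennreal (F (?p \<theta>)) \<partial>?\<Lambda>)" for F :: "(nat \<Rightarrow> real) \<Rightarrow> real"
  have Jadd: "J (\<lambda>\<theta>. F \<theta> + G \<theta>) = J F + J G"
    if [measurable]: "(\<lambda>\<theta>. F (?p \<theta>)) \<in> borel_measurable ?\<Lambda>" "(\<lambda>\<theta>. G (?p \<theta>)) \<in> borel_measurable ?\<Lambda>"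
      and nn: "\<And>\<theta>. ?D \<theta> \<noteq> 0 \<Longrightarrow> 0 \<le> F (?p \<theta>)" "\<And>\<theta>. ?D \<theta> \<noteq> 0 \<Longrightarrow> 0 \<le> G (?p \<theta>)" for F G
  proof -
    have "?D \<theta> * ennreal (F (?p \<theta>) + G (?p \<theta>)) = ?D \<theta> * ennreal (F (?p \<theta>)) + ?D \<theta> * ennreal (G (?p \<theta>))" for \<theta>
      using nn[of \<theta>] by (cases "?D \<theta> = 0") (auto simp: distrib_left)
    then have "J (\<lambda>\<theta>. F \<theta> + G \<theta>) = (\<integral>\<^sup>+ \<theta>. ?D \<theta> * ennreal (F (?p \<theta>)) + ?D \<theta> * ennreal (G (?p \<theta>)) \<partial>?\<Lambda>)"
      unfolding J_def by (simp only:)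
    also have "\<dots> = J F + J G"
      unfolding J_def by (rule nn_integral_add) measurable
    finally show ?thesis .
  qed
  have Jsum: "J (\<lambda>\<theta>. \<Sum>j\<in>{1..N}. F \<theta> j) = (\<Sum>j\<in>{1..N}. J (\<lambda>\<theta>. F \<theta> j))"
    if m: "\<And>j. j \<in> {1..N} \<Longrightarrow> (\<lambda>\<theta>. F (?p \<theta>) j) \<in> borel_measurable ?\<Lambda>"
      and nn: "\<And>\<theta> j. ?D \<theta> \<noteq> 0 \<Longrightarrow> j \<in> {1..N} \<Longrightarrow> 0 \<le> F (?p \<theta>) j" for F
  proof -
    have "?D \<theta> * ennreal (\<Sum>j\<in>{1..N}. F (?p \<theta>) j) = (\<Sum>j\<in>{1..N}. ?D \<theta> * ennreal (F (?p \<theta>) j))" for \<theta>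
    proof (cases "?D \<theta> = 0")
      case False
      then have "ennreal (\<Sum>j\<in>{1..N}. F (?p \<theta>) j) = (\<Sum>j\<in>{1..N}. ennreal (F (?p \<theta>) j))"
        using nn[of \<theta>] by (intro sum_ennreal[symmetric]) auto
      then show ?thesis by (simp add: sum_distrib_left)
    qed simp
    then have "J (\<lambda>\<theta>. \<Sum>j\<in>{1..N}. F \<theta> j) = (\<integral>\<^sup>+ \<theta>. (\<Sum>j\<in>{1..N}. ?D \<theta> * ennreal (F (?p \<theta>) j)) \<partial>?\<Lambda>)"
      unfolding J_def by simp
    also have "\<dots> = (\<Sum>j\<in>{1..N}. J (\<lambda>\<theta>. F \<theta> j))"
      unfolding J_def by (rule nn_integral_sum) (intro borel_measurable_times_ennreal
        path_density_measurable measurable_compose[OF m measurable_ennreal])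
    finally show ?thesis .
  qed
  have XY: "J (\<lambda>\<theta>. X \<theta> j) = J (\<lambda>\<theta>. Y \<theta> j)" if j: "j \<in> {1..N}" for j
  proof -
    have 1: "X \<theta> j = wt_except r N \<theta> \<xi> j * (feed r (odds (\<theta> (j - 1))) (\<theta> j) (\<xi> j)
      + feed r (odds (\<theta> (Suc j))) (\<theta> j) (\<xi> j) + 2 * ln (1 + \<theta> j) * nbp r (\<theta> j) (\<xi> j))" for \<theta>
      unfolding X_def U_def L_def wt_split[OF j] by (simp add: algebra_simps)
    have 2: "Y \<theta> j = wt_except r N \<theta> \<xi> j * (2 * feed r (odds (\<theta> j)) (\<theta> j) (\<xi> j)
      + (ln (1 + \<theta> (j - 1)) + ln (1 + \<theta> (Suc j))) * nbp r (\<theta> j) (\<xi> j))" for \<theta>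
      unfolding Y_def U_def L_def wt_split[OF j] by (simp add: algebra_simps)
    show ?thesis unfolding J_def 1 2 by (rule site_balance[OF r a j])
  qed
  have bal: "In \<theta> + S \<theta> = (\<Sum>j\<in>{1..N}. X \<theta> j) + E \<theta>" "Out \<theta> + S \<theta> = (\<Sum>j\<in>{1..N}. Y \<theta> j) + E \<theta>" for \<theta>
    using wt_flow_balance[OF N, where \<theta> = \<theta> and r = r and \<xi> = \<xi>] unfolding In_def Out_def S_def E_def X_def Y_def U_def L_def by auto
  have "J In + J S = J (\<lambda>\<theta>. In \<theta> + S \<theta>)"
    by (rule Jadd[symmetric, OF Inm Sm nnIn(1) nnS(1)])
  also have "\<dots> = (\<Sum>j\<in>{1..N}. J (\<lambda>\<theta>. X \<theta> j)) + J E"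
    unfolding bal
    by (subst Jadd[OF borel_measurable_sum[OF Xm] Em sum_nonneg[OF nnX(1)] nnS(2)], assumption+)
       (subst Jsum[OF Xm nnX(1)], assumption+, rule refl)
  also have "\<dots> = (\<Sum>j\<in>{1..N}. J (\<lambda>\<theta>. Y \<theta> j)) + J E" using XY by simp
  also have "\<dots> = J (\<lambda>\<theta>. Out \<theta> + S \<theta>)"
    unfolding bal
    by (subst Jadd[OF borel_measurable_sum[OF Ym] Em sum_nonneg[OF nnX(2)] nnS(2)], assumption+)
       (subst Jsum[OF Ym nnX(2)], assumption+, rule refl)
  also have "\<dots> = J Out + J S"
    by (rule Jadd[OF Outm Sm nnIn(2) nnS(1)])
  finally have sum: "J In + J S = J Out + J S" .
  have Jmix: "J (\<lambda>\<theta>. wt r N \<theta> \<xi>) = mix r a b N \<xi>" by (simp add: J_def mix_def)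
  have mixfin: "mix r a b N \<xi> < \<infinity>"
    using nn_integral_ge_point[OF \<xi>, of "mix r a b N"] mix_total[OF r a, where b = b and N = N] kap_finite[of _ a b]
    by (metis le_less_trans)
  \<comment> \<open>The auxiliary sum needs a finite integral before it can be cancelled; on the
    support all densities are at most b, which bounds the logarithms.\<close>
  have JSfin: "J S < \<infinity>"
  proof -
    have "J S \<le> (\<integral>\<^sup>+ \<theta>. ennreal (2 * real N * ln (1 + b)) * (?D \<theta> * ennreal (wt r N (?p \<theta>) \<xi>)) \<partial>?\<Lambda>)"
      unfolding J_def
    proof (rule nn_integral_mono)
      fix \<theta>
      show "?D \<theta> * ennreal (S (?p \<theta>)) \<le> ennreal (2 * real N * ln (1 + b)) * (?D \<theta> * ennreal (wt r N (?p \<theta>) \<xi>))"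
      proof (cases "?D \<theta> = 0")
        case False
        have p: "0 \<le> ?p \<theta> l" if "l \<le> Suc N" for l by (rule pinned_nonneg[OF False a that])
        have w: "0 \<le> wt r N (?p \<theta>) \<xi>" by (rule wt_nonneg[OF r]) (use p in auto)
        have lt: "?p \<theta> l < ?p \<theta> (Suc l)" if "l \<le> N" for l
        proof (rule ccontr)
          assume "\<not> ?thesis"
          then have "kap r (?p \<theta> l) (?p \<theta> (Suc l)) = 0" by (simp add: kap_eq_0)
          then have "?D \<theta> = 0" unfolding path_density_def using that by (intro prod_zero) auto
          with False show False by simp
        qed
        have le: "?p \<theta> l \<le> b" if "l \<le> Suc N" for l
          using that
        proof (induction l rule: inc_induct)
          case (step l)
          then show ?case using lt[of l] by simp
        qed simp
        have b0: "0 \<le> b" using p[of "Suc N"] by simp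
        have "S (?p \<theta>) \<le> (\<Sum>j\<in>{1..N}. 2 * (ln (1 + b) * wt r N (?p \<theta>) \<xi>))"
          unfolding S_def L_def using p le w
          by (intro sum_mono mult_left_mono mult_right_mono) (auto intro!: ln_mono add_pos_nonneg)
        also have "\<dots> = (2 * real N * ln (1 + b)) * wt r N (?p \<theta>) \<xi>" by simp
        finally have "ennreal (S (?p \<theta>)) \<le> ennreal (2 * real N * ln (1 + b)) * ennreal (wt r N (?p \<theta>) \<xi>)"
          using w b0 by (simp add: ennreal_leI flip: ennreal_mult)
        then have "?D \<theta> * ennreal (S (?p \<theta>)) \<le> ?D \<theta> * (ennreal (2 * real N * ln (1 + b)) * ennreal (wt r N (?p \<theta>) \<xi>))"
          by (rule mult_left_mono) simp
        then show ?thesis by (simp only: mult_ac)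
      qed simp
    qed
    also have "\<dots> = ennreal (2 * real N * ln (1 + b)) * mix r a b N \<xi>"
      unfolding mix_def by (rule nn_integral_cmult) measurable
    also have "\<dots> < \<infinity>" using mixfin by (simp add: ennreal_mult_less_top)
    finally show ?thesis .
  qed
  have InOut: "J In = J Out" using sum JSfin by (auto simp: ennreal_add_left_cancel add.commute)
  have fl: "flow s N \<theta>0 \<eta> \<zeta> = flow s N (?p \<theta>) \<eta> \<zeta>" "exit s N \<theta>0 \<eta> = exit s N (?p \<theta>) \<eta>" for \<eta> \<zeta> \<theta>
    using \<theta>0 by (intro flow_cong; simp)+
  have "(\<integral>\<^sup>+ \<eta>. mix r a b N \<eta> * flow s N \<theta>0 \<eta> \<xi> \<partial>count_space (configs N))
    = (\<integral>\<^sup>+ \<eta>. \<integral>\<^sup>+ \<theta>. ?D \<theta> * ennreal (wt r N (?p \<theta>) \<eta>) * flow s N \<theta>0 \<eta> \<xi> \<partial>?\<Lambda> \<partial>count_space (configs N))"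
    unfolding mix_def by (intro nn_integral_cong nn_integral_multc[symmetric]) measurable
  also have "\<dots> = (\<integral>\<^sup>+ \<theta>. \<integral>\<^sup>+ \<eta>. ?D \<theta> * ennreal (wt r N (?p \<theta>) \<eta>) * flow s N \<theta>0 \<eta> \<xi> \<partial>count_space (configs N) \<partial>?\<Lambda>)"
    by (rule nn_integral_count_space_nn_integral[OF countable_configs, symmetric]) measurable
  also have "\<dots> = J In"
    unfolding J_def
  proof (rule nn_integral_cong)
    fix \<theta>
    show "(\<integral>\<^sup>+ \<eta>. ?D \<theta> * ennreal (wt r N (?p \<theta>) \<eta>) * flow s N \<theta>0 \<eta> \<xi> \<partial>count_space (configs N)) = ?D \<theta> * ennreal (In (?p \<theta>))"
    proof (cases "?D \<theta> = 0")
      case False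
      have "(\<integral>\<^sup>+ \<eta>. ?D \<theta> * ennreal (wt r N (?p \<theta>) \<eta>) * flow s N \<theta>0 \<eta> \<xi> \<partial>count_space (configs N))
         = ?D \<theta> * (\<integral>\<^sup>+ \<eta>. ennreal (wt r N (?p \<theta>) \<eta>) * flow s N (?p \<theta>) \<eta> \<xi> \<partial>count_space (configs N))"
        unfolding fl(1)[of _ _ \<theta>] by (subst nn_integral_cmult[symmetric]) (auto simp: mult_ac)
      also have "(\<integral>\<^sup>+ \<eta>. ennreal (wt r N (?p \<theta>) \<eta>) * flow s N (?p \<theta>) \<eta> \<xi> \<partial>count_space (configs N)) = ennreal (In (?p \<theta>))"
        unfolding r_def In_def U_def L_def
        by (rule wt_inflow[OF s _ \<xi>]) (rule pinned_nonneg[OF False a])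
      finally show ?thesis .
    qed simp
  qed
  also have "J In = J Out" by (rule InOut)
  also have "J Out = (\<integral>\<^sup>+ \<theta>. ?D \<theta> * ennreal (wt r N (?p \<theta>) \<xi>) * exit s N \<theta>0 \<xi> \<partial>?\<Lambda>)"
    unfolding J_def
  proof (rule nn_integral_cong)
    fix \<theta>
    show "?D \<theta> * ennreal (Out (?p \<theta>)) = ?D \<theta> * ennreal (wt r N (?p \<theta>) \<xi>) * exit s N \<theta>0 \<xi>"
    proof (cases "?D \<theta> = 0")
      case False
      have "ennreal (wt r N (?p \<theta>) \<xi>) * exit s N (?p \<theta>) \<xi> = ennreal (Out (?p \<theta>))"
        unfolding r_def Out_def U_def L_def
        by (rule wt_outflow[OF s]) (rule pinned_nonneg[OF False a])
      then show ?thesis unfolding fl(2)[of _ \<theta>] by (simp add: mult.assoc)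
    qed simp
  qed
  also have "\<dots> = mix r a b N \<xi> * exit s N \<theta>0 \<xi>"
    unfolding mix_def by (rule nn_integral_multc) measurable
  finally show "(\<integral>\<^sup>+ \<eta>. mix r a b N \<eta> * flow s N \<theta>0 \<eta> \<xi> \<partial>count_space (configs N)) = mix r a b N \<xi> * exit s N \<theta>0 \<xi>" .
  show "mix r a b N \<xi> * exit s N \<theta>0 \<xi> < \<infinity>"
  proof (cases "mix r a b N \<xi> = 0")
    case False
    have "\<exists>\<theta>. ?D \<theta> \<noteq> 0"
    proof (rule ccontr)
      assume "\<not> ?thesis"
      then have "mix r a b N \<xi> = 0" by (simp add: mix_def)
      with False show False by simp
    qed
    then obtain \<theta> where D: "?D \<theta> \<noteq> 0" ..
    then have "exit s N \<theta>0 \<xi> < \<infinity>"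
      using pinned_nonneg[OF D a, of "Suc N"] a \<theta>0
        exit_finite[OF s, of "\<lambda>i. if i = 0 then a else b" N \<xi>]
        flow_cong(2)[of \<theta>0 "\<lambda>i. if i = 0 then a else b" N s \<xi>] by simp
    then show ?thesis using mixfin by (simp add: ennreal_mult_less_top)
  qed simp
qed

lemma feed_suminf:
  assumes "0 < r" "0 \<le> \<theta>"
  shows "(\<Sum>n. ennreal (feed r (odds \<theta>) \<theta> n)) = ennreal (ln (1 + \<theta>))"
proof -
  have o: "\<bar>odds \<theta>\<bar> < 1" "0 \<le> odds \<theta>" using odds_bounds[OF assms(2)] by auto
  have "1 - odds \<theta> = inverse (1 + \<theta>)" using assms by (simp add: odds_def field_simps)
  then have "- ln (1 - odds \<theta>) = ln (1 + \<theta>)" using assms by (simp add: ln_inverse)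
  then show ?thesis
    using feed_sums[OF assms, of "odds \<theta>" 1] o feed_nonneg[OF assms o(2)]
    by (subst suminf_ennreal2) (auto simp: sums_iff)
qed

text \<open>Under the product law the mean exit rate of a site along one channel is the total mass
  of \<open>feed\<close>, namely ln (1 + \<theta> i) \<le> ln (1 + b). This leads to the finite
  total outflow that \<open>subinvariant_eq_invariant\<close> demands.\<close>

lemma wt_exit_total:
  assumes s: "0 < s" and \<theta>: "\<And>i. i \<le> Suc N \<Longrightarrow> 0 \<le> \<theta> i" and b: "\<And>i. i \<le> Suc N \<Longrightarrow> \<theta> i \<le> b"
  shows "(\<integral>\<^sup>+ \<eta>. ennreal (wt (2 * s) N \<theta> \<eta>) * exit s N \<theta> \<eta> \<partial>count_space (configs N))
     \<le> of_nat (card (channels N)) * ennreal (ln (1 + b))"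
proof -
  define r where "r = 2 * s"
  have r: "0 < r" using s by (simp add: r_def)
  define F where "F c \<eta> = (if fst c \<in> {1..N} then wt_except r N \<theta> \<eta> (fst c) * feed r (odds (\<theta> (fst c))) (\<theta> (fst c)) (\<eta> (fst c))
       else ln (1 + \<theta> (fst c)) * wt r N \<theta> \<eta>)" for c :: "nat \<times> nat" and \<eta>
  have fc: "fst c \<le> Suc N" if "c \<in> channels N" for c
    using channels_le[of "fst c" "snd c" N] that by auto
  have w0: "0 \<le> wt r N \<theta> \<eta>" "0 \<le> wt_except r N \<theta> \<eta> j" for \<eta> j
    using \<theta> by (auto intro!: wt_nonneg wt_except_nonneg r)
  have F0: "0 \<le> F c \<eta>" if "c \<in> channels N" for c \<eta>
    unfolding F_def using w0 \<theta>[OF fc[OF that]] odds_bounds[of "\<theta> (fst c)"]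
    by (auto intro!: mult_nonneg_nonneg feed_nonneg r)
  have "(\<integral>\<^sup>+ \<eta>. ennreal (wt r N \<theta> \<eta>) * exit s N \<theta> \<eta> \<partial>count_space (configs N))
     = (\<integral>\<^sup>+ \<eta>. (\<Sum>c\<in>channels N. ennreal (F c \<eta>)) \<partial>count_space (configs N))"
  proof (rule nn_integral_cong)
    fix \<eta>
    have "ennreal (wt r N \<theta> \<eta>) * exit s N \<theta> \<eta> = ennreal (\<Sum>c\<in>channels N. F c \<eta>)"
      unfolding r_def F_def using wt_outflow[where \<theta> = \<theta> and \<xi> = \<eta> and N = N, OF s \<theta>] by (simp add: case_prod_beta)
    also have "\<dots> = (\<Sum>c\<in>channels N. ennreal (F c \<eta>))"
      by (rule sum_ennreal[symmetric]) (rule F0)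
    finally show "ennreal (wt r N \<theta> \<eta>) * exit s N \<theta> \<eta> = (\<Sum>c\<in>channels N. ennreal (F c \<eta>))" .
  qed
  also have "\<dots> = (\<Sum>c\<in>channels N. \<integral>\<^sup>+ \<eta>. ennreal (F c \<eta>) \<partial>count_space (configs N))"
    by (rule nn_integral_sum) simp
  also have "\<dots> \<le> (\<Sum>c\<in>channels N. ennreal (ln (1 + b)))"
  proof (rule sum_mono)
    fix c assume c: "c \<in> channels N"
    define i where "i = fst c"
    have i: "0 \<le> \<theta> i" "\<theta> i \<le> b" using \<theta> b fc[OF c] by (auto simp: i_def)
    have nb: "ennreal (wt r N \<theta> \<eta>) = (\<Prod>l\<in>{1..N}. ennreal (nbp r (\<theta> l) (\<eta> l)))" for \<eta>
      unfolding wt_def by (rule prod_ennreal[symmetric]) (use \<theta> nbp_nonneg[OF r] in auto)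
    have one: "(\<Sum>n. ennreal (nbp r (\<theta> l) n)) = 1" if "l \<in> {1..N}" for l
      by (rule nbp_suminf[OF r]) (use \<theta> that in auto)
    have "(\<integral>\<^sup>+ \<eta>. ennreal (F c \<eta>) \<partial>count_space (configs N)) = ennreal (ln (1 + \<theta> i))"
    proof (cases "i \<in> {1..N}")
      case True
      define g where "g l n = ennreal (if l = i then feed r (odds (\<theta> i)) (\<theta> i) n else nbp r (\<theta> l) n)" for l n
      have "ennreal (F c \<eta>) = (\<Prod>l\<in>{1..N}. g l (\<eta> l))" for \<eta>
      proof -
        have "(\<Prod>l\<in>{1..N}. g l (\<eta> l)) = g i (\<eta> i) * (\<Prod>l\<in>{1..N} - {i}. g l (\<eta> l))"
          using True by (subst prod.remove[of _ i]) auto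
        also have "(\<Prod>l\<in>{1..N} - {i}. g l (\<eta> l)) = (\<Prod>l\<in>{1..N} - {i}. ennreal (nbp r (\<theta> l) (\<eta> l)))"
          by (intro prod.cong) (auto simp: g_def)
        also have "\<dots> = ennreal (wt_except r N \<theta> \<eta> i)"
          unfolding wt_except_def by (rule prod_ennreal) (use \<theta> nbp_nonneg[OF r] in auto)
        finally show ?thesis
          using True w0 feed_nonneg[OF r i(1)] odds_bounds[OF i(1)]
          by (simp add: F_def g_def i_def[symmetric] ennreal_mult mult.commute)
      qed
      then have "(\<integral>\<^sup>+ \<eta>. ennreal (F c \<eta>) \<partial>count_space (configs N)) = (\<Prod>l\<in>{1..N}. \<Sum>n. g l n)"
        using nn_integral_configs_prod[of N g] by simp
      also have "\<dots> = (\<Sum>n. g i n) * (\<Prod>l\<in>{1..N} - {i}. \<Sum>n. g l n)"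
        using True by (subst prod.remove[of _ i]) auto
      also have "(\<Prod>l\<in>{1..N} - {i}. \<Sum>n. g l n) = 1"
        by (rule prod.neutral) (auto simp: g_def one)
      also have "(\<Sum>n. g i n) = ennreal (ln (1 + \<theta> i))"
        using feed_suminf[OF r i(1)] by (simp add: g_def)
      finally show ?thesis by simp
    next
      case False
      have "ennreal (F c \<eta>) = ennreal (ln (1 + \<theta> i)) * (\<Prod>l\<in>{1..N}. ennreal (nbp r (\<theta> l) (\<eta> l)))" for \<eta>
        unfolding nb[symmetric] F_def i_def[symmetric] if_not_P[OF False] using i w0
        by (simp add: ennreal_mult)
      then have "(\<integral>\<^sup>+ \<eta>. ennreal (F c \<eta>) \<partial>count_space (configs N))
        = ennreal (ln (1 + \<theta> i)) * (\<Prod>l\<in>{1..N}. \<Sum>n. ennreal (nbp r (\<theta> l) n))"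
        using nn_integral_configs_prod[of N "\<lambda>l n. ennreal (nbp r (\<theta> l) n)"]
        by (simp only:) (subst nn_integral_cmult; simp)
      also have "(\<Prod>l\<in>{1..N}. \<Sum>n. ennreal (nbp r (\<theta> l) n)) = 1"
        by (rule prod.neutral) (auto simp: one)
      finally show ?thesis by simp
    qed
    then show "(\<integral>\<^sup>+ \<eta>. ennreal (F c \<eta>) \<partial>count_space (configs N)) \<le> ennreal (ln (1 + b))"
      using i by (simp add: ennreal_leI)
  qed
  also have "\<dots> = of_nat (card (channels N)) * ennreal (ln (1 + b))" by simp
  finally show ?thesis by (simp only: r_def)
qed

lemma path_density_lt:
  assumes "path_density r N \<theta> \<noteq> 0" "l \<le> N"
  shows "\<theta> l < \<theta> (Suc l)"
proof (rule ccontr)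
  assume "\<not> ?thesis"
  then have "kap r (\<theta> l) (\<theta> (Suc l)) = 0" by (simp add: kap_eq_0)
  then have "path_density r N \<theta> = 0"
    unfolding path_density_def using assms(2) by (intro prod_zero) auto
  with assms(1) show False by simp
qed

lemma pinned_le:
  assumes "path_density r N (pinned a b N \<theta>) \<noteq> 0" "l \<le> Suc N"
  shows "pinned a b N \<theta> l \<le> b"
  using assms(2)
proof (induction l rule: inc_induct)
  case (step l)
  then show ?case using path_density_lt[OF assms(1), of l] by simp
qed simp

lemma mix_exit_finite:
  assumes s: "0 < s" and a: "0 \<le> a" and \<theta>0: "\<theta>0 0 = a" "\<theta>0 (Suc N) = b"
  shows "(\<integral>\<^sup>+ \<eta>. mix (2 * s) a b N \<eta> * exit s N \<theta>0 \<eta> \<partial>count_space (configs N)) < \<infinity>"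
proof -
  define r where "r = 2 * s"
  have r: "0 < r" using s by (simp add: r_def)
  let ?\<Lambda> = "PiM {1..N} (\<lambda>_. lborel :: real measure)"
  let ?p = "pinned a b N"
  let ?D = "\<lambda>\<theta>. path_density r N (?p \<theta>)"
  let ?C = "of_nat (card (channels N)) * ennreal (ln (1 + b))"
  have "(\<integral>\<^sup>+ \<eta>. mix r a b N \<eta> * exit s N \<theta>0 \<eta> \<partial>count_space (configs N))
    = (\<integral>\<^sup>+ \<eta>. \<integral>\<^sup>+ \<theta>. ?D \<theta> * ennreal (wt r N (?p \<theta>) \<eta>) * exit s N \<theta>0 \<eta> \<partial>?\<Lambda> \<partial>count_space (configs N))"
    unfolding mix_def by (intro nn_integral_cong nn_integral_multc[symmetric]) measurable
  also have "\<dots> = (\<integral>\<^sup>+ \<theta>. \<integral>\<^sup>+ \<eta>. ?D \<theta> * ennreal (wt r N (?p \<theta>) \<eta>) * exit s N \<theta>0 \<eta> \<partial>count_space (configs N) \<partial>?\<Lambda>)"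
    by (rule nn_integral_count_space_nn_integral[OF countable_configs, symmetric]) measurable
  also have "\<dots> \<le> (\<integral>\<^sup>+ \<theta>. ?C * ?D \<theta> \<partial>?\<Lambda>)"
  proof (rule nn_integral_mono)
    fix \<theta>
    show "(\<integral>\<^sup>+ \<eta>. ?D \<theta> * ennreal (wt r N (?p \<theta>) \<eta>) * exit s N \<theta>0 \<eta> \<partial>count_space (configs N)) \<le> ?C * ?D \<theta>"
    proof (cases "?D \<theta> = 0")
      case False
      have "(\<integral>\<^sup>+ \<eta>. ?D \<theta> * ennreal (wt r N (?p \<theta>) \<eta>) * exit s N \<theta>0 \<eta> \<partial>count_space (configs N))
         = ?D \<theta> * (\<integral>\<^sup>+ \<eta>. ennreal (wt r N (?p \<theta>) \<eta>) * exit s N (?p \<theta>) \<eta> \<partial>count_space (configs N))"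
        using flow_cong(2)[of \<theta>0 "?p \<theta>" N s] \<theta>0
        by (subst nn_integral_cmult[symmetric]) (auto simp: mult_ac)
      also have "\<dots> \<le> ?D \<theta> * ?C"
        unfolding r_def
        by (intro mult_left_mono wt_exit_total s)
           (use pinned_nonneg[OF False a] pinned_le[OF False] in \<open>auto simp: r_def\<close>)
      finally show ?thesis by (simp add: mult.commute)
    qed simp
  qed
  also have "\<dots> = ?C * (\<integral>\<^sup>+ \<theta>. ?D \<theta> \<partial>?\<Lambda>)" by (rule nn_integral_cmult) measurable
  also have "(\<integral>\<^sup>+ \<theta>. ?D \<theta> \<partial>?\<Lambda>) = kap (r * real (Suc N)) a b"
    using path_integral_chain[where M = "\<lambda>_ _. 1" and r = r and N = N and a = a and b = b] chain_one[OF r, where b = b and n = N and j = 1 and x = a] by simp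
  also have "?C * kap (r * real (Suc N)) a b < \<infinity>"
    using kap_finite[of "r * real (Suc N)" a b] by (simp add: ennreal_mult_less_top of_nat_less_top)
  finally show ?thesis by (simp only: r_def)
qed

text \<open>\<open>subinvariant_eq_invariant\<close> with the given measure in the subinvariant and
  the normalised mixture in the invariant role: exact balance and a finite mean exit rate are known
  for the mixture.\<close>

theorem invariant_measure_mixture:
  assumes s: "0 < s" and \<rho>: "0 \<le> \<rho>l" "\<rho>l < \<rho>r" and N: "1 \<le> N"
    and P: "harmonic_process s \<rho>l \<rho>r N P" and \<mu>: "invariant_measure N P \<mu>" and \<xi>: "\<xi> \<in> configs N"
  shows "ennreal (pmf \<mu> \<xi>) = mix (2 * s) \<rho>l \<rho>r N \<xi> / kap (2 * s * real (Suc N)) \<rho>l \<rho>r"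
proof -
  define r where "r = 2 * s"
  have r: "0 < r" using s by (simp add: r_def)
  define K where "K = kap (r * real (Suc N)) \<rho>l \<rho>r"
  have K: "0 < K" "K < \<infinity>" unfolding K_def using r \<rho> by (simp_all add: kap_pos kap_finite del: of_nat_Suc infinity_ennreal_def)
  define \<theta>0 where "\<theta>0 = (\<lambda>i::nat. if i = 0 then \<rho>l else \<rho>r)"
  have \<theta>0: "\<theta>0 0 = \<rho>l" "\<theta>0 (Suc N) = \<rho>r" "0 \<le> \<theta>0 i" "0 < \<theta>0 (Suc N)" for i
    using \<rho> by (auto simp: \<theta>0_def)
  have "ennreal (pmf \<mu> \<xi>) = mix r \<rho>l \<rho>r N \<xi> / K"
  proof (rule subinvariant_eq_invariant[where m = "\<lambda>\<eta>. ennreal (pmf \<mu> \<eta>)"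
      and n = "\<lambda>\<eta>. mix r \<rho>l \<rho>r N \<eta> / K" and S = "configs N" and q = "flow s N \<theta>0" and out = "exit s N \<theta>0"])
    show "countable (configs N)" by (rule countable_configs)
    have "(\<integral>\<^sup>+ \<eta>. ennreal (pmf \<mu> \<eta>) \<partial>count_space (configs N)) = emeasure (measure_pmf \<mu>) (configs N)"
      by (rule nn_integral_pmf)
    also have "\<dots> = 1"
      using \<mu> by (intro measure_pmf.emeasure_eq_1_AE) (auto simp: AE_measure_pmf_iff invariant_measure_def)
    finally show "(\<integral>\<^sup>+ \<eta>. ennreal (pmf \<mu> \<eta>) \<partial>count_space (configs N)) = 1" .
    show "(\<integral>\<^sup>+ \<eta>. mix r \<rho>l \<rho>r N \<eta> / K \<partial>count_space (configs N)) = 1"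
      using K mix_total[OF r \<rho>(1), where b = \<rho>r and N = N]
      by (subst nn_integral_divide) (auto simp: K_def ennreal_divide_self)
    show "(\<integral>\<^sup>+ \<eta>. ennreal (pmf \<mu> \<eta>) * flow s N \<theta>0 \<eta> \<zeta> \<partial>count_space (configs N)) \<le> ennreal (pmf \<mu> \<zeta>) * exit s N \<theta>0 \<zeta>"
      if "\<zeta> \<in> configs N" for \<zeta>
      by (rule invariant_subinvariant[OF s N \<theta>0(3,1,2) P \<mu> that])
    have div: "(\<integral>\<^sup>+ \<eta>. mix r \<rho>l \<rho>r N \<eta> / K * f \<eta> \<partial>count_space (configs N))
       = (\<integral>\<^sup>+ \<eta>. mix r \<rho>l \<rho>r N \<eta> * f \<eta> \<partial>count_space (configs N)) / K" for f
      by (subst nn_integral_divide[symmetric]) (auto simp: divide_ennreal_def mult_ac)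
    show "(\<integral>\<^sup>+ \<eta>. mix r \<rho>l \<rho>r N \<eta> / K * flow s N \<theta>0 \<eta> \<zeta> \<partial>count_space (configs N)) = mix r \<rho>l \<rho>r N \<zeta> / K * exit s N \<theta>0 \<zeta>"
      if "\<zeta> \<in> configs N" for \<zeta>
      unfolding div
      unfolding r_def mix_flow(1)[OF s \<rho>(1) \<theta>0(1,2) N that] by (simp only: divide_ennreal_def mult_ac)
    show "(\<integral>\<^sup>+ \<zeta>. flow s N \<theta>0 \<eta> \<zeta> \<partial>count_space (configs N)) = exit s N \<theta>0 \<eta>" if "\<eta> \<in> configs N" for \<eta>
      by (rule flow_total[OF that])
    show "(\<integral>\<^sup>+ \<eta>. mix r \<rho>l \<rho>r N \<eta> / K * exit s N \<theta>0 \<eta> \<partial>count_space (configs N)) < \<infinity>"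
      unfolding div unfolding r_def using mix_exit_finite[OF s \<rho>(1) \<theta>0(1,2)] K
      by (auto simp: less_top[symmetric] ennreal_divide_eq_top_iff)
    show "Z = configs N" if "Z \<subseteq> configs N" "Z \<noteq> {}"
      "\<And>\<eta> \<zeta>. \<eta> \<in> configs N \<Longrightarrow> \<zeta> \<in> Z \<Longrightarrow> 0 < flow s N \<theta>0 \<eta> \<zeta> \<Longrightarrow> \<eta> \<in> Z" for Z
      by (rule flow_irreducible[OF s N _ that(1,2)]) (use \<theta>0(4) that(3) in auto)
    show "\<xi> \<in> configs N" by (rule \<xi>)
  qed
  then show ?thesis by (simp add: r_def K_def)
qed

section \<open>Moment generating functions as iterated integrals\<close>

definition site_mgf :: "real \<Rightarrow> real \<Rightarrow> real \<Rightarrow> ennreal" where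
  "site_mgf r c \<theta> = (if 0 < 1 + (1 - exp c) * \<theta> then ennreal ((1 + (1 - exp c) * \<theta>) powr (- r)) else \<infinity>)"

lemma site_mgf_measurable [measurable]: "site_mgf r c \<in> borel_measurable borel"
  unfolding site_mgf_def by measurable

text \<open>Convergence of the negative binomial series means
  \<open>odds \<theta> * exp c < 1\<close>, which is the positivity of
  \<open>1 + (1 - exp c) * \<theta>\<close>. At the radius it diverges because r > 0.\<close>

lemma nbp_mgf:
  assumes r: "0 < r" and \<theta>: "0 \<le> \<theta>"
  shows "(\<Sum>n. ennreal (nbp r \<theta> n) * ennreal (exp c ^ n)) = site_mgf r c \<theta>"
proof -
  have pos: "0 < 1 + (1 - exp c) * \<theta> \<longleftrightarrow> odds \<theta> * exp c < 1"
    using one_minus_odds[OF \<theta>, of "exp c"] \<theta>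
    by (smt (verit) mult_le_0_iff mult_pos_pos)
  show ?thesis
  proof (cases "0 < 1 + (1 - exp c) * \<theta>")
    case True
    then have o: "\<bar>odds \<theta> * exp c\<bar> < 1" using pos odds_bounds[OF \<theta>] by (simp add: abs_mult)
    have "(\<Sum>n. ennreal (nbp r \<theta> n) * ennreal (exp c ^ n)) = (\<Sum>n. ennreal (nbp r \<theta> n * exp c ^ n))"
      using nbp_nonneg[OF r \<theta>] by (simp add: ennreal_mult)
    also have "\<dots> = ennreal ((1 + (1 - exp c) * \<theta>) powr (- r))"
      using nbp_sums[OF \<theta> o, of r] nbp_nonneg[OF r \<theta>]
      by (subst suminf_ennreal2) (auto simp: sums_iff)
    finally show ?thesis using True by (simp add: site_mgf_def)
  next
    case False
    then have y: "1 \<le> odds \<theta> * exp c" using pos by simp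
    \<comment> \<open>From the radius on, the series dominates the convergent one at every x < 1,
      whose sum is unbounded as x tends to 1.\<close>
    have ge: "ennreal ((1 + \<theta>) powr (- r) * (1 - x) powr (- r)) \<le> (\<Sum>n. ennreal (nbp r \<theta> n) * ennreal (exp c ^ n))"
      if x: "0 \<le> x" "x < 1" for x
    proof -
      have "(\<lambda>n. (1 + \<theta>) powr (- r) * (nbw r n * x ^ n)) sums ((1 + \<theta>) powr (- r) * (1 - x) powr (- r))"
        by (intro sums_mult nbw_sums) (use x in auto)
      then have "ennreal ((1 + \<theta>) powr (- r) * (1 - x) powr (- r)) = (\<Sum>n. ennreal ((1 + \<theta>) powr (- r) * (nbw r n * x ^ n)))"
        using nbw_pos[OF r] x by (subst suminf_ennreal2) (auto simp: sums_iff less_imp_le)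
      also have "\<dots> \<le> (\<Sum>n. ennreal (nbp r \<theta> n) * ennreal (exp c ^ n))"
      proof (intro suminf_le summableI)
        fix n
        have "x ^ n \<le> (odds \<theta> * exp c) ^ n" using x y by (intro power_mono) auto
        then have "(1 + \<theta>) powr (- r) * (nbw r n * x ^ n) \<le> (1 + \<theta>) powr (- r) * (nbw r n * (odds \<theta> * exp c) ^ n)"
          using nbw_pos[OF r, of n] by (intro mult_left_mono) auto
        also have "\<dots> = nbp r \<theta> n * exp c ^ n" by (simp add: nbp_def power_mult_distrib mult_ac)
        finally show "ennreal ((1 + \<theta>) powr (- r) * (nbw r n * x ^ n)) \<le> ennreal (nbp r \<theta> n) * ennreal (exp c ^ n)"
          using nbp_nonneg[OF r \<theta>] by (simp add: ennreal_leI flip: ennreal_mult)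
      qed
      finally show ?thesis .
    qed
    have "(\<Sum>n. ennreal (nbp r \<theta> n) * ennreal (exp c ^ n)) = \<infinity>"
    proof (rule ccontr)
      assume "\<not> ?thesis"
      then obtain A where A: "(\<Sum>n. ennreal (nbp r \<theta> n) * ennreal (exp c ^ n)) = ennreal A" "0 \<le> A"
        by (cases "(\<Sum>n. ennreal (nbp r \<theta> n) * ennreal (exp c ^ n))") auto
      define d where "d = (1 + \<theta>) powr (- r)"
      have d: "0 < d" using \<theta> by (simp add: d_def)
      \<comment> \<open>Solves d * e powr (- r) = A + 1 + d, so that x = 1 - e already exceeds the
        supposed finite sum A.\<close>
      define e where "e = ((A + 1) / d + 1) powr (- 1 / r)"
      have A1: "1 < (A + 1) / d + 1" using A d by simp
      have e0: "0 < e" using A1 by (simp add: e_def)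
      have e1: "e \<le> 1" unfolding e_def using A1 r by (simp add: powr_minus_divide divide_le_eq ge_one_powr_ge_zero)
      have "d * e powr (- r) \<le> A"
        using ge[of "1 - e"] e0 e1 A by (simp add: d_def)
      moreover have "e powr (- r) = (A + 1) / d + 1"
        using r A1 by (simp add: e_def powr_powr)
      moreover have "d * ((A + 1) / d + 1) = A + 1 + d" using d by (simp add: field_simps)
      ultimately show False using d by simp
    qed
    then show ?thesis using False by (simp add: site_mgf_def)
  qed
qed

theorem mgf_chain:
  assumes s: "0 < s" and \<rho>: "0 \<le> \<rho>l" "\<rho>l < \<rho>r" and N: "1 \<le> N"
    and P: "harmonic_process s \<rho>l \<rho>r N P" and \<mu>: "invariant_measure N P \<mu>"
  shows "(\<integral>\<^sup>+ \<eta>. ennreal (exp (\<Sum>i = 1..N. real (\<eta> i) * c i)) \<partial>measure_pmf \<mu>)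
    = chain (2 * s) \<rho>r (\<lambda>i. site_mgf (2 * s) (c i)) N 1 \<rho>l / kap (2 * s * real (Suc N)) \<rho>l \<rho>r"
proof -
  define r where "r = 2 * s"
  have r: "0 < r" using s by (simp add: r_def)
  define K where "K = kap (r * real (Suc N)) \<rho>l \<rho>r"
  have set: "set_pmf \<mu> \<subseteq> configs N" using \<mu> by (simp add: invariant_measure_def)
  have e: "ennreal (exp (\<Sum>i = 1..N. real (\<eta> i) * c i)) = (\<Prod>i\<in>{1..N}. ennreal (exp (c i) ^ \<eta> i))" for \<eta>
    by (simp add: exp_sum prod_ennreal exp_of_nat_mult)
  have "(\<integral>\<^sup>+ \<eta>. ennreal (exp (\<Sum>i = 1..N. real (\<eta> i) * c i)) \<partial>measure_pmf \<mu>)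
    = (\<integral>\<^sup>+ \<eta>. ennreal (pmf \<mu> \<eta>) * (\<Prod>i\<in>{1..N}. ennreal (exp (c i) ^ \<eta> i)) \<partial>count_space (configs N))"
    unfolding nn_integral_measure_pmf e using set
    by (intro nn_integral_count_space_eq) (auto simp: set_pmf_iff)
  also have "\<dots> = (\<integral>\<^sup>+ \<eta>. mix r \<rho>l \<rho>r N \<eta> * (\<Prod>i\<in>{1..N}. ennreal (exp (c i) ^ \<eta> i)) / K \<partial>count_space (configs N))"
    using invariant_measure_mixture[OF s \<rho> N P \<mu>]
    by (intro nn_integral_cong) (simp add: r_def K_def divide_ennreal_def mult_ac)
  also have "\<dots> = (\<integral>\<^sup>+ \<eta>. mix r \<rho>l \<rho>r N \<eta> * (\<Prod>i\<in>{1..N}. ennreal (exp (c i) ^ \<eta> i)) \<partial>count_space (configs N)) / K"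
    by (rule nn_integral_divide) simp
  also have "(\<integral>\<^sup>+ \<eta>. mix r \<rho>l \<rho>r N \<eta> * (\<Prod>i\<in>{1..N}. ennreal (exp (c i) ^ \<eta> i)) \<partial>count_space (configs N))
    = chain r \<rho>r (\<lambda>l \<theta>. \<Sum>n. ennreal (nbp r \<theta> n) * ennreal (exp (c l) ^ n)) N 1 \<rho>l"
    by (rule mix_product[OF r \<rho>(1)])
  also have "\<dots> = chain r \<rho>r (\<lambda>l. site_mgf r (c l)) N 1 \<rho>l"
    by (rule chain_cong_ge[of \<rho>l]) (use \<rho> in \<open>auto intro!: nbp_mgf[OF r]\<close>)
  finally show ?thesis by (simp add: r_def K_def)
qed

section \<open>Gamma function asymptotics\<close>

lemma ln_Gamma_plus1:
  assumes "0 < (x::real)"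
  shows "ln_Gamma (x + 1) = ln_Gamma x + ln x"
  using assms Gamma_plus1[of x] Gamma_real_pos[OF assms]
  by (simp add: ln_Gamma_real_pos ln_mult_pos add.commute nonpos_Ints_def)

lemma MVT_ln_Gamma:
  assumes "0 < x" "x < (y::real)"
  obtains z where "x < z" "z < y" "ln_Gamma y - ln_Gamma x = (y - x) * Digamma z"
proof -
  have "\<exists>z>x. z < y \<and> ln_Gamma y - ln_Gamma x = (y - x) * Digamma z"
    using assms by (intro MVT2) (auto intro: has_field_derivative_ln_Gamma_real)
  then show ?thesis using that by blast
qed

text \<open>The increment of \<open>ln_Gamma\<close> over [x, x + 1] is ln x, so Digamma takes the
  value ln x inside that interval; it is increasing. The lower bound below uses [x - 1, x] in the
  same way.\<close>

lemma Digamma_le_ln: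
  assumes "0 < (x::real)"
  shows "Digamma x \<le> ln x"
proof -
  obtain z where z: "x < z" "z < x + 1" "ln_Gamma (x + 1) - ln_Gamma x = (x + 1 - x) * Digamma z"
    by (rule MVT_ln_Gamma[of x "x + 1"]) (use assms in auto)
  then have "ln x = Digamma z" using ln_Gamma_plus1[OF assms] by simp
  then show ?thesis using Digamma_real_mono[OF assms, of z] z by simp
qed

lemma Digamma_ge_ln:
  assumes "1 < (x::real)"
  shows "ln (x - 1) \<le> Digamma x"
proof -
  have x: "0 < x - 1" using assms by simp
  obtain z where z: "x - 1 < z" "z < x" "ln_Gamma x - ln_Gamma (x - 1) = (x - (x - 1)) * Digamma z"
    by (rule MVT_ln_Gamma[of "x - 1" x]) (use x in auto)
  then have "ln (x - 1) = Digamma z" using ln_Gamma_plus1[OF x] by simp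
  then show ?thesis using Digamma_real_mono[of z x] z x by simp
qed

text \<open>The leading order of Stirling's formula suffices, since errors o(N) in an exponent do
  not affect the rate. L'Hopital reduces it to Digamma x - ln x tending to 0.\<close>

lemma ln_Gamma_asymptotics: "((\<lambda>x::real. (ln_Gamma x - x * ln x) / x) \<longlongrightarrow> - 1) at_top"
proof (rule lhospital_at_top_at_top[where f' = "\<lambda>x. Digamma x - (ln x + 1)" and g' = "\<lambda>_. 1"])
  show "\<forall>\<^sub>F x in at_top. ((\<lambda>x. ln_Gamma x - x * ln x) has_real_derivative Digamma x - (ln x + 1)) (at x)"
    using eventually_gt_at_top[of "0::real"]
    by eventually_elim (auto intro!: derivative_eq_intros)
  show "((\<lambda>x::real. (Digamma x - (ln x + 1)) / 1) \<longlongrightarrow> - 1) at_top"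
  proof (rule tendsto_sandwich)
    show "((\<lambda>x::real. ln (x - 1) - ln x - 1) \<longlongrightarrow> - 1) at_top" by real_asymp
    show "((\<lambda>x::real. - 1) \<longlongrightarrow> - 1) at_top" by simp
    show "\<forall>\<^sub>F x :: real in at_top. ln (x - 1) - ln x - 1 \<le> (Digamma x - (ln x + 1)) / 1"
      using eventually_gt_at_top[of "1::real"]
    proof eventually_elim
      case (elim x)
      then show ?case using Digamma_ge_ln[of x] by simp
    qed
    show "\<forall>\<^sub>F x :: real in at_top. (Digamma x - (ln x + 1)) / 1 \<le> - 1"
      using eventually_gt_at_top[of "0::real"]
    proof eventually_elim
      case (elim x)
      then show ?case using Digamma_le_ln[of x] by simp
    qed
  qed
qed (auto simp: filterlim_ident)

text \<open>Subtracting a multiple of ln N, rather than of the logarithm of the argument, makes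
  different arguments comparable; these terms cancel in \<open>Gamma_block_limit\<close>.\<close>

lemma ln_Gamma_scaled:
  assumes r: "0 < r" and \<alpha>: "0 < \<alpha>" and m: "(\<lambda>N. m N / real N) \<longlonglongrightarrow> \<alpha>"
  shows "(\<lambda>N. (ln_Gamma (r * m N) - r * m N * ln (real N)) / real N) \<longlonglongrightarrow> r * \<alpha> * ln (r * \<alpha>) - r * \<alpha>"
proof -
  define y where "y N = r * m N" for N
  have yN: "(\<lambda>N. y N / real N) \<longlonglongrightarrow> r * \<alpha>"
    using tendsto_mult_left[OF m, of r] by (simp add: y_def)
  have ev: "\<forall>\<^sub>F N in sequentially. r * \<alpha> / 2 < y N / real N"
    using yN r \<alpha> by (intro order_tendstoD) auto
  have yinf: "filterlim y at_top sequentially"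
  proof (rule filterlim_at_top_mono)
    show "filterlim (\<lambda>N. (r * \<alpha> / 2) * real N) at_top sequentially"
      using r \<alpha> by (intro filterlim_tendsto_pos_mult_at_top[OF tendsto_const] filterlim_real_sequentially) auto
    show "\<forall>\<^sub>F N in sequentially. (r * \<alpha> / 2) * real N \<le> y N"
      using ev eventually_gt_at_top[of "0::nat"] by eventually_elim (simp add: field_simps)
  qed
  have "(\<lambda>N. (y N / real N) * ((ln_Gamma (y N) - y N * ln (y N)) / y N) + (y N / real N) * ln (y N / real N))
     \<longlonglongrightarrow> (r * \<alpha>) * (- 1) + (r * \<alpha>) * ln (r * \<alpha>)"
    using r \<alpha> by (intro tendsto_add tendsto_mult yN tendsto_ln filterlim_compose[OF ln_Gamma_asymptotics yinf]) auto
  then have "(\<lambda>N. (y N / real N) * ((ln_Gamma (y N) - y N * ln (y N)) / y N) + (y N / real N) * ln (y N / real N))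
     \<longlonglongrightarrow> r * \<alpha> * ln (r * \<alpha>) - r * \<alpha>" by simp
  then show ?thesis
  proof (rule Lim_transform_eventually)
    show "\<forall>\<^sub>F N in sequentially. (y N / real N) * ((ln_Gamma (y N) - y N * ln (y N)) / y N) + (y N / real N) * ln (y N / real N)
       = (ln_Gamma (r * m N) - r * m N * ln (real N)) / real N"
      using ev eventually_gt_at_top[of "0::nat"]
    proof eventually_elim
      case (elim N)
      have "0 < r * \<alpha> / 2" using r \<alpha> by simp
      then have "0 < y N / real N" using elim(1) by linarith
      then have y0: "0 < y N" using elim(2) by (simp add: zero_less_divide_iff)
      have "ln (y N / real N) = ln (y N) - ln (real N)" using y0 elim(2) by (simp add: ln_div)
      then have "(y N / real N) * ((ln_Gamma (y N) - y N * ln (y N)) / y N) + (y N / real N) * ln (y N / real N)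
         = (ln_Gamma (y N) - y N * ln (y N)) / real N + (y N / real N) * (ln (y N) - ln (real N))"
        using y0 by simp
      also have "\<dots> = (ln_Gamma (y N) - y N * ln (real N)) / real N"
        by (simp add: diff_divide_distrib right_diff_distrib)
      finally show ?case by (simp only: y_def)
    qed
  qed
qed

lemma tendsto_div_const:
  assumes "0 < K"
  shows "(\<lambda>N. real (N div K) / real N) \<longlonglongrightarrow> 1 / real K"
proof (rule tendsto_sandwich)
  show "(\<lambda>N. 1 / real K - 1 / real N) \<longlonglongrightarrow> 1 / real K" by real_asymp
  show "(\<lambda>N. 1 / real K) \<longlonglongrightarrow> 1 / real K" by simp
  show "\<forall>\<^sub>F N in sequentially. 1 / real K - 1 / real N \<le> real (N div K) / real N"
    using eventually_gt_at_top[of "0::nat"]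
  proof eventually_elim
    case (elim N)
    have "real N = real (N div K) * real K + real (N mod K)"
      by (metis div_mult_mod_eq of_nat_add of_nat_mult)
    moreover have "real (N mod K) \<le> real K" using assms by (simp add: less_imp_le)
    ultimately have "real N \<le> (real (N div K) + 1) * real K" by (simp add: algebra_simps)
    then have "real N / real K \<le> real (N div K) + 1" using assms by (simp add: divide_le_eq)
    then have "(real N / real K - 1) / real N \<le> real (N div K) / real N"
      by (intro divide_right_mono) auto
    then show ?case using elim by (simp add: diff_divide_distrib)
  qed
  show "\<forall>\<^sub>F N in sequentially. real (N div K) / real N \<le> 1 / real K"
    using eventually_gt_at_top[of "0::nat"]
  proof eventually_elim
    case (elim N)
    have "real (N div K) * real K \<le> real N"
      by (metis div_times_less_eq_dividend of_nat_le_iff of_nat_mult)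
    then show ?case using elim assms by (simp add: field_simps)
  qed
qed

text \<open>N + 1 kernels form K - 1 blocks of size N div K and a last block with the rest,
  including the extra kernel into the right end. The sizes add up to N + 1, so the terms in ln N and
  the linear terms cancel, and r ln r - r ln (r / K) remains.\<close>

lemma Gamma_block_limit:
  assumes r: "0 < r" and K: "0 < K"
  shows "(\<lambda>N. (ln_Gamma (r * real (Suc N)) - real (K - 1) * ln_Gamma (r * real (N div K))
       - ln_Gamma (r * real (N - (K - 1) * (N div K) + 1))) / real N) \<longlonglongrightarrow> r * ln (real K)"
proof -
  define nl where "nl N = N - (K - 1) * (N div K) + 1" for N
  have nl: "real (nl N) = real N - real (K - 1) * real (N div K) + 1" for N
  proof -
    have "(K - 1) * (N div K) \<le> N"
    proof -
      have "(K - 1) * (N div K) \<le> K * (N div K)" by (intro mult_right_mono) auto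
      also have "\<dots> \<le> N" by simp
      finally show ?thesis .
    qed
    then show ?thesis by (simp add: nl_def of_nat_diff)
  qed
  have l1: "(\<lambda>N. real (Suc N) / real N) \<longlonglongrightarrow> 1" by real_asymp
  have l2: "(\<lambda>N. real (N div K) / real N) \<longlonglongrightarrow> 1 / real K" by (rule tendsto_div_const[OF K])
  have l3: "(\<lambda>N. real (nl N) / real N) \<longlonglongrightarrow> 1 / real K"
  proof -
    have "(\<lambda>N. real (Suc N) / real N - real (K - 1) * (real (N div K) / real N)) \<longlonglongrightarrow> 1 - real (K - 1) * (1 / real K)"
      by (intro tendsto_diff l1 tendsto_mult tendsto_const l2)
    also have "1 - real (K - 1) * (1 / real K) = 1 / real K" using K by (simp add: of_nat_diff field_simps)
    finally show ?thesis
      by (rule Lim_transform_eventually) (auto simp: nl diff_divide_distrib add_divide_distrib)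
  qed
  define G where "G m N = (ln_Gamma (r * m N) - r * m N * ln (real N)) / real N" for m :: "nat \<Rightarrow> real" and N :: nat
  have K': "0 < 1 / real K" using K by simp
  have "(\<lambda>N. G (\<lambda>N. real (Suc N)) N - real (K - 1) * G (\<lambda>N. real (N div K)) N - G (\<lambda>N. real (nl N)) N) \<longlonglongrightarrow>
     (r * 1 * ln (r * 1) - r * 1) - real (K - 1) * (r * (1 / real K) * ln (r * (1 / real K)) - r * (1 / real K))
     - (r * (1 / real K) * ln (r * (1 / real K)) - r * (1 / real K))"
    unfolding G_def
    by (intro tendsto_diff tendsto_mult tendsto_const ln_Gamma_scaled[OF r] l1 l2 l3 K') auto
  also have "(r * 1 * ln (r * 1) - r * 1) - real (K - 1) * (r * (1 / real K) * ln (r * (1 / real K)) - r * (1 / real K))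
     - (r * (1 / real K) * ln (r * (1 / real K)) - r * (1 / real K)) = r * ln (real K)"
  proof -
    define c where "c = r * (1 / real K) * ln (r * (1 / real K)) - r * (1 / real K)"
    have "real (K - 1) * c + c = real K * c" using K by (simp add: of_nat_diff algebra_simps)
    also have "real K * c = r * ln (r * (1 / real K)) - r"
      using K by (simp add: c_def algebra_simps)
    also have "ln (r * (1 / real K)) = ln r - ln (real K)" using r K by (simp add: ln_div)
    finally have *: "real (K - 1) * c + c = r * (ln r - ln (real K)) - r" .
    have "(r * 1 * ln (r * 1) - r * 1) - real (K - 1) * c - c = r * ln (real K)"
      using * by (simp add: algebra_simps)
    then show ?thesis by (simp only: c_def)
  qed
  finally show ?thesis
  proof (rule Lim_transform_eventually)
    show "\<forall>\<^sub>F N in sequentially. G (\<lambda>N. real (Suc N)) N - real (K - 1) * G (\<lambda>N. real (N div K)) N - G (\<lambda>N. real (nl N)) N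
       = (ln_Gamma (r * real (Suc N)) - real (K - 1) * ln_Gamma (r * real (N div K))
       - ln_Gamma (r * real (N - (K - 1) * (N div K) + 1))) / real N"
      using eventually_gt_at_top[of "0::nat"]
    proof eventually_elim
      case (elim N)
      have "r * real (Suc N) * ln (real N) - real (K - 1) * (r * real (N div K) * ln (real N)) - r * real (nl N) * ln (real N) = 0"
        unfolding nl by (simp add: algebra_simps)
      moreover have "(A - p) / n - k * ((B - q) / n) - (C - u) / n = (A - k * B - C - (p - k * q - u)) / n"
        for A B C p q u k n :: real
        by (simp add: diff_divide_distrib right_diff_distrib)
      ultimately show ?case
        unfolding G_def nl_def[symmetric] by simp
    qed
  qed
qed

text \<open>Digamma is at most ln (x + y) on the interval of the mean value theorem. This and the
  next bound are not asymptotic, so they allow shifts y as large as x itself.\<close>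

lemma Gamma_add_le:
  assumes "0 < x" "0 \<le> y"
  shows "Gamma (x + y) \<le> Gamma x * (x + y) powr (y :: real)"
proof (cases "y = 0")
  case False
  then have y: "0 < y" using assms by simp
  obtain z where z: "x < z" "z < x + y" "ln_Gamma (x + y) - ln_Gamma x = (x + y - x) * Digamma z"
    by (rule MVT_ln_Gamma[of x "x + y"]) (use assms y in auto)
  have "Digamma z \<le> ln z" using z assms by (intro Digamma_le_ln) simp
  also have "\<dots> \<le> ln (x + y)" using z assms by simp
  finally have "Digamma z \<le> ln (x + y)" .
  then have "ln_Gamma (x + y) \<le> ln_Gamma x + y * ln (x + y)"
  proof -
    have "ln_Gamma (x + y) - ln_Gamma x = y * Digamma z" using z(3) by simp
    moreover have "y * Digamma z \<le> y * ln (x + y)" using y \<open>Digamma z \<le> ln (x + y)\<close> by (intro mult_left_mono) auto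
    ultimately show ?thesis by linarith
  qed
  then have "exp (ln_Gamma (x + y)) \<le> exp (ln_Gamma x) * exp (y * ln (x + y))"
    by (simp flip: exp_add)
  then show ?thesis
    using assms Gamma_real_pos[of x] Gamma_real_pos[of "x + y"]
    by (simp add: ln_Gamma_real_pos powr_def)
qed (use assms in simp)

lemma Gamma_add_ge:
  assumes "1 < x" "0 \<le> y"
  shows "Gamma x * (x - 1) powr y \<le> Gamma (x + y :: real)"
proof (cases "y = 0")
  case False
  then have y: "0 < y" using assms by simp
  obtain z where z: "x < z" "z < x + y" "ln_Gamma (x + y) - ln_Gamma x = (x + y - x) * Digamma z"
    by (rule MVT_ln_Gamma[of x "x + y"]) (use assms y in auto)
  have "ln (x - 1) \<le> ln (z - 1)" using z assms by simp
  also have "\<dots> \<le> Digamma z" using z assms by (intro Digamma_ge_ln) simp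
  finally have "ln (x - 1) \<le> Digamma z" .
  then have "ln_Gamma x + y * ln (x - 1) \<le> ln_Gamma (x + y)"
  proof -
    have "ln_Gamma (x + y) - ln_Gamma x = y * Digamma z" using z(3) by simp
    moreover have "y * ln (x - 1) \<le> y * Digamma z" using y \<open>ln (x - 1) \<le> Digamma z\<close> by (intro mult_left_mono) auto
    ultimately show ?thesis by linarith
  qed
  then have "exp (ln_Gamma x) * exp (y * ln (x - 1)) \<le> exp (ln_Gamma (x + y))"
    by (simp flip: exp_add)
  then show ?thesis
    using assms Gamma_real_pos[of x] Gamma_real_pos[of "x + y"]
    by (simp add: ln_Gamma_real_pos powr_def)
qed (use assms in simp)

section \<open>Iterated kernels over blocks\<close>

text \<open>As \<open>chain\<close>, except that the density of the last of the n sites is handed to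
  f. With a \<open>chain\<close> for f, blocks are glued together
  (\<open>chain_blk\<close>).\<close>

primrec blk :: "real \<Rightarrow> (nat \<Rightarrow> real \<Rightarrow> ennreal) \<Rightarrow> (real \<Rightarrow> ennreal) \<Rightarrow> nat \<Rightarrow> nat \<Rightarrow> real \<Rightarrow> ennreal" where
  "blk r M f 0 j x = f x"
| "blk r M f (Suc n) j x = (\<integral>\<^sup>+ y. kap r x y * M j y * blk r M f n (Suc j) y \<partial>lborel)"

lemma chain_blk: "chain r b M (n + m) j x = blk r M (chain r b M m (j + n)) n j x"
  by (induction n arbitrary: j x) simp_all

lemma blk_measurable [measurable]:
  assumes M: "\<And>l. M l \<in> borel_measurable borel" and f: "f \<in> borel_measurable borel"
  shows "blk r M f n j \<in> borel_measurable borel"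
proof (induction n arbitrary: j)
  case 0
  show ?case using f by (simp cong: measurable_cong)
next
  case (Suc n)
  note [measurable] = Suc[of "Suc j"] M
  show ?case by simp
qed

lemma blk_add:
  assumes M [measurable]: "\<And>l. M l \<in> borel_measurable borel"
    and f [measurable]: "f \<in> borel_measurable borel" "g \<in> borel_measurable borel"
  shows "blk r M (\<lambda>x. f x + g x) n j x = blk r M f n j x + blk r M g n j x"
proof (induction n arbitrary: j x)
  case (Suc n)
  note [measurable] = blk_measurable[OF M f(1)] blk_measurable[OF M f(2)]
  show ?case by (simp add: Suc distrib_left nn_integral_add)
qed simp

lemma blk_zero:
  assumes "\<And>y. x \<le> y \<Longrightarrow> f y = 0"
  shows "blk r M f n j x = 0"
  using assms
proof (induction n arbitrary: j x)
  case (Suc n)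
  have "kap r x y * M j y * blk r M f n (Suc j) y = 0" for y
    using Suc by (cases "x < y") (auto simp: kap_eq_0)
  then show ?case by (simp del: mult_eq_0_iff)
qed simp

lemma chain_zero: "b \<le> x \<Longrightarrow> chain r b M n j x = 0"
  using chain_blk[of r b M n 0 j x] blk_zero[of x "chain r b M 0 (j + n)"] by (simp add: kap_eq_0)

text \<open>In a block all densities lie between the entry x and the exit t, the density of its last
  site, and \<open>B x t\<close> bounds their factors; the bare kernels then compose. Antitonicity
  of B lets the bound survive when the entry moves right in the induction, and the restriction to f
  t \<noteq> 0 is how cutoffs enter.\<close>

lemma blk_upper:
  assumes r: "0 < r" and M [measurable]: "\<And>l. M l \<in> borel_measurable borel"
    and f [measurable]: "f \<in> borel_measurable borel" and B: "\<And>x. B x \<in> borel_measurable borel"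
    and bound: "\<And>i x y t. i \<in> {j..<j + Suc n} \<Longrightarrow> a \<le> x \<Longrightarrow> x \<le> y \<Longrightarrow> y \<le> t \<Longrightarrow> f t \<noteq> 0 \<Longrightarrow> M i y \<le> B x t"
    and anti: "\<And>x y t. a \<le> x \<Longrightarrow> x \<le> y \<Longrightarrow> B y t \<le> B x t" and x: "a \<le> x"
  shows "blk r M f (Suc n) j x \<le> (\<integral>\<^sup>+ t. kap (r * real (Suc n)) x t * B x t ^ Suc n * f t \<partial>lborel)"
  using bound x
proof (induction n arbitrary: j x)
  case 0
  have "kap r x y * M j y * f y \<le> kap r x y * B x y * f y" for y
  proof (cases "x < y \<and> f y \<noteq> 0")
    case True
    then show ?thesis using "0.prems"(1)[of j x y y] "0.prems"(2) by (intro mult_left_mono mult_right_mono) auto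
  qed (auto simp: kap_eq_0)
  then show ?case by (auto intro!: nn_integral_mono)
next
  case (Suc n)
  note [measurable] = B
  let ?\<kappa> = "kap (r * real (Suc n))"
  have "blk r M f (Suc (Suc n)) j x = (\<integral>\<^sup>+ y. kap r x y * M j y * blk r M f (Suc n) (Suc j) y \<partial>lborel)"
    by simp
  also have "\<dots> \<le> (\<integral>\<^sup>+ y. \<integral>\<^sup>+ t. kap r x y * ?\<kappa> y t * (B x t ^ Suc (Suc n) * f t) \<partial>lborel \<partial>lborel)"
  proof (rule nn_integral_mono)
    fix y :: real
    show "kap r x y * M j y * blk r M f (Suc n) (Suc j) y \<le> (\<integral>\<^sup>+ t. kap r x y * ?\<kappa> y t * (B x t ^ Suc (Suc n) * f t) \<partial>lborel)"
    proof (cases "x < y")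
      case True
      have "kap r x y * M j y * blk r M f (Suc n) (Suc j) y \<le> kap r x y * M j y * (\<integral>\<^sup>+ t. ?\<kappa> y t * B y t ^ Suc n * f t \<partial>lborel)"
        using Suc.prems True by (intro mult_left_mono Suc.IH) auto
      also have "\<dots> = (\<integral>\<^sup>+ t. kap r x y * M j y * (?\<kappa> y t * B y t ^ Suc n * f t) \<partial>lborel)"
        by (rule nn_integral_cmult[symmetric]) measurable
      also have "\<dots> \<le> (\<integral>\<^sup>+ t. kap r x y * ?\<kappa> y t * (B x t ^ Suc (Suc n) * f t) \<partial>lborel)"
      proof (rule nn_integral_mono)
        fix t :: real
        show "kap r x y * M j y * (?\<kappa> y t * B y t ^ Suc n * f t) \<le> kap r x y * ?\<kappa> y t * (B x t ^ Suc (Suc n) * f t)"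
        proof (cases "y < t \<and> f t \<noteq> 0")
          case True
          then have "M j y \<le> B x t" "B y t \<le> B x t"
            using Suc.prems \<open>x < y\<close> anti by auto
          then have "M j y * B y t ^ Suc n \<le> B x t * B x t ^ Suc n"
            by (intro mult_mono power_mono) auto
          then have "(kap r x y * ?\<kappa> y t * f t) * (M j y * B y t ^ Suc n) \<le> (kap r x y * ?\<kappa> y t * f t) * (B x t * B x t ^ Suc n)"
            by (rule mult_left_mono) simp
          then show ?thesis by (simp add: mult_ac)
        qed (auto simp: kap_eq_0)
      qed
      finally show ?thesis .
    qed (simp add: kap_eq_0)
  qed
  also have "\<dots> = (\<integral>\<^sup>+ t. \<integral>\<^sup>+ y. kap r x y * ?\<kappa> y t * (B x t ^ Suc (Suc n) * f t) \<partial>lborel \<partial>lborel)"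
    by (rule lborel_pair.Fubini') measurable
  also have "\<dots> = (\<integral>\<^sup>+ t. kap (r * real (Suc (Suc n))) x t * B x t ^ Suc (Suc n) * f t \<partial>lborel)"
  proof (rule nn_integral_cong)
    fix t :: real
    have "(\<integral>\<^sup>+ y. kap r x y * ?\<kappa> y t * (B x t ^ Suc (Suc n) * f t) \<partial>lborel)
       = (\<integral>\<^sup>+ y. kap r x y * ?\<kappa> y t \<partial>lborel) * (B x t ^ Suc (Suc n) * f t)"
      by (rule nn_integral_multc) measurable
    also have "(\<integral>\<^sup>+ y. kap r x y * ?\<kappa> y t \<partial>lborel) = kap (r + r * real (Suc n)) x t"
      using r by (intro kap_comp) auto
    also have "r + r * real (Suc n) = r * real (Suc (Suc n))" by (simp add: algebra_simps)
    finally show "(\<integral>\<^sup>+ y. kap r x y * ?\<kappa> y t * (B x t ^ Suc (Suc n) * f t) \<partial>lborel)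
       = kap (r * real (Suc (Suc n))) x t * B x t ^ Suc (Suc n) * f t" by (simp only: mult.assoc)
  qed
  finally show ?case .
qed

text \<open>Confining the exit below h confines every site of the block, and there c is a lower
  bound for the factors.\<close>

lemma blk_lower:
  assumes r: "0 < r" and M [measurable]: "\<And>l. M l \<in> borel_measurable borel"
    and f [measurable]: "f \<in> borel_measurable borel"
    and bound: "\<And>i y. i \<in> {j..<j + Suc n} \<Longrightarrow> a \<le> y \<Longrightarrow> y \<le> h \<Longrightarrow> c \<le> M i y" and x: "a \<le> x"
  shows "(\<integral>\<^sup>+ t. kap (r * real (Suc n)) x t * (c ^ Suc n * (f t * indicator {..h} t)) \<partial>lborel) \<le> blk r M f (Suc n) j x"
  using bound x
proof (induction n arbitrary: j x)
  case 0
  have "kap r x y * (c * (f y * indicator {..h} y)) \<le> kap r x y * M j y * f y" for y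
  proof (cases "x < y \<and> y \<le> h")
    case True
    then have "c * f y \<le> M j y * f y" using "0.prems"(1)[of j y] "0.prems"(2) by (intro mult_right_mono) auto
    then have "kap r x y * (c * f y) \<le> kap r x y * (M j y * f y)" by (rule mult_left_mono) simp
    then show ?thesis using True by (simp add: mult.assoc)
  qed (auto simp: kap_eq_0)
  then show ?case by (auto intro!: nn_integral_mono)
next
  case (Suc n)
  let ?\<kappa> = "kap (r * real (Suc n))"
  let ?g = "\<lambda>t. f t * indicator {..h} t"
  have "(\<integral>\<^sup>+ t. kap (r * real (Suc (Suc n))) x t * (c ^ Suc (Suc n) * ?g t) \<partial>lborel)
     = (\<integral>\<^sup>+ t. \<integral>\<^sup>+ y. kap r x y * ?\<kappa> y t * (c ^ Suc (Suc n) * ?g t) \<partial>lborel \<partial>lborel)"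
  proof (rule nn_integral_cong)
    fix t :: real
    have "(\<integral>\<^sup>+ y. kap r x y * ?\<kappa> y t * (c ^ Suc (Suc n) * ?g t) \<partial>lborel)
       = (\<integral>\<^sup>+ y. kap r x y * ?\<kappa> y t \<partial>lborel) * (c ^ Suc (Suc n) * ?g t)"
      by (rule nn_integral_multc) measurable
    also have "(\<integral>\<^sup>+ y. kap r x y * ?\<kappa> y t \<partial>lborel) = kap (r + r * real (Suc n)) x t"
      using r by (intro kap_comp) auto
    also have "r + r * real (Suc n) = r * real (Suc (Suc n))" by (simp add: algebra_simps)
    finally show "kap (r * real (Suc (Suc n))) x t * (c ^ Suc (Suc n) * ?g t)
       = (\<integral>\<^sup>+ y. kap r x y * ?\<kappa> y t * (c ^ Suc (Suc n) * ?g t) \<partial>lborel)" ..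
  qed
  also have "\<dots> = (\<integral>\<^sup>+ y. \<integral>\<^sup>+ t. kap r x y * ?\<kappa> y t * (c ^ Suc (Suc n) * ?g t) \<partial>lborel \<partial>lborel)"
    by (rule lborel_pair.Fubini'[symmetric]) measurable
  also have "\<dots> \<le> (\<integral>\<^sup>+ y. kap r x y * M j y * blk r M f (Suc n) (Suc j) y \<partial>lborel)"
  proof (rule nn_integral_mono)
    fix y :: real
    show "(\<integral>\<^sup>+ t. kap r x y * ?\<kappa> y t * (c ^ Suc (Suc n) * ?g t) \<partial>lborel) \<le> kap r x y * M j y * blk r M f (Suc n) (Suc j) y"
    proof (cases "x < y")
      case True
      have "(\<integral>\<^sup>+ t. kap r x y * ?\<kappa> y t * (c ^ Suc (Suc n) * ?g t) \<partial>lborel)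
         \<le> (\<integral>\<^sup>+ t. kap r x y * M j y * (?\<kappa> y t * (c ^ Suc n * ?g t)) \<partial>lborel)"
      proof (rule nn_integral_mono)
        fix t :: real
        show "kap r x y * ?\<kappa> y t * (c ^ Suc (Suc n) * ?g t) \<le> kap r x y * M j y * (?\<kappa> y t * (c ^ Suc n * ?g t))"
        proof (cases "y < t \<and> t \<le> h")
          case True
          then have "c \<le> M j y" using Suc.prems \<open>x < y\<close> by auto
          then have "(kap r x y * ?\<kappa> y t * ?g t * c ^ Suc n) * c \<le> (kap r x y * ?\<kappa> y t * ?g t * c ^ Suc n) * M j y"
            by (rule mult_left_mono) simp
          then show ?thesis by (simp add: mult_ac)
        qed (auto simp: kap_eq_0)
      qed
      also have "\<dots> = kap r x y * M j y * (\<integral>\<^sup>+ t. ?\<kappa> y t * (c ^ Suc n * ?g t) \<partial>lborel)"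
        by (rule nn_integral_cmult) measurable
      also have "\<dots> \<le> kap r x y * M j y * blk r M f (Suc n) (Suc j) y"
        using Suc.prems True by (intro mult_left_mono Suc.IH) auto
      finally show ?thesis .
    qed (simp add: kap_eq_0)
  qed
  finally show ?case by simp
qed

lemma chain_upper:
  assumes r: "0 < r" and bound: "\<And>i y. i \<in> {j..<j + n} \<Longrightarrow> a \<le> y \<Longrightarrow> y < b \<Longrightarrow> M i y \<le> C" and x: "a \<le> x"
  shows "chain r b M n j x \<le> C ^ n * kap (r * real (Suc n)) x b"
  using bound x
proof (induction n arbitrary: j x)
  case (Suc n)
  have "chain r b M (Suc n) j x \<le> (\<integral>\<^sup>+ y. C ^ Suc n * (kap r x y * kap (r * real (Suc n)) y b) \<partial>lborel)"
    unfolding chain.simps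
  proof (rule nn_integral_mono)
    fix y :: real
    show "kap r x y * M j y * chain r b M n (Suc j) y \<le> C ^ Suc n * (kap r x y * kap (r * real (Suc n)) y b)"
    proof (cases "x < y \<and> y < b")
      case True
      then have "M j y * chain r b M n (Suc j) y \<le> C * (C ^ n * kap (r * real (Suc n)) y b)"
        using Suc.prems by (intro mult_mono Suc.IH) auto
      then have "kap r x y * (M j y * chain r b M n (Suc j) y) \<le> kap r x y * (C * (C ^ n * kap (r * real (Suc n)) y b))"
        by (rule mult_left_mono) simp
      then show ?thesis by (simp add: mult_ac)
    next
      case False
      then show ?thesis by (auto simp: kap_eq_0 chain_zero not_less)
    qed
  qed
  also have "\<dots> = C ^ Suc n * kap (r + r * real (Suc n)) x b"
    using r by (subst nn_integral_cmult) (auto simp: kap_comp)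
  also have "r + r * real (Suc n) = r * real (Suc (Suc n))" by (simp add: algebra_simps)
  finally show ?case .
qed simp

lemma chain_lower:
  assumes r: "0 < r" and bound: "\<And>i y. i \<in> {j..<j + n} \<Longrightarrow> a \<le> y \<Longrightarrow> y < b \<Longrightarrow> C \<le> M i y" and x: "a \<le> x"
  shows "C ^ n * kap (r * real (Suc n)) x b \<le> chain r b M n j x"
  using bound x
proof (induction n arbitrary: j x)
  case (Suc n)
  have "C ^ Suc n * kap (r * real (Suc (Suc n))) x b = C ^ Suc n * kap (r + r * real (Suc n)) x b"
    by (simp add: algebra_simps)
  also have "\<dots> = (\<integral>\<^sup>+ y. C ^ Suc n * (kap r x y * kap (r * real (Suc n)) y b) \<partial>lborel)"
    using r by (subst nn_integral_cmult) (auto simp: kap_comp)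
  also have "\<dots> \<le> chain r b M (Suc n) j x"
    unfolding chain.simps
  proof (rule nn_integral_mono)
    fix y :: real
    show "C ^ Suc n * (kap r x y * kap (r * real (Suc n)) y b) \<le> kap r x y * M j y * chain r b M n (Suc j) y"
    proof (cases "x < y \<and> y < b")
      case True
      then have "C * (C ^ n * kap (r * real (Suc n)) y b) \<le> M j y * chain r b M n (Suc j) y"
        using Suc.prems by (intro mult_mono Suc.IH) auto
      then have "kap r x y * (C * (C ^ n * kap (r * real (Suc n)) y b)) \<le> kap r x y * (M j y * chain r b M n (Suc j) y)"
        by (rule mult_left_mono) simp
      then show ?thesis by (simp add: mult_ac)
    qed (auto simp: kap_eq_0 not_less)
  qed
  finally show ?case .
qed simp

text \<open>The extracted p powers of the length can be estimated pointwise, while the remaining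
  kernel of index \<beta> > 0 stays integrable and can be composed again.\<close>

lemma kap_split:
  assumes "0 < r" "0 < \<beta>"
  shows "kap (\<beta> + r * real p) x y
     = ennreal (Gamma \<beta> / Gamma (\<beta> + r * real p)) * kap \<beta> x y * ennreal ((y - x) powr r) ^ p"
proof (cases "x < y")
  case True
  have b: "0 < \<beta> + r * real p" using assms by (simp add: add_pos_nonneg)
  have G: "0 < Gamma \<beta>" "0 < Gamma (\<beta> + r * real p)" using assms b by (auto intro: Gamma_real_pos)
  have "ennreal ((y - x) powr r) ^ p = ennreal ((y - x) powr (r * real p))"
    using True by (simp add: ennreal_power powr_realpow[symmetric] powr_powr del: powr_realpow)
  moreover have "kap \<beta> x y * ennreal ((y - x) powr (r * real p)) = ennreal (Gamma (\<beta> + r * real p) / Gamma \<beta>) * kap (\<beta> + r * real p) x y"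
    by (rule kap_mult_powr) (use assms b in auto)
  moreover have "ennreal (Gamma \<beta> / Gamma (\<beta> + r * real p)) * ennreal (Gamma (\<beta> + r * real p) / Gamma \<beta>) = 1"
    using G by (simp flip: ennreal_mult)
  ultimately show ?thesis by (metis mult.assoc mult.left_neutral)
qed (simp add: kap_eq_0)

text \<open>Each block yields the p-th power of length powr r times B. Along every chain of block
  ends their product is at most X, which gives X ^ p under the integral. What remains, a kernel of
  index r per block and one of index r (q + 2) in the last, composes; D bounds the surplus site
  factors, and q is the number of sites left over by the division into blocks.\<close>

lemma block_chain_upper:
  fixes F :: "nat \<Rightarrow> real \<Rightarrow> ennreal" and B :: "nat \<Rightarrow> real \<Rightarrow> real \<Rightarrow> ennreal"
  assumes r: "0 < r" and ab: "a < b"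
    and Fm [measurable]: "\<And>k. F k \<in> borel_measurable borel" and Bm [measurable]: "\<And>k x. B k x \<in> borel_measurable borel"
    and zero: "\<And>k t. b \<le> t \<Longrightarrow> F k t = 0"
    and step: "\<And>k x. k < m0 \<Longrightarrow> a \<le> x \<Longrightarrow> x < b \<Longrightarrow>
       F k x \<le> (\<integral>\<^sup>+ t. kap (r * real (Suc p)) x t * B k x t ^ Suc p * F (Suc k) t \<partial>lborel)"
    and last: "\<And>x. a \<le> x \<Longrightarrow> x < b \<Longrightarrow> F m0 x \<le> kap (r * real (p + q + 2)) x b * B m0 x b ^ (p + q + 1)"
    and BD: "\<And>k x t. a \<le> x \<Longrightarrow> x < t \<Longrightarrow> t \<le> b \<Longrightarrow> B k x t \<le> D"
    and chains: "\<And>t. t 0 = a \<Longrightarrow> (\<And>k. k \<le> m0 \<Longrightarrow> t k < t (Suc k)) \<Longrightarrow> t (Suc m0) = b \<Longrightarrow>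
       (\<Prod>k\<in>{0..m0}. ennreal ((t (Suc k) - t k) powr r) * B k (t k) (t (Suc k))) \<le> X"
  shows "F 0 a \<le> (ennreal (Gamma r / Gamma (r * real (Suc p))) * D) ^ m0 *
     (ennreal (Gamma (r * real (q + 2)) / Gamma (r * real (p + q + 2))) * D ^ (q + 1)) * X ^ p *
     kap (r * real m0 + r * real (q + 2)) a b"
proof -
  define W where "W k x t = ennreal ((t - x) powr r) * B k x t" for k x t
  define C1 where "C1 = ennreal (Gamma r / Gamma (r * real (Suc p))) * D"
  define C2 where "C2 = ennreal (Gamma (r * real (q + 2)) / Gamma (r * real (p + q + 2))) * D ^ (q + 1)"
  \<comment> \<open>c collects the factors of the blocks already passed, so that the hypothesis on
    complete chains can be applied when the last block is reached.\<close>
  have "c ^ p * F k x \<le> C1 ^ m * C2 * X ^ p * kap (r * real m + r * real (q + 2)) x b"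
    if "k + m = m0" "a \<le> x" "x < b"
      "\<And>t. t k = x \<Longrightarrow> (\<And>i. k \<le> i \<Longrightarrow> i \<le> m0 \<Longrightarrow> t i < t (Suc i)) \<Longrightarrow> t (Suc m0) = b \<Longrightarrow>
        c * (\<Prod>i\<in>{k..m0}. W i (t i) (t (Suc i))) \<le> X" for c k m x
    using that
  proof (induction m arbitrary: c k x)
    case 0
    then have k: "k = m0" by simp
    have cW: "c * W m0 x b \<le> X"
      using "0.prems"(4)[of "\<lambda>i. if i = m0 then x else b"] "0.prems"(3) k by simp
    have e: "kap (r * real (p + q + 2)) x b = ennreal (Gamma (r * real (q + 2)) / Gamma (r * real (p + q + 2))) * kap (r * real (q + 2)) x b * ennreal ((b - x) powr r) ^ p"
    proof -
      have "r * real (q + 2) + r * real p = r * real (p + q + 2)" by (simp add: algebra_simps)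
      moreover have "0 < r * real (q + 2)" using r by simp
      ultimately show ?thesis using kap_split[OF r, of "r * real (q + 2)" p x b] by simp
    qed
    have "c ^ p * F k x \<le> c ^ p * (kap (r * real (p + q + 2)) x b * B m0 x b ^ (p + q + 1))"
      unfolding k using "0.prems" by (intro mult_left_mono last) auto
    also have "\<dots> = ennreal (Gamma (r * real (q + 2)) / Gamma (r * real (p + q + 2))) * kap (r * real (q + 2)) x b *
        ((c * W m0 x b) ^ p * B m0 x b ^ (q + 1))"
      unfolding e W_def by (simp add: power_add power_mult_distrib mult_ac)
    also have "\<dots> \<le> ennreal (Gamma (r * real (q + 2)) / Gamma (r * real (p + q + 2))) * kap (r * real (q + 2)) x b *
        (X ^ p * D ^ (q + 1))"
      using cW BD[of x b m0] "0.prems" by (intro mult_left_mono mult_mono power_mono) auto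
    also have "\<dots> = C1 ^ 0 * C2 * X ^ p * kap (r * real 0 + r * real (q + 2)) x b"
      by (simp add: C2_def mult_ac)
    finally show ?case .
  next
    case (Suc m)
    then have k: "k < m0" by simp
    have e: "kap (r * real (Suc p)) x t = ennreal (Gamma r / Gamma (r * real (Suc p))) * kap r x t * ennreal ((t - x) powr r) ^ p" for t
    proof -
      have "r + r * real p = r * real (Suc p)" by (simp add: algebra_simps)
      then show ?thesis using kap_split[OF r r, of p x t] by simp
    qed
    have "c ^ p * F k x \<le> c ^ p * (\<integral>\<^sup>+ t. kap (r * real (Suc p)) x t * B k x t ^ Suc p * F (Suc k) t \<partial>lborel)"
      using Suc.prems k by (intro mult_left_mono step) auto
    also have "\<dots> = (\<integral>\<^sup>+ t. c ^ p * (kap (r * real (Suc p)) x t * B k x t ^ Suc p * F (Suc k) t) \<partial>lborel)"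
      by (rule nn_integral_cmult[symmetric]) measurable
    also have "\<dots> \<le> (\<integral>\<^sup>+ t. (C1 * (C1 ^ m * C2 * X ^ p)) * (kap r x t * kap (r * real m + r * real (q + 2)) t b) \<partial>lborel)"
    proof (rule nn_integral_mono)
      fix t :: real
      show "c ^ p * (kap (r * real (Suc p)) x t * B k x t ^ Suc p * F (Suc k) t)
         \<le> (C1 * (C1 ^ m * C2 * X ^ p)) * (kap r x t * kap (r * real m + r * real (q + 2)) t b)"
      proof (cases "x < t \<and> t < b")
        case True
        have IH: "(c * W k x t) ^ p * F (Suc k) t \<le> C1 ^ m * C2 * X ^ p * kap (r * real m + r * real (q + 2)) t b"
        proof (rule Suc.IH)
          show "Suc k + m = m0" "a \<le> t" "t < b" using Suc.prems True by auto
          \<comment> \<open>A chain from t is prolonged to the left by x, which moves the factor of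
            block k into c.\<close>
          fix u assume u: "u (Suc k) = t" "\<And>i. Suc k \<le> i \<Longrightarrow> i \<le> m0 \<Longrightarrow> u i < u (Suc i)" "u (Suc m0) = b"
          have "c * (\<Prod>i\<in>{k..m0}. W i ((u(k := x)) i) ((u(k := x)) (Suc i))) \<le> X"
            by (rule Suc.prems(4)) (use u True k in auto)
          moreover have "{k..m0} = insert k {Suc k..m0}" using k by auto
          moreover have "(\<Prod>i\<in>{Suc k..m0}. W i ((u(k := x)) i) ((u(k := x)) (Suc i))) = (\<Prod>i\<in>{Suc k..m0}. W i (u i) (u (Suc i)))"
            by (intro prod.cong) auto
          ultimately show "c * W k x t * (\<Prod>i\<in>{Suc k..m0}. W i (u i) (u (Suc i))) \<le> X"
            using u(1) by (simp add: mult.assoc)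
        qed
        have "c ^ p * (kap (r * real (Suc p)) x t * B k x t ^ Suc p * F (Suc k) t)
           = ennreal (Gamma r / Gamma (r * real (Suc p))) * kap r x t * B k x t * ((c * W k x t) ^ p * F (Suc k) t)"
          unfolding e W_def by (simp add: power_mult_distrib mult_ac)
        also have "\<dots> \<le> ennreal (Gamma r / Gamma (r * real (Suc p))) * kap r x t * D * (C1 ^ m * C2 * X ^ p * kap (r * real m + r * real (q + 2)) t b)"
          using BD[of x t k] Suc.prems True by (intro mult_mono IH) auto
        also have "\<dots> = (C1 * (C1 ^ m * C2 * X ^ p)) * (kap r x t * kap (r * real m + r * real (q + 2)) t b)"
          by (simp add: C1_def mult_ac)
        finally show ?thesis .
      next
        case False
        then show ?thesis by (auto simp: kap_eq_0 zero not_less)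
      qed
    qed
    also have "\<dots> = C1 ^ Suc m * C2 * X ^ p * (\<integral>\<^sup>+ t. kap r x t * kap (r * real m + r * real (q + 2)) t b \<partial>lborel)"
      by (subst nn_integral_cmult) (auto simp: mult_ac)
    also have "(\<integral>\<^sup>+ t. kap r x t * kap (r * real m + r * real (q + 2)) t b \<partial>lborel) = kap (r + (r * real m + r * real (q + 2))) x b"
      using r by (intro kap_comp) (auto intro: add_nonneg_pos)
    also have "r + (r * real m + r * real (q + 2)) = r * real (Suc m) + r * real (q + 2)" by (simp add: algebra_simps)
    finally show ?case .
  qed
  from this[of 0 m0 a 1] ab chains show ?thesis
    by (simp add: C1_def C2_def W_def)
qed

text \<open>The factor \<open>(b - y) powr (- r)\<close> lowers the index of the kernel by \<open>r\<close>, which convolution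
  with \<open>kap r\<close> restores: the kernel is an eigenfunction.\<close>

lemma blk_critical:
  assumes r: "0 < r" "r < \<beta>" and b: "0 < b"
    and M: "\<And>i y. i \<in> {j..<j + n} \<Longrightarrow> a \<le> y \<Longrightarrow> y < b \<Longrightarrow> M i y \<le> ennreal (b powr r * (b - y) powr (- r))"
    and f: "\<And>t. a \<le> t \<Longrightarrow> f t \<le> c * kap \<beta> t b" and x: "a \<le> x"
  shows "blk r M f n j x \<le> c * ennreal (b powr r * (Gamma (\<beta> - r) / Gamma \<beta>)) ^ n * kap \<beta> x b"
  using M x
proof (induction n arbitrary: j x)
  case 0
  then show ?case using f by simp
next
  case (Suc n)
  define E where "E = ennreal (b powr r * (Gamma (\<beta> - r) / Gamma \<beta>))"
  have G: "0 < Gamma (\<beta> - r)" "0 < Gamma \<beta>" using r by (auto intro!: Gamma_real_pos)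
  have "blk r M f (Suc n) j x \<le> (\<integral>\<^sup>+ y. c * E ^ Suc n * (kap r x y * kap (\<beta> - r) y b) \<partial>lborel)"
    unfolding blk.simps
  proof (rule nn_integral_mono)
    fix y :: real
    show "kap r x y * M j y * blk r M f n (Suc j) y \<le> c * E ^ Suc n * (kap r x y * kap (\<beta> - r) y b)"
    proof (cases "x < y")
      case True
      have IH: "blk r M f n (Suc j) y \<le> c * E ^ n * kap \<beta> y b"
        unfolding E_def using Suc.prems True by (intro Suc.IH) auto
      show ?thesis
      proof (cases "y < b")
        case yb: True
        have k: "ennreal (b powr r * (b - y) powr (- r)) * kap \<beta> y b = E * kap (\<beta> - r) y b"
        proof -
          have "kap \<beta> y b * ennreal ((b - y) powr (- r)) = ennreal (Gamma (\<beta> - r) / Gamma \<beta>) * kap (\<beta> - r) y b"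
            using kap_mult_powr[of \<beta> "- r" y b] r by simp
          then show ?thesis using G by (simp add: E_def ennreal_mult mult_ac flip: times_divide_eq_right)
        qed
        have "M j y * blk r M f n (Suc j) y \<le> ennreal (b powr r * (b - y) powr (- r)) * (c * E ^ n * kap \<beta> y b)"
          using Suc.prems True yb by (intro mult_mono IH) auto
        also have "\<dots> = c * E ^ n * (ennreal (b powr r * (b - y) powr (- r)) * kap \<beta> y b)" by (simp only: mult_ac)
        also have "\<dots> = c * E ^ Suc n * kap (\<beta> - r) y b" unfolding k by (simp add: mult_ac)
        finally have "kap r x y * (M j y * blk r M f n (Suc j) y) \<le> kap r x y * (c * E ^ Suc n * kap (\<beta> - r) y b)"
          by (rule mult_left_mono) simp
        then show ?thesis by (simp only: mult_ac)
      next
        case False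
        then have "blk r M f n (Suc j) y = 0" using IH by (simp add: kap_eq_0)
        then show ?thesis by simp
      qed
    qed (simp add: kap_eq_0)
  qed
  also have "\<dots> = c * E ^ Suc n * (\<integral>\<^sup>+ y. kap r x y * kap (\<beta> - r) y b \<partial>lborel)"
    by (rule nn_integral_cmult) measurable
  also have "(\<integral>\<^sup>+ y. kap r x y * kap (\<beta> - r) y b \<partial>lborel) = kap \<beta> x b"
    using kap_comp[of r "\<beta> - r" x b] r by simp
  finally show ?case by (simp only: E_def)
qed

section \<open>Discretisation errors and exponential bounds over blocks of sites\<close>

definition level :: "(real \<Rightarrow> real) \<Rightarrow> real \<Rightarrow> real \<Rightarrow> real" where
  "level h x \<theta> = 1 + (1 - exp (h x)) * \<theta>"

lemma site_mgf_level:
  "site_mgf r (h x) \<theta> = (if 0 < level h x \<theta> then ennreal (level h x \<theta> powr (- r)) else \<infinity>)"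
  by (simp add: site_mgf_def level_def)

lemma ln_diff_le:
  assumes "0 < c" "c \<le> x" "c \<le> (y::real)"
  shows "\<bar>ln x - ln y\<bar> \<le> \<bar>x - y\<bar> / c"
proof -
  have *: "ln u - ln v \<le> \<bar>u - v\<bar> / c" if "c \<le> u" "c \<le> v" for u v :: real
  proof -
    have "ln u - ln v = ln (u / v)" using that assms(1) by (simp add: ln_div)
    also have "\<dots> \<le> u / v - 1" using that assms(1) by (intro ln_le_minus_one) auto
    also have "\<dots> = (u - v) / v" using that assms(1) by (simp add: field_simps)
    also have "\<dots> \<le> \<bar>u - v\<bar> / v" using that assms(1) by (intro divide_right_mono) auto
    also have "\<dots> \<le> \<bar>u - v\<bar> / c" using that assms(1) by (intro divide_left_mono) auto
    finally show ?thesis .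
  qed
  show ?thesis
    unfolding abs_le_iff[of "ln x - ln y"]
    using *[OF assms(2,3)] *[OF assms(3,2)] abs_minus_commute[of x y] by auto
qed

text \<open>Block k starts after k (N div K) sites and the last block takes the remainder. The
  neglected remainders displace i / N by at most K K / (N K), which K K \<le> N keeps within 1 /
  K.\<close>

lemma block_index:
  fixes N K k i :: nat
  assumes K: "0 < K" "K * K \<le> N" and k: "k < K"
    and i: "Suc (k * (N div K)) \<le> i" "i \<le> (k + 1) * (N div K) \<or> k = K - 1 \<and> i \<le> N"
  shows "\<bar>real i / real N - real k / real K\<bar> \<le> 1 / real K" "1 \<le> i" "i \<le> N"
proof -
  define d q where "d = N div K" and "q = N mod K"
  have N: "N = K * d + q" "q < K" using K by (auto simp: d_def q_def)
  have le: "(k + 1) * d \<le> N"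
  proof -
    have "(k + 1) * d \<le> K * d" using k by (intro mult_right_mono) auto
    then show ?thesis using N by simp
  qed
  show "1 \<le> i" "i \<le> N" using i le by (auto simp: d_def)
  have N0: "0 < N" using K by (metis less_le_trans nat_0_less_mult_iff)
  have lo: "k * N \<le> i * K + N"
  proof -
    have "k * N = k * d * K + k * q" using N by (simp add: algebra_simps)
    also have "k * d * K \<le> i * K" using i(1) by (intro mult_right_mono) (auto simp: d_def)
    also have "k * q \<le> K * K" using k N by (intro mult_mono) auto
    finally show ?thesis using K by simp
  qed
  have hi: "i * K \<le> k * N + N"
  proof (cases "i \<le> (k + 1) * d")
    case True
    then have "i * K \<le> (k + 1) * d * K" by (rule mult_right_mono) simp
    also have "\<dots> = (k + 1) * (K * d)" by (simp only: mult_ac)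
    also have "\<dots> \<le> (k + 1) * N" using N by (intro mult_left_mono) auto
    finally show ?thesis by simp
  next
    case False
    then have "k = K - 1" "i \<le> N" using i(2) by (auto simp: d_def)
    then have "i * K \<le> N * (k + 1)" using k by (intro mult_mono) auto
    then show ?thesis by (simp add: algebra_simps)
  qed
  have "real k * real N \<le> real i * real K + real N" "real i * real K \<le> real k * real N + real N"
    using lo hi by (metis of_nat_add of_nat_le_iff of_nat_mult)+
  then have 1: "\<bar>real i * real K - real k * real N\<bar> \<le> real N" by linarith
  have "real i / real N - real k / real K = (real i * real K - real k * real N) / (real N * real K)"
    using N0 K by (simp add: field_simps)
  then have "\<bar>real i / real N - real k / real K\<bar> = \<bar>real i * real K - real k * real N\<bar> / (real N * real K)"
    by (simp add: abs_divide)
  also have "\<dots> \<le> real N / (real N * real K)" using 1 by (intro divide_right_mono) auto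
  also have "\<dots> = 1 / real K" using N0 by simp
  finally show "\<bar>real i / real N - real k / real K\<bar> \<le> 1 / real K" .
qed

lemma mod_bounded_div_tendsto:
  fixes g :: "nat \<Rightarrow> real"
  assumes "0 < K"
  shows "(\<lambda>N. g (N mod K) / real N) \<longlonglongrightarrow> 0"
proof (rule Lim_null_comparison)
  define G where "G = (\<Sum>q<K. \<bar>g q\<bar>)"
  show "(\<lambda>N. G / real N) \<longlonglongrightarrow> 0" by real_asymp
  show "\<forall>\<^sub>F N in sequentially. norm (g (N mod K) / real N) \<le> G / real N"
  proof (rule always_eventually, rule allI)
    fix N
    have "\<bar>g (N mod K)\<bar> \<le> G"
      unfolding G_def using assms by (intro member_le_sum[of "N mod K" _ "\<lambda>q. \<bar>g q\<bar>"]) auto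
    then show "norm (g (N mod K) / real N) \<le> G / real N" by (simp add: abs_divide divide_right_mono)
  qed
qed

text \<open>A bound for one site factor in block k with entry x and exit t: the factor at the exit
  times the error of \<open>level_compare\<close>. The value 0 beyond the cutoff removes the chains
  that leave the admissible region.\<close>

definition step_bound :: "real \<Rightarrow> (real \<Rightarrow> real) \<Rightarrow> nat \<Rightarrow> real \<Rightarrow> real \<Rightarrow> (nat \<Rightarrow> real) \<Rightarrow> nat \<Rightarrow> real \<Rightarrow> real \<Rightarrow> real" where
  "step_bound r h K w C cutoff k x t =
     (if t \<le> cutoff k then exp (r * (w + C * (t - x))) * level h (real k / real K) t powr (- r) else 0)"

lemma blk_blk: "blk r M f (n + m) j x = blk r M (blk r M f m (j + n)) n j x"
  by (induction n arbitrary: j x) simp_all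

text \<open>Two errors: the position inside the block costs w, and the change of density costs C
  times its increment. Increments telescope over the blocks, so the second error contributes C (b -
  a) / K in the mean.\<close>

lemma level_compare:
  assumes r: "0 < r" and c0: "0 < c0" and b: "0 \<le> y" "y \<le> t" "t \<le> b"
    and A: "c0 \<le> level h x y" "c0 \<le> level h z t"
    and v: "\<bar>exp (h x) - exp (h z)\<bar> * b \<le> w * c0" and V: "\<bar>1 - exp (h x)\<bar> \<le> C * c0"
  shows "\<bar>ln (level h x y) - ln (level h z t)\<bar> \<le> w + C * (t - y)"
proof -
  have "level h x y - level h z t = (exp (h z) - exp (h x)) * t + (1 - exp (h x)) * (y - t)"
    by (simp add: level_def algebra_simps)
  moreover have "\<bar>(exp (h z) - exp (h x)) * t\<bar> \<le> \<bar>exp (h x) - exp (h z)\<bar> * b"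
    using b unfolding abs_mult by (intro mult_mono) auto
  moreover have "\<bar>(1 - exp (h x)) * (y - t)\<bar> = \<bar>1 - exp (h x)\<bar> * (t - y)"
    using b unfolding abs_mult by simp
  moreover have "\<bar>1 - exp (h x)\<bar> * (t - y) \<le> C * c0 * (t - y)"
    using V b by (intro mult_right_mono) auto
  ultimately have "\<bar>level h x y - level h z t\<bar> \<le> w * c0 + C * c0 * (t - y)"
    using v by linarith
  then have "\<bar>level h x y - level h z t\<bar> / c0 \<le> (w * c0 + C * c0 * (t - y)) / c0"
    using c0 by (intro divide_right_mono) auto
  also have "\<dots> = w + C * (t - y)" using c0 by (simp add: field_simps)
  finally show ?thesis using ln_diff_le[OF c0 A] by linarith
qed

text \<open>\<open>block_chain_upper\<close> gives X to a power close to N / K, and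
  \<open>Gamma_block_limit\<close> compares with the normalising kernel. The indicator after
  \<kappa> blocks keeps the path below b - \<eta> in these blocks; in the later ones the levels are
  bounded below up to b.\<close>

lemma upper_main:
  fixes h :: "real \<Rightarrow> real"
  assumes r: "0 < r" and a: "0 \<le> a" "a < b" and \<eta>: "0 < \<eta>" and c0: "0 < c0" and C: "0 \<le> C" and w: "0 \<le> w"
    and K: "0 < \<kappa>" "\<kappa> < K"
    and cutoff: "cutoff = (\<lambda>k. if k < \<kappa> then b - \<eta> else b)"
    and A: "\<And>k x \<theta>. k < K \<Longrightarrow> x \<in> {0..1} \<Longrightarrow> \<bar>x - real k / real K\<bar> \<le> 1 / real K \<Longrightarrow> a \<le> \<theta> \<Longrightarrow> \<theta> \<le> cutoff k \<Longrightarrow> c0 \<le> level h x \<theta>"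
    and v: "\<And>k x. k < K \<Longrightarrow> x \<in> {0..1} \<Longrightarrow> \<bar>x - real k / real K\<bar> \<le> 1 / real K \<Longrightarrow>
        \<bar>exp (h x) - exp (h (real k / real K))\<bar> * b \<le> w * c0"
    and V: "\<And>x. x \<in> {0..1} \<Longrightarrow> \<bar>1 - exp (h x)\<bar> \<le> C * c0"
    and X: "0 < X"
    and chains: "\<And>t. t 0 = a \<Longrightarrow> (\<And>k. k < K \<Longrightarrow> t k < t (Suc k)) \<Longrightarrow> t K = b \<Longrightarrow>
       (\<Prod>k\<in>{0..<K}. (t (Suc k) - t k) powr r * step_bound r h K w C cutoff k (t k) (t (Suc k))) \<le> X"
    and e: "0 < e"
  shows "\<forall>\<^sub>F N in sequentially.
     blk r (\<lambda>i. site_mgf r (h (real i / real N)))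
       (\<lambda>t. chain r b (\<lambda>i. site_mgf r (h (real i / real N))) (N - \<kappa> * (N div K)) (Suc (\<kappa> * (N div K))) t * indicator {..b - \<eta>} t)
       (\<kappa> * (N div K)) 1 a
     \<le> kap (r * real (Suc N)) a b * ennreal (exp (real N * (ln X / real K + r * ln (real K) - r * ln (b - a) + e)))"
proof -
  define m0 where "m0 = K - 1"
  have Km: "K = Suc m0" using K by (simp add: m0_def)
  define D where "D = exp (r * (w + C * (b - a))) * c0 powr (- r)"
  have D: "0 < D" using c0 by (simp add: D_def)
  define B where "B k x t = ennreal (step_bound r h K w C cutoff k x t)" for k x t
  have Bm [measurable]: "B k x \<in> borel_measurable borel" for k x
    unfolding B_def step_bound_def level_def by measurable
  have cutoff_le: "cutoff k \<le> b" for k using \<eta> by (simp add: cutoff)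
  have kK: "real k / real K \<in> {0..1}" if "k < K" for k using that by auto
  have sb0: "0 \<le> step_bound r h K w C cutoff k x t" for k x t by (simp add: step_bound_def)
  have BD: "B k x t \<le> ennreal D" if "k < K" "a \<le> x" "x < t" for k x t
  proof -
    have "step_bound r h K w C cutoff k x t \<le> D"
    proof (cases "t \<le> cutoff k")
      case True
      have "c0 \<le> level h (real k / real K) t" using A[OF that(1) kK[OF that(1)], of t] that True by simp
      then have "level h (real k / real K) t powr (- r) \<le> c0 powr (- r)"
        using r c0 by (intro powr_mono2') auto
      moreover have "exp (r * (w + C * (t - x))) \<le> exp (r * (w + C * (b - a)))"
        using r C that True cutoff_le[of k] by (auto intro!: mult_left_mono)
      ultimately show ?thesis unfolding step_bound_def D_def using True by (auto intro!: mult_mono)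
    qed (use D in \<open>simp add: step_bound_def\<close>)
    then show ?thesis by (simp add: B_def ennreal_leI)
  qed
  define nb where "nb N = N div K" for N
  define M where "M N i = site_mgf r (h (real i / real N))" for N i :: nat
  have Mm [measurable]: "M N i \<in> borel_measurable borel" for N i unfolding M_def by measurable
  \<comment> \<open>The integral over all sites from block k on, as a function of the preceding
    density; for k \<le> \<kappa> the indicator is still ahead.\<close>
  define F where "F N k = (if k \<le> \<kappa> then blk r (M N)
       (\<lambda>t. chain r b (M N) (N - \<kappa> * nb N) (Suc (\<kappa> * nb N)) t * indicator {..b - \<eta>} t) ((\<kappa> - k) * nb N) (Suc (k * nb N))
     else chain r b (M N) (N - k * nb N) (Suc (k * nb N)))" for N k
  have chm [measurable]: "chain r b (M N) n j \<in> borel_measurable borel" for N n j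
    by (rule chain_measurable) measurable
  have Fm [measurable]: "F N k \<in> borel_measurable borel" for N k
    unfolding F_def by (cases "k \<le> \<kappa>") (auto intro!: blk_measurable)
  have Fchain: "F N k x \<le> chain r b (M N) (N - k * nb N) (Suc (k * nb N)) x" if "\<kappa> \<le> k" for N k x
    using that by (auto simp: F_def indicator_def)
  have Fzero: "F N k t = 0" if "b \<le> t" for N k t
    unfolding F_def using that by (auto intro!: blk_zero simp: chain_zero)
  have Fzero2: "F N k t = 0" if "k \<le> \<kappa>" "b - \<eta> < t" for N k t
    unfolding F_def using that by (auto intro!: blk_zero)
  have Mbound: "M N i y \<le> B k x t"
    if N: "K * K \<le> N" and k: "k < K" and i: "Suc (k * nb N) \<le> i" "i \<le> (k + 1) * nb N \<or> k = K - 1 \<and> i \<le> N"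
      and xy: "a \<le> x" "x \<le> y" "y \<le> t" "t \<le> cutoff k" for N k i x y t
  proof -
    note ind = block_index[of K N k i] 
    have i1: "\<bar>real i / real N - real k / real K\<bar> \<le> 1 / real K" "1 \<le> i" "i \<le> N"
      using ind K N k i by (auto simp: nb_def)
    have u: "real i / real N \<in> {0..1}" using i1 by auto
    have A1: "c0 \<le> level h (real i / real N) y" using A[OF k u i1(1), of y] xy by simp
    have A2: "c0 \<le> level h (real k / real K) t" using A[OF k kK[OF k], of t] xy by simp
    have "\<bar>ln (level h (real i / real N) y) - ln (level h (real k / real K) t)\<bar> \<le> w + C * (t - y)"
      by (rule level_compare[OF r c0 _ _ _ A1 A2 v[OF k u i1(1)] V[OF u]]) (use xy a cutoff_le[of k] in auto)
    also have "\<dots> \<le> w + C * (t - x)" using xy C by (auto intro!: mult_left_mono)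
    finally have l: "- ln (level h (real i / real N) y) \<le> w + C * (t - x) - ln (level h (real k / real K) t)" by simp
    have "level h (real i / real N) y powr (- r) = exp (r * (- ln (level h (real i / real N) y)))"
      using A1 c0 by (simp add: powr_def)
    also have "\<dots> \<le> exp (r * (w + C * (t - x) - ln (level h (real k / real K) t)))"
      using l r by (intro exp_le_cancel_iff[THEN iffD2] mult_left_mono) auto
    also have "\<dots> = exp (r * (w + C * (t - x))) * level h (real k / real K) t powr (- r)"
      using A2 c0 by (simp add: powr_def algebra_simps flip: exp_add)
    finally show ?thesis
      using A1 c0 xy by (simp add: M_def site_mgf_level B_def step_bound_def ennreal_leI)
  qed
  have Banti: "B k y t \<le> B k x t" if "x \<le> y" for k x y t
    unfolding B_def step_bound_def using that r C by (auto intro!: ennreal_leI mult_right_mono mult_left_mono)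
  have Fstep: "F N k x \<le> (\<integral>\<^sup>+ t. kap (r * real (Suc p)) x t * B k x t ^ Suc p * F N (Suc k) t \<partial>lborel)"
    if N: "K * K \<le> N" and p: "nb N = Suc p" and k: "k < m0" and x: "a \<le> x" for N k x p
  proof -
    have kK': "k < K" using k Km by simp
    have le: "Suc k * nb N \<le> N"
    proof -
      have "Suc k * nb N \<le> K * nb N" using k Km by (intro mult_right_mono) auto
      also have "\<dots> \<le> N" by (simp add: nb_def)
      finally show ?thesis .
    qed
    have "F N k x \<le> blk r (M N) (F N (Suc k)) (Suc p) (Suc (k * nb N)) x"
    proof (cases "k < \<kappa>")
      case True
      have "(\<kappa> - k) * nb N = Suc p + (\<kappa> - Suc k) * nb N"
        using True p by (metis Suc_diff_Suc add.commute mult_Suc)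
      moreover have "Suc (k * nb N) + Suc p = Suc (Suc k * nb N)" using p by simp
      ultimately show ?thesis
        using True unfolding F_def by (simp only: blk_blk if_True less_imp_le Suc_leI order_refl)
    next
      case False
      have "F N k x \<le> chain r b (M N) (N - k * nb N) (Suc (k * nb N)) x" using Fchain False by simp
      also have "N - k * nb N = Suc p + (N - Suc k * nb N)" using le p by simp
      also have "chain r b (M N) (Suc p + (N - Suc k * nb N)) (Suc (k * nb N)) x = blk r (M N) (F N (Suc k)) (Suc p) (Suc (k * nb N)) x"
      proof -
        have "Suc (k * nb N) + Suc p = Suc (Suc k * nb N)" using p by simp
        moreover have "\<not> Suc k \<le> \<kappa>" using False by simp
        ultimately show ?thesis unfolding chain_blk F_def by (simp only: if_False)
      qed
      finally show ?thesis .
    qed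
    also have "\<dots> \<le> (\<integral>\<^sup>+ t. kap (r * real (Suc p)) x t * B k x t ^ Suc p * F N (Suc k) t \<partial>lborel)"
    proof (rule blk_upper[where a = a, OF r Mm Fm Bm _ Banti x])
      fix i x y t assume *: "i \<in> {Suc (k * nb N)..<Suc (k * nb N) + Suc p}" "a \<le> x" "x \<le> y" "y \<le> t" "F N (Suc k) t \<noteq> 0"
      have "t < b" using Fzero[of t N "Suc k"] *(5) by (meson not_le)
      moreover have "k < \<kappa> \<Longrightarrow> t \<le> b - \<eta>" using Fzero2[of "Suc k" t N] *(5) by (meson Suc_leI not_le)
      ultimately have "t \<le> cutoff k" by (simp add: cutoff)
      then show "M N i y \<le> B k x t"
        using * by (intro Mbound[OF N kK']) (auto simp: p)
    qed
    finally show ?thesis .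
  qed
  have Flast: "F N m0 x \<le> kap (r * real (p + N mod K + 2)) x b * B m0 x b ^ (p + N mod K + 1)"
    if N: "K * K \<le> N" and p: "nb N = Suc p" and x: "a \<le> x" for N x p
  proof -
    have \<kappa>m: "\<kappa> \<le> m0" using K Km by simp
    have "N = K * nb N + N mod K" by (simp add: nb_def)
    then have nl: "N - m0 * nb N = p + N mod K + 1" using Km p by simp
    have le: "m0 * nb N + (p + N mod K + 1) = N" using nl \<open>N = K * nb N + N mod K\<close> Km by simp
    have "F N m0 x \<le> chain r b (M N) (p + N mod K + 1) (Suc (m0 * nb N)) x"
      using Fchain[OF \<kappa>m, of N x] nl by simp
    also have "\<dots> \<le> B m0 x b ^ (p + N mod K + 1) * kap (r * real (Suc (p + N mod K + 1))) x b"
    proof (rule chain_upper[OF r _ order_refl])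
      fix i y assume "i \<in> {Suc (m0 * nb N)..<Suc (m0 * nb N) + (p + N mod K + 1)}" "x \<le> y" "y < b"
      then show "M N i y \<le> B m0 x b"
        using le Km x \<kappa>m by (intro Mbound[OF N]) (auto simp: cutoff)
    qed
    finally show ?thesis by (simp add: mult.commute)
  qed
  have Fbound: "F N 0 a \<le> (ennreal (Gamma r / Gamma (r * real (Suc p))) * ennreal D) ^ m0 *
     (ennreal (Gamma (r * real (N mod K + 2)) / Gamma (r * real (p + N mod K + 2))) * ennreal D ^ (N mod K + 1)) * ennreal X ^ p *
     kap (r * real m0 + r * real (N mod K + 2)) a b"
    if N: "K * K \<le> N" and p: "nb N = Suc p" for N p
  proof -
    \<comment> \<open>\<open>block_chain_upper\<close> asks for the bound D at every index k, so B
      is continued by 0 beyond the last block.\<close>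
    define B' where "B' k x t = (if k < K then B k x t else 0)" for k x t
    have B'm: "B' k x \<in> borel_measurable borel" for k x unfolding B'_def by simp
    show ?thesis
    proof (rule block_chain_upper[where F = "F N" and B = B', OF r a(2) Fm B'm Fzero])
      fix k x assume k: "k < m0" and "a \<le> x" "x < b"
      then show "F N k x \<le> (\<integral>\<^sup>+ t. kap (r * real (Suc p)) x t * B' k x t ^ Suc p * F N (Suc k) t \<partial>lborel)"
        using Fstep[OF N p k] Km by (simp add: B'_def)
    next
      fix x assume "a \<le> x" "x < b"
      then show "F N m0 x \<le> kap (r * real (p + N mod K + 2)) x b * B' m0 x b ^ (p + N mod K + 1)"
        using Flast[OF N p] Km by (simp add: B'_def)
    next
      fix k x t assume "a \<le> x" "x < t" "t \<le> b"
      then show "B' k x t \<le> ennreal D" using BD by (simp add: B'_def)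
    next
      fix t :: "nat \<Rightarrow> real" assume t: "t 0 = a" "\<And>k. k \<le> m0 \<Longrightarrow> t k < t (Suc k)" "t (Suc m0) = b"
      have "(\<Prod>k\<in>{0..m0}. ennreal ((t (Suc k) - t k) powr r) * B' k (t k) (t (Suc k)))
         = (\<Prod>k\<in>{0..<K}. ennreal ((t (Suc k) - t k) powr r * step_bound r h K w C cutoff k (t k) (t (Suc k))))"
      proof (rule prod.cong)
        show "{0..m0} = {0..<K}" using Km by auto
        fix k assume "k \<in> {0..<K}"
        then have "B' k (t k) (t (Suc k)) = ennreal (step_bound r h K w C cutoff k (t k) (t (Suc k)))"
          by (simp add: B'_def B_def)
        then show "ennreal ((t (Suc k) - t k) powr r) * B' k (t k) (t (Suc k))
          = ennreal ((t (Suc k) - t k) powr r * step_bound r h K w C cutoff k (t k) (t (Suc k)))"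
          by (simp only: ennreal_mult[OF powr_ge_zero sb0])
      qed
      also have "\<dots> = ennreal (\<Prod>k\<in>{0..<K}. (t (Suc k) - t k) powr r * step_bound r h K w C cutoff k (t k) (t (Suc k)))"
        by (rule prod_ennreal) (auto intro!: mult_nonneg_nonneg sb0)
      also have "\<dots> \<le> ennreal X"
        by (intro ennreal_leI chains) (use t Km in auto)
      finally show "(\<Prod>k\<in>{0..m0}. ennreal ((t (Suc k) - t k) powr r) * B' k (t k) (t (Suc k))) \<le> ennreal X" .
    qed
  qed
  \<comment> \<open>Everything in the exponent that depends on N only through N mod K; it disappears
    after division by N.\<close>
  define g where "g q = real m0 * (ln_Gamma r + ln D) + ln_Gamma (r * real (q + 2)) + real (q + 1) * ln D - ln X
     + (r * real m0 + r * real (q + 2)) * ln (b - a) - ln_Gamma (r * real m0 + r * real (q + 2)) - r * ln (b - a)" for q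
  define E where "E N = (ln_Gamma (r * real (Suc N)) - real m0 * ln_Gamma (r * real (nb N))
       - ln_Gamma (r * real (N - m0 * nb N + 1))) / real N + g (N mod K) / real N
       + real (nb N) / real N * ln X - r * ln (b - a)" for N
  have Elim: "E \<longlonglongrightarrow> r * ln (real K) + 0 + 1 / real K * ln X - r * ln (b - a)"
    unfolding E_def[abs_def] nb_def m0_def using K
    by (intro tendsto_intros Gamma_block_limit[OF r] mod_bounded_div_tendsto tendsto_div_const) auto
  have ev: "\<forall>\<^sub>F N in sequentially. E N < ln X / real K + r * ln (real K) - r * ln (b - a) + e"
    by (rule order_tendstoD(2)[OF Elim]) (use e in simp)
  show ?thesis
    using ev eventually_ge_at_top[of "K * K"] eventually_gt_at_top[of 0]
  proof eventually_elim
    case (elim N)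
    have nb0: "0 < nb N"
    proof -
      have "K \<le> N" using elim(2) K by (metis le_square le_trans)
      then show ?thesis using K by (simp add: nb_def div_greater_zero_iff)
    qed
    then obtain p where p: "nb N = Suc p" by (cases "nb N") auto
    define q where "q = N mod K"
    have "N = K * nb N + N mod K" by (simp add: nb_def)
    then have nl: "N - m0 * nb N + 1 = p + q + 2" using Km p by (simp add: q_def)
    have F0: "F N 0 a = blk r (\<lambda>i. site_mgf r (h (real i / real N)))
       (\<lambda>t. chain r b (\<lambda>i. site_mgf r (h (real i / real N))) (N - \<kappa> * (N div K)) (Suc (\<kappa> * (N div K))) t * indicator {..b - \<eta>} t)
       (\<kappa> * (N div K)) 1 a"
      by (simp add: F_def nb_def M_def[abs_def])
    have pos: "0 < r * real (Suc p)" "0 < r * real (q + 2)" "0 < r * real (p + q + 2)"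
       "0 < r * real m0 + r * real (q + 2)" "0 < r * real (Suc N)"
      using r by (auto intro: add_nonneg_pos)
    note G = Gamma_real_pos[OF r] Gamma_real_pos[OF pos(1)] Gamma_real_pos[OF pos(2)] Gamma_real_pos[OF pos(3)]
      Gamma_real_pos[OF pos(4)] Gamma_real_pos[OF pos(5)]
    have Ge: "Gamma x = exp (ln_Gamma x)" if "0 < x" for x :: real
      using that Gamma_real_pos[OF that] by (simp add: ln_Gamma_real_pos)
    have De: "D = exp (ln D)" and Xe: "X = exp (ln X)" and be: "\<And>z. (b - a) powr z = exp (z * ln (b - a))"
      using D X a by (auto simp: powr_def)
    define R where "R = (Gamma r / Gamma (r * real (Suc p)) * D) ^ m0 *
       (Gamma (r * real (q + 2)) / Gamma (r * real (p + q + 2)) * D ^ (q + 1)) * X ^ p *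
       ((b - a) powr (r * real m0 + r * real (q + 2) - 1) / Gamma (r * real m0 + r * real (q + 2)))"
    have Rle: "F N 0 a \<le> ennreal R"
      using Fbound[OF elim(2) p] a G D X
      by (simp add: R_def kap_def q_def[symmetric] ennreal_mult[symmetric] ennreal_power
          less_imp_le del: of_nat_Suc of_nat_add)
    define S where "S = (b - a) powr (r * real (Suc N) - 1) / Gamma (r * real (Suc N))"
    have S: "0 < S" "kap (r * real (Suc N)) a b = ennreal S" using a G by (auto simp: S_def kap_def)
    \<comment> \<open>With p + 1 = N div K the bound is rewritten relative to the normalising kernel
      S, which identifies E as its exponential rate.\<close>
    have "R = S * exp (real N * E N)"
    proof -
      have "R = exp (real m0 * (ln_Gamma r - ln_Gamma (r * real (Suc p)) + ln D)
         + (ln_Gamma (r * real (q + 2)) - ln_Gamma (r * real (p + q + 2)) + real (q + 1) * ln D) + real p * ln X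
         + ((r * real m0 + r * real (q + 2) - 1) * ln (b - a) - ln_Gamma (r * real m0 + r * real (q + 2))))"
        unfolding R_def Ge[OF r] Ge[OF pos(1)] Ge[OF pos(2)] Ge[OF pos(3)] Ge[OF pos(4)] be
        apply (subst De, subst (2) De, subst Xe)
        by (simp only: exp_add exp_diff exp_of_nat_mult power_mult_distrib power_divide times_divide_eq_left times_divide_eq_right)
      also have "real m0 * (ln_Gamma r - ln_Gamma (r * real (Suc p)) + ln D)
         + (ln_Gamma (r * real (q + 2)) - ln_Gamma (r * real (p + q + 2)) + real (q + 1) * ln D) + real p * ln X
         + ((r * real m0 + r * real (q + 2) - 1) * ln (b - a) - ln_Gamma (r * real m0 + r * real (q + 2)))
        = ((r * real (Suc N) - 1) * ln (b - a) - ln_Gamma (r * real (Suc N))) + real N * E N"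
      proof -
        have "real N * E N = (ln_Gamma (r * real (Suc N)) - real m0 * ln_Gamma (r * real (nb N))
           - ln_Gamma (r * real (N - m0 * nb N + 1))) + g q + real (nb N) * ln X - real N * (r * ln (b - a))"
        proof -
          have "n * (A / n + c / n + d / n * l - u) = A + c + d * l - n * u" if "n \<noteq> 0" for n A c d l u :: real
            using that by (simp add: distrib_left right_diff_distrib)
          then show ?thesis unfolding E_def q_def[symmetric] using elim(3) by simp
        qed
        then show ?thesis unfolding nl unfolding p g_def by (simp add: algebra_simps)
      qed
      finally show ?thesis
        unfolding S_def Ge[OF pos(5)] be by (simp add: exp_add exp_diff)
    qed
    also have "\<dots> \<le> S * exp (real N * (ln X / real K + r * ln (real K) - r * ln (b - a) + e))"
      using S elim(1) by (intro mult_left_mono exp_le_cancel_iff[THEN iffD2]) auto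
    finally have "ennreal R \<le> kap (r * real (Suc N)) a b * ennreal (exp (real N * (ln X / real K + r * ln (real K) - r * ln (b - a) + e)))"
      unfolding S(2) using S(1) by (simp add: ennreal_leI flip: ennreal_mult)
    with Rle show ?case unfolding F0 by (rule order_trans)
  qed
qed

text \<open>Paths are confined to windows of width \<epsilon> below the points t k at the inner
  block ends. This costs a fixed number of factors \<epsilon>, irrelevant for the rate, and leaves a
  length of at least t (Suc k) - t k - \<epsilon> to each block.\<close>

lemma lower_main:
  fixes h :: "real \<Rightarrow> real" and t :: "nat \<Rightarrow> real"
  assumes r: "0 < r" and a: "0 \<le> a" "a < b" and c0: "0 < c0" and C: "0 \<le> C" and w: "0 \<le> w" and K: "0 < K"
    and A: "\<And>x \<theta>. x \<in> {0..1} \<Longrightarrow> a \<le> \<theta> \<Longrightarrow> \<theta> \<le> b \<Longrightarrow> c0 \<le> level h x \<theta>"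
    and v: "\<And>k x. k < K \<Longrightarrow> x \<in> {0..1} \<Longrightarrow> \<bar>x - real k / real K\<bar> \<le> 1 / real K \<Longrightarrow>
        \<bar>exp (h x) - exp (h (real k / real K))\<bar> * b \<le> w * c0"
    and V: "\<And>x. x \<in> {0..1} \<Longrightarrow> \<bar>1 - exp (h x)\<bar> \<le> C * c0"
    and t: "t 0 = a" "t K = b"
    and \<epsilon>: "0 < \<epsilon>" "\<And>k. k < K \<Longrightarrow> \<epsilon> < t (Suc k) - t k"
    and e: "0 < e"
  defines "L2 \<equiv> \<lambda>k. - r * (w + C * (t (Suc k) - t k + \<epsilon>)) - r * ln (level h (real k / real K) (t (Suc k)))"
  shows "\<forall>\<^sub>F N in sequentially.
     kap (r * real (Suc N)) a b * ennreal (exp (real N * ((\<Sum>k<K. L2 k + r * ln (t (Suc k) - t k - \<epsilon>)) / real K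
        + r * ln (real K) - r * ln (b - a) - e)))
     \<le> chain r b (\<lambda>i. site_mgf r (h (real i / real N))) N 1 a"
proof -
  define m0 where "m0 = K - 1"
  have Km: "K = Suc m0" using K by (simp add: m0_def)
  define d where "d k = t (Suc k) - t k - \<epsilon>" for k
  have d: "0 < d k" if "k < K" for k using \<epsilon>(2)[OF that] by (simp add: d_def)
  have tlt: "t k < t (Suc k)" if "k < K" for k using \<epsilon>(1) \<epsilon>(2)[OF that] by simp
  have tge: "k \<le> K \<Longrightarrow> a \<le> t k" for k
  proof (induction k)
    case (Suc k)
    then show ?case using tlt[of k] by simp
  qed (simp add: t)
  have tle: "k \<le> K \<Longrightarrow> t k \<le> b" for k
  proof (induction k rule: inc_induct)
    case (step n)
    then show ?case using tlt[of n] by simp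
  qed (simp add: t)
  have kK: "real k / real K \<in> {0..1}" if "k < K" for k using that by auto
  \<comment> \<open>The lower edge of the window at t k; for k = 0 the path starts at a exactly, so
    the window is cut there.\<close>
  define lo where "lo k = max a (t k - \<epsilon>)" for k
  define nb where "nb N = N div K" for N
  define M where "M N i = site_mgf r (h (real i / real N))" for N i :: nat
  have Mm [measurable]: "M N i \<in> borel_measurable borel" for N i unfolding M_def by measurable
  define F where "F N k = chain r b (M N) (N - k * nb N) (Suc (k * nb N))" for N k
  have Fm [measurable]: "F N k \<in> borel_measurable borel" for N k
    unfolding F_def by (rule chain_measurable) measurable
  have Mbound: "ennreal (exp (L2 k)) \<le> M N i y"
    if N: "K * K \<le> N" and k: "k < K" and i: "Suc (k * nb N) \<le> i" "i \<le> (k + 1) * nb N \<or> k = K - 1 \<and> i \<le> N"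
      and y: "lo k \<le> y" "y \<le> t (Suc k)" for N k i y
  proof -
    have i1: "\<bar>real i / real N - real k / real K\<bar> \<le> 1 / real K" "1 \<le> i" "i \<le> N"
      using block_index[of K N k i] K N k i by (auto simp: nb_def)
    have u: "real i / real N \<in> {0..1}" using i1 by auto
    have yb: "a \<le> y" "y \<le> b" "t k - \<epsilon> \<le> y" using y tle[of "Suc k"] k by (auto simp: lo_def)
    have A1: "c0 \<le> level h (real i / real N) y" using A[OF u, of y] yb by simp
    have A2: "c0 \<le> level h (real k / real K) (t (Suc k))" using A[OF kK[OF k], of "t (Suc k)"] tge tle k by simp
    have "\<bar>ln (level h (real i / real N) y) - ln (level h (real k / real K) (t (Suc k)))\<bar> \<le> w + C * (t (Suc k) - y)"
      by (rule level_compare[OF r c0 _ _ _ A1 A2 v[OF k u i1(1)] V[OF u]]) (use yb y a tle[of "Suc k"] k in auto)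
    also have "\<dots> \<le> w + C * (t (Suc k) - t k + \<epsilon>)" using yb C by (auto intro!: mult_left_mono)
    finally have l: "- (w + C * (t (Suc k) - t k + \<epsilon>)) - ln (level h (real k / real K) (t (Suc k))) \<le> - ln (level h (real i / real N) y)" by linarith
    have "L2 k = r * (- (w + C * (t (Suc k) - t k + \<epsilon>)) - ln (level h (real k / real K) (t (Suc k))))"
      unfolding L2_def by (simp add: algebra_simps)
    also have "\<dots> \<le> r * (- ln (level h (real i / real N) y))" using l r by (intro mult_left_mono) auto
    finally have "exp (L2 k) \<le> level h (real i / real N) y powr (- r)"
      using A1 c0 by (simp add: powr_def)
    then show ?thesis using A1 c0 by (simp add: M_def site_mgf_level ennreal_leI)
  qed
  \<comment> \<open>The logarithm of the bound for the blocks from k on. The last block ends at b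
    exactly, hence has no window and no ln \<epsilon>.\<close>
  define T where "T N p q k = (\<Sum>i = k..<m0. real (Suc p) * L2 i + (r * real (Suc p) - 1) * ln (d i) - ln_Gamma (r * real (Suc p)) + ln \<epsilon>)
     + real (p + q + 1) * L2 m0 + (r * real (p + q + 2) - 1) * ln (d m0) - ln_Gamma (r * real (p + q + 2))" for N p q k :: nat
  have Ge: "Gamma x = exp (ln_Gamma x)" if "0 < x" for x :: real
    using that Gamma_real_pos[OF that] by (simp add: ln_Gamma_real_pos)
  \<comment> \<open>Index at least 1 makes the kernel increasing in the length; for small r this
    holds once the blocks are long enough (\<open>ev2\<close>).\<close>
  have kapge: "ennreal (exp ((\<beta> - 1) * ln c - ln_Gamma \<beta>)) \<le> kap \<beta> x y" if "1 \<le> \<beta>" "0 < c" "c \<le> y - x" for \<beta> c x y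
  proof -
    have "exp ((\<beta> - 1) * ln c - ln_Gamma \<beta>) = c powr (\<beta> - 1) / Gamma \<beta>"
      using that Ge[of \<beta>] by (simp add: powr_def exp_diff)
    also have "\<dots> \<le> (y - x) powr (\<beta> - 1) / Gamma \<beta>"
      using that Gamma_real_pos[of \<beta>] by (intro divide_right_mono powr_mono2) auto
    finally show ?thesis using that by (simp add: kap_def ennreal_leI)
  qed
  have Fbound: "ennreal (exp (T N p (N mod K) k)) \<le> F N k x"
    if "K * K \<le> N" "nb N = Suc p" "1 \<le> r * real (Suc p)" "k + m = m0" "lo k \<le> x" "x \<le> t k" for N p k m x
    using that
  proof (induction m arbitrary: k x)
    case 0
    then have k: "k = m0" by simp
    define q where "q = N mod K"
    have "N = K * nb N + N mod K" by (simp add: nb_def)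
    then have nl: "N - m0 * nb N = p + q + 1" "m0 * nb N + (p + q + 1) = N"
      using Km "0.prems"(2) by (auto simp: q_def)
    have "ennreal (exp (L2 m0)) ^ (p + q + 1) * kap (r * real (Suc (p + q + 1))) x b \<le> chain r b (M N) (p + q + 1) (Suc (m0 * nb N)) x"
    proof (rule chain_lower[OF r, where a = "lo m0"])
      fix i y assume "i \<in> {Suc (m0 * nb N)..<Suc (m0 * nb N) + (p + q + 1)}" "lo m0 \<le> y" "y < b"
      then show "ennreal (exp (L2 m0)) \<le> M N i y"
        using nl Km t by (intro Mbound[OF "0.prems"(1)]) auto
    qed (use "0.prems" k in auto)
    moreover have "ennreal (exp ((r * real (p + q + 2) - 1) * ln (d m0) - ln_Gamma (r * real (p + q + 2)))) \<le> kap (r * real (Suc (p + q + 1))) x b"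
    proof -
      have "1 \<le> r * real (p + q + 2)"
      proof -
        have "r * real (Suc p) \<le> r * real (p + q + 2)" using r by (intro mult_left_mono) auto
        then show ?thesis using "0.prems"(3) by linarith
      qed
      moreover have "d m0 \<le> b - x" using "0.prems" k t Km \<epsilon> by (simp add: d_def)
      ultimately have "ennreal (exp ((r * real (p + q + 2) - 1) * ln (d m0) - ln_Gamma (r * real (p + q + 2)))) \<le> kap (r * real (p + q + 2)) x b"
        using d[of m0] Km by (intro kapge) auto
      then show ?thesis by simp
    qed
    ultimately have "ennreal (exp (L2 m0)) ^ (p + q + 1) * ennreal (exp ((r * real (p + q + 2) - 1) * ln (d m0) - ln_Gamma (r * real (p + q + 2)))) \<le> F N k x"
      unfolding F_def k nl(1) by (meson mult_left_mono order_trans zero_le)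
    moreover have "ennreal (exp (L2 m0)) ^ (p + q + 1) * ennreal (exp ((r * real (p + q + 2) - 1) * ln (d m0) - ln_Gamma (r * real (p + q + 2))))
       = ennreal (exp (T N p (N mod K) k))"
      unfolding T_def k q_def[symmetric]
      by (simp add: ennreal_power exp_of_nat_mult[symmetric] add_diff_eq del: of_nat_add of_nat_Suc power_add power_Suc flip: ennreal_mult exp_add)
    ultimately show ?case by simp
  next
    case (Suc m)
    note N = Suc.prems(1) and p = Suc.prems(2)
    have k: "k < m0" "k < K" using Suc.prems Km by auto
    have lo1: "lo (Suc k) = t (Suc k) - \<epsilon>" using \<epsilon>(2)[OF k(2)] tge[of k] k by (simp add: lo_def)
    have le: "Suc k * nb N \<le> N"
    proof -
      have "Suc k * nb N \<le> K * nb N" using k Km by (intro mult_right_mono) auto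
      also have "\<dots> \<le> N" by (simp add: nb_def)
      finally show ?thesis .
    qed
    define c where "c = ennreal (exp (L2 k))"
    define \<tau> where "\<tau> = T N p (N mod K) (Suc k)"
    define \<gamma> where "\<gamma> = (r * real (Suc p) - 1) * ln (d k) - ln_Gamma (r * real (Suc p))"
    have IH: "ennreal (exp \<tau>) \<le> F N (Suc k) y" if "t (Suc k) - \<epsilon> \<le> y" "y \<le> t (Suc k)" for y
      unfolding \<tau>_def using Suc.prems that lo1 by (intro Suc.IH) auto
    have "F N k x = blk r (M N) (F N (Suc k)) (Suc p) (Suc (k * nb N)) x"
    proof -
      have 1: "N - k * nb N = Suc p + (N - Suc k * nb N)" using le p by simp
      have 2: "Suc (k * nb N) + Suc p = Suc (Suc k * nb N)" using p by simp
      show ?thesis unfolding F_def 1 chain_blk 2 ..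
    qed
    also have "(\<integral>\<^sup>+ u. kap (r * real (Suc p)) x u * (c ^ Suc p * (F N (Suc k) u * indicator {..t (Suc k)} u)) \<partial>lborel) \<le> \<dots>"
    proof (rule blk_lower[OF r Mm Fm, where a = "lo k"])
      fix i y assume "i \<in> {Suc (k * nb N)..<Suc (k * nb N) + Suc p}" "lo k \<le> y" "y \<le> t (Suc k)"
      then show "c \<le> M N i y" unfolding c_def using p by (intro Mbound[OF N k(2)]) auto
    qed (use Suc.prems in auto)
    finally have 1: "(\<integral>\<^sup>+ u. kap (r * real (Suc p)) x u * (c ^ Suc p * (F N (Suc k) u * indicator {..t (Suc k)} u)) \<partial>lborel) \<le> F N k x" .
    have "(\<integral>\<^sup>+ u. ennreal (exp \<gamma>) * (c ^ Suc p * ennreal (exp \<tau>)) * indicator {t (Suc k) - \<epsilon>..t (Suc k)} u \<partial>lborel)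
       \<le> (\<integral>\<^sup>+ u. kap (r * real (Suc p)) x u * (c ^ Suc p * (F N (Suc k) u * indicator {..t (Suc k)} u)) \<partial>lborel)"
    proof (rule nn_integral_mono)
      fix u :: real
      show "ennreal (exp \<gamma>) * (c ^ Suc p * ennreal (exp \<tau>)) * indicator {t (Suc k) - \<epsilon>..t (Suc k)} u
         \<le> kap (r * real (Suc p)) x u * (c ^ Suc p * (F N (Suc k) u * indicator {..t (Suc k)} u))"
      proof (cases "t (Suc k) - \<epsilon> \<le> u \<and> u \<le> t (Suc k)")
        case True
        have "ennreal (exp \<gamma>) \<le> kap (r * real (Suc p)) x u"
          unfolding \<gamma>_def using Suc.prems True d[OF k(2)] by (intro kapge) (auto simp: d_def)
        then show ?thesis using True IH[of u] by (auto intro!: mult_mono mult_left_mono)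
      qed (auto simp: indicator_def)
    qed
    also note 1
    finally have "ennreal (exp \<gamma>) * (c ^ Suc p * ennreal (exp \<tau>)) * ennreal \<epsilon> \<le> F N k x"
      using \<epsilon>(1) by (subst (asm) nn_integral_cmult) auto
    moreover have "ennreal (exp \<gamma>) * (c ^ Suc p * ennreal (exp \<tau>)) * ennreal \<epsilon> = ennreal (exp (\<gamma> + real (Suc p) * L2 k + \<tau> + ln \<epsilon>))"
    proof -
      have "ennreal \<epsilon> = ennreal (exp (ln \<epsilon>))" using \<epsilon>(1) by simp
      moreover have "c ^ Suc p = ennreal (exp (real (Suc p) * L2 k))"
        unfolding c_def by (simp only: ennreal_power[OF exp_ge_zero] exp_of_nat_mult[symmetric])
      ultimately show ?thesis by (simp only: ennreal_mult[symmetric] exp_ge_zero mult_nonneg_nonneg exp_add mult.assoc)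
    qed
    moreover have "\<gamma> + real (Suc p) * L2 k + \<tau> + ln \<epsilon> = T N p (N mod K) k"
      unfolding \<gamma>_def \<tau>_def T_def using k by (simp add: sum.atLeast_Suc_lessThan algebra_simps)
    ultimately show ?case by simp
  qed
  define SL where "SL = (\<Sum>k<K. L2 k + r * ln (d k))"
  define g where "g q = real q * L2 m0 + r * real (q + 1) * ln (d m0) - (\<Sum>k<K. ln (d k)) + real m0 * ln \<epsilon> - (r - 1) * ln (b - a)" for q
  define E where "E N = (ln_Gamma (r * real (Suc N)) - real m0 * ln_Gamma (r * real (nb N))
       - ln_Gamma (r * real (N - m0 * nb N + 1))) / real N + g (N mod K) / real N
       + real (nb N) / real N * SL - r * ln (b - a)" for N
  have Elim: "E \<longlonglongrightarrow> r * ln (real K) + 0 + 1 / real K * SL - r * ln (b - a)"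
    unfolding E_def[abs_def] nb_def m0_def using K
    by (intro tendsto_intros Gamma_block_limit[OF r] mod_bounded_div_tendsto tendsto_div_const) auto
  have ev: "\<forall>\<^sub>F N in sequentially. SL / real K + r * ln (real K) - r * ln (b - a) - e < E N"
    by (rule order_tendstoD(1)[OF Elim]) (use e in simp)
  have ev2: "\<forall>\<^sub>F N in sequentially. 1 \<le> r * real (nb N)"
  proof -
    obtain n0 :: nat where n0: "1 / r < real n0" using reals_Archimedean2 by blast
    have "1 \<le> r * real (nb N)" if "K * n0 \<le> N" for N
    proof -
      have "n0 \<le> nb N" unfolding nb_def using K that by (simp add: less_eq_div_iff_mult_less_eq mult.commute)
      then have "1 / r \<le> real (nb N)" using n0 by simp
      then show ?thesis using r by (simp add: divide_le_eq mult.commute)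
    qed
    then show ?thesis unfolding eventually_sequentially by blast
  qed
  show ?thesis
    using ev ev2 eventually_ge_at_top[of "K * K"] eventually_gt_at_top[of 0]
  proof eventually_elim
    case (elim N)
    have "0 < nb N" using elim(2) by (cases "nb N = 0") auto
    then obtain p where p: "nb N = Suc p" by (cases "nb N") auto
    define q where "q = N mod K"
    have "N = K * nb N + N mod K" by (simp add: nb_def)
    then have nl: "N - m0 * nb N + 1 = p + q + 2" using Km p by (simp add: q_def)
    have pos: "0 < r * real (Suc N)" using r by simp
    define S where "S = (b - a) powr (r * real (Suc N) - 1) / Gamma (r * real (Suc N))"
    have S: "0 < S" "kap (r * real (Suc N)) a b = ennreal S" "S = exp ((r * real (Suc N) - 1) * ln (b - a) - ln_Gamma (r * real (Suc N)))"
      using a Gamma_real_pos[OF pos] Ge[OF pos] by (auto simp: S_def kap_def powr_def exp_diff)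
    have sums: "(\<Sum>i = 0..<m0. f i) + f m0 = (\<Sum>k<K. f k)" for f :: "nat \<Rightarrow> real"
      using Km by (simp add: atLeast0LessThan)
    have TE: "T N p q 0 = (r * real (Suc N) - 1) * ln (b - a) - ln_Gamma (r * real (Suc N)) + real N * E N"
    proof -
      have "n * (A / n + c / n + d / n * l - u) = A + c + d * l - n * u" if "n \<noteq> 0" for n A c d l u :: real
        using that by (simp add: distrib_left right_diff_distrib)
      then have "real N * E N = (ln_Gamma (r * real (Suc N)) - real m0 * ln_Gamma (r * real (nb N))
           - ln_Gamma (r * real (N - m0 * nb N + 1))) + g q + real (nb N) * SL - real N * (r * ln (b - a))"
        unfolding E_def q_def[symmetric] using elim(4) by simp
      moreover have "T N p q 0 = real (Suc p) * SL + real q * L2 m0 + r * real (q + 1) * ln (d m0) - (\<Sum>k<K. ln (d k)) + real m0 * ln \<epsilon>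
          - real m0 * ln_Gamma (r * real (Suc p)) - ln_Gamma (r * real (p + q + 2))"
        unfolding T_def SL_def sums[symmetric]
        by (simp add: sum.distrib sum_subtractf sum_distrib_left algebra_simps)
      ultimately show ?thesis unfolding nl unfolding p g_def by (simp add: algebra_simps)
    qed
    have F0: "F N 0 a = chain r b (\<lambda>i. site_mgf r (h (real i / real N))) N 1 a"
      by (simp add: F_def M_def[abs_def])
    have "kap (r * real (Suc N)) a b * ennreal (exp (real N * (SL / real K + r * ln (real K) - r * ln (b - a) - e)))
       \<le> kap (r * real (Suc N)) a b * ennreal (exp (real N * E N))"
      using elim(1) by (intro mult_left_mono ennreal_leI exp_le_cancel_iff[THEN iffD2]) auto
    also have "\<dots> = ennreal (exp (T N p q 0))"
      unfolding S(2) TE by (simp add: S(3) exp_add flip: ennreal_mult)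
    also have "\<dots> \<le> F N 0 a"
      unfolding q_def using elim(2,3) p \<epsilon>(1) t by (intro Fbound[where m = m0]) (auto simp: lo_def)
    finally show ?case unfolding F0 SL_def d_def .
  qed
qed

text \<open>A path that is above \<open>b - \<eta>\<close> at step \<open>m\<close> spends the remaining \<open>\<delta> N\<close> steps in an interval of length
  \<open>\<eta>\<close>, which costs \<open>\<eta> powr (r * \<delta> * N)\<close>; this beats every factor exponential in \<open>N\<close> as \<open>\<eta> \<rightarrow> 0\<close>.\<close>

lemma crude_bound:
  assumes r: "0 < r" and a: "0 \<le> a" "a < b" and \<delta>: "0 < \<delta>" "\<delta> < 1" and D: "0 < D"
  shows "\<exists>C N0. \<forall>N m M \<eta>. N0 \<le> N \<longrightarrow> real m \<le> (1 - \<delta>) * real N \<longrightarrow> 0 < \<eta> \<longrightarrow> \<eta> < 1 \<longrightarrow>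
     (\<forall>i. M i \<in> borel_measurable borel) \<longrightarrow>
     (\<forall>i y. 1 \<le> i \<and> i \<le> m \<and> a \<le> y \<and> y < b \<longrightarrow> M i y \<le> ennreal (b powr r * (b - y) powr (- r))) \<longrightarrow>
     (\<forall>i y. m < i \<and> i \<le> N \<and> a \<le> y \<and> y < b \<longrightarrow> M i y \<le> ennreal D) \<longrightarrow>
     blk r M (\<lambda>t. chain r b M (N - m) (Suc m) t * indicator {b - \<eta><..} t) m 1 a
       \<le> kap (r * real (Suc N)) a b * ennreal (exp (C * real N + r * ln \<eta> * (\<delta> * real N / 2 - 1)))"
proof -
  define C1 where "C1 = max 0 (ln D)"
  define C2 where "C2 = max 0 (r * ln (8 * b / \<delta>))"
  define C3 where "C3 = max 0 (- ln (b - a))"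
  define C where "C = C1 + C2 + 2 * r * C3"
  have b: "0 < b" using a by simp
  \<comment> \<open>Chosen so that the reduced index \<beta> below satisfies \<beta> - r - 1 \<ge>
    \<delta> r N / 4.\<close>
  obtain N0 :: nat where N0: "(8 * (r + 2)) / (\<delta> * r) < real N0" using reals_Archimedean2 by blast
  have N1: "1 \<le> N0"
  proof -
    have "0 < (8 * (r + 2)) / (\<delta> * r)" using r \<delta> by simp
    then have "0 < real N0" using N0 by linarith
    then show ?thesis by simp
  qed
  show ?thesis
  proof (intro exI[of _ C] exI[of _ N0] allI impI)
    fix N m :: nat and M :: "nat \<Rightarrow> real \<Rightarrow> ennreal" and \<eta> :: real
    assume N: "N0 \<le> N" and m: "real m \<le> (1 - \<delta>) * real N" and \<eta>: "0 < \<eta>" "\<eta> < 1"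
      and Mm: "\<forall>i. M i \<in> borel_measurable borel"
      and M1: "\<forall>i y. 1 \<le> i \<and> i \<le> m \<and> a \<le> y \<and> y < b \<longrightarrow> M i y \<le> ennreal (b powr r * (b - y) powr (- r))"
      and M2: "\<forall>i y. m < i \<and> i \<le> N \<and> a \<le> y \<and> y < b \<longrightarrow> M i y \<le> ennreal D"
    have mN: "m \<le> N"
    proof -
      have "(1 - \<delta>) * real N \<le> 1 * real N" using \<delta> by (intro mult_right_mono) auto
      then show ?thesis using m by simp
    qed
    \<comment> \<open>q kernels follow site m. The length powers of about half of them, p, are
      traded for the small factor \<eta> powr (r p); the others keep the index \<beta> large for
      \<open>blk_critical\<close> on the first m sites.\<close>
    define q where "q = Suc N - m"
    define p where "p = q div 2"
    have q: "real q = real N + 1 - real m" using mN by (simp add: q_def of_nat_diff)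
    have q\<delta>: "\<delta> * real N + 1 \<le> real q" using m by (simp add: q algebra_simps)
    have p2: "real q / 2 - 1 \<le> real p" "real p \<le> real q / 2" "p \<le> q"
      unfolding p_def by linarith+
    have Nbig: "8 * (r + 2) \<le> \<delta> * r * real N"
    proof -
      have "(8 * (r + 2)) / (\<delta> * r) < real N" using N0 N by linarith
      then show ?thesis using r \<delta> by (simp add: divide_less_eq mult.commute)
    qed
    define \<beta> where "\<beta> = r * real (q - p)"
    have \<beta>e: "\<beta> = r * real q - r * real p" using p2(3) by (simp add: \<beta>_def of_nat_diff algebra_simps)
    have \<beta>1: "\<delta> * r * real N / 2 \<le> \<beta>"
    proof -
      have "\<delta> * real N / 2 \<le> real q - real p" using p2 q\<delta> by linarith
      then have "r * (\<delta> * real N / 2) \<le> r * (real q - real p)" using r by (intro mult_left_mono) auto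
      then show ?thesis unfolding \<beta>e by (simp add: algebra_simps)
    qed
    have \<beta>2: "\<delta> * r * real N / 4 \<le> \<beta> - r - 1" "1 < \<beta> - r" "0 < \<beta>" "r < \<beta>"
    proof -
      define Y where "Y = \<delta> * r * real N"
      have Y: "8 * (r + 2) \<le> Y" "Y / 2 \<le> \<beta>" using \<beta>1 Nbig by (auto simp: Y_def)
      show "\<delta> * r * real N / 4 \<le> \<beta> - r - 1" unfolding Y_def[symmetric] using Y r by argo
      show "1 < \<beta> - r" "0 < \<beta>" "r < \<beta>" using Y r by argo+
    qed
    have rq: "0 < r * real q" using r q mN by simp
    have G: "0 < Gamma \<beta>" "0 < Gamma (\<beta> - r)" "0 < Gamma (r * real q)" "0 < Gamma (r * real (Suc N))"
      using \<beta>2 rq r by (auto intro!: Gamma_real_pos)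
    define c where "c = ennreal D ^ (N - m) * ennreal (\<eta> powr (r * real p) * (Gamma \<beta> / Gamma (r * real q)))"
    have f: "chain r b M (N - m) (Suc m) t * indicator {b - \<eta><..} t \<le> c * kap \<beta> t b" if t: "a \<le> t" for t
    proof (cases "b - \<eta> < t \<and> t < b")
      case True
      have "chain r b M (N - m) (Suc m) t \<le> ennreal D ^ (N - m) * kap (r * real (Suc (N - m))) t b"
        using M2 mN t by (intro chain_upper[OF r, where a = a]) auto
      also have "Suc (N - m) = q" using mN by (simp add: q_def)
      finally have 1: "chain r b M (N - m) (Suc m) t \<le> ennreal D ^ (N - m) * kap (r * real q) t b" .
      have "1 \<le> \<eta> powr (r * real p) * (b - t) powr (- (r * real p))"
      proof -
        have "(b - t) powr (r * real p) \<le> \<eta> powr (r * real p)" using True r by (intro powr_mono2) auto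
        then show ?thesis using True by (simp add: powr_minus_divide)
      qed
      then have "ennreal 1 \<le> ennreal (\<eta> powr (r * real p) * (b - t) powr (- (r * real p)))" by (rule ennreal_leI)
      then have "chain r b M (N - m) (Suc m) t * 1 \<le> ennreal D ^ (N - m) * kap (r * real q) t b * ennreal (\<eta> powr (r * real p) * (b - t) powr (- (r * real p)))"
        by (intro mult_mono 1) auto
      also have "\<dots> = ennreal D ^ (N - m) * ennreal (\<eta> powr (r * real p)) * (kap (r * real q) t b * ennreal ((b - t) powr (- (r * real p))))"
        by (simp add: ennreal_mult mult_ac)
      also have "kap (r * real q) t b * ennreal ((b - t) powr (- (r * real p))) = ennreal (Gamma \<beta> / Gamma (r * real q)) * kap \<beta> t b"
        using kap_mult_powr[of "r * real q" "- (r * real p)" t b] rq \<beta>2 \<beta>e by simp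
      also have "ennreal D ^ (N - m) * ennreal (\<eta> powr (r * real p)) * (ennreal (Gamma \<beta> / Gamma (r * real q)) * kap \<beta> t b) = c * kap \<beta> t b"
        unfolding c_def using G by (simp add: ennreal_mult mult_ac del: times_divide_eq_right)
      finally show ?thesis using True by simp
    next
      case False
      then show ?thesis by (auto simp: indicator_def chain_zero)
    qed
    have blk1: "blk r M (\<lambda>t. chain r b M (N - m) (Suc m) t * indicator {b - \<eta><..} t) m 1 a
       \<le> c * ennreal (b powr r * (Gamma (\<beta> - r) / Gamma \<beta>)) ^ m * kap \<beta> a b"
      by (rule blk_critical[OF r \<beta>2(4) b, where a = a]) (use M1 f in auto)
    define R where "R = D ^ (N - m) * (\<eta> powr (r * real p) * (Gamma \<beta> / Gamma (r * real q))) * (b powr r * (Gamma (\<beta> - r) / Gamma \<beta>)) ^ m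
        * ((b - a) powr (\<beta> - 1) / Gamma \<beta>)"
    have R: "c * ennreal (b powr r * (Gamma (\<beta> - r) / Gamma \<beta>)) ^ m * kap \<beta> a b = ennreal R"
    proof -
      have n1: "0 \<le> D ^ (N - m)" using D by simp
      have n2: "0 \<le> \<eta> powr (r * real p) * (Gamma \<beta> / Gamma (r * real q))" using G by simp
      have n3: "0 \<le> b powr r * (Gamma (\<beta> - r) / Gamma \<beta>)" using G by simp
      have n4: "0 \<le> (b powr r * (Gamma (\<beta> - r) / Gamma \<beta>)) ^ m" using n3 by simp
      have D0: "0 \<le> D" using D by simp
      have k: "kap \<beta> a b = ennreal ((b - a) powr (\<beta> - 1) / Gamma \<beta>)" using a by (simp add: kap_def)
      have n5: "0 \<le> (b - a) powr (\<beta> - 1) / Gamma \<beta>" using G by simp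
      show ?thesis unfolding R_def c_def k ennreal_power[OF D0] ennreal_power[OF n3]
        by (simp only: ennreal_mult[OF n1 n2] ennreal_mult[OF mult_nonneg_nonneg[OF n1 n2] n4]
            ennreal_mult[OF mult_nonneg_nonneg[OF mult_nonneg_nonneg[OF n1 n2] n4] n5])
    qed
    define S where "S = (b - a) powr (r * real (Suc N) - 1) / Gamma (r * real (Suc N))"
    have S: "0 < S" "kap (r * real (Suc N)) a b = ennreal S" using a G by (auto simp: S_def kap_def)
    have e1: "\<beta> - 1 = (r * real (Suc N) - 1) + (- (r * (real m + real p)))"
      unfolding \<beta>e q by (simp add: algebra_simps)
    have "R = S * (D ^ (N - m) * \<eta> powr (r * real p) * (b - a) powr (- (r * (real m + real p))) *
        ((b powr r * (Gamma (\<beta> - r) / Gamma \<beta>)) ^ m * (Gamma (r * real (Suc N)) / Gamma (r * real q))))"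
      unfolding R_def S_def e1 powr_add using G by (simp add: field_simps)
    also have "\<dots> \<le> S * exp (C * real N + r * ln \<eta> * (\<delta> * real N / 2 - 1))"
    proof (rule mult_left_mono)
      have d1: "D ^ (N - m) \<le> exp (C1 * real N)"
      proof -
        have "D ^ (N - m) = exp (ln D * real (N - m))" using D by (simp add: exp_of_nat2_mult)
        also have "\<dots> \<le> exp (C1 * real N)"
          unfolding C1_def by (intro exp_le_cancel_iff[THEN iffD2] mult_mono) auto
        finally show ?thesis .
      qed
      have d2: "\<eta> powr (r * real p) \<le> exp (r * ln \<eta> * (\<delta> * real N / 2 - 1))"
      proof -
        have "\<delta> * real N / 2 - 1 \<le> real p" using p2 q\<delta> by linarith
        moreover have "r * ln \<eta> \<le> 0" using r \<eta> by (simp add: mult_nonneg_nonpos)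
        ultimately have "r * ln \<eta> * real p \<le> r * ln \<eta> * (\<delta> * real N / 2 - 1)" by (rule mult_left_mono_neg)
        then show ?thesis using \<eta> by (simp add: powr_def mult_ac)
      qed
      have d3: "(b - a) powr (- (r * (real m + real p))) \<le> exp (2 * r * C3 * real N)"
      proof -
        have mp: "real m + real p \<le> 2 * real N"
        proof -
          have "real p \<le> (real N + 1) / 2" using p2(2) q by simp
          moreover have "1 \<le> real N" "real m \<le> real N" using N1 N mN by auto
          ultimately show ?thesis by argo
        qed
        have "(- ln (b - a)) * (r * (real m + real p)) \<le> C3 * (r * (2 * real N))"
          unfolding C3_def using r mp by (intro mult_mono mult_left_mono) auto
        then show ?thesis using a by (simp add: powr_def mult_ac)
      qed
      \<comment> \<open>Each critical site contributes Gamma (\<beta> - r) / Gamma \<beta>, of order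
        N powr (- r), and the ratio of normalisations is of order N powr (r m). The powers of N
        cancel and leave the constant (8 b / \<delta>) powr r per site.\<close>
      have d4: "(b powr r * (Gamma (\<beta> - r) / Gamma \<beta>)) ^ m * (Gamma (r * real (Suc N)) / Gamma (r * real q)) \<le> exp (C2 * real N)"
      proof -
        have N0': "0 < real N" using N1 N by simp
        define \<nu> where "\<nu> = \<delta> * r * real N / 4"
        have \<nu>: "0 < \<nu>" using \<delta> r N0' by (simp add: \<nu>_def)
        have "Gamma (\<beta> - r) * (\<beta> - r - 1) powr r \<le> Gamma (\<beta> - r + r)"
          using \<beta>2 r by (intro Gamma_add_ge) auto
        then have "Gamma (\<beta> - r) / Gamma \<beta> \<le> (\<beta> - r - 1) powr (- r)"
          using G \<beta>2 by (simp add: powr_minus_divide field_simps)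
        also have "\<dots> \<le> \<nu> powr (- r)"
          using \<beta>2(1) \<nu> r by (intro powr_mono2') (auto simp: \<nu>_def)
        finally have g1: "b powr r * (Gamma (\<beta> - r) / Gamma \<beta>) \<le> b powr r * \<nu> powr (- r)"
          by (intro mult_left_mono) auto
        have "r * real (Suc N) = r * real q + r * real m" unfolding q by (simp add: algebra_simps)
        moreover have "Gamma (r * real q + r * real m) \<le> Gamma (r * real q) * (r * real q + r * real m) powr (r * real m)"
          using rq r by (intro Gamma_add_le) auto
        ultimately have "Gamma (r * real (Suc N)) / Gamma (r * real q) \<le> (r * real (Suc N)) powr (r * real m)"
          using G by (simp add: divide_le_eq mult.commute del: of_nat_Suc)
        also have "\<dots> \<le> (2 * r * real N) powr (r * real m)"
          using r N1 N by (intro powr_mono2) auto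
        also have "\<dots> = ((2 * r * real N) powr r) ^ m"
          using r N0' by (simp add: powr_realpow[symmetric] powr_powr del: powr_realpow)
        finally have g2: "Gamma (r * real (Suc N)) / Gamma (r * real q) \<le> ((2 * r * real N) powr r) ^ m" .
        have "(b powr r * (Gamma (\<beta> - r) / Gamma \<beta>)) ^ m * (Gamma (r * real (Suc N)) / Gamma (r * real q))
            \<le> (b powr r * \<nu> powr (- r)) ^ m * ((2 * r * real N) powr r) ^ m"
          by (rule mult_mono[OF power_mono[OF g1] g2]) (use G in auto)
        also have "\<dots> = ((8 * b / \<delta>) powr r) ^ m"
        proof -
          have "b powr r * \<nu> powr (- r) * (2 * r * real N) powr r = (b / \<nu> * (2 * r * real N)) powr r"
            using b \<nu> by (simp add: powr_mult powr_divide powr_minus_divide)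
          also have "b / \<nu> * (2 * r * real N) = 8 * b / \<delta>"
            unfolding \<nu>_def using \<delta> r N0' by (simp add: field_simps)
          finally show ?thesis by (simp add: power_mult_distrib[symmetric])
        qed
        also have "\<dots> = exp ((r * ln (8 * b / \<delta>)) * real m)"
          using b \<delta> by (simp add: powr_def exp_of_nat2_mult)
        also have "\<dots> \<le> exp (C2 * real N)"
          unfolding C2_def using mN by (intro exp_le_cancel_iff[THEN iffD2] mult_mono) auto
        finally show ?thesis .
      qed
      have "D ^ (N - m) * \<eta> powr (r * real p) * (b - a) powr (- (r * (real m + real p))) *
        ((b powr r * (Gamma (\<beta> - r) / Gamma \<beta>)) ^ m * (Gamma (r * real (Suc N)) / Gamma (r * real q)))
        \<le> exp (C1 * real N) * exp (r * ln \<eta> * (\<delta> * real N / 2 - 1)) * exp (2 * r * C3 * real N) * exp (C2 * real N)"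
        using D G by (intro mult_mono d1 d2 d3 d4) auto
      also have "\<dots> = exp (C * real N + r * ln \<eta> * (\<delta> * real N / 2 - 1))"
        by (simp add: C_def algebra_simps flip: exp_add)
      finally show "D ^ (N - m) * \<eta> powr (r * real p) * (b - a) powr (- (r * (real m + real p))) *
        ((b powr r * (Gamma (\<beta> - r) / Gamma \<beta>)) ^ m * (Gamma (r * real (Suc N)) / Gamma (r * real q)))
        \<le> exp (C * real N + r * ln \<eta> * (\<delta> * real N / 2 - 1))" .
    qed (use S in simp)
    finally have "ennreal R \<le> kap (r * real (Suc N)) a b * ennreal (exp (C * real N + r * ln \<eta> * (\<delta> * real N / 2 - 1)))"
      unfolding S(2) using S(1) by (simp add: ennreal_leI flip: ennreal_mult)
    then show "blk r M (\<lambda>t. chain r b M (N - m) (Suc m) t * indicator {b - \<eta><..} t) m 1 a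
       \<le> kap (r * real (Suc N)) a b * ennreal (exp (C * real N + r * ln \<eta> * (\<delta> * real N / 2 - 1)))"
      using blk1 unfolding R by (rule order_trans[rotated])
  qed
qed

section \<open>Values of profiles\<close>

lemma unit_integral_mono_AE:
  assumes "AE x in lebesgue. x \<in> {0..1} \<longrightarrow> f x \<le> g x"
  shows "unit_integral f \<le> unit_integral g"
  unfolding unit_integral_def
proof (rule ereal_minus_mono)
  show "enn2ereal (\<integral>\<^sup>+ x \<in> {0..1}. e2ennreal (f x) \<partial>lebesgue) \<le> enn2ereal (\<integral>\<^sup>+ x \<in> {0..1}. e2ennreal (g x) \<partial>lebesgue)"
    using assms by (simp add: less_eq_ennreal.rep_eq[symmetric])
      (rule nn_integral_mono_AE, auto elim!: eventually_mono simp: indicator_def e2ennreal_mono)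
  show "enn2ereal (\<integral>\<^sup>+ x \<in> {0..1}. e2ennreal (- g x) \<partial>lebesgue) \<le> enn2ereal (\<integral>\<^sup>+ x \<in> {0..1}. e2ennreal (- f x) \<partial>lebesgue)"
    using assms by (simp add: less_eq_ennreal.rep_eq[symmetric])
      (rule nn_integral_mono_AE, auto elim!: eventually_mono simp: indicator_def e2ennreal_mono)
qed

lemma unit_integral_real:
  assumes \<phi>: "integrable lebesgue (\<lambda>x. indicator {0..1} x * \<phi> x)"
  shows "unit_integral (\<lambda>x. ereal (\<phi> x)) = ereal (\<integral>x. indicator {0..1} x * \<phi> x \<partial>lebesgue)"
proof -
  have 1: "(\<integral>\<^sup>+ x \<in> {0..1}. e2ennreal (ereal (\<phi> x)) \<partial>lebesgue) = (\<integral>\<^sup>+ x. ennreal (indicator {0..1} x * \<phi> x) \<partial>lebesgue)"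
    by (intro nn_integral_cong) (auto simp: indicator_def ennreal.abs_eq)
  have 2: "(\<integral>\<^sup>+ x \<in> {0..1}. e2ennreal (- ereal (\<phi> x)) \<partial>lebesgue) = (\<integral>\<^sup>+ x. ennreal (- (indicator {0..1} x * \<phi> x)) \<partial>lebesgue)"
    by (intro nn_integral_cong) (auto simp: indicator_def ennreal.abs_eq)
  have f: "(\<integral>\<^sup>+ x. ennreal (indicator {0..1} x * \<phi> x) \<partial>lebesgue) \<noteq> \<infinity>" "(\<integral>\<^sup>+ x. ennreal (- (indicator {0..1} x * \<phi> x)) \<partial>lebesgue) \<noteq> \<infinity>"
    using \<phi> real_integrable_def by blast+
  have e: "enn2ereal z = ereal (enn2real z)" if "z \<noteq> \<infinity>" for z
    using that by (cases z) auto
  show ?thesis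
    unfolding unit_integral_def 1 2 e[OF f(1)] e[OF f(2)] real_lebesgue_integral_def[OF \<phi>] by simp
qed

definition stepf :: "nat \<Rightarrow> (nat \<Rightarrow> real) \<Rightarrow> real \<Rightarrow> real" where
  "stepf K c x = (\<Sum>k<K. c k * indicator {real k / real K..<real (Suc k) / real K} x)"

lemma block_unique:
  assumes "0 < K" "x \<in> {real k / real K..<real (Suc k) / real K}"
  shows "nat \<lfloor>real K * x\<rfloor> = k"
proof -
  have "real k \<le> real K * x" "real K * x < real k + 1" using assms by (auto simp: field_simps)
  then have "\<lfloor>real K * x\<rfloor> = int k" by (simp add: floor_eq_iff)
  then show ?thesis by simp
qed

lemma block_exists:
  assumes "0 < K" "0 \<le> x" "x < 1"
  obtains k where "k < K" "x \<in> {real k / real K..<real (Suc k) / real K}"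
proof
  define k where "k = nat \<lfloor>real K * x\<rfloor>"
  have k: "real k \<le> real K * x" "real K * x < real k + 1"
    using assms by (auto simp: k_def)
  have "real K * x < real K * 1" using assms by (intro mult_strict_left_mono) auto
  then have "real k < real K" using k by simp
  then show "k < K" by simp
  show "x \<in> {real k / real K..<real (Suc k) / real K}" using k assms by (auto simp: field_simps)
qed

lemma stepf_eq:
  assumes "0 < K" "k < K" "x \<in> {real k / real K..<real (Suc k) / real K}"
  shows "stepf K c x = c k"
proof -
  have "stepf K c x = (\<Sum>i<K. if i = k then c k else 0)"
    unfolding stepf_def
    using block_unique[OF assms(1,3)] block_unique[OF assms(1)] assms(3)
    by (intro sum.cong refl) (auto simp: indicator_def)
  then show ?thesis using assms by simp
qed

lemma integral_stepf:
  assumes K: "0 < K"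
  shows "integrable lebesgue (\<lambda>x. indicator {0..1} x * stepf K c x)"
    and "(\<integral>x. indicator {0..1} x * stepf K c x \<partial>lebesgue) = (\<Sum>k<K. c k) / real K"
proof -
  have sub: "indicator {0..1} x * stepf K c x = stepf K c x" for x
  proof (cases "x \<in> {0..1}")
    case False
    have "indicator {real k / real K..<real (Suc k) / real K} x = (0::real)" if "k < K" for k
    proof -
      have 1: "0 \<le> real k / real K" "real (Suc k) / real K \<le> 1" using that by (auto simp: divide_le_eq)
      have "x \<notin> {real k / real K..<real (Suc k) / real K}"
      proof
        assume "x \<in> {real k / real K..<real (Suc k) / real K}"
        then have "real k / real K \<le> x" "x < real (Suc k) / real K" by auto
        then have "0 \<le> x" "x \<le> 1" using 1 by linarith+
        with False show False by simp
      qed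
      then show ?thesis by (rule indicator_simps(2))
    qed
    then show ?thesis using False by (simp add: stepf_def)
  qed simp
  have hb: "has_bochner_integral lebesgue (stepf K c) (\<Sum>k<K. c k * (1 / real K))"
    unfolding stepf_def[abs_def]
  proof (intro has_bochner_integral_sum has_bochner_integral_mult_right)
    fix k
    have le: "real k / real K \<le> real (Suc k) / real K" by (intro divide_right_mono) auto
    have "has_bochner_integral lebesgue (indicator {real k / real K..<real (Suc k) / real K} :: real \<Rightarrow> real)
       (measure lebesgue {real k / real K..<real (Suc k) / real K})"
      by (rule has_bochner_integral_real_indicator) (simp_all add: emeasure_lborel_Ico[OF le] del: of_nat_Suc)
    moreover have "measure lebesgue {real k / real K..<real (Suc k) / real K} = 1 / real K"
      using K by (simp add: measure_completion measure_lborel_Ico[OF le] diff_divide_distrib[symmetric] del: of_nat_Suc)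
    ultimately show "has_bochner_integral lebesgue (indicator {real k / real K..<real (Suc k) / real K} :: real \<Rightarrow> real) (1 / real K)"
      by simp
  qed
  show "integrable lebesgue (\<lambda>x. indicator {0..1} x * stepf K c x)"
    and "(\<integral>x. indicator {0..1} x * stepf K c x \<partial>lebesgue) = (\<Sum>k<K. c k) / real K"
    unfolding sub using hb by (auto simp: has_bochner_integral_iff sum_divide_distrib)
qed

lemma unit_integral_stepf: "0 < K \<Longrightarrow> unit_integral (\<lambda>x. ereal (stepf K c x)) = ereal ((\<Sum>k<K. c k) / real K)"
  using unit_integral_real[OF integral_stepf(1), of K c] integral_stepf(2)[of K c] by simp

text \<open>The finitely many block boundaries are a null set, so the kinks of an interpolant can be
  ignored.\<close>

lemma AE_blocks:
  assumes K: "0 < K"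
    and P: "\<And>k x. k < K \<Longrightarrow> real k / real K < x \<Longrightarrow> x < real (Suc k) / real K \<Longrightarrow> P x"
  shows "AE x in lebesgue. x \<in> {0..1} \<longrightarrow> P x"
proof -
  define S where "S = (\<lambda>k. real k / real K) ` {0..K}"
  have "finite S" by (simp add: S_def)
  then have "S \<in> null_sets lebesgue"
    by (simp add: finite_imp_null_set_lborel null_sets_completionI)
  then have "AE x in lebesgue. x \<notin> S" by (rule AE_not_in)
  then show ?thesis
  proof eventually_elim
    case (elim x)
    show ?case
    proof
      assume x: "x \<in> {0..1}"
      have "x \<noteq> 1" using elim K by (auto simp: S_def image_iff dest!: bspec[of _ _ K])
      then obtain k where k: "k < K" "x \<in> {real k / real K..<real (Suc k) / real K}"
        using block_exists[OF K, of x] x by auto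
      have "x \<noteq> real k / real K" using elim k(1) by (auto simp: S_def)
      then show "P x" using P[OF k(1)] k(2) by auto
    qed
  qed
qed

section \<open>Piecewise linear interpolation of chains\<close>

definition pl :: "nat \<Rightarrow> (nat \<Rightarrow> real) \<Rightarrow> real \<Rightarrow> real" where
  "pl K t x = (let k = nat \<lfloor>real K * x\<rfloor> in t k + (real K * x - real k) * (t (Suc k) - t k))"

lemma pl_block:
  assumes "0 < K" "x \<in> {real k / real K..<real (Suc k) / real K}"
  shows "pl K t x = t k + (real K * x - real k) * (t (Suc k) - t k)"
  using block_unique[OF assms] by (simp add: pl_def)

lemma pl_end: "0 < K \<Longrightarrow> pl K t 1 = t K"
  by (simp add: pl_def)

lemma pl_block_bounds:
  assumes K: "0 < K" "x \<in> {real k / real K..<real (Suc k) / real K}" and t: "t k < t (Suc k)"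
  shows "t k \<le> pl K t x" "pl K t x < t (Suc k)"
proof -
  have u: "0 \<le> real K * x - real k" "real K * x - real k < 1" using K by (auto simp: field_simps)
  show "t k \<le> pl K t x" unfolding pl_block[OF K] using u t by simp
  have "(real K * x - real k) * (t (Suc k) - t k) < 1 * (t (Suc k) - t k)"
    using u t by (intro mult_strict_right_mono) auto
  then show "pl K t x < t (Suc k)" unfolding pl_block[OF K] by simp
qed

lemma pl_profile:
  assumes K: "0 < K" and t: "\<And>k. k < K \<Longrightarrow> t k < t (Suc k)" and a: "0 \<le> t 0"
  shows "pl K t \<in> profiles (t 0) (t K)"
proof -
  have mono: "t i \<le> t j" if "i \<le> j" "j \<le> K" for i j
    using that
  proof (induction j rule: dec_induct)
    case (step n)
    then show ?case using t[of n] by simp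
  qed simp
  have s: "pl K t x < pl K t y" if xy: "x \<in> {0..1}" "y \<in> {0..1}" "x < y" for x y
  proof -
    obtain k where k: "k < K" "x \<in> {real k / real K..<real (Suc k) / real K}"
      using block_exists[OF K, of x] xy by auto
    note kb = pl_block_bounds[OF K k(2) t[OF k(1)]]
    show ?thesis
    proof (cases "y = 1")
      case True
      then show ?thesis using kb mono[of "Suc k" K] k pl_end[OF K] by simp
    next
      case False
      then obtain l where l: "l < K" "y \<in> {real l / real K..<real (Suc l) / real K}"
        using block_exists[OF K, of y] xy by auto
      note lb = pl_block_bounds[OF K l(2) t[OF l(1)]]
      have "real k / real K < real (Suc l) / real K" using k l xy by (meson atLeastLessThan_iff le_less_trans less_trans)
      then have "k \<le> l" using K by (simp add: divide_less_cancel)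
      show ?thesis
      proof (cases "k = l")
        case True
        have "(real K * x - real k) * (t (Suc k) - t k) < (real K * y - real k) * (t (Suc k) - t k)"
          using t[OF k(1)] xy K by (intro mult_strict_right_mono) auto
        then show ?thesis using pl_block[OF K k(2)] pl_block[OF K l(2)] True by simp
      next
        case False
        then have "t (Suc k) \<le> t l" using \<open>k \<le> l\<close> l by (intro mono) auto
        then show ?thesis using kb lb by simp
      qed
    qed
  qed
  have 0: "pl K t 0 = t 0" using K by (simp add: pl_def)
  have "pl K t x \<ge> 0" if "x \<in> {0..1}" for x
    using s[of 0 x] that 0 a by (cases "x = 0") auto
  then show ?thesis
    using s 0 pl_end[OF K] by (auto simp: profiles_def strict_mono_on_def)
qed

lemma pl_deriv:
  assumes K: "0 < K" and x: "real k / real K < x" "x < real (Suc k) / real K"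
  shows "(pl K t has_real_derivative real K * (t (Suc k) - t k)) (at x)"
proof (rule has_field_derivative_transform_within_open[where S = "{real k / real K<..<real (Suc k) / real K}"])
  show "((\<lambda>x. t k + (real K * x - real k) * (t (Suc k) - t k)) has_real_derivative real K * (t (Suc k) - t k)) (at x)"
    by (auto intro!: derivative_eq_intros)
  show "t k + (real K * y - real k) * (t (Suc k) - t k) = pl K t y" if "y \<in> {real k / real K<..<real (Suc k) / real K}" for y
    using pl_block[OF K, of y k t] that by auto
qed (use x in auto)

text \<open>On a block the interpolant has constant slope, so its cost is exactly the discrete one;
  only the local pressure is approximated, with the errors of \<open>level_compare\<close>. This
  bounds the discrete functional of a chain by the supremum over profiles.\<close>

lemma value_pl:
  fixes h :: "real \<Rightarrow> real"
  assumes s: "0 < s" and a: "0 \<le> a" "a < b" and c0: "0 < c0" and C: "0 \<le> C" and K: "0 < K"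
    and t: "t 0 = a" "t K = b" "\<And>k. k < K \<Longrightarrow> t k < t (Suc k)" "\<And>k. k < K \<Longrightarrow> t (Suc k) \<le> cutoff k"
    and cutoff: "\<And>k. k < K \<Longrightarrow> cutoff k \<le> b"
    and A: "\<And>k x \<theta>. k < K \<Longrightarrow> x \<in> {0..1} \<Longrightarrow> \<bar>x - real k / real K\<bar> \<le> 1 / real K \<Longrightarrow> a \<le> \<theta> \<Longrightarrow> \<theta> \<le> cutoff k \<Longrightarrow> c0 \<le> level h x \<theta>"
    and v: "\<And>k x. k < K \<Longrightarrow> x \<in> {0..1} \<Longrightarrow> \<bar>x - real k / real K\<bar> \<le> 1 / real K \<Longrightarrow>
        \<bar>exp (h x) - exp (h (real k / real K))\<bar> * b \<le> w * c0"
    and V: "\<And>x. x \<in> {0..1} \<Longrightarrow> \<bar>1 - exp (h x)\<bar> \<le> C * c0"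
  shows "ereal (2 * s * (\<Sum>k<K. ln (real K * (t (Suc k) - t k) / (b - a)) - ln (level h (real k / real K) (t (Suc k)))
        - w - C * (t (Suc k) - t k)) / real K)
     \<le> local_pressure s h (pl K t) - profile_cost s a b (pl K t)"
proof -
  define c where "c k = - ln (level h (real k / real K) (t (Suc k))) - w - C * (t (Suc k) - t k)" for k
  define d where "d k = ln (real K * (t (Suc k) - t k) / (b - a))" for k
  have tge: "k \<le> K \<Longrightarrow> a \<le> t k" for k
  proof (induction k)
    case (Suc k)
    then show ?case using t(3)[of k] by simp
  qed (simp add: t)
  have kK: "real k / real K \<in> {0..1}" if "k < K" for k using that by auto
  have near: "x \<in> {0..1} \<and> \<bar>x - real k / real K\<bar> \<le> 1 / real K"
    if "k < K" "real k / real K < x" "x < real (Suc k) / real K" for k x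
  proof -
    have "real (Suc k) / real K \<le> 1" "0 \<le> real k / real K" using that(1) by (auto simp: divide_le_eq)
    moreover have "real (Suc k) / real K = real k / real K + 1 / real K" by (simp add: add_divide_distrib)
    ultimately have "0 \<le> x" "x \<le> 1" "0 \<le> x - real k / real K" "x - real k / real K \<le> 1 / real K"
      using that(2,3) by linarith+
    then show ?thesis by simp
  qed
  have P: "ereal ((\<Sum>k<K. c k) / real K) \<le> unit_integral (\<lambda>x. - ereal_ln (ereal (1 + (1 - exp (h x)) * pl K t x)))"
    unfolding unit_integral_stepf[OF K, symmetric]
  proof (rule unit_integral_mono_AE, rule AE_blocks[OF K])
    fix k x assume k: "k < K" and x: "real k / real K < x" "x < real (Suc k) / real K"
    have xb: "x \<in> {real k / real K..<real (Suc k) / real K}" using x by auto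
    note pb = pl_block_bounds[OF K xb t(3)[OF k]]
    have nx: "x \<in> {0..1}" "\<bar>x - real k / real K\<bar> \<le> 1 / real K" using near[OF k x] by auto
    have A1: "c0 \<le> level h x (pl K t x)"
      using A[OF k nx, of "pl K t x"] pb t(4)[OF k] tge[of k] k by simp
    have A2: "c0 \<le> level h (real k / real K) (t (Suc k))"
      using A[OF k kK[OF k], of "t (Suc k)"] t(4)[OF k] tge[of "Suc k"] k by simp
    have "\<bar>ln (level h x (pl K t x)) - ln (level h (real k / real K) (t (Suc k)))\<bar> \<le> w + C * (t (Suc k) - pl K t x)"
      using pb a tge[of k] k t(4)[OF k] cutoff[OF k] s
      by (intro level_compare[where r = s, OF _ c0 _ _ _ A1 A2 v[OF k nx] V[OF nx(1)]]) auto
    also have "\<dots> \<le> w + C * (t (Suc k) - t k)" using pb C by (auto intro!: mult_left_mono)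
    finally have "c k \<le> - ln (level h x (pl K t x))" unfolding c_def by linarith
    then show "ereal (stepf K c x) \<le> - ereal_ln (ereal (1 + (1 - exp (h x)) * pl K t x))"
      using A1 c0 stepf_eq[OF K k xb, of c] by (simp add: ereal_ln_def level_def)
  qed
  have J: "ereal ((\<Sum>k<K. d k) / real K) \<le> unit_integral
      (\<lambda>x. if pl K t differentiable (at x) then ereal_ln (ereal (deriv (pl K t) x / (b - a))) else - \<infinity>)"
    unfolding unit_integral_stepf[OF K, symmetric]
  proof (rule unit_integral_mono_AE, rule AE_blocks[OF K])
    fix k x assume k: "k < K" and x: "real k / real K < x" "x < real (Suc k) / real K"
    have xb: "x \<in> {real k / real K..<real (Suc k) / real K}" using x by auto
    note D = pl_deriv[OF K x, of t]
    have "pl K t differentiable (at x)" using D by (meson real_differentiable_def)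
    moreover have "deriv (pl K t) x = real K * (t (Suc k) - t k)" using D by (rule DERIV_imp_deriv)
    moreover have "0 < real K * (t (Suc k) - t k) / (b - a)" using K t(3)[OF k] a by simp
    ultimately show "ereal (stepf K d x) \<le> (if pl K t differentiable (at x) then ereal_ln (ereal (deriv (pl K t) x / (b - a))) else - \<infinity>)"
      using stepf_eq[OF K k xb, of d] by (simp add: ereal_ln_def d_def)
  qed
  have "ereal (2 * s * (\<Sum>k<K. d k + c k) / real K) = ereal (2 * s) * ereal ((\<Sum>k<K. c k) / real K) + ereal (2 * s) * ereal ((\<Sum>k<K. d k) / real K)"
    by (simp add: sum.distrib algebra_simps add_divide_distrib)
  also have "\<dots> \<le> local_pressure s h (pl K t) - profile_cost s a b (pl K t)"
    unfolding local_pressure_def profile_cost_def minus_ereal_def ereal_uminus_uminus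
    using s by (intro add_mono ereal_mult_left_mono P J) auto
  finally show ?thesis by (simp add: c_def d_def algebra_simps)
qed

text \<open>Fatou's lemma for the difference quotients; no differentiability almost everywhere is needed.\<close>

lemma mono_derivative_integral:
  fixes f :: "real \<Rightarrow> real"
  assumes pq: "p < q" and f: "mono_on {p..q} f"
  obtains g :: "real \<Rightarrow> ennreal" where "g \<in> borel_measurable borel"
    "\<And>x. p < x \<Longrightarrow> x < q \<Longrightarrow> f differentiable (at x) \<Longrightarrow> g x = ennreal (deriv f x)"
    "(\<integral>\<^sup>+ x. g x * indicator {p..q} x \<partial>lborel) \<le> ennreal (f q - f p)"
proof
  \<comment> \<open>f is frozen outside [p, q], so that difference quotients are defined up to the
    right end and F stays monotone, hence measurable.\<close>
  define F where "F x = f (max p (min q x)) - f p" for x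
  have cl: "max p (min q x) \<in> {p..q}" for x using pq by auto
  have Fmono: "mono F"
    unfolding F_def using f pq by (intro monoI) (auto intro!: mono_onD[OF f])
  have Fm [measurable]: "F \<in> borel_measurable borel" by (rule borel_measurable_mono[OF Fmono])
  have F0: "0 \<le> F x" "F x \<le> f q - f p" for x
    unfolding F_def using cl[of x] pq by (auto intro!: mono_onD[OF f])
  define t where "t n = 1 / real (Suc n)" for n
  have t0: "0 < t n" for n by (simp add: t_def)
  define D where "D n x = ennreal ((F (x + t n) - F x) / t n)" for n x
  have Dm [measurable]: "D n \<in> borel_measurable borel" for n unfolding D_def by measurable
  define g where "g x = liminf (\<lambda>n. D n x)" for x
  show gm: "g \<in> borel_measurable borel" unfolding g_def by measurable
  show "g x = ennreal (deriv f x)" if x: "p < x" "x < q" "f differentiable (at x)" for x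
  proof -
    have "(f has_real_derivative deriv f x) (at x)"
      using x(3) by (simp add: DERIV_deriv_iff_real_differentiable)
    then have "((\<lambda>h. (f (x + h) - f x) / h) \<longlongrightarrow> deriv f x) (at 0)" by (simp add: DERIV_def)
    moreover have "filterlim t (at 0) sequentially"
    proof -
      have "t \<longlonglongrightarrow> 0" using LIMSEQ_inverse_real_of_nat by (simp add: t_def[abs_def] inverse_eq_divide)
      then show ?thesis using t0 by (auto simp: filterlim_at less_imp_neq[symmetric] intro!: always_eventually)
    qed
    ultimately have "(\<lambda>n. (f (x + t n) - f x) / t n) \<longlonglongrightarrow> deriv f x" by (rule filterlim_compose)
    moreover have "\<forall>\<^sub>F n in sequentially. (f (x + t n) - f x) / t n = (F (x + t n) - F x) / t n"
    proof -
      have "t \<longlonglongrightarrow> 0" using LIMSEQ_inverse_real_of_nat by (simp add: t_def[abs_def] inverse_eq_divide)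
      then have "\<forall>\<^sub>F n in sequentially. t n < q - x" using x by (intro order_tendstoD) auto
      then show ?thesis
      proof eventually_elim
        case (elim n)
        then show ?case using x t0[of n] by (simp add: F_def)
      qed
    qed
    ultimately have "(\<lambda>n. (F (x + t n) - F x) / t n) \<longlonglongrightarrow> deriv f x" by (rule Lim_transform_eventually)
    then have "(\<lambda>n. D n x) \<longlonglongrightarrow> ennreal (deriv f x)" unfolding D_def by (rule tendsto_ennrealI)
    then show ?thesis unfolding g_def by (intro lim_imp_Liminf) auto
  qed
  have bound: "(\<integral>\<^sup>+ x. D n x * indicator {p..q} x \<partial>lborel) \<le> ennreal (f q - f p)" for n
  proof -
    define u where "u = (\<integral>\<^sup>+ x. ennreal (F x) * indicator {p..q} x \<partial>lborel)"
    define v where "v = (\<integral>\<^sup>+ x. ennreal (F (x + t n)) * indicator {p..q} x \<partial>lborel)"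
    have fq: "0 \<le> f q - f p" using F0[of q] by linarith
    have u_fin: "u \<noteq> \<infinity>"
    proof -
      have "u \<le> (\<integral>\<^sup>+ x. ennreal (f q - f p) * indicator {p..q} x \<partial>lborel)"
        unfolding u_def using F0 by (intro nn_integral_mono mult_right_mono ennreal_leI) auto
      also have "\<dots> = ennreal (f q - f p) * ennreal (q - p)" using pq by (subst nn_integral_cmult) auto
      finally show ?thesis by (auto simp: top_unique ennreal_mult_eq_top_iff)
    qed
    \<comment> \<open>After the shift by t n, the excess of v over u comes from a strip of width t n
      to the right of q, where F is at most f q - f p.\<close>
    have "v = (\<integral>\<^sup>+ x. ennreal (F x) * indicator {p + t n..q + t n} x \<partial>lborel)"
      unfolding v_def
      by (subst (2) nn_integral_real_affine[where c = 1 and t = "t n"]) (auto intro!: nn_integral_cong simp: indicator_def add.commute)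
    also have "\<dots> \<le> (\<integral>\<^sup>+ x. ennreal (F x) * indicator {p..q} x + ennreal (f q - f p) * indicator {q<..q + t n} x \<partial>lborel)"
      using F0 t0[of n] by (intro nn_integral_mono) (auto simp: indicator_def intro!: ennreal_leI)
    also have "\<dots> = u + ennreal (f q - f p) * ennreal (t n)"
      unfolding u_def using t0[of n] by (subst nn_integral_add) (auto simp: nn_integral_cmult)
    finally have vu: "v \<le> u + ennreal (f q - f p) * ennreal (t n)" .
    have "(\<integral>\<^sup>+ x. D n x * indicator {p..q} x \<partial>lborel)
       = (\<integral>\<^sup>+ x. ennreal (1 / t n) * (ennreal (F (x + t n)) * indicator {p..q} x - ennreal (F x) * indicator {p..q} x) \<partial>lborel)"
    proof (intro nn_integral_cong)
      fix x
      have "F x \<le> F (x + t n)" using Fmono t0[of n] by (simp add: monoD)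
      then show "D n x * indicator {p..q} x = ennreal (1 / t n) * (ennreal (F (x + t n)) * indicator {p..q} x - ennreal (F x) * indicator {p..q} x)"
        using F0 t0[of n] by (auto simp: D_def indicator_def ennreal_minus simp flip: ennreal_mult)
    qed
    also have "\<dots> = ennreal (1 / t n) * (\<integral>\<^sup>+ x. ennreal (F (x + t n)) * indicator {p..q} x - ennreal (F x) * indicator {p..q} x \<partial>lborel)"
      by (rule nn_integral_cmult) measurable
    also have "(\<integral>\<^sup>+ x. ennreal (F (x + t n)) * indicator {p..q} x - ennreal (F x) * indicator {p..q} x \<partial>lborel) = v - u"
      unfolding u_def v_def using u_fin Fmono t0[of n]
      by (intro nn_integral_diff) (auto simp: u_def indicator_def intro!: ennreal_leI monoD[OF Fmono])
    also have "ennreal (1 / t n) * (v - u) \<le> ennreal (1 / t n) * (ennreal (f q - f p) * ennreal (t n))"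
      using vu u_fin by (intro mult_left_mono) (auto simp: ennreal_minus_le_iff add.commute)
    also have "\<dots> = ennreal (f q - f p)"
      using t0[of n] fq by (simp flip: ennreal_mult)
    finally show ?thesis .
  qed
  have "(\<integral>\<^sup>+ x. g x * indicator {p..q} x \<partial>lborel) = (\<integral>\<^sup>+ x. liminf (\<lambda>n. D n x * indicator {p..q} x) \<partial>lborel)"
    unfolding g_def by (intro nn_integral_cong) (auto simp: indicator_def Liminf_const)
  also have "\<dots> \<le> liminf (\<lambda>n. \<integral>\<^sup>+ x. D n x * indicator {p..q} x \<partial>lborel)"
    by (rule nn_integral_liminf) measurable
  also have "\<dots> \<le> ennreal (f q - f p)"
    using bound by (intro Liminf_le) (auto intro: always_eventually)
  finally show "(\<integral>\<^sup>+ x. g x * indicator {p..q} x \<partial>lborel) \<le> ennreal (f q - f p)" .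
qed

text \<open>On each block the logarithm of \<open>\<theta>'\<close> is replaced by its tangent line at the mean slope of the block.\<close>

lemma value_profile_upper:
  fixes g h :: "real \<Rightarrow> real"
  assumes s: "0 < s" and a: "0 \<le> a" "a < b" and c0: "0 < c0" and C: "0 \<le> C" and K: "0 < K"
    and \<theta>: "\<theta> \<in> profiles a b"
    and A: "\<And>x \<theta>. x \<in> {0..1} \<Longrightarrow> a \<le> \<theta> \<Longrightarrow> \<theta> \<le> b \<Longrightarrow> c0 \<le> level g x \<theta>"
    and v: "\<And>k x. k < K \<Longrightarrow> x \<in> {0..1} \<Longrightarrow> \<bar>x - real k / real K\<bar> \<le> 1 / real K \<Longrightarrow>
        \<bar>exp (g x) - exp (g (real k / real K))\<bar> * b \<le> w * c0"
    and V: "\<And>x. x \<in> {0..1} \<Longrightarrow> \<bar>1 - exp (g x)\<bar> \<le> C * c0"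
    and gh: "\<And>x. 0 \<le> x \<Longrightarrow> x < 1 \<Longrightarrow> 0 < level h x (\<theta> x)"
      "\<And>x. 0 \<le> x \<Longrightarrow> x < 1 \<Longrightarrow> - ln (level h x (\<theta> x)) \<le> - ln (level g x (\<theta> x)) + \<kappa>"
  defines "t \<equiv> \<lambda>k. \<theta> (real k / real K)"
  shows "local_pressure s h \<theta> - profile_cost s a b \<theta>
     \<le> ereal (2 * s * (((\<Sum>k<K. ln (real K * (t (Suc k) - t k) / (b - a)) - ln (level g (real k / real K) (t (Suc k)))
        + w + C * (t (Suc k) - t k))) / real K + \<kappa>))"
proof -
  define c where "c k = - ln (level g (real k / real K) (t (Suc k))) + w + C * (t (Suc k) - t k) + \<kappa>" for k
  define m where "m k = real K * (t (Suc k) - t k) / (b - a)" for k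
  have mono: "x \<in> {0..1} \<Longrightarrow> y \<in> {0..1} \<Longrightarrow> x < y \<Longrightarrow> \<theta> x < \<theta> y" for x y
    using \<theta> by (auto simp: profiles_def strict_mono_on_def)
  have monole: "x \<in> {0..1} \<Longrightarrow> y \<in> {0..1} \<Longrightarrow> x \<le> y \<Longrightarrow> \<theta> x \<le> \<theta> y" for x y
    using mono[of x y] by (cases "x = y") auto
  have ends: "\<theta> 0 = a" "\<theta> 1 = b" using \<theta> by (auto simp: profiles_def)
  have range: "a \<le> \<theta> x" "\<theta> x \<le> b" if "x \<in> {0..1}" for x
    using monole[of 0 x] monole[of x 1] that ends by auto
  have kK: "real k / real K \<in> {0..1}" "real (Suc k) / real K \<in> {0..1}" "real k / real K < real (Suc k) / real K" if "k < K" for k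
    using that by (auto simp: divide_le_eq divide_strict_right_mono)
  have dt: "t k < t (Suc k)" if "k < K" for k unfolding t_def using kK[OF that] by (intro mono)
  have m: "0 < m k" if "k < K" for k using dt[OF that] K a by (simp add: m_def)
  have near: "x \<in> {0..1} \<and> \<bar>x - real k / real K\<bar> \<le> 1 / real K"
    if "k < K" "real k / real K < x" "x < real (Suc k) / real K" for k x
  proof -
    have "real (Suc k) / real K \<le> 1" "0 \<le> real k / real K" using that(1) by (auto simp: divide_le_eq)
    moreover have "real (Suc k) / real K = real k / real K + 1 / real K" by (simp add: add_divide_distrib)
    ultimately have "0 \<le> x" "x \<le> 1" "0 \<le> x - real k / real K" "x - real k / real K \<le> 1 / real K"
      using that(2,3) by linarith+
    then show ?thesis by simp
  qed
  have P: "unit_integral (\<lambda>x. - ereal_ln (ereal (1 + (1 - exp (h x)) * \<theta> x))) \<le> ereal ((\<Sum>k<K. c k) / real K)"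
    unfolding unit_integral_stepf[OF K, symmetric]
  proof (rule unit_integral_mono_AE, rule AE_blocks[OF K])
    fix k x assume k: "k < K" and x: "real k / real K < x" "x < real (Suc k) / real K"
    have xb: "x \<in> {real k / real K..<real (Suc k) / real K}" using x by auto
    have nx: "x \<in> {0..1}" "\<bar>x - real k / real K\<bar> \<le> 1 / real K" using near[OF k x] by auto
    have x1: "x < 1" using x(2) kK(2)[OF k] by auto
    have th: "t k \<le> \<theta> x" "\<theta> x \<le> t (Suc k)" unfolding t_def using nx kK[OF k] x by (auto intro!: monole simp del: of_nat_Suc)
    have tb: "a \<le> t (Suc k)" "t (Suc k) \<le> b" unfolding t_def using range kK(2)[OF k] by auto
    have A1: "c0 \<le> level g x (\<theta> x)" using A nx range by blast
    have A2: "c0 \<le> level g (real k / real K) (t (Suc k))" using A[OF kK(1)[OF k] tb] .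
    have "\<bar>ln (level g x (\<theta> x)) - ln (level g (real k / real K) (t (Suc k)))\<bar> \<le> w + C * (t (Suc k) - \<theta> x)"
      using a range[OF nx(1)] s
      by (intro level_compare[where r = s, OF _ c0 _ th(2) tb(2) A1 A2 v[OF k nx] V[OF nx(1)]]) auto
    also have "\<dots> \<le> w + C * (t (Suc k) - t k)" using th C by (auto intro!: mult_left_mono)
    finally have "- ln (level h x (\<theta> x)) \<le> c k" unfolding c_def using gh(2)[of x] nx x1 by auto
    then show "- ereal_ln (ereal (1 + (1 - exp (h x)) * \<theta> x)) \<le> ereal (stepf K c x)"
      using gh(1)[of x] nx x1 stepf_eq[OF K k xb, of c] by (simp add: ereal_ln_def level_def)
  qed
  define blkset where "blkset k = {real k / real K..<real (Suc k) / real K}" for k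
  have "\<exists>g. g \<in> borel_measurable borel \<and>
      (\<forall>x. real k / real K < x \<longrightarrow> x < real (Suc k) / real K \<longrightarrow> \<theta> differentiable (at x) \<longrightarrow> g x = ennreal (deriv \<theta> x)) \<and>
      (\<integral>\<^sup>+ x. g x * indicator {real k / real K..real (Suc k) / real K} x \<partial>lborel) \<le> ennreal (t (Suc k) - t k)"
    if k: "k < K" for k
  proof -
    have sub: "{real k / real K..real (Suc k) / real K} \<subseteq> {0..1}"
      using kK(1,2)[OF k] by (simp only: atLeastatMost_subset_iff atLeastAtMost_iff) blast
    have "mono_on {real k / real K..real (Suc k) / real K} \<theta>"
      by (intro mono_onI monole) (use sub in blast)+
    from mono_derivative_integral[OF kK(3)[OF k] this]
    show ?thesis unfolding t_def by metis
  qed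
  then obtain gg where gg: "\<And>k. k < K \<Longrightarrow> gg k \<in> borel_measurable borel"
      "\<And>k x. k < K \<Longrightarrow> real k / real K < x \<Longrightarrow> x < real (Suc k) / real K \<Longrightarrow> \<theta> differentiable (at x) \<Longrightarrow> gg k x = ennreal (deriv \<theta> x)"
      "\<And>k. k < K \<Longrightarrow> (\<integral>\<^sup>+ x. gg k x * indicator {real k / real K..real (Suc k) / real K} x \<partial>lborel) \<le> ennreal (t (Suc k) - t k)"
    by metis
  \<comment> \<open>A measurable stand-in for \<theta>' on block k. Where \<theta> is not
    differentiable it may be arbitrary, since the integrand of the cost is - \<infinity>
    there.\<close>
  define H where "H k x = enn2real (gg k x) * indicator (blkset k) x" for k x
  have Hint: "integrable lebesgue (H k)" "(\<integral>x. H k x \<partial>lebesgue) \<le> t (Suc k) - t k" if k: "k < K" for k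
  proof -
    have [measurable]: "gg k \<in> borel_measurable borel" using gg(1)[OF k] .
    have [measurable]: "H k \<in> borel_measurable borel" unfolding H_def blkset_def by measurable
    have le: "(\<integral>\<^sup>+ x. ennreal (H k x) \<partial>lborel) \<le> ennreal (t (Suc k) - t k)"
    proof (rule order_trans[OF nn_integral_mono gg(3)[OF k]])
      fix x
      show "ennreal (H k x) \<le> gg k x * indicator {real k / real K..real (Suc k) / real K} x"
        by (cases "gg k x") (auto simp: H_def blkset_def indicator_def)
    qed
    have pos: "0 \<le> H k x" for x by (simp add: H_def)
    have i: "integrable lborel (H k)"
      using le by (intro integrableI_nonneg) (auto simp: pos intro: le_less_trans)
    then show "integrable lebesgue (H k)" by (rule integrable_completion[THEN iffD2, rotated]) simp
    have "(\<integral>x. H k x \<partial>lebesgue) = (\<integral>x. H k x \<partial>lborel)" by (rule integral_completion) simp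
    also have "\<dots> = enn2real (\<integral>\<^sup>+ x. ennreal (H k x) \<partial>lborel)"
      by (intro integral_eq_nn_integral) (auto simp: pos)
    also have "\<dots> \<le> enn2real (ennreal (t (Suc k) - t k))" using le by (intro enn2real_mono) auto
    finally show "(\<integral>x. H k x \<partial>lebesgue) \<le> t (Suc k) - t k" using dt[OF k] by simp
  qed
  \<comment> \<open>The slope relative to the mean slope of the block, which is the linear part of
    the tangent ln z \<le> ln m + z / m - 1. As \<theta>' integrates to at most the increment, G
    integrates to at most 1 and is compensated by the -1.\<close>
  define G where "G x = (\<Sum>k<K. H k x / (m k * (b - a)))" for x
  have Gint: "integrable lebesgue G" unfolding G_def using Hint(1) by (intro Bochner_Integration.integrable_sum) auto
  have Gle: "(\<integral>x. G x \<partial>lebesgue) \<le> 1"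
  proof -
    have "(\<integral>x. G x \<partial>lebesgue) = (\<Sum>k<K. (\<integral>x. H k x \<partial>lebesgue) / (m k * (b - a)))"
      unfolding G_def using Hint(1) by (subst Bochner_Integration.integral_sum) auto
    also have "\<dots> \<le> (\<Sum>k<K. (t (Suc k) - t k) / (m k * (b - a)))"
      using Hint(2) m a by (intro sum_mono divide_right_mono) (auto intro!: mult_nonneg_nonneg less_imp_le)
    also have "\<dots> = (\<Sum>k<K. 1 / real K)"
    proof (intro sum.cong refl)
      fix k assume "k \<in> {..<K}"
      then have d: "t (Suc k) - t k \<noteq> 0" using dt[of k] by simp
      show "(t (Suc k) - t k) / (m k * (b - a)) = 1 / real K" using d a by (simp add: m_def)
    qed
    also have "\<dots> = 1" using K by simp
    finally show ?thesis .
  qed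
  have Hout: "H k x = 0" if "k < K" "x \<notin> {0..1}" for k x
  proof -
    have "x \<notin> blkset k"
    proof
      assume "x \<in> blkset k"
      then have "real k / real K \<le> x" "x < real (Suc k) / real K" by (auto simp: blkset_def)
      moreover have "0 \<le> real k / real K" "real (Suc k) / real K \<le> 1" using kK(1,2)[OF that(1)] by auto
      ultimately have "0 \<le> x" "x \<le> 1" by linarith+
      with that(2) show False by simp
    qed
    then show ?thesis by (simp add: H_def)
  qed
  have Gout: "indicator {0..1} x * G x = G x" for x
  proof (cases "x \<in> {0..1}")
    case False
    then show ?thesis using Hout[OF _ False] by (simp add: G_def)
  qed simp
  define \<phi> where "\<phi> x = stepf K (\<lambda>k. ln (m k) - 1) x + G x" for x
  have \<phi>split: "(\<lambda>x. indicator {0..1} x * \<phi> x) = (\<lambda>x. indicator {0..1} x * stepf K (\<lambda>k. ln (m k) - 1) x + G x)"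
    by (rule ext) (simp only: \<phi>_def distrib_left Gout)
  have \<phi>int: "integrable lebesgue (\<lambda>x. indicator {0..1} x * \<phi> x)"
    unfolding \<phi>split by (intro Bochner_Integration.integrable_add integral_stepf K Gint)
  have "unit_integral (\<lambda>x. if \<theta> differentiable (at x) then ereal_ln (ereal (deriv \<theta> x / (b - a))) else - \<infinity>)
     \<le> unit_integral (\<lambda>x. ereal (\<phi> x))"
  proof (rule unit_integral_mono_AE, rule AE_blocks[OF K])
    fix k x assume k: "k < K" and x: "real k / real K < x" "x < real (Suc k) / real K"
    have xb: "x \<in> {real k / real K..<real (Suc k) / real K}" using x by auto
    show "(if \<theta> differentiable (at x) then ereal_ln (ereal (deriv \<theta> x / (b - a))) else - \<infinity>) \<le> ereal (\<phi> x)"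
    proof (cases "\<theta> differentiable (at x) \<and> 0 < deriv \<theta> x")
      case True
      define z where "z = deriv \<theta> x / (b - a)"
      have z: "0 < z" using True a by (simp add: z_def)
      have "H k x / (m k * (b - a)) \<le> G x"
        unfolding G_def
      proof (rule member_le_sum)
        show "0 \<le> H i x / (m i * (b - a))" if "i \<in> {..<K} - {k}" for i using m[of i] that a by (simp add: H_def)
      qed (use k in auto)
      moreover have "H k x = deriv \<theta> x"
        using gg(2)[OF k x] True xb by (simp add: H_def blkset_def)
      ultimately have "z / m k \<le> G x" by (simp add: z_def mult.commute)
      moreover have "ln z = ln (m k) + ln (z / m k)" using z m[OF k] by (simp add: ln_div)
      moreover have "ln (z / m k) \<le> z / m k - 1" using z m[OF k] by (intro ln_le_minus_one) simp
      ultimately have "ln z \<le> \<phi> x" using stepf_eq[OF K k xb, of "\<lambda>k. ln (m k) - 1"] by (simp add: \<phi>_def)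
      then show ?thesis using True z by (simp add: ereal_ln_def z_def[symmetric])
    next
      case False
      then have "\<not> \<theta> differentiable (at x) \<or> deriv \<theta> x / (b - a) \<le> 0" using a by (auto simp: divide_le_0_iff)
      then show ?thesis by (auto simp: ereal_ln_def)
    qed
  qed
  also have "unit_integral (\<lambda>x. ereal (\<phi> x)) = ereal ((\<Sum>k<K. ln (m k) - 1) / real K + (\<integral>x. G x \<partial>lebesgue))"
    unfolding unit_integral_real[OF \<phi>int] \<phi>split
    by (subst Bochner_Integration.integral_add) (auto simp: integral_stepf K Gint)
  also have "\<dots> \<le> ereal ((\<Sum>k<K. ln (m k)) / real K)"
    using Gle K by (simp add: sum_subtractf diff_divide_distrib)
  finally have J: "unit_integral (\<lambda>x. if \<theta> differentiable (at x) then ereal_ln (ereal (deriv \<theta> x / (b - a))) else - \<infinity>)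
     \<le> ereal ((\<Sum>k<K. ln (m k)) / real K)" .
  have "local_pressure s h \<theta> - profile_cost s a b \<theta> \<le> ereal (2 * s) * ereal ((\<Sum>k<K. c k) / real K) + ereal (2 * s) * ereal ((\<Sum>k<K. ln (m k)) / real K)"
    unfolding local_pressure_def profile_cost_def minus_ereal_def ereal_uminus_uminus
    using s by (intro add_mono ereal_mult_left_mono P J) auto
  also have "\<dots> = ereal (2 * s * ((\<Sum>k<K. c k) / real K + (\<Sum>k<K. ln (m k)) / real K))"
    by (simp add: distrib_left)
  also have "(\<Sum>k<K. c k) / real K + (\<Sum>k<K. ln (m k)) / real K
     = ((\<Sum>k<K. ln (m k) - ln (level g (real k / real K) (t (Suc k))) + w + C * (t (Suc k) - t k))) / real K + \<kappa>"
    using K by (simp add: c_def sum.distrib sum_subtractf sum_negf add_divide_distrib diff_divide_distrib)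
  finally show ?thesis by (simp add: m_def)
qed

section \<open>Matching exponential bounds\<close>

lemma chain_mono:
  assumes "\<And>j y. 0 \<le> y \<Longrightarrow> M j y \<le> M' j y" "0 \<le> x"
  shows "chain r b M n j x \<le> chain r b M' n j x"
  using assms(2)
proof (induction n arbitrary: j x)
  case (Suc n)
  have "kap r x y * M j y * chain r b M n (Suc j) y \<le> kap r x y * M' j y * chain r b M' n (Suc j) y" for y
    using Suc assms(1)[of y j] by (cases "x < y") (auto simp: kap_eq_0 intro!: mult_mono)
  then show ?case by (simp add: nn_integral_mono)
qed simp

text \<open>At the critical value of h the level is exactly 1 - \<theta> / b, and lowering h raises
  it.\<close>

lemma critical_level:
  assumes b: "0 < b" and h: "h x \<le> ln (1 + 1 / b)" and \<theta>: "0 \<le> \<theta>"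
  shows "1 - \<theta> / b \<le> level h x \<theta>"
proof -
  have "exp (h x) \<le> 1 + 1 / b" using h b by (simp add: ln_ge_iff[symmetric] add_pos_pos)
  then have "(exp (h x) - 1) * \<theta> \<le> (1 / b) * \<theta>" using \<theta> by (intro mult_right_mono) auto
  then show ?thesis by (simp add: level_def algebra_simps)
qed

text \<open>Near 1, h stays below some c' that is still subcritical. The level for c' is affine in
  \<theta>, so its minimum over [0, b] is attained at \<theta> = 0 or at \<theta> = b.\<close>

lemma end_level:
  fixes h :: "real \<Rightarrow> real"
  assumes h: "continuous_on {0..1} h" and b: "0 < b" and h1: "h 1 < ln (1 + 1 / b)"
  obtains \<delta> c where "0 < \<delta>" "\<delta> < 1" "0 < c"
    "\<And>x \<theta>. 1 - \<delta> \<le> x \<Longrightarrow> x \<le> 1 \<Longrightarrow> 0 \<le> \<theta> \<Longrightarrow> \<theta> \<le> b \<Longrightarrow> c \<le> level h x \<theta>"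
proof -
  obtain c' where c': "h 1 < c'" "c' < ln (1 + 1 / b)" using dense[OF h1] by blast
  have "\<exists>d>0. \<forall>x\<in>{0..1}. dist x 1 < d \<longrightarrow> dist (h x) (h 1) < c' - h 1"
    using h c' unfolding continuous_on_iff by (meson atLeastAtMost_iff diff_gt_0_iff_gt order_refl zero_le_one)
  then obtain d where d: "0 < d" "\<And>x. x \<in> {0..1} \<Longrightarrow> dist x 1 < d \<Longrightarrow> dist (h x) (h 1) < c' - h 1" by blast
  have E: "exp c' < 1 + 1 / b"
    using c'(2) b exp_less_mono[OF c'(2)] by (simp add: add_pos_pos)
  define c where "c = min 1 (1 + (1 - exp c') * b)"
  have "0 < 1 + (1 - exp c') * b" using E b by (simp add: field_simps)
  then have c: "0 < c" by (simp add: c_def)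
  show thesis
  proof (rule that[of "min (d / 2) (1 / 2)" c])
    show "0 < min (d / 2) (1 / 2)" "min (d / 2) (1 / 2) < 1" using d by auto
    show "0 < c" by (rule c)
    fix x \<theta> :: real assume x: "1 - min (d / 2) (1 / 2) \<le> x" "x \<le> 1" and \<theta>: "0 \<le> \<theta>" "\<theta> \<le> b"
    have "x \<in> {0..1}" "dist x 1 < d" using x d(1) by (auto simp: dist_real_def)
    then have "dist (h x) (h 1) < c' - h 1" by (rule d(2))
    then have "exp (h x) \<le> exp c'" by (simp add: dist_real_def)
    then have l: "1 + (1 - exp c') * \<theta> \<le> level h x \<theta>"
      using \<theta> unfolding level_def by (intro add_left_mono mult_right_mono) auto
    have "c \<le> 1 + (1 - exp c') * \<theta>"
    proof (cases "1 - exp c' \<ge> 0")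
      case True
      then have "0 \<le> (1 - exp c') * \<theta>" using \<theta> by simp
      then show ?thesis by (simp add: c_def)
    next
      case False
      then have "(1 - exp c') * b \<le> (1 - exp c') * \<theta>" using \<theta> by (intro mult_left_mono_neg) auto
      then show ?thesis by (simp add: c_def)
    qed
    then show "c \<le> level h x \<theta>" using l by linarith
  qed
qed

lemma continuity_moduli:
  fixes h :: "real \<Rightarrow> real"
  assumes h: "continuous_on {0..1} h" and b: "0 < b" and c0: "0 < c0" and w: "0 < w"
  obtains C K0 where "0 \<le> C" "\<And>x. x \<in> {0..1} \<Longrightarrow> \<bar>1 - exp (h x)\<bar> \<le> C * c0"
    "\<And>K k x. K0 \<le> K \<Longrightarrow> 0 < K \<Longrightarrow> k < K \<Longrightarrow> x \<in> {0..1} \<Longrightarrow> \<bar>x - real k / real K\<bar> \<le> 1 / real K \<Longrightarrow>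
        \<bar>exp (h x) - exp (h (real k / real K))\<bar> * b \<le> w * c0"
proof -
  have c: "continuous_on {0..1} (\<lambda>x. exp (h x))" by (intro continuous_intros h)
  have "bounded ((\<lambda>x. 1 - exp (h x)) ` {0..1})"
    by (intro compact_imp_bounded compact_continuous_image continuous_intros h compact_Icc)
  then obtain B where B: "0 < B" "\<And>x. x \<in> {0..1} \<Longrightarrow> \<bar>1 - exp (h x)\<bar> \<le> B"
    by (auto simp: bounded_pos)
  have "uniformly_continuous_on {0..1} (\<lambda>x. exp (h x))" using c by (rule compact_uniformly_continuous) simp
  moreover have "0 < w * c0 / b" using w c0 b by simp
  ultimately have "\<exists>d>0. \<forall>x\<in>{0..1}. \<forall>y\<in>{0..1}. dist y x < d \<longrightarrow> dist (exp (h y)) (exp (h x)) < w * c0 / b"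
    unfolding uniformly_continuous_on_def by blast
  then obtain d where d: "0 < d" "\<And>x y. x \<in> {0..1} \<Longrightarrow> y \<in> {0..1} \<Longrightarrow> dist y x < d \<Longrightarrow> dist (exp (h y)) (exp (h x)) < w * c0 / b"
    by blast
  obtain K0 :: nat where K0: "1 / d < real K0" using reals_Archimedean2 by blast
  show thesis
  proof (rule that[of "B / c0" K0])
    show "0 \<le> B / c0" using B c0 by simp
    show "\<bar>1 - exp (h x)\<bar> \<le> B / c0 * c0" if "x \<in> {0..1}" for x using B(2)[OF that] c0 by simp
    fix K k :: nat and x :: real
    assume K: "K0 \<le> K" "0 < K" "k < K" and x: "x \<in> {0..1}" "\<bar>x - real k / real K\<bar> \<le> 1 / real K"
    have "1 / d < real K" using K0 K by linarith
    then have "1 / real K < d" using d K by (simp add: field_simps)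
    then have "dist (exp (h x)) (exp (h (real k / real K))) < w * c0 / b"
      using x K by (intro d(2)) (auto simp: dist_real_def)
    then have "\<bar>exp (h x) - exp (h (real k / real K))\<bar> \<le> w * c0 / b" by (simp add: dist_real_def)
    then show "\<bar>exp (h x) - exp (h (real k / real K))\<bar> * b \<le> w * c0" using b by (simp add: pos_le_divide_eq)
  qed
qed

text \<open>The factor \<open>1 - \<gamma>\<close> in \<open>exp g\<close> makes every level at least \<open>\<gamma>\<close>, uniformly up to the end point.\<close>

lemma chain_lower_value:
  fixes h :: "real \<Rightarrow> real"
  assumes s: "0 < s" and a: "0 \<le> a" "a < b" and h: "continuous_on {0..1} h"
    and hc: "\<And>x. x \<in> {0..1} \<Longrightarrow> h x \<le> ln (1 + 1 / b)" and h1: "h 1 < ln (1 + 1 / b)"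
    and \<theta>: "\<theta> \<in> profiles a b"
    and u: "ereal u < local_pressure s h \<theta> - profile_cost s a b \<theta>"
  shows "\<forall>\<^sub>F N in sequentially. kap (2 * s * real (Suc N)) a b * ennreal (exp (real N * u))
     \<le> chain (2 * s) b (\<lambda>i. site_mgf (2 * s) (h (real i / real N))) N 1 a"
proof -
  have b: "0 < b" using a by simp
  have mono: "x \<in> {0..1} \<Longrightarrow> y \<in> {0..1} \<Longrightarrow> x < y \<Longrightarrow> \<theta> x < \<theta> y" for x y
    using \<theta> by (auto simp: profiles_def strict_mono_on_def)
  have monole: "x \<in> {0..1} \<Longrightarrow> y \<in> {0..1} \<Longrightarrow> x \<le> y \<Longrightarrow> \<theta> x \<le> \<theta> y" for x y
    using mono[of x y] by (cases "x = y") auto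
  have ends: "\<theta> 0 = a" "\<theta> 1 = b" using \<theta> by (auto simp: profiles_def)
  have range: "a \<le> \<theta> x" "\<theta> x \<le> b" if "x \<in> {0..1}" for x
    using monole[of 0 x] monole[of x 1] that ends by auto
  \<comment> \<open>The slack 6 e covers five errors of at most e each: passing from h to g, the two
    discretisation errors, the windows, and the limit in \<open>lower_main\<close>.\<close>
  obtain e where e: "0 < e" "ereal (u + 6 * e) \<le> local_pressure s h \<theta> - profile_cost s a b \<theta>"
  proof -
    obtain z where z: "ereal u < z" "z < local_pressure s h \<theta> - profile_cost s a b \<theta>" using u dense by blast
    then obtain z' where z': "z = ereal z'" by (cases z) auto
    have eq: "u + 6 * ((z' - u) / 6) = z'" by (simp add: field_simps)
    show thesis
      by (rule that[of "(z' - u) / 6", unfolded eq]) (use z z' in \<open>auto simp: less_imp_le\<close>)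
  qed
  \<comment> \<open>Along the profile the level of h is bounded away from 0: before 1 - \<delta>
    because \<theta> is at most \<theta> (1 - \<delta>) < b, afterwards because h is strictly
    subcritical.\<close>
  obtain c1 where c1: "0 < c1" "\<And>x. 0 \<le> x \<Longrightarrow> x < 1 \<Longrightarrow> c1 \<le> level h x (\<theta> x)"
  proof -
    obtain \<delta> c where d: "0 < \<delta>" "\<delta> < 1" "0 < c"
      "\<And>x \<theta>. 1 - \<delta> \<le> x \<Longrightarrow> x \<le> 1 \<Longrightarrow> 0 \<le> \<theta> \<Longrightarrow> \<theta> \<le> b \<Longrightarrow> c \<le> level h x \<theta>"
      using end_level[OF h b h1] by blast
    have "\<theta> (1 - \<delta>) < b" using mono[of "1 - \<delta>" 1] d ends by auto
    then have p: "0 < 1 - \<theta> (1 - \<delta>) / b" using b by simp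
    show thesis
    proof (rule that[of "min c (1 - \<theta> (1 - \<delta>) / b)"])
      show "0 < min c (1 - \<theta> (1 - \<delta>) / b)" using p d by simp
      fix x :: real assume x: "0 \<le> x" "x < 1"
      have r: "a \<le> \<theta> x" "\<theta> x \<le> b" using range x by auto
      show "min c (1 - \<theta> (1 - \<delta>) / b) \<le> level h x (\<theta> x)"
      proof (cases "1 - \<delta> \<le> x")
        case True
        then show ?thesis using d(4)[of x "\<theta> x"] x r a by simp
      next
        case False
        then have "\<theta> x \<le> \<theta> (1 - \<delta>)" using x d by (intro monole) auto
        then have "1 - \<theta> (1 - \<delta>) / b \<le> 1 - \<theta> x / b" using b by (simp add: divide_right_mono)
        also have "\<dots> \<le> level h x (\<theta> x)" using hc[of x] x r a by (intro critical_level b) auto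
        finally show ?thesis by simp
      qed
    qed
  qed
  \<comment> \<open>Small enough for 2 s \<kappa> \<le> e, where \<kappa> = \<gamma> (b + 1) / c1 is
    the price of replacing h by g along \<theta>.\<close>
  define \<gamma> where "\<gamma> = min (1 / 2) (e * c1 / (2 * s * (b + 1)))"
  have \<gamma>: "0 < \<gamma>" "\<gamma> < 1" using e c1 s b by (auto simp: \<gamma>_def)
  define g where "g x = h x + ln (1 - \<gamma>)" for x
  have eg: "exp (g x) = (1 - \<gamma>) * exp (h x)" for x using \<gamma> by (simp add: g_def exp_add mult.commute)
  have gcont: "continuous_on {0..1} g" unfolding g_def by (intro continuous_intros h)
  \<comment> \<open>A convex combination of the level of h, which is nonnegative up to b, and of 1 +
    y \<ge> 1; this yields the uniform bound \<gamma>.\<close>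
  have lg: "level g x y = (1 - \<gamma>) * level h x y + \<gamma> * (1 + y)" for x y
    by (simp add: level_def eg algebra_simps)
  have lg': "level g x y = level h x y + \<gamma> * exp (h x) * y" for x y
    by (simp add: level_def eg algebra_simps)
  have A: "\<gamma> \<le> level g x y" if "x \<in> {0..1}" "a \<le> y" "y \<le> b" for x y
  proof -
    have "0 \<le> 1 - y / b" using that b by simp
    also have "\<dots> \<le> level h x y" using hc[OF that(1)] that a by (intro critical_level b) auto
    finally have "0 \<le> (1 - \<gamma>) * level h x y" using \<gamma> by simp
    moreover have "\<gamma> * 1 \<le> \<gamma> * (1 + y)" using \<gamma> that a by (intro mult_left_mono) auto
    ultimately show ?thesis unfolding lg by simp
  qed
  define \<kappa> where "\<kappa> = \<gamma> * (b + 1) / c1"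
  have \<kappa>: "2 * s * \<kappa> \<le> e"
  proof -
    have "\<gamma> \<le> e * c1 / (2 * s * (b + 1))" by (simp add: \<gamma>_def)
    moreover have "0 < 2 * s * (b + 1)" using s b by simp
    ultimately have "\<gamma> * (2 * s * (b + 1)) \<le> e * c1" by (simp only: pos_le_divide_eq)
    then have "\<gamma> * (2 * s * (b + 1)) / c1 \<le> e" using c1 by (simp add: pos_divide_le_eq)
    then show ?thesis by (simp add: \<kappa>_def algebra_simps)
  qed
  have gh: "- ln (level h x (\<theta> x)) \<le> - ln (level g x (\<theta> x)) + \<kappa>" if x: "0 \<le> x" "x < 1" for x
  proof -
    have r: "0 \<le> \<theta> x" "\<theta> x \<le> b" using range[of x] x a by auto
    have le: "level h x (\<theta> x) \<le> level g x (\<theta> x)" unfolding lg' using \<gamma> r by simp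
    have "\<bar>ln (level g x (\<theta> x)) - ln (level h x (\<theta> x))\<bar> \<le> \<bar>level g x (\<theta> x) - level h x (\<theta> x)\<bar> / c1"
      using c1(1) c1(2)[OF x] le by (intro ln_diff_le) auto
    also have "\<dots> \<le> \<kappa>" unfolding \<kappa>_def
    proof (rule divide_right_mono)
      have "exp (h x) \<le> 1 + 1 / b" using hc[of x] x b by (simp add: ln_ge_iff[symmetric] add_pos_pos)
      then have "exp (h x) * \<theta> x \<le> (1 + 1 / b) * b" using r b by (intro mult_mono) auto
      moreover have "(1 + 1 / b) * b = b + 1" using b by (simp add: distrib_right)
      ultimately have "exp (h x) * \<theta> x \<le> b + 1" by linarith
      then have "\<gamma> * (exp (h x) * \<theta> x) \<le> \<gamma> * (b + 1)" using \<gamma> by (intro mult_left_mono) auto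
      then show "\<bar>level g x (\<theta> x) - level h x (\<theta> x)\<bar> \<le> \<gamma> * (b + 1)" unfolding lg' using \<gamma> r by (simp add: mult.assoc)
    qed (use c1 in simp)
    finally show ?thesis by linarith
  qed
  define w where "w = e / (4 * s)"
  have w: "0 < w" using e s by (simp add: w_def)
  obtain C K0 where C: "0 \<le> C" "\<And>x. x \<in> {0..1} \<Longrightarrow> \<bar>1 - exp (g x)\<bar> \<le> C * \<gamma>"
    and K0: "\<And>K k x. K0 \<le> K \<Longrightarrow> 0 < K \<Longrightarrow> k < K \<Longrightarrow> x \<in> {0..1} \<Longrightarrow> \<bar>x - real k / real K\<bar> \<le> 1 / real K \<Longrightarrow>
        \<bar>exp (g x) - exp (g (real k / real K))\<bar> * b \<le> w * \<gamma>"
    using continuity_moduli[OF gcont b \<gamma>(1) w] by blast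
  obtain K1 :: nat where K1: "4 * s * C * (b - a) / e < real K1" using reals_Archimedean2 by blast
  define K where "K = max 1 (max K0 K1)"
  have K: "0 < K" "K0 \<le> K" by (auto simp: K_def)
  have K2: "4 * s * C * (b - a) / real K \<le> e"
  proof -
    have "4 * s * C * (b - a) / e \<le> real K" using K1 by (simp add: K_def)
    then show ?thesis using e K by (simp add: field_simps)
  qed
  define t where "t k = \<theta> (real k / real K)" for k
  have t0: "t 0 = a" "t K = b" using ends K by (auto simp: t_def)
  have dt: "t k < t (Suc k)" if "k < K" for k
    unfolding t_def using that by (intro mono) (auto simp: divide_le_eq divide_strict_right_mono)
  define S where "S = (\<Sum>k<K. ln (real K * (t (Suc k) - t k) / (b - a)) - ln (level g (real k / real K) (t (Suc k))) + w + C * (t (Suc k) - t k))"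
  have "local_pressure s h \<theta> - profile_cost s a b \<theta> \<le> ereal (2 * s * (S / real K + \<kappa>))"
    unfolding S_def t_def
  proof (rule value_profile_upper[OF s a \<gamma>(1) C(1) K(1) \<theta>])
    show "0 < level h x (\<theta> x)" if "0 \<le> x" "x < 1" for x using c1(1) c1(2)[OF that] by linarith
  qed (fact A K0[OF K(2,1)] C(2) gh)+
  then have "ereal (u + 6 * e) \<le> ereal (2 * s * (S / real K + \<kappa>))" using e(2) by (rule order_trans[rotated])
  then have Su: "u + 6 * e \<le> 2 * s * (S / real K) + 2 * s * \<kappa>" by (simp add: distrib_left)
  \<comment> \<open>The sum in the rate of \<open>lower_main\<close> as a function of the window
    width; continuity at 0 provides a suitable \<epsilon>.\<close>
  define Q where "Q \<epsilon> = (\<Sum>k<K. - (2 * s) * (w + C * (t (Suc k) - t k + \<epsilon>)) - 2 * s * ln (level g (real k / real K) (t (Suc k)))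
       + 2 * s * ln (t (Suc k) - t k - \<epsilon>))" for \<epsilon>
  have "isCont Q 0"
    unfolding Q_def using dt by (intro continuous_intros) (auto simp: less_imp_neq[symmetric])
  then have "(Q \<longlongrightarrow> Q 0) (at_right 0)" unfolding isCont_def by (rule filterlim_mono) (auto intro: at_le)
  then have "\<forall>\<^sub>F \<epsilon> in at_right 0. Q 0 - e < Q \<epsilon>" using e by (intro order_tendstoD) auto
  moreover have "\<forall>\<^sub>F \<epsilon> in at_right 0. \<forall>k\<in>{..<K}. \<epsilon> < t (Suc k) - t k"
    using dt by (intro eventually_ball_finite ballI order_tendstoD(2)[OF tendsto_ident_at]) auto
  moreover have "\<forall>\<^sub>F \<epsilon> in at_right (0::real). 0 < \<epsilon>" by (simp add: eventually_at_filter)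
  ultimately have "\<forall>\<^sub>F \<epsilon> in at_right 0. Q 0 - e < Q \<epsilon> \<and> (\<forall>k\<in>{..<K}. \<epsilon> < t (Suc k) - t k) \<and> 0 < \<epsilon>"
    by eventually_elim blast
  then have "\<exists>\<epsilon>. Q 0 - e < Q \<epsilon> \<and> (\<forall>k\<in>{..<K}. \<epsilon> < t (Suc k) - t k) \<and> 0 < \<epsilon>"
    by (rule eventually_happens'[OF trivial_limit_at_right_real])
  then obtain \<epsilon> where \<epsilon>: "Q 0 - e < Q \<epsilon>" "\<And>k. k < K \<Longrightarrow> \<epsilon> < t (Suc k) - t k" "0 < \<epsilon>"
    by (elim exE conjE) (rule that, auto)
  have sumdt: "(\<Sum>k<K. t (Suc k) - t k) = b - a" using t0 by (simp add: sum_lessThan_telescope)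
  \<comment> \<open>At width 0 the sum differs from the upper sum S, scaled by 2 s, only by twice
    the discretisation errors and by the normalisation of the logarithms.\<close>
  have Q0: "Q 0 = 2 * s * S - 4 * s * w * real K - 4 * s * C * (b - a) - 2 * s * real K * ln (real K) + 2 * s * real K * ln (b - a)"
  proof -
    define p where "p k = ln (real K * (t (Suc k) - t k) / (b - a)) - ln (level g (real k / real K) (t (Suc k))) + w + C * (t (Suc k) - t k)" for k
    define q where "q k = - 4 * s * w - 4 * s * C * (t (Suc k) - t k) - 2 * s * ln (real K) + 2 * s * ln (b - a)" for k
    have gen: "(\<Sum>k<K. A - B * d k - E + F) = A * real K - B * (\<Sum>k<K. d k) - E * real K + F * real K"
      for A B E F :: real and d :: "nat \<Rightarrow> real"
      by (simp add: sum.distrib sum_subtractf sum_distrib_left)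
    have "Q 0 = (\<Sum>k<K. 2 * s * p k + q k)"
      unfolding Q_def
    proof (intro sum.cong refl)
      fix k assume "k \<in> {..<K}"
      then have l: "ln (real K * (t (Suc k) - t k) / (b - a)) = ln (real K) + ln (t (Suc k) - t k) - ln (b - a)"
        using dt[of k] K a by (simp add: ln_div ln_mult)
      show "- (2 * s) * (w + C * (t (Suc k) - t k + 0)) - 2 * s * ln (level g (real k / real K) (t (Suc k))) + 2 * s * ln (t (Suc k) - t k - 0) =
         2 * s * p k + q k"
        unfolding p_def q_def l by (simp add: algebra_simps)
    qed
    also have "\<dots> = 2 * s * S + (\<Sum>k<K. q k)"
      by (simp add: S_def p_def[symmetric] sum.distrib sum_distrib_left)
    also have "(\<Sum>k<K. q k) = - 4 * s * w * real K - 4 * s * C * (\<Sum>k<K. t (Suc k) - t k) - 2 * s * ln (real K) * real K + 2 * s * ln (b - a) * real K"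
      unfolding q_def by (rule gen)
    finally show ?thesis unfolding sumdt by (simp add: algebra_simps)
  qed
  have main: "u \<le> Q \<epsilon> / real K + 2 * s * ln (real K) - 2 * s * ln (b - a) - e"
  proof -
    have "Q 0 / real K - e \<le> (Q 0 - e) / real K"
      using e K by (simp add: diff_divide_distrib divide_le_eq mult_le_cancel_left1)
    also have "\<dots> \<le> Q \<epsilon> / real K" using \<epsilon>(1) by (intro divide_right_mono) auto
    finally have 1: "Q 0 / real K - e \<le> Q \<epsilon> / real K" .
    have "Q 0 / real K = 2 * s * (S / real K) - 4 * s * w - 4 * s * C * (b - a) / real K - 2 * s * ln (real K) + 2 * s * ln (b - a)"
      unfolding Q0 using K by (simp add: diff_divide_distrib add_divide_distrib)
    moreover have "4 * s * w = e" using s by (simp add: w_def)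
    ultimately show ?thesis using 1 Su \<kappa> K2 e by linarith
  qed
  have "\<forall>\<^sub>F N in sequentially. kap (2 * s * real (Suc N)) a b * ennreal (exp (real N * (Q \<epsilon> / real K + 2 * s * ln (real K) - 2 * s * ln (b - a) - e)))
     \<le> chain (2 * s) b (\<lambda>i. site_mgf (2 * s) (g (real i / real N))) N 1 a"
    unfolding Q_def
    by (rule lower_main[OF _ a \<gamma>(1) C(1) less_imp_le[OF w] K(1)]) (use s in simp, (fact A K0[OF K(2,1)] C(2) t0 \<epsilon>(3) \<epsilon>(2) e(1))+)
  then show ?thesis
  proof eventually_elim
    case (elim N)
    have "kap (2 * s * real (Suc N)) a b * ennreal (exp (real N * u))
       \<le> kap (2 * s * real (Suc N)) a b * ennreal (exp (real N * (Q \<epsilon> / real K + 2 * s * ln (real K) - 2 * s * ln (b - a) - e)))"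
      using main by (intro mult_left_mono ennreal_leI) (auto intro!: mult_left_mono)
    also note elim
    \<comment> \<open>g lies below h, so its site factors are smaller and the lower bound passes to
      h.\<close>
    also have "chain (2 * s) b (\<lambda>i. site_mgf (2 * s) (g (real i / real N))) N 1 a \<le> chain (2 * s) b (\<lambda>i. site_mgf (2 * s) (h (real i / real N))) N 1 a"
    proof (rule chain_mono[OF _ a(1)])
      fix i and y :: real assume y: "0 \<le> y"
      have "level h (real i / real N) y \<le> level g (real i / real N) y" unfolding lg' using \<gamma> y by simp
      then show "site_mgf (2 * s) (g (real i / real N)) y \<le> site_mgf (2 * s) (h (real i / real N)) y"
        using s unfolding site_mgf_level by (auto intro!: ennreal_leI powr_mono2')
    qed
    finally show ?case .
  qed
qed

lemma blk_cut:
  assumes M: "\<And>l. M l \<in> borel_measurable borel" and m: "m \<le> N"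
  shows "chain r b M N 1 a = blk r M (\<lambda>t. chain r b M (N - m) (Suc m) t * indicator {..c} t) m 1 a
     + blk r M (\<lambda>t. chain r b M (N - m) (Suc m) t * indicator {c<..} t) m 1 a"
proof -
  have [measurable]: "chain r b M (N - m) (Suc m) \<in> borel_measurable borel" by (rule chain_measurable[OF M])
  have "chain r b M N 1 a = blk r M (chain r b M (N - m) (Suc m)) m 1 a"
    using chain_blk[of r b M m "N - m" 1 a] m by simp
  also have "chain r b M (N - m) (Suc m) = (\<lambda>t. chain r b M (N - m) (Suc m) t * indicator {..c} t + chain r b M (N - m) (Suc m) t * indicator {c<..} t)"
    by (rule ext) (auto simp: indicator_def)
  also have "blk r M \<dots> m 1 a = blk r M (\<lambda>t. chain r b M (N - m) (Suc m) t * indicator {..c} t) m 1 a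
     + blk r M (\<lambda>t. chain r b M (N - m) (Suc m) t * indicator {c<..} t) m 1 a"
    by (rule blk_add[OF M]) measurable
  finally show ?thesis .
qed

text \<open>The integral is split by the position of the path at a site m near (1 - \<delta>) N.
  Paths below b - \<eta> there keep away from critical levels up to m, and beyond m the levels are
  bounded because h is subcritical near 1; \<open>upper_main\<close> applies, and its chains are
  compared with profiles by \<open>value_pl\<close>. Paths above b - \<eta> are negligible by
  \<open>crude_bound\<close>.\<close>

lemma chain_upper_value:
  fixes h :: "real \<Rightarrow> real"
  assumes s: "0 < s" and a: "0 \<le> a" "a < b" and h: "continuous_on {0..1} h"
    and hc: "\<And>x. x \<in> {0..1} \<Longrightarrow> h x \<le> ln (1 + 1 / b)" and h1: "h 1 < ln (1 + 1 / b)"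
    and y: "\<And>\<theta>. \<theta> \<in> profiles a b \<Longrightarrow> local_pressure s h \<theta> - profile_cost s a b \<theta> \<le> ereal y"
    and e: "0 < e"
  shows "\<forall>\<^sub>F N in sequentially. chain (2 * s) b (\<lambda>i. site_mgf (2 * s) (h (real i / real N))) N 1 a
     \<le> kap (2 * s * real (Suc N)) a b * ennreal (exp (real N * (y + e)))"
proof -
  have b: "0 < b" using a by simp
  define r where "r = 2 * s"
  have r: "0 < r" using s by (simp add: r_def)
  obtain d c where d: "0 < d" "d < 1" "0 < c"
    and end_le: "\<And>x \<theta>. 1 - d \<le> x \<Longrightarrow> x \<le> 1 \<Longrightarrow> 0 \<le> \<theta> \<Longrightarrow> \<theta> \<le> b \<Longrightarrow> c \<le> level h x \<theta>"
    using end_level[OF h b h1] by blast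
  \<comment> \<open>Halving leaves room for rounding: m is a block boundary, and m / N may fall
    below 1 - \<delta> but not below 1 - 2 \<delta>.\<close>
  define \<delta> where "\<delta> = d / 2"
  have \<delta>: "0 < \<delta>" "\<delta> < 1 / 2" using d by (auto simp: \<delta>_def)
  have end_le: "c \<le> level h x \<theta>" if "1 - 2 * \<delta> \<le> x" "x \<le> 1" "0 \<le> \<theta>" "\<theta> \<le> b" for x \<theta>
    using end_le that by (simp add: \<delta>_def)
  define D where "D = c powr (- r)"
  have D: "0 < D" using d by (simp add: D_def)
  obtain C1 N1 where crude: "\<And>N m M \<eta>. N1 \<le> N \<Longrightarrow> real m \<le> (1 - \<delta>) * real N \<Longrightarrow> 0 < \<eta> \<Longrightarrow> \<eta> < 1 \<Longrightarrow>
     (\<And>i. M i \<in> borel_measurable borel) \<Longrightarrow>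
     (\<And>i y. 1 \<le> i \<and> i \<le> m \<and> a \<le> y \<and> y < b \<Longrightarrow> M i y \<le> ennreal (b powr r * (b - y) powr (- r))) \<Longrightarrow>
     (\<And>i y. m < i \<and> i \<le> N \<and> a \<le> y \<and> y < b \<Longrightarrow> M i y \<le> ennreal D) \<Longrightarrow>
     blk r M (\<lambda>t. chain r b M (N - m) (Suc m) t * indicator {b - \<eta><..} t) m 1 a
       \<le> kap (r * real (Suc N)) a b * ennreal (exp (C1 * real N + r * ln \<eta> * (\<delta> * real N / 2 - 1)))"
    using crude_bound[OF r a \<delta>(1) _ D] \<delta>(2) by (smt (verit, best) divide_less_eq_1_pos)
  \<comment> \<open>Makes the exponent of \<open>crude_bound\<close> with ln \<eta> = - L at most N
    (y + e / 2); the summand 1 absorbs the term r L once r L \<le> N.\<close>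
  define L where "L = max 1 (2 * (C1 - y - e / 2 + 1) / (r * \<delta>))"
  have L: "0 < L" "C1 - y - e / 2 + 1 \<le> r * L * \<delta> / 2"
  proof -
    have "2 * (C1 - y - e / 2 + 1) / (r * \<delta>) \<le> L" by (simp add: L_def)
    then have "2 * (C1 - y - e / 2 + 1) \<le> L * (r * \<delta>)" using r \<delta> by (subst (asm) pos_divide_le_eq) auto
    then show "C1 - y - e / 2 + 1 \<le> r * L * \<delta> / 2" by (simp add: algebra_simps)
  qed (simp add: L_def)
  define \<eta> where "\<eta> = exp (- L)"
  have \<eta>: "0 < \<eta>" "\<eta> < 1" "ln \<eta> = - L" using L by (auto simp: \<eta>_def)
  \<comment> \<open>\<eta> / b bounds the possibly critical levels below the cutoff b - \<eta>, and
    c the levels near the end.\<close>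
  define c0 where "c0 = min (\<eta> / b) c"
  have c0: "0 < c0" using \<eta> b d by (simp add: c0_def)
  define w where "w = e / (16 * r)"
  have w: "0 < w" using e r by (simp add: w_def)
  obtain C K0 where C: "0 \<le> C" "\<And>x. x \<in> {0..1} \<Longrightarrow> \<bar>1 - exp (h x)\<bar> \<le> C * c0"
    and K0: "\<And>K k x. K0 \<le> K \<Longrightarrow> 0 < K \<Longrightarrow> k < K \<Longrightarrow> x \<in> {0..1} \<Longrightarrow> \<bar>x - real k / real K\<bar> \<le> 1 / real K \<Longrightarrow>
        \<bar>exp (h x) - exp (h (real k / real K))\<bar> * b \<le> w * c0"
    using continuity_moduli[OF h b c0 w] by blast
  obtain K1 :: nat where K1: "16 * r * C * (b - a) / e < real K1" using reals_Archimedean2 by blast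
  obtain K2 :: nat where K2: "2 / \<delta> < real K2" using reals_Archimedean2 by blast
  define K where "K = max 1 (max K0 (max K1 K2))"
  have K: "0 < K" "K0 \<le> K" by (auto simp: K_def)
  have KC: "2 * r * C * (b - a) / real K \<le> e / 8"
  proof -
    have "16 * r * C * (b - a) / e \<le> real K" using K1 by (simp add: K_def)
    then have "16 * r * C * (b - a) \<le> real K * e" using e by (simp only: pos_divide_le_eq)
    then have "2 * r * C * (b - a) \<le> e / 8 * real K" by (simp add: algebra_simps)
    then show ?thesis using K by (simp add: pos_divide_le_eq)
  qed
  have K\<delta>: "2 \<le> \<delta> * real K"
  proof -
    have "2 / \<delta> \<le> real K" using K2 by (simp add: K_def)
    then show ?thesis using \<delta> by (simp add: pos_divide_le_eq mult.commute)
  qed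
  then have K\<delta>': "1 / real K \<le> \<delta> / 2" using K by (simp add: field_simps)
  define \<kappa> where "\<kappa> = nat \<lfloor>(1 - \<delta>) * real K\<rfloor>"
  have "0 \<le> (1 - \<delta>) * real K" using \<delta> by simp
  then have \<kappa>: "real \<kappa> \<le> (1 - \<delta>) * real K" "(1 - \<delta>) * real K < real \<kappa> + 1"
    by (auto simp: \<kappa>_def)
  have half: "\<delta> * real K \<le> (1 - \<delta>) * real K" using \<delta> by (intro mult_right_mono) auto
  have \<kappa>K: "0 < \<kappa>" "\<kappa> < K"
  proof -
    show "0 < \<kappa>" using half K\<delta> \<kappa> by simp
    have "real \<kappa> < real K" using \<kappa>(1) K\<delta> by (simp add: left_diff_distrib)
    then show "\<kappa> < K" by simp
  qed
  have \<kappa>lo: "1 - \<delta> - 1 / real K \<le> real \<kappa> / real K"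
  proof -
    have "(1 - \<delta> - 1 / real K) * real K \<le> real \<kappa>" using \<kappa>(2) K by (simp add: left_diff_distrib)
    then show ?thesis using K by (simp add: pos_le_divide_eq)
  qed
  define cutoff where "cutoff k = (if k < \<kappa> then b - \<eta> else b)" for k
  have cb: "cutoff k \<le> b" for k using \<eta> by (simp add: cutoff_def)
  have A: "c0 \<le> level h x \<theta>"
    if "k < K" "x \<in> {0..1}" "\<bar>x - real k / real K\<bar> \<le> 1 / real K" "a \<le> \<theta>" "\<theta> \<le> cutoff k" for k x \<theta>
  proof (cases "k < \<kappa>")
    case True
    then have "\<eta> / b \<le> 1 - \<theta> / b" using that(5) b by (simp add: cutoff_def field_simps)
    also have "\<dots> \<le> level h x \<theta>" using that a hc by (intro critical_level b) auto
    finally show ?thesis by (simp add: c0_def)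
  next
    case False
    then have "real \<kappa> / real K \<le> real k / real K" by (intro divide_right_mono) auto
    then have "1 - 2 * \<delta> \<le> x" using that(3) \<kappa>lo K\<delta>' by linarith
    then have "c \<le> level h x \<theta>" using that a cb[of k] by (intro end_le) auto
    then show ?thesis by (simp add: c0_def)
  qed
  \<comment> \<open>The main term K y comes from the bound y on profiles. The errors are doubled,
    since \<open>step_bound\<close> adds them to the factors and \<open>value_pl\<close> subtracts
    them from the value.\<close>
  define lX where "lX = real K * y + 2 * r * real K * w + 2 * r * C * (b - a) - r * real K * ln (real K) + r * real K * ln (b - a)"
  have chains: "(\<Prod>k\<in>{0..<K}. (t (Suc k) - t k) powr r * step_bound r h K w C cutoff k (t k) (t (Suc k))) \<le> exp lX"
    if t: "t 0 = a" "\<And>k. k < K \<Longrightarrow> t k < t (Suc k)" "t K = b" for t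
  proof (cases "\<forall>k<K. t (Suc k) \<le> cutoff k")
    case False
    then obtain k where k: "k < K" "\<not> t (Suc k) \<le> cutoff k" by blast
    then have "(t (Suc k) - t k) powr r * step_bound r h K w C cutoff k (t k) (t (Suc k)) = 0" by (simp add: step_bound_def)
    then have "(\<Prod>k\<in>{0..<K}. (t (Suc k) - t k) powr r * step_bound r h K w C cutoff k (t k) (t (Suc k))) = 0"
      by (intro prod_zero bexI[of _ k]) (use k in auto)
    also have "0 \<le> exp lX" by simp
    finally show ?thesis .
  next
    case True
    define z where "z k = ln (real K * (t (Suc k) - t k) / (b - a)) - ln (level h (real k / real K) (t (Suc k))) - w - C * (t (Suc k) - t k)" for k
    have tge: "k \<le> K \<Longrightarrow> a \<le> t k" for k
    proof (induction k)
      case (Suc k)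
      then show ?case using t(2)[of k] by simp
    qed (simp add: t)
    have "ereal (2 * s * (\<Sum>k<K. z k) / real K) \<le> local_pressure s h (pl K t) - profile_cost s a b (pl K t)"
      unfolding z_def using True cb
      by (intro value_pl[OF s a c0 C(1) K(1) t(1,3,2) _ _ A K0[OF K(2,1)] C(2)]) auto
    also have "\<dots> \<le> ereal y"
    proof (rule y)
      have "pl K t \<in> profiles (t 0) (t K)" by (rule pl_profile[OF K(1)]) (use t a in auto)
      then show "pl K t \<in> profiles a b" using t by simp
    qed
    finally have "r * (\<Sum>k<K. z k) \<le> real K * y" using K by (simp add: r_def pos_divide_le_eq mult.commute)
    then have zy: "(\<Sum>k<K. r * z k) \<le> real K * y" by (simp add: sum_distrib_left)
    have gen: "(\<Prod>k<K. exp (r * z k + (A + B * d k - E + F))) = exp ((\<Sum>k<K. r * z k) + (A * real K + B * (\<Sum>k<K. d k) - E * real K + F * real K))"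
      for A B E F :: real and d :: "nat \<Rightarrow> real"
      by (simp add: exp_sum[symmetric] sum.distrib sum_subtractf sum_distrib_left)
    have "(\<Prod>k\<in>{0..<K}. (t (Suc k) - t k) powr r * step_bound r h K w C cutoff k (t k) (t (Suc k)))
       = (\<Prod>k<K. exp (r * z k + (2 * r * w + 2 * r * C * (t (Suc k) - t k) - r * ln (real K) + r * ln (b - a))))"
    proof (intro prod.cong)
      fix k assume "k \<in> {..<K}"
      then have k: "k < K" by simp
      have dt: "0 < t (Suc k) - t k" using t(2)[OF k] by simp
      have "c0 \<le> level h (real k / real K) (t (Suc k))" using k True tge[of "Suc k"] by (intro A[of k]) auto
      then have l: "0 < level h (real k / real K) (t (Suc k))" using c0 by simp
      have z: "z k = ln (real K) + ln (t (Suc k) - t k) - ln (b - a) - ln (level h (real k / real K) (t (Suc k))) - w - C * (t (Suc k) - t k)"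
        using dt K a by (simp add: z_def ln_div ln_mult)
      have "(t (Suc k) - t k) powr r * step_bound r h K w C cutoff k (t k) (t (Suc k))
        = exp (r * ln (t (Suc k) - t k)) * (exp (r * (w + C * (t (Suc k) - t k))) * exp (- r * ln (level h (real k / real K) (t (Suc k)))))"
        using dt l True k by (simp add: step_bound_def powr_def)
      also have "\<dots> = exp (r * z k + (2 * r * w + 2 * r * C * (t (Suc k) - t k) - r * ln (real K) + r * ln (b - a)))"
        unfolding z exp_add[symmetric] by (simp add: algebra_simps)
      finally show "(t (Suc k) - t k) powr r * step_bound r h K w C cutoff k (t k) (t (Suc k))
        = exp (r * z k + (2 * r * w + 2 * r * C * (t (Suc k) - t k) - r * ln (real K) + r * ln (b - a)))" .
    qed (simp add: lessThan_atLeast0)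
    also have "\<dots> = exp ((\<Sum>k<K. r * z k) + (2 * r * w * real K + 2 * r * C * (\<Sum>k<K. t (Suc k) - t k) - r * ln (real K) * real K + r * ln (b - a) * real K))"
      by (rule gen)
    also have "(\<Sum>k<K. t (Suc k) - t k) = b - a" using t by (simp add: sum_lessThan_telescope)
    also have "exp ((\<Sum>k<K. r * z k) + (2 * r * w * real K + 2 * r * C * (b - a) - r * ln (real K) * real K + r * ln (b - a) * real K)) \<le> exp lX"
      using zy by (simp add: lX_def algebra_simps)
    finally show ?thesis .
  qed
  have expo: "ln (exp lX) / real K + r * ln (real K) - r * ln (b - a) + e / 8 \<le> y + e / 2"
  proof -
    have "ln (exp lX) / real K + r * ln (real K) - r * ln (b - a) + e / 8 = y + 2 * r * w + 2 * r * C * (b - a) / real K + e / 8"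
      using K by (simp add: lX_def add_divide_distrib diff_divide_distrib)
    moreover have "2 * r * w = e / 8" using r by (simp add: w_def)
    ultimately show ?thesis using KC e by linarith
  qed
  have e8: "0 < e / 8" using e by simp
  have main: "\<forall>\<^sub>F N in sequentially.
     blk r (\<lambda>i. site_mgf r (h (real i / real N)))
       (\<lambda>t. chain r b (\<lambda>i. site_mgf r (h (real i / real N))) (N - \<kappa> * (N div K)) (Suc (\<kappa> * (N div K))) t * indicator {..b - \<eta>} t)
       (\<kappa> * (N div K)) 1 a
     \<le> kap (r * real (Suc N)) a b * ennreal (exp (real N * (ln (exp lX) / real K + r * ln (real K) - r * ln (b - a) + e / 8)))"
    by (rule upper_main[OF r a \<eta>(1) c0 C(1) less_imp_le[OF w] \<kappa>K _ A K0[OF K(2,1)] C(2) exp_gt_zero chains e8])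
      (auto simp: cutoff_def)
  moreover have "\<forall>\<^sub>F N in sequentially. N1 \<le> N" by (rule eventually_ge_at_top)
  moreover have "\<forall>\<^sub>F N in sequentially. r * L \<le> real N" by real_asymp
  moreover have "\<forall>\<^sub>F N in sequentially. real K \<le> real N * (\<delta> / 2)" using \<delta> by real_asymp
  moreover have "\<forall>\<^sub>F N in sequentially. ln 2 \<le> real N * (e / 2)" using e by real_asymp
  ultimately show ?thesis
    unfolding r_def[symmetric]
  proof eventually_elim
    case (elim N)
    define m where "m = \<kappa> * (N div K)"
    define M where "M i = site_mgf r (h (real i / real N))" for i
    have N0: "0 < real N" using elim(4) K by (cases N) auto
    have div: "real (N div K) \<le> real N / real K" by (rule of_nat_div_le_of_nat)
    have div': "real N / real K - 1 \<le> real (N div K)"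
    proof -
      have "N < (N div K + 1) * K" using K by (simp add: dividend_less_div_times)
      then have "real N < (real (N div K) + 1) * real K" by (metis of_nat_1 of_nat_add of_nat_less_iff of_nat_mult)
      then have "real N / real K < real (N div K) + 1" using K by (simp add: pos_divide_less_eq)
      then show ?thesis by simp
    qed
    have m: "real m \<le> (1 - \<delta>) * real N"
    proof -
      have "real m \<le> ((1 - \<delta>) * real K) * (real N / real K)"
        unfolding m_def of_nat_mult using \<kappa>(1) div \<delta> by (intro mult_mono) auto
      then show ?thesis using K by simp
    qed
    have mN: "m \<le> N"
    proof -
      have "(1 - \<delta>) * real N \<le> 1 * real N" using \<delta> by (intro mult_right_mono) auto
      then show ?thesis using m by simp
    qed
    have mlo: "1 - 2 * \<delta> \<le> real m / real N"
    proof -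
      define u where "u = real \<kappa> * (real N / real K)"
      have "real \<kappa> * (real N / real K - 1) \<le> real m" unfolding m_def of_nat_mult using div' by (intro mult_left_mono) auto
      then have 1: "u - real \<kappa> \<le> real m" by (simp add: u_def right_diff_distrib)
      have "(1 - \<delta> - 1 / real K) * real N \<le> real \<kappa> / real K * real N" using \<kappa>lo by (intro mult_right_mono) auto
      then have 2: "real N - \<delta> * real N - 1 / real K * real N \<le> u" by (simp add: u_def left_diff_distrib)
      have 3: "1 / real K * real N \<le> \<delta> / 2 * real N" using K\<delta>' by (intro mult_right_mono) auto
      have 4: "real \<kappa> \<le> \<delta> / 2 * real N" using elim(4) \<kappa>K by (simp add: mult.commute)
      have "(1 - 2 * \<delta>) * real N = real N - \<delta> * real N - \<delta> / 2 * real N - \<delta> / 2 * real N" by (simp add: algebra_simps)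
      then have "(1 - 2 * \<delta>) * real N \<le> real m" using 1 2 3 4 by linarith
      then show ?thesis using N0 by (simp add: pos_le_divide_eq)
    qed
    have Mm: "M i \<in> borel_measurable borel" for i unfolding M_def by measurable
    have crudeN: "blk r M (\<lambda>t. chain r b M (N - m) (Suc m) t * indicator {b - \<eta><..} t) m 1 a
       \<le> kap (r * real (Suc N)) a b * ennreal (exp (C1 * real N + r * ln \<eta> * (\<delta> * real N / 2 - 1)))"
    proof (rule crude[OF elim(2) m \<eta>(1,2) Mm])
      fix i y assume i: "1 \<le> i \<and> i \<le> m \<and> a \<le> y \<and> y < b"
      have x: "real i / real N \<in> {0..1}" using i mN N0 by (auto simp: divide_le_eq)
      have "(b - y) / b = 1 - y / b" using b by (simp add: diff_divide_distrib)
      also have "\<dots> \<le> level h (real i / real N) y" using hc[OF x] i a by (intro critical_level b) auto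
      finally have l: "(b - y) / b \<le> level h (real i / real N) y" .
      have p: "0 < (b - y) / b" using i b by simp
      have "level h (real i / real N) y powr (- r) \<le> ((b - y) / b) powr (- r)" using l p r by (intro powr_mono2') auto
      also have "\<dots> = b powr r * (b - y) powr (- r)" using i b by (simp add: powr_divide powr_minus field_simps)
      finally show "M i y \<le> ennreal (b powr r * (b - y) powr (- r))"
        unfolding M_def site_mgf_level using l p by (auto intro: ennreal_leI)
    next
      fix i y assume i: "m < i \<and> i \<le> N \<and> a \<le> y \<and> y < b"
      have "real m / real N \<le> real i / real N" using i by (intro divide_right_mono) auto
      moreover have "real i / real N \<le> 1" using i N0 by (simp add: divide_le_eq)
      ultimately have l: "c \<le> level h (real i / real N) y" using mlo i a by (intro end_le) auto
      then have "level h (real i / real N) y powr (- r) \<le> D" unfolding D_def using d r by (intro powr_mono2') auto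
      then show "M i y \<le> ennreal D" unfolding M_def site_mgf_level using l d by (auto intro: ennreal_leI)
    qed
    have e1: "C1 * real N + r * ln \<eta> * (\<delta> * real N / 2 - 1) \<le> real N * (y + e / 2)"
    proof -
      have "real N * (C1 - y - e / 2 + 1) \<le> real N * (r * L * \<delta> / 2)" using L by (intro mult_left_mono) auto
      then show ?thesis using elim(3) unfolding \<eta>(3) by (simp add: algebra_simps)
    qed
    have "chain r b M N 1 a = blk r M (\<lambda>t. chain r b M (N - m) (Suc m) t * indicator {..b - \<eta>} t) m 1 a
      + blk r M (\<lambda>t. chain r b M (N - m) (Suc m) t * indicator {b - \<eta><..} t) m 1 a"
      by (rule blk_cut[OF Mm mN])
    also have "\<dots> \<le> kap (r * real (Suc N)) a b * ennreal (exp (real N * (y + e / 2))) + kap (r * real (Suc N)) a b * ennreal (exp (real N * (y + e / 2)))"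
    proof (rule add_mono)
      show "blk r M (\<lambda>t. chain r b M (N - m) (Suc m) t * indicator {..b - \<eta>} t) m 1 a \<le> kap (r * real (Suc N)) a b * ennreal (exp (real N * (y + e / 2)))"
        using elim(1) expo unfolding M_def m_def
        by (elim order_trans) (auto intro!: mult_left_mono ennreal_leI)
      show "blk r M (\<lambda>t. chain r b M (N - m) (Suc m) t * indicator {b - \<eta><..} t) m 1 a \<le> kap (r * real (Suc N)) a b * ennreal (exp (real N * (y + e / 2)))"
        using crudeN e1 by (elim order_trans) (auto intro!: mult_left_mono ennreal_leI)
    qed
    \<comment> \<open>The two parts cost a factor 2, which the spare e / 2 in the exponent absorbs
      for large N.\<close>
    also have "\<dots> = kap (r * real (Suc N)) a b * ennreal (2 * exp (real N * (y + e / 2)))"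
      by (simp add: distrib_left[symmetric] ennreal_plus[symmetric] del: ennreal_plus)
    also have "\<dots> \<le> kap (r * real (Suc N)) a b * ennreal (exp (real N * (y + e)))"
    proof (intro mult_left_mono ennreal_leI)
      have "2 * exp (real N * (y + e / 2)) = exp (ln 2 + real N * (y + e / 2))" by (simp add: exp_add)
      also have "\<dots> \<le> exp (real N * (y + e))" using elim(5) by (simp add: algebra_simps)
      finally show "2 * exp (real N * (y + e / 2)) \<le> exp (real N * (y + e))" .
    qed simp
    finally show ?case by (simp add: M_def[abs_def])
  qed
qed

section \<open>The supercritical case and the conclusion\<close>

lemma nn_integral_pos_interval:
  assumes f: "f \<in> borel_measurable borel" and pq: "p < (q::real)" and pos: "\<And>x. p < x \<Longrightarrow> x < q \<Longrightarrow> 0 < f x"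
  shows "0 < (\<integral>\<^sup>+ x. f x \<partial>lborel)"
proof (rule ccontr)
  assume "\<not> ?thesis"
  then have "(\<integral>\<^sup>+ x. f x \<partial>lborel) = 0" by simp
  then have "AE x in lborel. f x = 0" using f by (subst (asm) nn_integral_0_iff_AE) auto
  then have "AE x in lborel. x \<notin> {p<..<q}" by eventually_elim (use pos in force)
  then have "{p<..<q} \<in> null_sets lborel" by (subst (asm) AE_iff_null_sets[symmetric]) auto
  then show False using pq by (simp add: null_sets_def)
qed

lemma nn_integral_infinite_interval:
  assumes pq: "p < (q::real)" and inf: "\<And>x. p < x \<Longrightarrow> x < q \<Longrightarrow> f x = \<infinity>"
  shows "(\<integral>\<^sup>+ x. f x \<partial>lborel) = \<infinity>"
proof -
  have "(\<infinity>::ennreal) = \<infinity> * ennreal (q - p)" using pq by (simp add: ennreal_top_mult)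
  also have "\<dots> = (\<integral>\<^sup>+ x. \<infinity> * indicator {p<..<q} x \<partial>lborel)"
    using pq by (subst nn_integral_cmult_indicator) auto
  also have "\<dots> \<le> (\<integral>\<^sup>+ x. f x \<partial>lborel)" by (intro nn_integral_mono) (auto simp: inf indicator_def)
  finally show ?thesis by (simp add: top_unique)
qed

lemma site_mgf_pos: "0 < site_mgf r c \<theta>"
  by (simp add: site_mgf_def)

lemma chain_pos:
  assumes M: "\<And>j. M j \<in> borel_measurable borel" "\<And>j y. 0 < M j y" and r: "0 < r" and x: "x < b"
  shows "0 < chain r b M n j x"
  using x
proof (induction n arbitrary: j x)
  case 0
  then show ?case using r by (simp add: kap_pos)
next
  case (Suc n)
  note [measurable] = M(1) chain_measurable[where M = M, OF M(1)]
  have "0 < (\<integral>\<^sup>+ y. kap r x y * M j y * chain r b M n (Suc j) y \<partial>lborel)"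
    using Suc M(2) r by (intro nn_integral_pos_interval[of _ x b]) (auto simp: ennreal_zero_less_mult_iff kap_pos)
  then show ?case by simp
qed

text \<open>The path visits densities in (c, b) at site i with positive weight, where the factor is
  infinite; positivity of the other factors carries this through every outer integral.\<close>

lemma chain_infinite:
  assumes M: "\<And>j. M j \<in> borel_measurable borel" "\<And>j y. 0 < M j y" and r: "0 < r" and c: "c < b"
    and i: "\<And>y. c < y \<Longrightarrow> y < b \<Longrightarrow> M i y = \<infinity>"
    and ij: "j \<le> i" "i < j + n" and x: "x < b"
  shows "chain r b M n j x = \<infinity>"
  using ij x
proof (induction n arbitrary: j x)
  case (Suc n)
  have k: "kap r x y \<noteq> 0" if "x < y" for y using kap_pos[OF r that] by simp
  have ch: "chain r b M n (Suc j) y \<noteq> 0" if "y < b" for y using chain_pos[where M = M and n = n and j = "Suc j", OF M r that] by simp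
  have "(\<integral>\<^sup>+ y. kap r x y * M j y * chain r b M n (Suc j) y \<partial>lborel) = \<infinity>"
  proof (rule nn_integral_infinite_interval)
    show "max c x < b" using c Suc.prems by simp
    show "kap r x y * M j y * chain r b M n (Suc j) y = \<infinity>" if y: "max c x < y" "y < b" for y
    proof (cases "i = j")
      case True
      then show ?thesis using i[of y] y k[of y] ch[of y] by (simp add: ennreal_mult_top ennreal_top_mult)
    next
      case False
      then have "chain r b M n (Suc j) y = \<infinity>" using Suc.prems y by (intro Suc.IH) auto
      moreover have "M j y \<noteq> 0" using M(2)[of j y] by simp
      ultimately show ?thesis using k[of y] y by (simp add: ennreal_mult_top)
    qed
  qed
  then show ?case by simp
qed simp

text \<open>E separates h x from the critical value, and c = 1 / (exp E - 1) is the density at which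
  the level for exp E vanishes; E being supercritical means c < b.\<close>

lemma supercritical_interval:
  fixes h :: "real \<Rightarrow> real"
  assumes h: "continuous_on {0..1} h" and x: "x \<in> {0..1}" "ln (1 + 1 / b) < h x" and b: "0 < b"
  obtains p q c where "0 < p" "p < q" "q < 1" "0 < c" "c < b"
    "\<And>y \<theta>. p \<le> y \<Longrightarrow> y \<le> q \<Longrightarrow> c \<le> \<theta> \<Longrightarrow> level h y \<theta> \<le> 0"
proof -
  obtain E where E: "ln (1 + 1 / b) < E" "E < h x" using dense[OF x(2)] by blast
  have "\<exists>d>0. \<forall>y\<in>{0..1}. dist y x < d \<longrightarrow> dist (h y) (h x) < h x - E"
    using h E x(1) unfolding continuous_on_iff by (meson diff_gt_0_iff_gt)
  then obtain d where d: "0 < d" "\<And>y. y \<in> {0..1} \<Longrightarrow> dist y x < d \<Longrightarrow> dist (h y) (h x) < h x - E" by blast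
  have "1 + 1 / b < exp E" using E(1) b by (metis add_pos_pos exp_less_mono exp_ln zero_less_divide_1_iff zero_less_one)
  then have Eb: "1 / b < exp E - 1" by simp
  have Ep: "0 < exp E - 1" using Eb b by (meson less_trans zero_less_divide_1_iff)
  have cb: "1 / (exp E - 1) < b" using Eb Ep b by (simp add: field_simps)
  define \<delta> where "\<delta> = min (d / 4) (1 / 8)"
  have \<delta>: "0 < \<delta>" "4 * \<delta> \<le> d" "8 * \<delta> \<le> 1" using d(1) by (auto simp: \<delta>_def)
  \<comment> \<open>The interval is moved towards the middle, so that it lies inside (0, 1) even if
    x is an end point.\<close>
  obtain p q where pq: "0 < p" "p < q" "q < 1" "x - d < p" "q < x + d"
  proof (cases "x \<le> 1 / 2")
    case True
    show thesis by (rule that[of "x + \<delta>" "x + 2 * \<delta>"]) (use x(1) \<delta> True in auto)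
  next
    case False
    show thesis by (rule that[of "x - 2 * \<delta>" "x - \<delta>"]) (use x(1) \<delta> False in auto)
  qed
  show thesis
  proof (rule that[of p q "1 / (exp E - 1)"])
    fix y \<theta> :: real assume y: "p \<le> y" "y \<le> q" and \<theta>: "1 / (exp E - 1) \<le> \<theta>"
    have "dist (h y) (h x) < h x - E" using y pq by (intro d(2)) (auto simp: dist_real_def)
    then have "exp E \<le> exp (h y)" by (simp add: dist_real_def)
    moreover have "0 \<le> \<theta>" using \<theta> Ep by (meson less_imp_le order_trans zero_less_divide_1_iff)
    ultimately have "(exp E - 1) * \<theta> \<le> (exp (h y) - 1) * \<theta>" by (intro mult_right_mono) auto
    moreover have "1 \<le> (exp E - 1) * \<theta>" using \<theta> Ep by (simp add: pos_divide_le_eq mult.commute)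
    ultimately show "level h y \<theta> \<le> 0" by (simp add: level_def algebra_simps)
  qed (use pq cb Ep in auto)
qed

lemma supercritical_chain:
  fixes h :: "real \<Rightarrow> real"
  assumes r: "0 < r" and a: "0 \<le> a" "a < b" and h: "continuous_on {0..1} h"
    and x: "x \<in> {0..1}" "ln (1 + 1 / b) < h x"
  shows "\<forall>\<^sub>F N in sequentially. chain r b (\<lambda>i. site_mgf r (h (real i / real N))) N 1 a = \<infinity>"
proof -
  obtain p q c where pq: "0 < p" "p < q" "q < 1" and c: "0 < c" "c < b"
    "\<And>y \<theta>. p \<le> y \<Longrightarrow> y \<le> q \<Longrightarrow> c \<le> \<theta> \<Longrightarrow> level h y \<theta> \<le> 0"
    using supercritical_interval[OF h x le_less_trans[OF a]] by blast
  have "\<forall>\<^sub>F N in sequentially. 1 < real N * (q - p)" using pq by real_asymp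
  moreover have "\<forall>\<^sub>F N::nat in sequentially. 0 < N" by (rule eventually_gt_at_top)
  ultimately show ?thesis
  proof eventually_elim
    case (elim N)
    \<comment> \<open>The least site with i / N \<ge> p; it also satisfies i / N < q as soon as N (q
      - p) > 1.\<close>
    define i where "i = nat \<lceil>real N * p\<rceil>"
    have "0 \<le> real N * p" using pq by simp
    then have i: "real N * p \<le> real i" "real i < real N * p + 1" by (auto simp: i_def) linarith
    have hi: "real i < real N * q" using i elim(1) by (simp add: right_diff_distrib)
    have "0 < real N * p" using pq elim(2) by simp
    then have "0 < i" using i(1) by (metis less_le_trans of_nat_0_less_iff)
    moreover have "real N * q \<le> real N * 1" using pq by (intro mult_left_mono) auto
    then have "i < Suc N" using hi by simp
    ultimately show ?case
    proof (intro chain_infinite[where i = i and c = c])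
      show "site_mgf r (h (real i / real N)) y = \<infinity>" if "c < y" "y < b" for y
      proof -
        have "level h (real i / real N) y \<le> 0"
          using i(1) hi elim(2) that by (intro c(3)) (auto simp: pos_le_divide_eq pos_divide_le_eq mult.commute)
        then show ?thesis by (simp add: site_mgf_level)
      qed
    qed (use r a c in \<open>auto simp: site_mgf_pos\<close>)
  qed
qed

text \<open>A profile so steep at 0 that it has reached c at p has nonpositive level on (p, q). The
  negative part of the integrand is at most b, so the integral is a genuine \<infinity> and not a
  difference of infinities.\<close>

lemma supercritical_profile:
  fixes h :: "real \<Rightarrow> real"
  assumes s: "0 < s" and a: "0 \<le> a" "a < b" and h: "continuous_on {0..1} h"
    and x: "x \<in> {0..1}" "ln (1 + 1 / b) < h x"
  obtains \<theta> where "\<theta> \<in> profiles a b" "local_pressure s h \<theta> = \<infinity>"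
proof -
  obtain p q c where pq: "0 < p" "p < q" "q < 1" and c: "0 < c" "c < b"
    "\<And>y \<theta>. p \<le> y \<Longrightarrow> y \<le> q \<Longrightarrow> c \<le> \<theta> \<Longrightarrow> level h y \<theta> \<le> 0"
    using supercritical_interval[OF h x le_less_trans[OF a]] by blast
  obtain m where m: "(1 - p) ^ m < (b - c) / (b - a)"
    using real_arch_pow_inv[of "(b - c) / (b - a)" "1 - p"] pq c a by auto
  \<comment> \<open>The successor guarantees n \<ge> 1, needed for strict monotonicity and for
    \<theta> 1 = b.\<close>
  define n where "n = Suc m"
  have n: "(b - a) * (1 - p) ^ n \<le> b - c"
  proof -
    have "(1 - p) ^ n \<le> (1 - p) ^ m" unfolding n_def using pq by (intro power_decreasing) auto
    then have "(1 - p) ^ n \<le> (b - c) / (b - a)" using m by simp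
    then show ?thesis using a by (simp add: pos_le_divide_eq mult.commute)
  qed
  define \<theta> where "\<theta> x = b - (b - a) * (1 - x) ^ n" for x
  have mono: "\<theta> x < \<theta> y" if "x \<in> {0..1}" "y \<in> {0..1}" "x < y" for x y
  proof -
    have "(1 - y) ^ n < (1 - x) ^ n" using that by (intro power_strict_mono) (auto simp: n_def)
    then show ?thesis using a by (simp add: \<theta>_def)
  qed
  have ends: "\<theta> 0 = a" "\<theta> 1 = b" by (auto simp: \<theta>_def n_def)
  have range: "0 \<le> \<theta> y" "\<theta> y \<le> b" if "y \<in> {0..1}" for y
    using mono[of 0 y] mono[of y 1] that ends a by (cases "y = 0"; cases "y = 1"; auto)+
  have prof: "\<theta> \<in> profiles a b"
    using mono ends range by (auto simp: profiles_def strict_mono_on_def)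
  define f where "f x = - ereal_ln (ereal (level h x (\<theta> x)))" for x
  have "(\<integral>\<^sup>+ (x::real). \<infinity> * indicator {p<..<q} x \<partial>lebesgue) \<le> (\<integral>\<^sup>+ x \<in> {0..1}. e2ennreal (f x) \<partial>lebesgue)"
  proof (rule nn_integral_mono)
    fix y
    show "\<infinity> * indicator {p<..<q} y \<le> e2ennreal (f y) * indicator {0..1} y"
    proof (cases "y \<in> {p<..<q}")
      case True
      have "(1 - y) ^ n \<le> (1 - p) ^ n" using True pq by (intro power_mono) auto
      then have "(b - a) * (1 - y) ^ n \<le> b - c" using n a by (meson diff_ge_0_iff_ge less_imp_le mult_left_mono order_trans)
      then have "c \<le> \<theta> y" by (simp add: \<theta>_def)
      then have "level h y (\<theta> y) \<le> 0" using True by (intro c(3)) auto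
      then show ?thesis using True pq by (simp add: f_def ereal_ln_def)
    qed simp
  qed
  also have "(\<integral>\<^sup>+ (x::real). \<infinity> * indicator {p<..<q} x \<partial>lebesgue) = (\<infinity>::ennreal)"
    using pq by (subst nn_integral_cmult_indicator) (auto simp: ennreal_top_mult)
  finally have inf: "(\<integral>\<^sup>+ x \<in> {0..1}. e2ennreal (f x) \<partial>lebesgue) = \<infinity>" by (simp add: top_unique)
  have "(\<integral>\<^sup>+ x \<in> {0..1}. e2ennreal (- f x) \<partial>lebesgue) \<le> (\<integral>\<^sup>+ (x::real). ennreal b * indicator {0..1} x \<partial>lebesgue)"
  proof (rule nn_integral_mono)
    fix y :: real
    show "e2ennreal (- f y) * indicator {0..1} y \<le> ennreal b * indicator {0..1} y"
    proof (cases "y \<in> {0..1}")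
      case True
      have "0 \<le> exp (h y) * \<theta> y" using range[OF True] by simp
      moreover have "level h y (\<theta> y) = 1 + \<theta> y - exp (h y) * \<theta> y" by (simp add: level_def algebra_simps)
      ultimately have l: "level h y (\<theta> y) \<le> 1 + b" using range(2)[OF True] by linarith
      have "- f y \<le> ereal b"
      proof (cases "0 < level h y (\<theta> y)")
        case pos: True
        have "ln (level h y (\<theta> y)) \<le> level h y (\<theta> y) - 1" using pos by (rule ln_le_minus_one)
        then show ?thesis using pos l by (simp add: f_def ereal_ln_def)
      qed (simp add: f_def ereal_ln_def)
      then have "e2ennreal (- f y) \<le> e2ennreal (ereal b)" by (rule e2ennreal_mono)
      also have "\<dots> = ennreal b" by (simp add: ennreal.abs_eq)
      finally have "e2ennreal (- f y) \<le> ennreal b" .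
      then show ?thesis using True by simp
    qed simp
  qed
  also have "\<dots> = ennreal b" by (subst nn_integral_cmult_indicator) auto
  finally have fin: "(\<integral>\<^sup>+ x \<in> {0..1}. e2ennreal (- f x) \<partial>lebesgue) < \<infinity>" by (rule le_less_trans) simp
  then obtain v where v: "(\<integral>\<^sup>+ x \<in> {0..1}. e2ennreal (- f x) \<partial>lebesgue) = ennreal v" "0 \<le> v"
    unfolding infinity_ennreal_def less_top_ennreal by blast
  have "unit_integral f = \<infinity>"
    unfolding unit_integral_def inf v(1) using v(2) by (simp add: enn2ereal_ennreal)
  then have "local_pressure s h \<theta> = \<infinity>"
    using s by (simp add: local_pressure_def f_def[abs_def] level_def)
  with prof show thesis by (rule that)
qed

lemma ereal_ln_mono:
  assumes "x \<le> y"
  shows "ereal_ln x \<le> ereal_ln y"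
  using assms by (cases x; cases y) (auto simp: ereal_ln_def)

lemma ereal_ln_exp: "ereal_ln (enn2ereal (ennreal (exp v))) = ereal v"
  by (simp add: ereal_ln_def enn2ereal_ennreal)

theorem theorem4p1:
  fixes s \<rho>l \<rho>r :: real
    and h :: "real \<Rightarrow> real"
    and P :: "nat \<Rightarrow> real \<Rightarrow> config \<Rightarrow> config pmf"
    and \<mu> :: "nat \<Rightarrow> config pmf"
  assumes "0 < s" and "0 \<le> \<rho>l" and "\<rho>l < \<rho>r"
    and "\<And>N. 1 \<le> N \<Longrightarrow> harmonic_process s \<rho>l \<rho>r N (P N)"
    and "\<And>N. 1 \<le> N \<Longrightarrow> invariant_measure N (P N) (\<mu> N)"
    and "smooth_unit h"
    and "not_critical_at_end \<rho>r h"
  shows "scaled_log_mgf \<mu> h \<longlonglongrightarrow> pressure \<mu> h \<and>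
    pressure \<mu> h =
      (SUP \<theta> \<in> profiles \<rho>l \<rho>r. local_pressure s h \<theta> - profile_cost s \<rho>l \<rho>r \<theta>)"
proof -
  note s = assms(1) and \<rho> = assms(2,3)
  define val where "val \<theta> = local_pressure s h \<theta> - profile_cost s \<rho>l \<rho>r \<theta>" for \<theta>
  define S where "S = (SUP \<theta> \<in> profiles \<rho>l \<rho>r. val \<theta>)"
  define Ch where "Ch N = chain (2 * s) \<rho>r (\<lambda>i. site_mgf (2 * s) (h (real i / real N))) N 1 \<rho>l" for N
  define Kp where "Kp N = kap (2 * s * real (Suc N)) \<rho>l \<rho>r" for N
  have Kp: "0 < Kp N" "Kp N \<noteq> \<infinity>" for N
    using s \<rho> by (auto simp: Kp_def kap_pos simp del: of_nat_Suc) (simp add: kap_def)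
  have KK: "Kp N * x / Kp N = x" for N x
    using Kp[of N] by (subst mult.commute) (rule mult_divide_eq_ennreal, auto)
  have sc: "scaled_log_mgf \<mu> h N = ereal (1 / real N) * ereal_ln (enn2ereal (Ch N / Kp N))" if "1 \<le> N" for N
    unfolding scaled_log_mgf_def Ch_def Kp_def
    using mgf_chain[OF s \<rho> that assms(4,5)[OF that], of "\<lambda>i. h (real i / real N)"] by simp
  have exp_scaled: "ereal (1 / real N) * ereal_ln (enn2ereal (ennreal (exp (real N * u)))) = ereal u" if "1 \<le> N" for N u
    unfolding ereal_ln_exp using that by simp
  have lower: "ereal u \<le> scaled_log_mgf \<mu> h N" if "1 \<le> N" "Kp N * ennreal (exp (real N * u)) \<le> Ch N" for N u
  proof -
    have "ennreal (exp (real N * u)) = Kp N * ennreal (exp (real N * u)) / Kp N"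
      by (rule KK[symmetric])
    also have "\<dots> \<le> Ch N / Kp N" using that(2) by (rule divide_right_mono_ennreal)
    finally have "ereal_ln (enn2ereal (ennreal (exp (real N * u)))) \<le> ereal_ln (enn2ereal (Ch N / Kp N))"
      by (intro ereal_ln_mono) (simp add: less_eq_ennreal.rep_eq)
    then show ?thesis unfolding sc[OF that(1)] exp_scaled[OF that(1), of u, symmetric] by (rule ereal_mult_left_mono) simp
  qed
  have upper: "scaled_log_mgf \<mu> h N \<le> ereal u" if "1 \<le> N" "Ch N \<le> Kp N * ennreal (exp (real N * u))" for N u
  proof -
    have "Ch N / Kp N \<le> Kp N * ennreal (exp (real N * u)) / Kp N" using that(2) by (rule divide_right_mono_ennreal)
    also have "\<dots> = ennreal (exp (real N * u))"
      by (rule KK)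
    finally have "ereal_ln (enn2ereal (Ch N / Kp N)) \<le> ereal_ln (enn2ereal (ennreal (exp (real N * u))))"
      by (intro ereal_ln_mono) (simp add: less_eq_ennreal.rep_eq)
    then show ?thesis unfolding sc[OF that(1)] exp_scaled[OF that(1), of u, symmetric] by (rule ereal_mult_left_mono) simp
  qed
  have h: "continuous_on {0..1} h"
  proof -
    obtain D :: "nat \<Rightarrow> real \<Rightarrow> real" where D: "\<And>x. x \<in> {0..1} \<Longrightarrow> D 0 x = h x"
      "\<And>x. x \<in> {0..1} \<Longrightarrow> (D 0 has_real_derivative D 1 x) (at x within {0..1})"
      using assms(6) unfolding smooth_unit_def One_nat_def by blast
    have "continuous_on {0..1} (D 0)" using D(2) by (rule DERIV_continuous_on)
    moreover have "continuous_on {0..1} (D 0) \<longleftrightarrow> continuous_on {0..1} h" by (intro continuous_on_cong refl D(1))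
    ultimately show ?thesis by simp
  qed
  have "scaled_log_mgf \<mu> h \<longlonglongrightarrow> S"
  proof (cases "\<exists>x\<in>{0..1}. ln (1 + 1 / \<rho>r) < h x")
    case True
    then obtain x where x: "x \<in> {0..1}" "ln (1 + 1 / \<rho>r) < h x" by blast
    obtain \<theta> where \<theta>: "\<theta> \<in> profiles \<rho>l \<rho>r" "local_pressure s h \<theta> = \<infinity>"
      using supercritical_profile[OF s \<rho> h x] .
    \<comment> \<open>In \<open>ereal\<close>, \<infinity> minus any cost is \<infinity>.\<close>
    have "val \<theta> = \<infinity>" unfolding val_def \<theta>(2) by (simp add: minus_ereal_def)
    then have S: "S = \<infinity>" using SUP_upper[OF \<theta>(1), of val] by (simp add: S_def)
    have r: "0 < 2 * s" using s by simp
    have "\<forall>\<^sub>F N in sequentially. Ch N = \<infinity>"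
      unfolding Ch_def by (rule supercritical_chain[OF r \<rho> h x])
    then have "\<forall>\<^sub>F N in sequentially. scaled_log_mgf \<mu> h N = S"
      using eventually_ge_at_top[of 1]
    proof eventually_elim
      case (elim N)
      have "Ch N / Kp N = \<infinity>" using elim Kp[of N] by (simp add: ennreal_top_divide)
      then show ?case using elim by (simp add: sc S ereal_ln_def)
    qed
    then show ?thesis by (rule tendsto_eventually)
  next
    case False
    then have hc: "h x \<le> ln (1 + 1 / \<rho>r)" if "x \<in> {0..1}" for x using that not_less by blast
    \<comment> \<open>Without a supercritical point, \<open>not_critical_at_end\<close> rules out
      equality at 1; this strictness is what \<open>end_level\<close> builds on.\<close>
    have h1: "h 1 < ln (1 + 1 / \<rho>r)"
    proof -
      have "h 1 \<noteq> ln (1 + 1 / \<rho>r)" using assms(7) False unfolding not_critical_at_end_def by blast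
      moreover have "h 1 \<le> ln (1 + 1 / \<rho>r)" by (rule hc) simp
      ultimately show ?thesis by simp
    qed
    show ?thesis
    proof (rule order_tendstoI)
      fix z assume "z < S"
      then obtain \<theta> where \<theta>: "\<theta> \<in> profiles \<rho>l \<rho>r" "z < val \<theta>" by (auto simp: S_def less_SUP_iff)
      then obtain u where u: "z < ereal u" "ereal u < val \<theta>" using ereal_dense2 by blast
      have "\<forall>\<^sub>F N in sequentially. Kp N * ennreal (exp (real N * u)) \<le> Ch N"
        unfolding Kp_def Ch_def by (rule chain_lower_value[OF s \<rho> h hc h1 \<theta>(1) u(2)[unfolded val_def]])
      then show "\<forall>\<^sub>F N in sequentially. z < scaled_log_mgf \<mu> h N"
        using eventually_ge_at_top[of 1]
      proof eventually_elim
        case (elim N)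
        then have "ereal u \<le> scaled_log_mgf \<mu> h N" by (intro lower)
        with u(1) show ?case by (rule less_le_trans)
      qed
    next
      fix z assume "S < z"
      then obtain u where u: "S < ereal u" "ereal u < z" using ereal_dense2 by blast
      \<comment> \<open>A second point strictly above S: y bounds all values, and u - y > 0 serves
        as the error in \<open>chain_upper_value\<close>.\<close>
      obtain y where y: "S < ereal y" "ereal y < ereal u" using u(1) ereal_dense2 by blast
      have "\<forall>\<^sub>F N in sequentially. Ch N \<le> Kp N * ennreal (exp (real N * (y + (u - y))))"
        unfolding Kp_def Ch_def
      proof (rule chain_upper_value[OF s \<rho> h hc h1])
        show "local_pressure s h \<theta> - profile_cost s \<rho>l \<rho>r \<theta> \<le> ereal y" if "\<theta> \<in> profiles \<rho>l \<rho>r" for \<theta>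
          using SUP_upper[OF that, of val] y(1) by (simp add: S_def val_def)
        show "0 < u - y" using y(2) by simp
      qed
      then show "\<forall>\<^sub>F N in sequentially. scaled_log_mgf \<mu> h N < z"
        using eventually_ge_at_top[of 1]
      proof eventually_elim
        case (elim N)
        then have "scaled_log_mgf \<mu> h N \<le> ereal u" by (intro upper) simp_all
        then show ?case using u(2) by (rule le_less_trans)
      qed
    qed
  qed
  moreover from this have "pressure \<mu> h = S" unfolding pressure_def by (rule limI)
  ultimately show ?thesis by (simp only: S_def val_def)
qed

end
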